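(* Consider the uplink with receive combining vector $\mathbf v=\hat{\mathbf h}/\|\hat{\mathbf h}\|_2$ and no instantaneous CSI used for decoding at the BS ($\tilde{\mathcal H}^{\mathrm{BS}}=\emptyset$). If $\mathbb E\{\|\mathbf Q_{\mathcal H}\|_2\}\le\mathcal O(N^n)$ for some $n<1$, then the lower capacity bound ${\tt C}^{\mathrm{UL}}_{\mathrm{lower}}$ on ${\tt C}^{\mathrm{UL}}$ can be expressed as $${\tt C}^{\mathrm{UL}}\ge\frac{T^{\mathrm{UL}}_{\mathrm{data}}}{T_{\mathrm{coher}}}\log_2\left(1+\frac{|\mathbb E\{\varphi\}|^2+\mathcal O\big(\frac1{\sqrt N}\big)}{(1+\kappa_t^{\mathrm{UE}})\mathbb E\{|\varphi|^2\}-|\mathbb E\{\varphi\}|^2+\mathcal O\big(\frac1{\sqrt N}+\frac1{N^{1-n}}\big)}\right),$$ where $$\varphi=\frac{(1+d^{-1}\eta_t^{\mathrm{UE}})\sqrt{\mathrm{tr}(\mathbf R-\mathbf C)}}{\sqrt{\mathrm{tr}\big(\mathbf A(|d+\eta_t^{\mathrm{UE}}|^2\mathbf R+\boldsymbol\Psi)\mathbf A^H\big)}}$$ (with $d$ and $\eta_t^{\mathrm{UE}}$ the pilot signal and the UE distortion noise of the pilot phase). The terms $\mathcal O(1/\sqrt N)$ and $\mathcal O(1/N^{1-n})$ vanish when $N\to\infty$, while the other terms are strictly positive in the limit.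
   Context: An $N$-antenna base station (BS) and a single-antenna user (UE) share a block-fading channel $\mathbf h=[h_1\dots h_N]^T\sim\mathcal{CN}(\mathbf 0,\mathbf R)$, constant in each coherence period of $T_{\mathrm{coher}}$ channel uses (of which $T^{\mathrm{UL}}_{\mathrm{data}}$ carry uplink data) and independent between periods. $\mathcal H$ is the set of realizations of all channels in the system. Uplink model (both phases): $\mathbf z=\mathbf h(d+\eta_t^{\mathrm{UE}})+\boldsymbol\eta_r^{\mathrm{BS}}+\boldsymbol\nu$; given $\mathcal H$, the distortion noises $\eta_t^{\mathrm{UE}}\sim\mathcal{CN}(0,\kappa_t^{\mathrm{UE}}p^{\mathrm{UE}})$ and $\boldsymbol\eta_r^{\mathrm{BS}}\sim\mathcal{CN}(\mathbf 0,\kappa_r^{\mathrm{BS}}p^{\mathrm{UE}}\mathrm{diag}(|h_1|^2,\dots,|h_N|^2))$ are independent of each other, of $d$, and over time. The term $\boldsymbol\nu$ is the sum of independent receiver noise $\mathcal{CN}(\mathbf 0,\sigma_{\mathrm{BS}}^2\mathbf I)$ and zero-mean interference that is independent of $d$ but might depend on the channel realizations in $\mathcal H$. Pilot phase: $d\in\mathbb C$ is a nonzero deterministic pilot with $|d|^2=p^{\mathrm{UE}}$, and the interference has covariance matrix $\mathbf S$. With $\mathbf R_{\mathrm{diag}}$ the diagonal part of $\mathbf R$: $\bar{\mathbf Z}=\mathbb E\{\mathbf z\mathbf z^H\}=p^{\mathrm{UE}}(1+\kappa_t^{\mathrm{UE}})\mathbf R+p^{\mathrm{UE}}\kappa_r^{\mathrm{BS}}\mathbf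 R_{\mathrm{diag}}+\mathbf S+\sigma_{\mathrm{BS}}^2\mathbf I$, $\mathbf A=d^*\mathbf R\bar{\mathbf Z}^{-1}$, $\boldsymbol\Psi=p^{\mathrm{UE}}\kappa_r^{\mathrm{BS}}\mathbf R_{\mathrm{diag}}+\mathbf S+\sigma_{\mathrm{BS}}^2\mathbf I$, the linear minimum mean square error (LMMSE) estimate is $\hat{\mathbf h}=\mathbf A\mathbf z$ (from the pilot-phase $\mathbf z$), and its error covariance is $\mathbf C=\mathbf R-p^{\mathrm{UE}}\mathbf R\bar{\mathbf Z}^{-1}\mathbf R$. Data phase: $d$ is a stochastic data signal of average power $p^{\mathrm{UE}}$, and the interference has conditional covariance matrix $\mathbf Q_{\mathcal H}$ given $\mathcal H$. Capacity: with imperfect channel knowledge $\mathcal H^{\mathrm{BS}}$ (at least $\hat{\mathbf h}$) at the BS and $\mathcal H^{\mathrm{UE}}$ at the UE, ${\tt C}^{\mathrm{UL}}=\frac{T^{\mathrm{UL}}_{\mathrm{data}}}{T_{\mathrm{coher}}}\mathbb E\{\max_{f(d|\mathcal H^{\mathrm{UE}}):\mathbb E\{|d|^2\}\le p^{\mathrm{UE}}}\mathcal I(d;\mathbf z|\mathcal H,\mathcal H^{\mathrm{BS}},\mathcal H^{\mathrm{UE}})\}$, where $\mathcal I$ is the conditional mutual information (bits) for the given realizations, $f(d|\mathcal H^{\mathrm{UE}})$ is the conditional distribution of the data signal, and the outer expectation is over $\mathcal H,\mathcal H^{\mathrm{BS}},\mathcal H^{\mathrm{UE}}$. $\tilde{\mathcal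 H}^{\mathrm{BS}}$ is the CSI used in the decoding at the BS (equal to or degraded compared with $\mathcal H^{\mathrm{BS}}$). For a unit-norm $\mathbf v=[v_1\dots v_N]^T$ that is a function of $\hat{\mathbf h}$, and $\tilde{\mathcal H}^{\mathrm{BS}}=\emptyset$, the lower bound is $${\tt C}^{\mathrm{UL}}_{\mathrm{lower}}=\frac{T^{\mathrm{UL}}_{\mathrm{data}}}{T_{\mathrm{coher}}}\log_2\left(1+\frac{|\mathbb E\{\mathbf h^H\mathbf v\}|^2}{(1+\kappa_t^{\mathrm{UE}})\mathbb E\{|\mathbf h^H\mathbf v|^2\}-|\mathbb E\{\mathbf h^H\mathbf v\}|^2+\kappa_r^{\mathrm{BS}}\sum_{i=1}^N\mathbb E\{|h_i|^2|v_i|^2\}+\frac{\mathbb E\{\mathbf v^H(\mathbf Q_{\mathcal H}+\sigma_{\mathrm{BS}}^2\mathbf I)\mathbf v\}}{p^{\mathrm{UE}}}}\right).$$ Standing assumptions: $\mathbf R,\mathbf S$ are positive semi-definite, $\|\mathbf R\|_2=\mathcal O(1)$, $\|\mathbf S\|_2=\mathcal O(1)$ (spectral norms), $0<\liminf_N\frac1N\mathrm{tr}(\mathbf R)\le\limsup_N\frac1N\mathrm{tr}(\mathbf R)<\infty$, $\mathbf R$ has strictly positive diagonal elements; the pilot, $p^{\mathrm{UE}}$, $\sigma_{\mathrm{BS}}^2>0$ and the constants $\kappa\ge0$ do not depend on $N$.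
   Formalization: Pilot interference is assumed to have mean 0 and covariance S given h, and quadratic forms x^H B x with mean-square fluctuation at most K N ||B||^2 (true for Gaussian); positivity of the denominator's difference is claimed only for kappa_t > 0. Without these the claim is false. *)

theory Defs
  imports
    "HOL-Probability.Probability"
    "HOL-Library.Landau_Symbols"
    "Jordan_Normal_Form.Gauss_Jordan_Elimination"
    "Jordan_Normal_Form.Schur_Decomposition"
begin

hide_const (open) Finite_Cartesian_Product.vec Finite_Cartesian_Product.mat
  Finite_Cartesian_Product.row
hide_type (open) Finite_Cartesian_Product.vec

section \<open>Matrices\<close>

text \<open>
  Deterministic vectors and matrices are those of Jordan_Normal_Form, so that the dimension
  \<open>N\<close> is an ordinary natural number; there \<open>x \<bullet>c y\<close> is \<open>y\<^sup>H x\<close>. On the complex numbers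
  \<open>0 \<le> z\<close> means that \<open>z\<close> is real and nonnegative, so \<open>psd\<close> includes being Hermitian.
\<close>

definition vnorm :: "complex vec \<Rightarrow> real" where
  "vnorm x = sqrt (Re (x \<bullet>c x))"

definition spectral_norm :: "complex mat \<Rightarrow> real" where
  "spectral_norm A = Sup {vnorm (A *\<^sub>v x) | x. x \<in> carrier_vec (dim_col A) \<and> vnorm x = 1}"

definition mtrace :: "complex mat \<Rightarrow> complex" where
  "mtrace A = (\<Sum>i<dim_row A. A $$ (i, i))"

definition psd :: "nat \<Rightarrow> complex mat \<Rightarrow> bool" where
  "psd N A \<longleftrightarrow> A \<in> carrier_mat N N \<and> (\<forall>x\<in>carrier_vec N. 0 \<le> (A *\<^sub>v x) \<bullet>c x)"

definition diag_part :: "nat \<Rightarrow> complex mat \<Rightarrow> complex mat" where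
  "diag_part N A = Matrix.mat N N (\<lambda>(i, j). if i = j then A $$ (i, i) else 0)"

definition minv :: "complex mat \<Rightarrow> complex mat" where
  "minv A = the (mat_inverse A)"


section \<open>Complex Gaussian vectors\<close>

text \<open>
  Random vectors take values in functions on the index set \<open>{..<N}\<close> (arbitrary outside it),
  which carry the product sigma-algebra.
\<close>

type_synonym cvec = "nat \<Rightarrow> complex"

abbreviation cspace :: "nat \<Rightarrow> cvec measure" where
  "cspace N \<equiv> PiM {..<N} (\<lambda>_. borel)"

text \<open>The scalar law \<open>CN(0, v)\<close>, with the point mass at 0 for \<open>v = 0\<close>.\<close>

definition CN :: "real \<Rightarrow> complex measure" where
  "CN v = distr (density lborel std_normal_density \<Otimes>\<^sub>M density lborel std_normal_density) borel
     (\<lambda>(x, y). Complex (sqrt (v / 2) * x) (sqrt (v / 2) * y))"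

text \<open>\<open>X \<sim> CN(0, K)\<close>: every linear functional \<open>a\<^sup>H X\<close> has the law \<open>CN(0, a\<^sup>H K a)\<close>.\<close>

definition complex_normal :: "nat \<Rightarrow> 'a measure \<Rightarrow> ('a \<Rightarrow> cvec) \<Rightarrow> complex mat \<Rightarrow> bool" where
  "complex_normal N M X K \<longleftrightarrow> X \<in> M \<rightarrow>\<^sub>M cspace N \<and>
     (\<forall>a\<in>carrier_vec N.
        distr M borel (\<lambda>\<omega>. Matrix.vec N (X \<omega>) \<bullet>c a) = CN (Re ((K *\<^sub>v a) \<bullet>c a)))"

text \<open>\<open>E{Y | X} = c\<close> almost surely, for a constant \<open>c\<close>.\<close>

definition has_cond_mean ::
    "'a measure \<Rightarrow> 'x measure \<Rightarrow> ('a \<Rightarrow> 'x) \<Rightarrow> ('a \<Rightarrow> complex) \<Rightarrow> complex \<Rightarrow> bool" where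
  "has_cond_mean M K X Y c \<longleftrightarrow> integrable M Y \<and>
     (\<forall>B\<in>sets K. (\<integral>\<omega>. indicat_real B (X \<omega>) *\<^sub>R Y \<omega> \<partial>M)
                  = measure M (X -` B \<inter> space M) *\<^sub>R c)"


section \<open>Uplink system\<close>

text \<open>
  The parameters that do not depend on \<open>N\<close>: \<open>p_UE\<close> is the transmit power, \<open>sigma2\<close> the receiver
  noise variance.
\<close>

record params =
  pilot :: complex
  p_UE :: real
  kappa_t :: real
  kappa_r :: real
  sigma2 :: real
  T_data :: nat
  T_coher :: nat

definition valid_params :: "params \<Rightarrow> bool" where
  "valid_params P \<longleftrightarrow> pilot P \<noteq> 0 \<and> (cmod (pilot P))\<^sup>2 = p_UE P \<and>
     0 \<le> kappa_t P \<and> 0 \<le> kappa_r P \<and> 0 < sigma2 P \<and> 0 < T_coher P \<and> T_data P \<le> T_coher P"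

text \<open>A disturbance is a tuple (UE distortion, BS distortion, receiver noise, interference).\<close>

type_synonym disturb = "complex \<times> cvec \<times> cvec \<times> cvec"

abbreviation disturb_space :: "nat \<Rightarrow> disturb measure" where
  "disturb_space N \<equiv> borel \<Otimes>\<^sub>M cspace N \<Otimes>\<^sub>M cspace N \<Otimes>\<^sub>M cspace N"

text \<open>
  The conditional law of the disturbance given the channel realizations, when the channel of the
  user is \<open>h\<close> and the interference has the conditional law \<open>L\<close>. A circularly symmetric
  Gaussian vector with diagonal covariance has independent components, whence the products.
\<close>

definition disturb_law :: "params \<Rightarrow> nat \<Rightarrow> cvec \<Rightarrow> cvec measure \<Rightarrow> disturb measure" where
  "disturb_law P N h L =
     CN (kappa_t P * p_UE P)
     \<Otimes>\<^sub>M PiM {..<N} (\<lambda>i. CN (kappa_r P * p_UE P * (cmod (h i))\<^sup>2))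
     \<Otimes>\<^sub>M PiM {..<N} (\<lambda>_. CN (sigma2 P))
     \<Otimes>\<^sub>M L"

definition received :: "nat \<Rightarrow> cvec \<Rightarrow> complex \<Rightarrow> disturb \<Rightarrow> cvec" where
  "received N h d w = (case w of (et, er, nr, ni) \<Rightarrow>
     (\<lambda>i\<in>{..<N}. h i * (d + et) + er i + (nr i + ni i)))"

text \<open>
  The system with \<open>N\<close> antennas. The elements of \<open>chans\<close> are the realizations of all channels in
  the system, \<open>chan\<close> is the random realization, and \<open>user\<close> extracts the channel \<open>h\<close> of the
  user. \<open>disturbance\<close> is the disturbance of the pilot phase, \<open>pilot_interf\<close> the conditional law
  of its interference given the channel realizations. \<open>data_interf\<close> is the conditional law of the
  data-phase interference given the channel realizations and the channel knowledge at BS and UE;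
  below its mean and covariance depend on the channel realizations only.
\<close>

record ('a, 'c, 'b, 'u) uplink =
  prb :: "'a measure"
  cov_R :: "complex mat"
  cov_S :: "complex mat"
  chans :: "'c measure"
  chan :: "'a \<Rightarrow> 'c"
  user :: "'c \<Rightarrow> cvec"
  disturbance :: "'a \<Rightarrow> disturb"
  pilot_interf :: "'c \<Rightarrow> cvec measure"
  bs_space :: "'b measure"
  bs_csi :: "'a \<Rightarrow> 'b"
  ue_space :: "'u measure"
  ue_csi :: "'a \<Rightarrow> 'u"
  data_interf :: "'c \<times> 'b \<times> 'u \<Rightarrow> cvec measure"
  cov_Q :: "'c \<Rightarrow> complex mat"

context
  fixes P :: params and N :: nat and U :: "('a, 'c, 'b, 'u) uplink"
begin

abbreviation (input) expect :: "('a \<Rightarrow> 'v::{banach, second_countable_topology}) \<Rightarrow> 'v" where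
  "expect X \<equiv> lebesgue_integral (prb U) X"

definition channel :: "'a \<Rightarrow> cvec" where
  "channel \<omega> = user U (chan U \<omega>)"

definition hvec :: "'a \<Rightarrow> complex vec" where
  "hvec \<omega> = Matrix.vec N (channel \<omega>)"

definition eta_t :: "'a \<Rightarrow> complex" where
  "eta_t \<omega> = fst (disturbance U \<omega>)"

definition interf :: "'a \<Rightarrow> cvec" where
  "interf \<omega> = snd (snd (snd (disturbance U \<omega>)))"

definition Psi :: "complex mat" where
  "Psi = complex_of_real (p_UE P * kappa_r P) \<cdot>\<^sub>m diag_part N (cov_R U) + cov_S U
     + complex_of_real (sigma2 P) \<cdot>\<^sub>m 1\<^sub>m N"

definition Zbar :: "complex mat" where
  "Zbar = complex_of_real (p_UE P * (1 + kappa_t P)) \<cdot>\<^sub>m cov_R U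
     + complex_of_real (p_UE P * kappa_r P) \<cdot>\<^sub>m diag_part N (cov_R U) + cov_S U
     + complex_of_real (sigma2 P) \<cdot>\<^sub>m 1\<^sub>m N"

definition lmmse :: "complex mat" where
  "lmmse = cnj (pilot P) \<cdot>\<^sub>m (cov_R U * minv Zbar)"

definition err_cov :: "complex mat" where
  "err_cov = cov_R U - complex_of_real (p_UE P) \<cdot>\<^sub>m (cov_R U * minv Zbar * cov_R U)"

definition hhat :: "'a \<Rightarrow> complex vec" where
  "hhat \<omega> = lmmse *\<^sub>v Matrix.vec N (received N (channel \<omega>) (pilot P) (disturbance U \<omega>))"

definition mrc :: "'a \<Rightarrow> complex vec" where
  "mrc \<omega> = complex_of_real (1 / vnorm (hhat \<omega>)) \<cdot>\<^sub>v hhat \<omega>"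

definition uplink_model :: bool where
  "uplink_model \<longleftrightarrow>
     prob_space (prb U) \<and>
     psd N (cov_R U) \<and> (\<forall>i<N. 0 < cov_R U $$ (i, i)) \<and> psd N (cov_S U) \<and>
     chan U \<in> prb U \<rightarrow>\<^sub>M chans U \<and> user U \<in> chans U \<rightarrow>\<^sub>M cspace N \<and>
     complex_normal N (prb U) channel (cov_R U) \<and>
     \<comment> \<open>pilot phase\<close>
     disturbance U \<in> prb U \<rightarrow>\<^sub>M disturb_space N \<and>
     pilot_interf U \<in> chans U \<rightarrow>\<^sub>M prob_algebra (cspace N) \<and>
     distr (prb U) (chans U \<Otimes>\<^sub>M disturb_space N) (\<lambda>\<omega>. (chan U \<omega>, disturbance U \<omega>)) =
       distr (prb U) (chans U) (chan U) \<bind>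
         (\<lambda>c. distr (disturb_law P N (user U c) (pilot_interf U c))
                (chans U \<Otimes>\<^sub>M disturb_space N) (Pair c)) \<and>
     (\<forall>i<N. has_cond_mean (prb U) (cspace N) channel (\<lambda>\<omega>. interf \<omega> i) 0) \<and>
     (\<forall>i<N. \<forall>j<N. has_cond_mean (prb U) (cspace N) channel
        (\<lambda>\<omega>. interf \<omega> i * cnj (interf \<omega> j)) (cov_S U $$ (i, j))) \<and>
     \<comment> \<open>channel knowledge\<close>
     bs_csi U \<in> prb U \<rightarrow>\<^sub>M bs_space U \<and> ue_csi U \<in> prb U \<rightarrow>\<^sub>M ue_space U \<and>
     (\<exists>g \<in> bs_space U \<rightarrow>\<^sub>M cspace N. \<forall>\<omega>\<in>space (prb U). hhat \<omega> = Matrix.vec N (g (bs_csi U \<omega>))) \<and>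
     \<comment> \<open>data phase\<close>
     data_interf U \<in> chans U \<Otimes>\<^sub>M bs_space U \<Otimes>\<^sub>M ue_space U \<rightarrow>\<^sub>M prob_algebra (cspace N) \<and>
     (\<forall>c\<in>space (chans U). cov_Q U c \<in> carrier_mat N N) \<and>
     (\<forall>c\<in>space (chans U). \<forall>b\<in>space (bs_space U). \<forall>u\<in>space (ue_space U). \<forall>i<N.
        integrable (data_interf U (c, b, u)) (\<lambda>x. x i) \<and>
        (\<integral>x. x i \<partial>data_interf U (c, b, u)) = 0 \<and>
        (\<forall>j<N. integrable (data_interf U (c, b, u)) (\<lambda>x. x i * cnj (x j)) \<and>
           (\<integral>x. x i * cnj (x j) \<partial>data_interf U (c, b, u)) = cov_Q U c $$ (i, j))) \<and>
     integrable (prb U) (\<lambda>\<omega>. spectral_norm (cov_Q U (chan U \<omega>)))"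

text \<open>
  The trace-lemma condition of random matrix theory for the pilot interference: the mean squared
  fluctuation of each quadratic form \<open>x\<^sup>H B x\<close> around its mean \<open>tr (B S)\<close> is at most
  \<open>K N \<parallel>B\<parallel>\<^sub>2\<^sup>2\<close>. Gaussian interference \<open>CN(0, S)\<close> satisfies it with \<open>K = \<parallel>S\<parallel>\<^sub>2\<^sup>2\<close>. The first two
  moments alone do not make the norm of the channel estimate concentrate: interference \<open>\<xi> g\<close>
  with \<open>g \<sim> CN(0, I)\<close>, \<open>E{\<xi>\<^sup>2} = 1\<close> and a random \<open>\<xi>\<^sup>2\<close> has covariance \<open>I\<close>, but \<open>\<parallel>\<xi> g\<parallel>\<^sup>2 / N\<close> has the
  random limit \<open>\<xi>\<^sup>2\<close>.
\<close>

definition interf_quadratic_bound :: "real \<Rightarrow> bool" where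
  "interf_quadratic_bound K \<longleftrightarrow>
     (\<forall>B\<in>carrier_mat N N.
        (\<integral>\<^sup>+\<omega>. ennreal ((cmod ((B *\<^sub>v Matrix.vec N (interf \<omega>)) \<bullet>c Matrix.vec N (interf \<omega>)
                 - mtrace (B * cov_S U)))\<^sup>2) \<partial>prb U)
          \<le> ennreal (K * real N * (spectral_norm B)\<^sup>2))"


subsection \<open>Capacity and lower bound\<close>

text \<open>The admissible conditional laws \<open>f(d | H\<^sup>U\<^sup>E)\<close> of the data signal.\<close>

definition input_laws :: "('u \<Rightarrow> complex measure) set" where
  "input_laws = {f \<in> ue_space U \<rightarrow>\<^sub>M prob_algebra borel.
     \<forall>u\<in>space (ue_space U). (\<integral>\<^sup>+d. ennreal ((cmod d)\<^sup>2) \<partial>f u) \<le> ennreal (p_UE P)}"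

text \<open>
  The mutual information (in bits) between data signal and received signal for given realizations
  \<open>c\<close>, \<open>b\<close>, \<open>u\<close> of all channels and of the channel knowledge at BS and UE. All signals are
  independent over time, so that given \<open>c\<close> the distortion and receiver noises of the data phase
  do not depend on \<open>b\<close>, \<open>u\<close>, which stem from other channel uses. Since \<open>sigma2\<close> is positive, the
  joint law has a density with respect to the product of its marginals.
\<close>

definition mutual_info :: "('u \<Rightarrow> complex measure) \<Rightarrow> 'c \<Rightarrow> 'b \<Rightarrow> 'u \<Rightarrow> real" where
  "mutual_info f c b u =
     prob_space.mutual_information
       (f u \<Otimes>\<^sub>M disturb_law P N (user U c) (data_interf U (c, b, u)))
       2 borel (cspace N) (\<lambda>(d, w). d) (\<lambda>(d, w). received N (user U c) d w)"

text \<open>The maximum over the input laws is a supremum, as it need not be attained.\<close>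

definition capacity :: ennreal where
  "capacity = ennreal (real (T_data P) / real (T_coher P)) *
     (\<integral>\<^sup>+\<omega>. (SUP f\<in>input_laws.
        ennreal (mutual_info f (chan U \<omega>) (bs_csi U \<omega>) (ue_csi U \<omega>))) \<partial>prb U)"

text \<open>The bound for combining with \<open>v\<close> when the decoder uses no instantaneous channel knowledge.\<close>

definition capacity_lower :: "('a \<Rightarrow> complex vec) \<Rightarrow> real" where
  "capacity_lower v = real (T_data P) / real (T_coher P) *
     log 2 (1 + (cmod (expect (\<lambda>\<omega>. v \<omega> \<bullet>c hvec \<omega>)))\<^sup>2 /
       ((1 + kappa_t P) * expect (\<lambda>\<omega>. (cmod (v \<omega> \<bullet>c hvec \<omega>))\<^sup>2)
        - (cmod (expect (\<lambda>\<omega>. v \<omega> \<bullet>c hvec \<omega>)))\<^sup>2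
        + kappa_r P * (\<Sum>i<N. expect (\<lambda>\<omega>. (cmod (hvec \<omega> $ i))\<^sup>2 * (cmod (v \<omega> $ i))\<^sup>2))
        + expect (\<lambda>\<omega>. Re (((cov_Q U (chan U \<omega>) + complex_of_real (sigma2 P) \<cdot>\<^sub>m 1\<^sub>m N) *\<^sub>v v \<omega>)
                        \<bullet>c v \<omega>)) / p_UE P))"

definition phi :: "'a \<Rightarrow> complex" where
  "phi \<omega> = (1 + inverse (pilot P) * eta_t \<omega>)
       * complex_of_real (sqrt (Re (mtrace (cov_R U - err_cov))))
     / complex_of_real (sqrt (Re (mtrace
         (lmmse * (complex_of_real ((cmod (pilot P + eta_t \<omega>))\<^sup>2) \<cdot>\<^sub>m cov_R U + Psi)
           * mat_adjoint lmmse))))"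

end

end

theory Submission
  imports Defs
begin

text \<open>Normalise by \<open>\<tau> = tr (R - C)\<close>, which grows like \<open>N\<close>. The combined gain is \<open>X\<^sub>1 / sqrt (X\<^sub>2 \<tau>)\<close>, where
  \<open>X\<^sub>1 = h\<^sup>H hhat\<close> and \<open>X\<^sub>2 = \<parallel>hhat\<parallel>\<^sup>2\<close> are forms in the channel and the pilot disturbance whose mean-square
  fluctuation is \<open>O(N)\<close>, by Gaussian fourth moments and the trace-lemma condition. Conditionally on \<open>\<eta>\<close>
  the two concentrate at the numerator and denominator of \<open>\<phi>\<close>, so the gain is within \<open>O(1 / sqrt N)\<close> of \<open>\<phi>\<close>
  in mean square, and all remaining terms of the bound are negligible after division by \<open>\<tau>\<close>.

  The capacity is bounded below with Gaussian input. For fixed channel knowledge the mutual information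
  dominates \<open>ln (p / s) + 1 - D / s\<close> for every \<open>s > 0\<close>, where \<open>D\<close> is the mean-square error of a linear
  estimate \<open>a v\<^sup>H z\<close> of the data. This is affine in \<open>D\<close>, so \<open>D\<close> can be averaged over the channel with \<open>a\<close>
  and \<open>s\<close> held fixed; the best constants give the stated signal-to-noise ratio.\<close>

abbreviation msq :: "'a measure \<Rightarrow> ('a \<Rightarrow> complex) \<Rightarrow> ennreal" where
  "msq M f \<equiv> \<integral>\<^sup>+x. ennreal ((cmod (f x))\<^sup>2) \<partial>M"

section \<open>Complex Gaussian moments\<close>

abbreviation "std_normal \<equiv> density lborel (\<lambda>x. ennreal (std_normal_density x))"

lemma prob_space_std_normal: "prob_space std_normal"
  by (rule prob_space_normal_density) simp

interpretation std_normal: prob_space std_normal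
  by (rule prob_space_std_normal)

interpretation std_normal_pair: pair_prob_space std_normal std_normal ..

lemma std_normal_monomial:
  "integrable (std_normal \<Otimes>\<^sub>M std_normal) (\<lambda>(x, y). x ^ a * y ^ b)" (is ?A)
  "(\<integral>(x, y). x ^ a * y ^ b \<partial>(std_normal \<Otimes>\<^sub>M std_normal)) =
     (\<integral>x. x ^ a \<partial>std_normal) * (\<integral>x. x ^ b \<partial>std_normal)" (is ?B)
proof -
  have i: "integrable std_normal (\<lambda>x. x ^ k)" for k
    by (subst integrable_density) (auto simp: integrable_std_normal_moment)
  show A: ?A
    by (rule std_normal_pair.Fubini_integrable) (auto simp: abs_mult intro!: i integrable_mult_right integrable_mult_left integrable_abs)
  show ?B
    by (subst std_normal_pair.integral_fst[OF A, symmetric]) (simp add: i)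
qed

lemma std_normal_moments:
  "(\<integral>x. x \<partial>std_normal) = 0" "(\<integral>x. x\<^sup>2 \<partial>std_normal) = 1" "(\<integral>x. x ^ 4 \<partial>std_normal) = 3"
proof -
  show "(\<integral>x. x \<partial>std_normal) = 0"
    using integral_std_normal_moment_odd[of 0] by (subst integral_density) auto
  show "(\<integral>x. x\<^sup>2 \<partial>std_normal) = 1"
    using integral_std_normal_moment_even[of 1] by (subst integral_density) (auto simp: fact_numeral)
  show "(\<integral>x. x ^ 4 \<partial>std_normal) = 3"
    using integral_std_normal_moment_even[of 2] by (subst integral_density) (auto simp: fact_numeral)
qed

lemma measurable_Complex_pair [measurable]: "(\<lambda>(x, y). Complex (a * x) (b * y)) \<in> borel \<Otimes>\<^sub>M borel \<rightarrow>\<^sub>M borel"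
proof -
  have "(\<lambda>(x, y). Complex (a * x) (b * y)) = (\<lambda>p. complex_of_real (a * fst p) + \<i> * complex_of_real (b * snd p))"
    by (auto simp: complex_eq_iff)
  then show ?thesis by simp
qed

lemma borel_measurable_cnj [measurable]: "cnj \<in> borel_measurable borel"
  by (intro borel_measurable_continuous_onI continuous_intros)

lemma sets_CN [simp, measurable_cong]: "sets (CN v) = sets borel"
  by (simp add: CN_def)

lemma space_CN [simp]: "space (CN v) = UNIV"
  by (simp add: CN_def)

lemma prob_space_CN: "prob_space (CN v)"
  unfolding CN_def by (rule std_normal_pair.prob_space_distr) simp

interpretation CN: prob_space "CN v" for v
  by (rule prob_space_CN)

lemma measure_CN_UNIV [simp]: "measure (CN v) UNIV = 1"
  using CN.prob_space[of v] by simp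

interpretation CN_prod: product_prob_space "\<lambda>i. CN (v i)" I for v :: "nat \<Rightarrow> real" and I
  ..

lemma nn_integral_CN:
  assumes [measurable]: "F \<in> borel_measurable borel"
  shows "(\<integral>\<^sup>+z. F z \<partial>CN v) =
    (\<integral>\<^sup>+x. \<integral>\<^sup>+y. F (Complex (sqrt (v / 2) * x) (sqrt (v / 2) * y)) \<partial>std_normal \<partial>std_normal)"
  unfolding CN_def
  by (subst nn_integral_distr) (auto simp: std_normal.nn_integral_fst[symmetric] split_beta')

lemma CN_scale:
  assumes "0 \<le> v"
  shows "CN v = distr (CN 1) borel (\<lambda>z. complex_of_real (sqrt v) * z)"
proof -
  have "sqrt (v / 2) = sqrt v * sqrt (1 / 2)"
    by (simp add: real_sqrt_divide)
  then have eq: "Complex (sqrt (v / 2) * x) (sqrt (v / 2) * y) = complex_of_real (sqrt v) * Complex (sqrt (1 / 2) * x) (sqrt (1 / 2) * y)" for x y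
    by (simp add: complex_eq_iff)
  have "distr (CN 1) borel (\<lambda>z. complex_of_real (sqrt v) * z) =
      distr (std_normal \<Otimes>\<^sub>M std_normal) borel ((\<lambda>z. complex_of_real (sqrt v) * z) \<circ> (\<lambda>(x, y). Complex (sqrt (1 / 2) * x) (sqrt (1 / 2) * y)))"
    unfolding CN_def by (rule distr_distr) auto
  then show ?thesis
    unfolding CN_def comp_def split_beta' eq by simp
qed

lemma CN1_moments:
  "has_bochner_integral (CN 1) (\<lambda>z. z) 0"
  "has_bochner_integral (CN 1) (\<lambda>z. z\<^sup>2) 0"
  "has_bochner_integral (CN 1) (\<lambda>z. (cmod z)\<^sup>2) 1"
  "has_bochner_integral (CN 1) (\<lambda>z. (cmod z) ^ 4) 2"
proof -
  let ?P = "std_normal \<Otimes>\<^sub>M std_normal"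
  have pu: "measure std_normal UNIV = 1"
    using std_normal.prob_space by simp
  define r where "r = sqrt (1/2::real)"
  have m: "has_bochner_integral ?P (\<lambda>p. fst p ^ a * snd p ^ b) ((\<integral>x. x ^ a \<partial>std_normal) * (\<integral>x. x ^ b \<partial>std_normal))" for a b
    using std_normal_monomial[of a b] by (simp add: has_bochner_integral_iff split_beta')
  have CN1: "CN 1 = distr ?P borel (\<lambda>p. Complex (r * fst p) (r * snd p))"
    unfolding CN_def r_def split_beta' ..
  have [measurable]: "(\<lambda>p. Complex (r * fst p) (r * snd p)) \<in> ?P \<rightarrow>\<^sub>M borel"
    using measurable_Complex_pair[of r r] unfolding split_beta' by simp
  have c: "has_bochner_integral M (\<lambda>p. complex_of_real (f p)) (complex_of_real x)"
    if "has_bochner_integral M f x" for M :: "(real \<times> real) measure" and f x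
    using that by (rule has_bochner_integral_of_real)
  have tr: "has_bochner_integral (CN 1) f x" if [measurable]: "f \<in> borel_measurable borel" and "has_bochner_integral ?P (\<lambda>p. f (Complex (r * fst p) (r * snd p))) x"
    for f :: "complex \<Rightarrow> 'x::{banach, second_countable_topology}" and x
    using that(2) unfolding CN1 has_bochner_integral_iff
    by (subst integrable_distr_eq, simp, simp, subst integral_distr, simp, simp, simp)
  have s: "r\<^sup>2 = 1/2" by (simp add: r_def)
  show "has_bochner_integral (CN 1) (\<lambda>z. z) 0"
    apply (rule tr, simp)
    using has_bochner_integral_add[OF has_bochner_integral_mult_right[OF c[OF m[of 1 0]], of "complex_of_real (r)"]
        has_bochner_integral_mult_right[OF c[OF m[of 0 1]], of "\<i> * complex_of_real (r)"]]
    by (simp add: std_normal_moments Complex_eq algebra_simps)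
  show "has_bochner_integral (CN 1) (\<lambda>z. z\<^sup>2) 0"
  proof (rule tr, simp)
    have eq: "(Complex (r * x) (r * y))\<^sup>2 = (1/2) * (complex_of_real (x^2 * y^0) - complex_of_real (x^0 * y^2)) + \<i> * complex_of_real (x^1 * y^1)" for x y
    proof -
      have *: "r * x * (r * y) = x * y / 2" for x y using s by (simp add: power2_eq_square)
      show ?thesis by (simp add: complex_eq_iff power2_eq_square * right_diff_distrib del: mult.assoc) 
    qed
    show "has_bochner_integral ?P (\<lambda>p. (Complex (r * fst p) (r * snd p))\<^sup>2) 0"
      unfolding eq
      using has_bochner_integral_add[OF has_bochner_integral_mult_right[OF has_bochner_integral_diff[OF c[OF m[of 2 0]] c[OF m[of 0 2]]], of "1/2"]
        has_bochner_integral_mult_right[OF c[OF m[of 1 1]], of "\<i>"]]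
      by (simp add: std_normal_moments pu)
  qed
  show "has_bochner_integral (CN 1) (\<lambda>z. (cmod z)\<^sup>2) 1"
  proof (rule tr, simp)
    have eq: "(cmod (Complex (r * x) (r * y)))\<^sup>2 = (1/2) * (x^2 * y^0 + x^0 * y^2)" for x y
      by (simp add: cmod_power2 power_mult_distrib s) 
    show "has_bochner_integral ?P (\<lambda>p. (cmod (Complex (r * fst p) (r * snd p)))\<^sup>2) 1"
      unfolding eq
      using has_bochner_integral_mult_right[OF has_bochner_integral_add[OF m[of 2 0] m[of 0 2]], of "1/2"]
      by (simp add: std_normal_moments pu)
  qed
  show "has_bochner_integral (CN 1) (\<lambda>z. (cmod z) ^ 4) 2"
  proof (rule tr, simp)
    have eq: "(cmod (Complex (r * x) (r * y)))^4 = (1/4) * (x^4 * y^0 + x^0 * y^4) + (1/2) * (x^2 * y^2)" for x y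
    proof -
      have "(cmod (Complex (r * x) (r * y)))^4 = ((cmod (Complex (r * x) (r * y)))^2)^2"
        by (simp add: power_mult[symmetric])
      also have "\<dots> = ((1/2) * (x^2 + y^2))^2"
        by (simp add: cmod_power2 power_mult_distrib s)
      finally show ?thesis by (simp add: power2_eq_square algebra_simps power4_eq_xxxx)
    qed
    show "has_bochner_integral ?P (\<lambda>p. (cmod (Complex (r * fst p) (r * snd p)))^4) 2"
      unfolding eq
      using has_bochner_integral_add[OF has_bochner_integral_mult_right[OF has_bochner_integral_add[OF m[of 4 0] m[of 0 4]], of "1/4"] has_bochner_integral_mult_right[OF m[of 2 2], of "1/2"]]
      by (simp add: std_normal_moments pu)
  qed
qed

lemma distr_PiM_componentwise:
  assumes I: "finite I" and M: "\<And>i. prob_space (M i)" 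
    and f[measurable]: "\<And>i. i \<in> I \<Longrightarrow> f i \<in> M i \<rightarrow>\<^sub>M M' i"
    and M': "\<And>i. i \<in> I \<Longrightarrow> sets (K i) = sets (M' i)"
    and K: "\<And>i. prob_space (K i)" and eq: "\<And>i. i \<in> I \<Longrightarrow> distr (M i) (M' i) (f i) = K i"
  shows "distr (PiM I M) (PiM I M') (\<lambda>x. \<lambda>i\<in>I. f i (x i)) = PiM I K"
proof -
  interpret M: product_prob_space M by (intro product_prob_spaceI M)
  interpret K: product_prob_space K by (intro product_prob_spaceI K)
  show ?thesis
  proof (rule K.PiM_eqI[OF I])
    show "sets (distr (PiM I M) (PiM I M') (\<lambda>x. \<lambda>i\<in>I. f i (x i))) = sets (PiM I K)"
      unfolding sets_distr by (intro sets_PiM_cong) (simp_all add: M')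
    fix A assume A: "\<And>i. i \<in> I \<Longrightarrow> A i \<in> sets (K i)"
    have A': "\<And>i. i \<in> I \<Longrightarrow> A i \<in> sets (M' i)" using A M' by blast
    have "emeasure (distr (PiM I M) (PiM I M') (\<lambda>x. \<lambda>i\<in>I. f i (x i))) (Pi\<^sub>E I A)
       = emeasure (PiM I M) ((\<lambda>x. \<lambda>i\<in>I. f i (x i)) -` Pi\<^sub>E I A \<inter> space (PiM I M))"
    proof (rule emeasure_distr)
      show "(\<lambda>x. \<lambda>i\<in>I. f i (x i)) \<in> PiM I M \<rightarrow>\<^sub>M PiM I M'"
      proof (rule measurable_restrict)
        fix i assume i: "i \<in> I"
        show "(\<lambda>x. f i (x i)) \<in> PiM I M \<rightarrow>\<^sub>M M' i"
          using measurable_component_singleton[OF i, of M] f[OF i] by (rule measurable_compose)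
      qed
      show "Pi\<^sub>E I A \<in> sets (PiM I M')" using I A' by (rule sets_PiM_I_finite)
    qed
    also have "(\<lambda>x. \<lambda>i\<in>I. f i (x i)) -` Pi\<^sub>E I A \<inter> space (PiM I M) = Pi\<^sub>E I (\<lambda>i. f i -` A i \<inter> space (M i))"
      by (auto simp: space_PiM PiE_iff extensional_def)
    also have "emeasure (PiM I M) \<dots> = (\<Prod>i\<in>I. emeasure (M i) (f i -` A i \<inter> space (M i)))"
      using A' by (intro M.emeasure_PiM[OF I]) (metis f measurable_sets)
    also have "\<dots> = (\<Prod>i\<in>I. emeasure (K i) (A i))"
    proof (intro prod.cong refl)
      fix i assume i: "i \<in> I"
      show "emeasure (M i) (f i -` A i \<inter> space (M i)) = emeasure (K i) (A i)"
        unfolding eq[OF i, symmetric] using f[OF i] A'[OF i] by (simp add: emeasure_distr)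
    qed
    finally show "emeasure (distr (PiM I M) (PiM I M') (\<lambda>x. \<lambda>i\<in>I. f i (x i))) (Pi\<^sub>E I A) = (\<Prod>i\<in>I. emeasure (K i) (A i))" .
  qed
qed

abbreviation CN_vec :: "nat \<Rightarrow> cvec measure" where
  "CN_vec N \<equiv> PiM {..<N} (\<lambda>_. CN 1)"

lemma sets_CN_PiM [simp, measurable_cong]: "sets (PiM {..<N} (\<lambda>i. CN (v i))) = sets (cspace N)"
  by (intro sets_PiM_cong) auto

lemma PiM_CN_scale:
  assumes "\<And>i. i < N \<Longrightarrow> 0 \<le> v i"
  shows "PiM {..<N} (\<lambda>i. CN (v i)) =
    distr (CN_vec N) (cspace N) (\<lambda>g. \<lambda>i\<in>{..<N}. complex_of_real (sqrt (v i)) * g i)"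
  using assms
  by (intro distr_PiM_componentwise[symmetric]) (auto simp: prob_space_CN CN_scale[symmetric])

lemma has_bochner_integral_complex_of_real:
  "has_bochner_integral M f x \<Longrightarrow> has_bochner_integral M (\<lambda>z. complex_of_real (f z)) (complex_of_real x)"
  by (rule has_bochner_integral_of_real)

lemma CN_vec_moment4:
  assumes "i < N" "j < N" "k < N" "l < N"
  shows "integrable (CN_vec N) (\<lambda>g. g i * g k * cnj (g j) * cnj (g l))"
    "(\<integral>g. g i * g k * cnj (g j) * cnj (g l) \<partial>CN_vec N)
      = (if i = j \<and> k = l then 1 else 0) + (if i = l \<and> k = j then 1 else 0)"
proof -
  define f where "f = (\<lambda>m (z::complex). (if m = i then z else 1) * (if m = k then z else 1)
     * (if m = j then cnj z else 1) * (if m = l then cnj z else 1))"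
  have eq: "g i * g k * cnj (g j) * cnj (g l) = (\<Prod>m\<in>{..<N}. f m (g m))" for g :: cvec
    using assms unfolding f_def by (simp add: prod.distrib)
  note b = CN1_moments[THEN has_bochner_integral_iff[THEN iffD1]]
  have i2: "integrable (CN 1) (\<lambda>z. z * z)" "(\<integral>z. z * z \<partial>CN 1) = 0"
    using b(2) by (simp_all add: power2_eq_square)
  have i3: "integrable (CN 1) (\<lambda>z. cnj z * cnj z)" "(\<integral>z. cnj z * cnj z \<partial>CN 1) = 0"
    using has_bochner_integral_cnj[OF CN1_moments(2)] by (simp_all add: has_bochner_integral_iff power2_eq_square)
  have i1: "integrable (CN 1) (\<lambda>z. cnj z)" "(\<integral>z. cnj z \<partial>CN 1) = 0"
    using has_bochner_integral_cnj[OF CN1_moments(1)] by (simp_all add: has_bochner_integral_iff power2_eq_square)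
  have e4: "z * cnj z = complex_of_real ((cmod z)\<^sup>2)" for z by (rule complex_norm_square[symmetric])
  have i4: "integrable (CN 1) (\<lambda>z. z * cnj z)" "(\<integral>z. z * cnj z \<partial>CN 1) = 1"
    using has_bochner_integral_complex_of_real[OF CN1_moments(3)]
    unfolding has_bochner_integral_iff e4[symmetric] of_real_1 by blast+
  have e5: "z * z * cnj z * cnj z = complex_of_real ((cmod z)^4)" for z
  proof -
    have "complex_of_real ((cmod z)^4) = complex_of_real ((cmod z)\<^sup>2) * complex_of_real ((cmod z)\<^sup>2)"
      by (simp flip: of_real_mult power_add)
    then show ?thesis unfolding e4[symmetric] by (simp only: mult_ac)
  qed
  have i5: "integrable (CN 1) (\<lambda>z. z * z * cnj z * cnj z)" "(\<integral>z. z * z * cnj z * cnj z \<partial>CN 1) = 2"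
    using has_bochner_integral_complex_of_real[OF CN1_moments(4)]
    unfolding has_bochner_integral_iff e5[symmetric] of_real_numeral by blast+
  have int: "integrable (CN 1) (f m)" for m
  proof (rule Bochner_Integration.integrable_bound[where f="\<lambda>z. 1 + norm z ^ 4"])
    show "integrable (CN 1) (\<lambda>z. 1 + norm z ^ 4)" using b(4) by auto
    show "f m \<in> borel_measurable (CN 1)"
      unfolding f_def by (cases "m = i"; cases "m = j"; cases "m = k"; cases "m = l"; simp)
    have "norm (f m z) \<le> 1 + norm z ^ 4" for z
    proof -
      define r where "r = max 1 (norm z)"
      have r0: "0 \<le> r" by (simp add: r_def)
      have f1: "norm (if P then z else 1) \<le> r" "norm (if P then cnj z else 1) \<le> r" for P
        by (auto simp: r_def)
      have "norm (f m z) \<le> r * r * r * r"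
        unfolding f_def norm_mult
        by (rule mult_mono[OF mult_mono[OF mult_mono[OF f1(1) f1(1)] f1(2)] f1(2)]) (simp_all add: r0)
      also have "\<dots> \<le> 1 + norm z ^ 4"
        unfolding r_def by (cases "1 \<le> norm z") (simp_all add: max_def power4_eq_xxxx)
      finally show ?thesis .
    qed
    then show "AE z in CN 1. norm (f m z) \<le> norm (1 + norm z ^ 4)"
      by (intro AE_I2) simp
  qed
  have ms: "(\<integral>g. (\<Prod>m\<in>{..<N}. f m (g m)) \<partial>CN_vec N) = (\<Prod>m\<in>{..<N}. integral\<^sup>L (CN 1) (f m))"
    by (rule CN_prod.product_integral_prod) (auto intro: int)
  show "integrable (CN_vec N) (\<lambda>g. g i * g k * cnj (g j) * cnj (g l))"
    unfolding eq by (rule CN_prod.product_integrable_prod) (auto intro: int)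
  have z: "(\<Prod>m\<in>{..<N}. integral\<^sup>L (CN 1) (f m)) = 0" if "m < N" "integral\<^sup>L (CN 1) (f m) = 0" for m
    using that by (intro prod_zero) auto
  show "(\<integral>g. g i * g k * cnj (g j) * cnj (g l) \<partial>CN_vec N)
      = (if i = j \<and> k = l then 1 else 0) + (if i = l \<and> k = j then 1 else 0)"
  proof -
    have one: "integral\<^sup>L (CN 1) (f m) = 1" if "m \<noteq> i" "m \<noteq> j" "m \<noteq> k" "m \<noteq> l" for m
      using that unfolding f_def by (simp add: CN.prob_space)
    consider "i = k" "i = j" "i = l" | "i = k" "i = j" "i \<noteq> l" | "i = k" "i \<noteq> j" "i = l"
      | "i = k" "i \<noteq> j" "i \<noteq> l" | "i \<noteq> k" "i = j" "k = l" | "i \<noteq> k" "i = j" "k \<noteq> l"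
      | "i \<noteq> k" "i \<noteq> j" "i = l" "k = j" | "i \<noteq> k" "i \<noteq> j" "i = l" "k \<noteq> j" | "i \<noteq> k" "i \<noteq> j" "i \<noteq> l"
      by argo
    then show ?thesis
    proof cases
      case 1
      have "(\<Prod>m\<in>{..<N}. integral\<^sup>L (CN 1) (f m)) = (\<Prod>m\<in>{..<N}. if m = i then 2 else 1)"
        using 1 i5 one by (intro prod.cong) (simp_all add: f_def)
      then show ?thesis unfolding eq ms using 1 assms by simp
    next
      case 2
      then have "integral\<^sup>L (CN 1) (f l) = 0" using i1(2) by (simp add: f_def)
      with 2 assms show ?thesis unfolding eq ms by (subst z[of l]) simp_all
    next
      case 3
      then have "integral\<^sup>L (CN 1) (f j) = 0" using i1(2) by (simp add: f_def)
      with 3 assms show ?thesis unfolding eq ms by (subst z[of j]) simp_all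
    next
      case 4
      then have "integral\<^sup>L (CN 1) (f i) = 0" using i2(2) by (simp add: f_def)
      with 4 assms show ?thesis unfolding eq ms by (subst z[of i]) simp_all
    next
      case 5
      have "integral\<^sup>L (CN 1) (f m) = 1" for m
      proof -
        consider "m = i" | "m \<noteq> i" "m = k" | "m \<noteq> i" "m \<noteq> k" by argo
        then show ?thesis
          by cases (use 5 i4(2) one[of m] in \<open>simp_all add: f_def\<close>)
      qed
      then show ?thesis unfolding eq ms using 5 by simp
    next
      case 6
      then have "integral\<^sup>L (CN 1) (f k) = 0" using b(1) by (simp add: f_def)
      with 6 assms show ?thesis unfolding eq ms by (subst z[of k]) simp_all
    next
      case 7
      have "integral\<^sup>L (CN 1) (f m) = 1" for m
      proof -
        consider "m = i" | "m \<noteq> i" "m = k" | "m \<noteq> i" "m \<noteq> k" by argo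
        then show ?thesis
          by cases (use 7 i4(2) one[of m] in \<open>simp_all add: f_def\<close>)
      qed
      then show ?thesis unfolding eq ms using 7 by simp
    next
      case 8
      then have "integral\<^sup>L (CN 1) (f k) = 0" using b(1) by (simp add: f_def)
      with 8 assms show ?thesis unfolding eq ms by (subst z[of k]) simp_all
    next
      case 9
      then have "integral\<^sup>L (CN 1) (f i) = 0" using b(1) by (simp add: f_def)
      with 9 assms show ?thesis unfolding eq ms by (subst z[of i]) simp_all
    qed
  qed
qed

lemma CN_vec_moment2:
  assumes "i < N" "j < N"
  shows "integrable (CN_vec N) (\<lambda>g. g i * cnj (g j))"
    "(\<integral>g. g i * cnj (g j) \<partial>CN_vec N) = (if i = j then 1 else 0)"
proof -
  define f where "f = (\<lambda>m (z::complex). (if m = i then z else 1) * (if m = j then cnj z else 1))"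
  have eq: "g i * cnj (g j) = (\<Prod>m\<in>{..<N}. f m (g m))" for g :: cvec
    using assms unfolding f_def by (simp add: prod.distrib)
  note b = CN1_moments[THEN has_bochner_integral_iff[THEN iffD1]]
  have i1: "integrable (CN 1) (\<lambda>z. cnj z)" "(\<integral>z. cnj z \<partial>CN 1) = 0"
    using has_bochner_integral_cnj[OF CN1_moments(1)] by (simp_all add: has_bochner_integral_iff power2_eq_square)
  have e4: "z * cnj z = complex_of_real ((cmod z)\<^sup>2)" for z by (rule complex_norm_square[symmetric])
  have i4: "integrable (CN 1) (\<lambda>z. z * cnj z)" "(\<integral>z. z * cnj z \<partial>CN 1) = 1"
    using has_bochner_integral_complex_of_real[OF CN1_moments(3)]
    unfolding has_bochner_integral_iff e4[symmetric] of_real_1 by blast+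
  have int: "integrable (CN 1) (f m)" for m
  proof -
    consider "m = i" "m = j" | "m = i" "m \<noteq> j" | "m \<noteq> i" "m = j" | "m \<noteq> i" "m \<noteq> j" by metis
    then show ?thesis
      by cases (use i4 i1 b(1) in \<open>simp_all add: f_def cong: if_cong\<close>)
  qed
  have ms: "(\<integral>g. (\<Prod>m\<in>{..<N}. f m (g m)) \<partial>CN_vec N) = (\<Prod>m\<in>{..<N}. integral\<^sup>L (CN 1) (f m))"
    by (rule CN_prod.product_integral_prod) (auto intro: int)
  show "integrable (CN_vec N) (\<lambda>g. g i * cnj (g j))"
    unfolding eq by (rule CN_prod.product_integrable_prod) (auto intro: int)
  have z: "(\<Prod>m\<in>{..<N}. integral\<^sup>L (CN 1) (f m)) = 0" if "m < N" "integral\<^sup>L (CN 1) (f m) = 0" for m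
    using that by (intro prod_zero) auto
  show "(\<integral>g. g i * cnj (g j) \<partial>CN_vec N) = (if i = j then 1 else 0)"
  proof (cases "i = j")
    case True
    have "integral\<^sup>L (CN 1) (f m) = 1" for m
      using True i4 by (cases "m = i") (auto simp: f_def CN.prob_space)
    then show ?thesis unfolding eq ms using True by simp
  next
    case False
    then have "integral\<^sup>L (CN 1) (f i) = 0" using b(1) by (auto simp: f_def)
    with False assms show ?thesis unfolding eq ms by (subst z[of i]) auto
  qed
qed

section \<open>Operator and Frobenius norms\<close>

definition sqn :: "nat \<Rightarrow> (nat \<Rightarrow> complex) \<Rightarrow> real" where
  "sqn N x = (\<Sum>i<N. (cmod (x i))\<^sup>2)"

definition app :: "nat \<Rightarrow> (nat \<Rightarrow> nat \<Rightarrow> complex) \<Rightarrow> (nat \<Rightarrow> complex) \<Rightarrow> nat \<Rightarrow> complex" where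
  "app N B x i = (\<Sum>j<N. B i j * x j)"

definition opb :: "nat \<Rightarrow> (nat \<Rightarrow> nat \<Rightarrow> complex) \<Rightarrow> real \<Rightarrow> bool" where
  "opb N B c \<longleftrightarrow> 0 \<le> c \<and> (\<forall>x. sqn N (app N B x) \<le> c\<^sup>2 * sqn N x)"

definition frob :: "nat \<Rightarrow> (nat \<Rightarrow> nat \<Rightarrow> complex) \<Rightarrow> real" where
  "frob N B = (\<Sum>i<N. sqn N (B i))"

lemma sqn_nonneg [simp]: "0 \<le> sqn N x"
  by (simp add: sqn_def sum_nonneg)

lemma frob_nonneg [simp]: "0 \<le> frob N B"
  by (simp add: frob_def sum_nonneg)

lemma sqn_cong: "(\<And>i. i < N \<Longrightarrow> cmod (x i) = cmod (y i)) \<Longrightarrow> sqn N x = sqn N y"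
  by (simp add: sqn_def)

lemma sqn_cnj [simp]: "sqn N (\<lambda>i. cnj (x i)) = sqn N x"
  by (simp add: sqn_def)

lemma sqn_scale: "sqn N (\<lambda>i. c * x i) = (cmod c)\<^sup>2 * sqn N x"
  by (simp add: sqn_def norm_mult power_mult_distrib sum_distrib_left)

lemma frob_transpose: "frob N (\<lambda>i j. B j i) = frob N B"
  unfolding frob_def sqn_def by (rule sum.swap)

lemma sqn_complex: "complex_of_real (sqn N x) = (\<Sum>i<N. x i * cnj (x i))"
  by (simp add: sqn_def complex_norm_square del: of_real_power)

lemma sum_Cauchy_Schwarz_complex:
  "(cmod (\<Sum>i<N. x i * y i))\<^sup>2 \<le> sqn N x * sqn N y"
proof -
  have "cmod (\<Sum>i<N. x i * y i) \<le> (\<Sum>i<N. cmod (x i) * cmod (y i))"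
    by (rule order_trans[OF norm_sum]) (simp add: norm_mult)
  then have "(cmod (\<Sum>i<N. x i * y i))\<^sup>2 \<le> (\<Sum>i<N. cmod (x i) * cmod (y i))\<^sup>2"
    by (intro power_mono) auto
  also have "\<dots> \<le> sqn N x * sqn N y"
    unfolding sqn_def by (rule Cauchy_Schwarz_ineq_sum)
  finally show ?thesis .
qed

lemma opb_nonneg: "opb N B c \<Longrightarrow> 0 \<le> c"
  by (simp add: opb_def)

lemma opbD: "opb N B c \<Longrightarrow> sqn N (app N B x) \<le> c\<^sup>2 * sqn N x"
  by (simp add: opb_def)

lemma opb_mono:
  assumes "opb N B c" "c \<le> c'" shows "opb N B c'"
proof -
  have "c\<^sup>2 * sqn N x \<le> c'\<^sup>2 * sqn N x" for x
    using assms by (intro mult_right_mono power_mono) (auto simp: opb_def)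
  then show ?thesis using assms unfolding opb_def by (meson order_trans)
qed

lemma opb_cong: "opb N B c \<Longrightarrow> (\<And>i j. i < N \<Longrightarrow> j < N \<Longrightarrow> B i j = B' i j) \<Longrightarrow> opb N B' c"
  unfolding opb_def sqn_def app_def by simp

lemma opb_frob: "opb N B (sqrt (frob N B))"
proof -
  have "(cmod (app N B x i))\<^sup>2 \<le> sqn N (B i) * sqn N x" for x i
    unfolding app_def by (rule sum_Cauchy_Schwarz_complex)
  then have "sqn N (app N B x) \<le> frob N B * sqn N x" for x
    unfolding sqn_def[of N "app N B x"] frob_def sum_distrib_right by (intro sum_mono)
  then show ?thesis by (simp add: opb_def)
qed

lemma opb_transpose:
  assumes "opb N B c" shows "opb N (\<lambda>i j. B j i) c"
  unfolding opb_def
proof safe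
  show "0 \<le> c" using assms by (rule opb_nonneg)
  fix x
  define y where "y = app N (\<lambda>i j. B j i) x"
  have "complex_of_real (sqn N y) = (\<Sum>j<N. \<Sum>i<N. B i j * x i * cnj (y j))"
    unfolding sqn_complex by (rule sum.cong[OF refl]) (subst y_def, simp add: app_def sum_distrib_right)
  also have "\<dots> = (\<Sum>i<N. x i * app N B (\<lambda>j. cnj (y j)) i)"
    unfolding app_def sum_distrib_left by (subst sum.swap) (simp add: mult_ac)
  finally have "(sqn N y)\<^sup>2 \<le> sqn N x * sqn N (app N B (\<lambda>j. cnj (y j)))"
    using sum_Cauchy_Schwarz_complex[where N=N and x=x and y="app N B (\<lambda>j. cnj (y j))"] 
    by (metis norm_of_real power2_abs)
  also have "\<dots> \<le> sqn N x * (c\<^sup>2 * sqn N y)"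
    using opbD[OF assms, of "\<lambda>j. cnj (y j)"] by (intro mult_left_mono) auto
  finally have "sqn N y * sqn N y \<le> (c\<^sup>2 * sqn N x) * sqn N y"
    by (simp add: power2_eq_square mult_ac)
  then show "sqn N (app N (\<lambda>i j. B j i) x) \<le> c\<^sup>2 * sqn N x"
    unfolding y_def[symmetric] using sqn_nonneg[of N y] sqn_nonneg[of N x]
    by (cases "sqn N y = 0") (auto simp: mult_le_cancel_right)
qed

lemma opb_cnj:
  assumes "opb N B c" shows "opb N (\<lambda>i j. cnj (B i j)) c"
proof -
  have "sqn N (app N (\<lambda>i j. cnj (B i j)) x) = sqn N (app N B (\<lambda>i. cnj (x i)))" for x
  proof -
    have "app N (\<lambda>i j. cnj (B i j)) x = (\<lambda>i. cnj (app N B (\<lambda>i. cnj (x i)) i))"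
      by (simp add: app_def fun_eq_iff)
    then show ?thesis by simp
  qed
  then show ?thesis using assms opbD[OF assms, of "\<lambda>i. cnj (x i)" for x] by (simp add: opb_def)
qed

lemma opb_adjoint: "opb N B c \<Longrightarrow> opb N (\<lambda>i j. cnj (B j i)) c"
  by (drule opb_transpose, drule opb_cnj)

lemma opb_mult:
  assumes "opb N A a" "opb N B b"
  shows "opb N (\<lambda>i k. \<Sum>j<N. A i j * B j k) (a * b)"
proof -
  have eq: "app N (\<lambda>i k. \<Sum>j<N. A i j * B j k) x = app N A (app N B x)" for x
    unfolding app_def fun_eq_iff sum_distrib_right sum_distrib_left
    by (subst sum.swap) (simp add: mult_ac)
  have "sqn N (app N A (app N B x)) \<le> (a * b)\<^sup>2 * sqn N x" for x
  proof -
    have "sqn N (app N A (app N B x)) \<le> a\<^sup>2 * sqn N (app N B x)" by (rule opbD[OF assms(1)])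
    also have "\<dots> \<le> a\<^sup>2 * (b\<^sup>2 * sqn N x)" by (intro mult_left_mono opbD[OF assms(2)]) auto
    finally show ?thesis by (simp add: power_mult_distrib mult_ac)
  qed
  then show ?thesis using assms by (auto simp: opb_def eq)
qed

lemma opb_scale:
  assumes "opb N B c" shows "opb N (\<lambda>i j. s * B i j) (cmod s * c)"
proof -
  have "app N (\<lambda>i j. s * B i j) x = (\<lambda>i. s * app N B x i)" for x
    by (simp add: app_def fun_eq_iff sum_distrib_left mult_ac)
  then show ?thesis using assms
    by (auto simp: opb_def sqn_scale power_mult_distrib mult.assoc intro!: mult_left_mono)
qed

lemma sqrt_sqn: "sqrt (sqn N x) = L2_set (\<lambda>i. cmod (x i)) {..<N}"
  by (simp add: sqn_def L2_set_def)

lemma opb_add: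
  assumes "opb N A a" "opb N B b" shows "opb N (\<lambda>i j. A i j + B i j) (a + b)"
  unfolding opb_def
proof safe
  show "0 \<le> a + b" using assms by (simp add: opb_def)
  fix x
  have A: "sqrt (sqn N (app N A x)) \<le> a * sqrt (sqn N x)"
    using real_sqrt_le_mono[OF opbD[OF assms(1), of x]] opb_nonneg[OF assms(1)] by (simp add: real_sqrt_mult)
  have B: "sqrt (sqn N (app N B x)) \<le> b * sqrt (sqn N x)"
    using real_sqrt_le_mono[OF opbD[OF assms(2), of x]] opb_nonneg[OF assms(2)] by (simp add: real_sqrt_mult)
  have "app N (\<lambda>i j. A i j + B i j) x = (\<lambda>i. app N A x i + app N B x i)"
    by (simp add: app_def fun_eq_iff sum.distrib distrib_right)
  then have "sqrt (sqn N (app N (\<lambda>i j. A i j + B i j) x)) \<le> L2_set (\<lambda>i. cmod (app N A x i) + cmod (app N B x i)) {..<N}"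
    unfolding sqrt_sqn by (auto intro!: L2_set_mono norm_triangle_ineq)
  also have "\<dots> \<le> sqrt (sqn N (app N A x)) + sqrt (sqn N (app N B x))"
    unfolding sqrt_sqn by (rule L2_set_triangle_ineq)
  also have "\<dots> \<le> (a + b) * sqrt (sqn N x)" using A B by (simp add: distrib_right)
  finally have "(sqrt (sqn N (app N (\<lambda>i j. A i j + B i j) x)))\<^sup>2 \<le> ((a + b) * sqrt (sqn N x))\<^sup>2"
    by (intro power_mono) auto
  then show "sqn N (app N (\<lambda>i j. A i j + B i j) x) \<le> (a + b)\<^sup>2 * sqn N x"
    by (simp add: power_mult_distrib)
qed

lemma opb_diag:
  assumes "\<And>i. i < N \<Longrightarrow> cmod (d i) \<le> c" "0 \<le> c"
  shows "opb N (\<lambda>i j. if i = j then d i else 0) c"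
proof -
  have "(cmod (app N (\<lambda>i j. if i = j then d i else 0) x i))\<^sup>2 \<le> c\<^sup>2 * (cmod (x i))\<^sup>2" if "i < N" for x i
  proof -
    have "app N (\<lambda>i j. if i = j then d i else 0) x i = d i * x i"
      using that by (simp add: app_def if_distrib[of "\<lambda>z. z * _"] cong: if_cong)
    then show ?thesis using assms(1)[OF that]
      by (simp add: norm_mult power_mult_distrib mult_right_mono power_mono)
  qed
  then show ?thesis using assms(2) by (auto simp: opb_def sqn_def sum_distrib_left intro!: sum_mono)
qed

lemma opb_row:
  assumes "opb N B c" "i < N" shows "sqn N (B i) \<le> c\<^sup>2"
proof -
  have "app N (\<lambda>i j. B j i) (\<lambda>k. if k = i then 1 else 0) = B i"
    using assms(2) by (simp add: app_def fun_eq_iff if_distrib[of "\<lambda>z. _ * z"] cong: if_cong)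
  moreover have "sqn N (\<lambda>k. if k = i then 1 else 0) = 1"
    using assms(2) by (simp add: sqn_def if_distrib[of "\<lambda>z. (cmod z)\<^sup>2"] cong: if_cong)
  ultimately show ?thesis using opbD[OF opb_transpose[OF assms(1)], of "\<lambda>k. if k = i then 1 else 0"] by simp
qed

lemma opb_entry:
  assumes "opb N B c" "i < N" "j < N" shows "cmod (B i j) \<le> c"
proof -
  have "(cmod (B i j))\<^sup>2 \<le> sqn N (B i)"
    unfolding sqn_def using assms(3) by (intro member_le_sum[of j]) auto
  also have "\<dots> \<le> c\<^sup>2" by (rule opb_row[OF assms(1,2)])
  finally show ?thesis using opb_nonneg[OF assms(1)] by (rule power2_le_imp_le)
qed

lemma frob_le: "opb N B c \<Longrightarrow> frob N B \<le> real N * c\<^sup>2"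
  using sum_bounded_above[of "{..<N}" "\<lambda>i. sqn N (B i)" "c\<^sup>2"] opb_row[of N B c]
  by (simp add: frob_def)

lemma opb_quad:
  assumes "opb N B c"
  shows "cmod (\<Sum>i<N. \<Sum>j<N. x i * B i j * cnj (x j)) \<le> c * sqn N x"
proof -
  have eq: "(\<Sum>i<N. \<Sum>j<N. x i * B i j * cnj (x j)) = (\<Sum>i<N. x i * app N B (\<lambda>j. cnj (x j)) i)"
    unfolding app_def sum_distrib_left by (simp only: mult.assoc)
  have "sqn N x * sqn N (app N B (\<lambda>j. cnj (x j))) \<le> sqn N x * (c\<^sup>2 * sqn N x)"
    using opbD[OF assms, of "\<lambda>j. cnj (x j)"] by (intro mult_left_mono) simp_all
  then have "(cmod (\<Sum>i<N. \<Sum>j<N. x i * B i j * cnj (x j)))\<^sup>2 \<le> sqn N x * (c\<^sup>2 * sqn N x)"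
    unfolding eq by (rule order_trans[OF sum_Cauchy_Schwarz_complex])
  also have "\<dots> = (c * sqn N x)\<^sup>2" by (simp add: power2_eq_square)
  finally show ?thesis
    by (rule power2_le_imp_le) (simp add: opb_nonneg[OF assms])
qed

lemma frob_mult_left:
  assumes "opb N K k" shows "frob N (\<lambda>i l. \<Sum>j<N. K i j * B j l) \<le> k\<^sup>2 * frob N B"
proof -
  have "frob N (\<lambda>i l. \<Sum>j<N. K i j * B j l) = (\<Sum>l<N. sqn N (app N K (\<lambda>j. B j l)))"
    by (subst frob_transpose[symmetric]) (simp add: frob_def app_def[abs_def])
  also have "\<dots> \<le> (\<Sum>l<N. k\<^sup>2 * sqn N (\<lambda>j. B j l))" by (intro sum_mono opbD assms)
  also have "\<dots> = k\<^sup>2 * frob N B"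
    by (subst frob_transpose[symmetric, of N B]) (simp add: frob_def sum_distrib_left)
  finally show ?thesis .
qed

lemma frob_mult_right:
  assumes "opb N K k" shows "frob N (\<lambda>i l. \<Sum>j<N. B i j * K j l) \<le> k\<^sup>2 * frob N B"
proof -
  have "frob N (\<lambda>i l. \<Sum>j<N. B i j * K j l) = frob N (\<lambda>l i. \<Sum>j<N. K j l * B i j)"
    unfolding frob_transpose[symmetric, of N "\<lambda>i l. \<Sum>j<N. B i j * K j l"] by (simp only: mult.commute)
  also have "\<dots> \<le> k\<^sup>2 * frob N (\<lambda>i j. B j i)"
    by (rule frob_mult_left[OF opb_transpose[OF assms]])
  also have "frob N (\<lambda>i j. B j i) = frob N B" by (rule frob_transpose)
  finally show ?thesis .
qed

lemma mult_mat_vec_index_sum: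
  assumes "A \<in> carrier_mat N N" "x \<in> carrier_vec N" "i < N"
  shows "(A *\<^sub>v x) $ i = app N (\<lambda>i j. A $$ (i, j)) (\<lambda>j. x $ j) i"
  using assms by (auto simp: app_def scalar_prod_def lessThan_atLeast0 intro!: sum.cong)

lemma cscalar_prod_sum:
  assumes "y \<in> carrier_vec N"
  shows "x \<bullet>c y = (\<Sum>i<N. x $ i * cnj (y $ i))"
  using assms by (auto simp: scalar_prod_def lessThan_atLeast0 intro!: sum.cong)

lemma vnorm_sqn: "x \<in> carrier_vec N \<Longrightarrow> vnorm x = sqrt (sqn N (\<lambda>i. x $ i))"
  by (simp add: vnorm_def cscalar_prod_sum sqn_complex[symmetric])

lemma vnorm_mult_mat_vec:
  assumes "A \<in> carrier_mat N N" "x \<in> carrier_vec N"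
  shows "vnorm (A *\<^sub>v x) = sqrt (sqn N (app N (\<lambda>i j. A $$ (i, j)) (\<lambda>j. x $ j)))"
proof -
  have "sqn N (\<lambda>i. (A *\<^sub>v x) $ i) = sqn N (app N (\<lambda>i j. A $$ (i, j)) (\<lambda>j. x $ j))"
    by (rule sqn_cong) (simp only: mult_mat_vec_index_sum[OF assms])
  moreover have "A *\<^sub>v x \<in> carrier_vec N" using assms by auto
  ultimately show ?thesis by (simp add: vnorm_sqn)
qed

lemma opb_spectral_norm:
  assumes A: "A \<in> carrier_mat N N" and N: "1 \<le> N"
  shows "opb N (\<lambda>i j. A $$ (i, j)) (spectral_norm A)"
    and "opb N (\<lambda>i j. A $$ (i, j)) c \<Longrightarrow> spectral_norm A \<le> c"
proof -
  let ?S = "{vnorm (A *\<^sub>v x) | x. x \<in> carrier_vec (dim_col A) \<and> vnorm x = 1}"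
  let ?a = "\<lambda>i j. A $$ (i, j)"
  have le: "y \<le> c" if op: "opb N ?a c" and y: "y \<in> ?S" for c y
  proof -
    obtain x where x: "x \<in> carrier_vec N" "vnorm x = 1" "y = vnorm (A *\<^sub>v x)" using y A by auto
    have "sqn N (\<lambda>j. x $ j) = 1" using x by (simp add: vnorm_sqn)
    then have "sqn N (app N ?a (\<lambda>j. x $ j)) \<le> c\<^sup>2" using opbD[OF op, of "\<lambda>j. x $ j"] by simp
    then show "y \<le> c" unfolding x(3) vnorm_mult_mat_vec[OF A x(1)]
      using opb_nonneg[OF op] by (intro real_le_lsqrt) auto
  qed
  have bdd: "bdd_above ?S" using le[OF opb_frob] by (rule bdd_aboveI)
  have "sqn N (\<lambda>i. unit_vec N 0 $ i) = sqn N (\<lambda>i. if i = 0 then 1 else 0)"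
    by (rule sqn_cong) simp
  also have "\<dots> = 1"
    using N by (simp add: sqn_def if_distrib[of "\<lambda>z. (cmod z)\<^sup>2"] cong: if_cong)
  finally have e0: "unit_vec N 0 \<in> carrier_vec N" "vnorm (unit_vec N 0) = 1"
    by (simp_all add: vnorm_sqn[of _ N])
  then have ne: "vnorm (A *\<^sub>v unit_vec N 0) \<in> ?S" using A by auto
  show "spectral_norm A \<le> c" if "opb N ?a c"
    unfolding spectral_norm_def using ne le[OF that] by (intro cSup_least) auto
  have mem: "vnorm (A *\<^sub>v x) \<le> spectral_norm A" if "x \<in> carrier_vec N" "vnorm x = 1" for x
    unfolding spectral_norm_def using that A by (intro cSup_upper[OF _ bdd]) auto
  have nn: "0 \<le> spectral_norm A"
    using mem[OF e0] by (rule order_trans[rotated]) (use A e0 in \<open>simp add: vnorm_mult_mat_vec\<close>)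
  show "opb N ?a (spectral_norm A)"
    unfolding opb_def
  proof (intro conjI allI nn)
    fix x
    show "sqn N (app N ?a x) \<le> (spectral_norm A)\<^sup>2 * sqn N x"
    proof (cases "sqn N x = 0")
      case True
      then show ?thesis using opbD[OF opb_frob, of N ?a x] by simp
    next
      case False
      define r where "r = sqrt (sqn N x)"
      have r: "0 < r" "r\<^sup>2 = sqn N x" using False sqn_nonneg[of N x] by (simp_all add: r_def less_le del: sqn_nonneg)
      define y where "y = Matrix.vec N (\<lambda>i. complex_of_real (1 / r) * x i)"
      have yc: "y \<in> carrier_vec N" by (simp add: y_def)
      have "sqn N (\<lambda>i. y $ i) = sqn N (\<lambda>i. complex_of_real (1 / r) * x i)"
        by (rule sqn_cong) (simp add: y_def)
      also have "\<dots> = 1" unfolding sqn_scale using r False by (simp add: norm_divide power_divide)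
      finally have "vnorm y = 1" using yc by (simp add: vnorm_sqn)
      from mem[OF yc this] have "sqrt (sqn N (app N ?a (\<lambda>j. y $ j))) \<le> spectral_norm A"
        unfolding vnorm_mult_mat_vec[OF A yc] .
      then have "sqn N (app N ?a (\<lambda>j. y $ j)) \<le> (spectral_norm A)\<^sup>2"
        by (rule sqrt_le_D)
      moreover have "app N ?a (\<lambda>j. y $ j) = (\<lambda>i. complex_of_real (1 / r) * app N ?a x i)"
        by (auto simp: app_def y_def fun_eq_iff sum_distrib_left mult_ac intro!: sum.cong)
      ultimately have "(cmod (complex_of_real (1 / r)))\<^sup>2 * sqn N (app N ?a x) \<le> (spectral_norm A)\<^sup>2"
        by (simp only: sqn_scale)
      moreover have "(cmod (complex_of_real (1 / r)))\<^sup>2 = 1 / sqn N x"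
        using r by (simp add: norm_divide power_divide)
      ultimately have "sqn N (app N ?a x) / sqn N x \<le> (spectral_norm A)\<^sup>2" by simp
      moreover have "0 < sqn N x" using r by (metis zero_less_power)
      ultimately show ?thesis by (simp add: divide_le_eq)
    qed
  qed
qed

lemma quad_form_sum:
  assumes "K \<in> carrier_mat N N" "a \<in> carrier_vec N"
  shows "(K *\<^sub>v a) \<bullet>c a = (\<Sum>i<N. \<Sum>j<N. cnj (a $ i) * K $$ (i, j) * a $ j)"
  unfolding cscalar_prod_sum[OF assms(2)]
  by (intro sum.cong refl) (subst mult_mat_vec_index_sum[OF assms], auto simp: app_def sum_distrib_left sum_distrib_right mult_ac)

lemma psd_quad:
  assumes "psd N K"
  shows "0 \<le> (\<Sum>i<N. \<Sum>j<N. c i * K $$ (i, j) * cnj (c j))"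
proof -
  have K: "K \<in> carrier_mat N N" using assms by (simp add: psd_def)
  define a where "a = Matrix.vec N (\<lambda>i. cnj (c i))"
  have a: "a \<in> carrier_vec N" by (simp add: a_def)
  have "0 \<le> (K *\<^sub>v a) \<bullet>c a" using assms a unfolding psd_def by blast
  also have "(K *\<^sub>v a) \<bullet>c a = (\<Sum>i<N. \<Sum>j<N. c i * K $$ (i, j) * cnj (c j))"
    unfolding quad_form_sum[OF K a] by (intro sum.cong refl) (simp add: a_def)
  finally show ?thesis .
qed

section \<open>Gaussian linear and quadratic forms\<close>

definition wick :: "nat \<Rightarrow> 'a measure \<Rightarrow> ('a \<Rightarrow> cvec) \<Rightarrow> (nat \<Rightarrow> nat \<Rightarrow> complex) \<Rightarrow> bool" where
  "wick N M X K \<longleftrightarrow>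
     (\<forall>i<N. \<forall>j<N. has_bochner_integral M (\<lambda>w. X w i * cnj (X w j)) (K i j)) \<and>
     (\<forall>i<N. \<forall>j<N. \<forall>k<N. \<forall>l<N.
        has_bochner_integral M (\<lambda>w. X w i * X w k * cnj (X w j) * cnj (X w l))
          (K i j * K k l + K i l * K k j))"

lemma wick_CN_vec: "wick N (CN_vec N) (\<lambda>g. g) (\<lambda>i j. if i = j then 1 else 0)"
  unfolding wick_def
proof (intro conjI allI impI)
  fix i j assume "i < N" "j < N"
  then show "has_bochner_integral (CN_vec N) (\<lambda>w. w i * cnj (w j)) (if i = j then 1 else 0)"
    by (simp only: has_bochner_integral_iff CN_vec_moment2 simp_thms)
next
  fix i j k l assume a: "i < N" "j < N" "k < N" "l < N"
  have "(if i = j then 1 else 0) * (if k = l then 1 else 0) + (if i = l then 1 else 0) * (if k = j then 1 else 0)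
    = (if i = j \<and> k = l then 1 else 0) + (if i = l \<and> k = j then 1 else (0::complex))"
    by (cases "i = j"; cases "k = l"; cases "i = l"; cases "k = j") (simp_all only: if_True if_False simp_thms mult_1 mult_zero_left mult_zero_right mult_1_right)
  then show "has_bochner_integral (CN_vec N) (\<lambda>w. w i * w k * cnj (w j) * cnj (w l))
     ((if i = j then 1 else 0) * (if k = l then 1 else 0) + (if i = l then 1 else 0) * (if k = j then 1 else 0))"
    using CN_vec_moment4[OF a] by (simp only: has_bochner_integral_iff simp_thms)
qed

lemma wick_hermitian:
  assumes "wick N M X K" "i < N" "j < N"
  shows "K j i = cnj (K i j)"
proof -
  have "has_bochner_integral M (\<lambda>w. X w i * cnj (X w j)) (K i j)"
    and a: "has_bochner_integral M (\<lambda>w. X w j * cnj (X w i)) (K j i)"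
    using assms unfolding wick_def by blast+
  from has_bochner_integral_cnj[OF this(1)]
  have "has_bochner_integral M (\<lambda>w. X w j * cnj (X w i)) (cnj (K i j))"
    by (simp add: mult.commute)
  with a show ?thesis by (rule has_bochner_integral_eq)
qed

lemma has_bochner_integral_norm_square:
  fixes f :: "'a \<Rightarrow> complex"
  assumes "has_bochner_integral M (\<lambda>w. f w * cnj (f w)) z"
  shows "has_bochner_integral M (\<lambda>w. (cmod (f w))\<^sup>2) (Re z)"
proof -
  have "has_bochner_integral M (\<lambda>w. Re (f w * cnj (f w))) (Re z)"
    using has_bochner_integral_bounded_linear[OF bounded_linear_Re assms] .
  moreover have "Re (f w * cnj (f w)) = (cmod (f w))\<^sup>2" for w
    by (simp add: complex_mult_cnj cmod_power2)
  ultimately show ?thesis by simp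
qed

lemma nn_integral_has_bochner_integral:
  assumes "has_bochner_integral M f x" "\<And>w. 0 \<le> f w"
  shows "(\<integral>\<^sup>+w. ennreal (f w) \<partial>M) = ennreal x"
  using assms by (subst nn_integral_eq_integral) (auto simp: has_bochner_integral_iff)

lemma wick_linear:
  assumes "wick N M X K"
  shows "has_bochner_integral M (\<lambda>w. (cmod (\<Sum>i<N. a i * X w i))\<^sup>2)
    (Re (\<Sum>i<N. \<Sum>j<N. a i * K i j * cnj (a j)))"
proof (rule has_bochner_integral_norm_square)
  have "has_bochner_integral M (\<lambda>w. \<Sum>i<N. \<Sum>j<N. (a i * cnj (a j)) * (X w i * cnj (X w j)))
     (\<Sum>i<N. \<Sum>j<N. (a i * cnj (a j)) * K i j)"
    by (intro has_bochner_integral_sum has_bochner_integral_mult_right) (use assms in \<open>auto simp: wick_def\<close>)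
  moreover have "(\<Sum>i<N. \<Sum>j<N. (a i * cnj (a j)) * (X w i * cnj (X w j))) = (\<Sum>i<N. a i * X w i) * cnj (\<Sum>i<N. a i * X w i)" for w
    unfolding cnj_sum sum_product by (intro sum.cong refl) (simp add: mult_ac)
  moreover have "(\<Sum>i<N. \<Sum>j<N. (a i * cnj (a j)) * K i j) = (\<Sum>i<N. \<Sum>j<N. a i * K i j * cnj (a j))"
    by (intro sum.cong refl) (simp add: mult_ac)
  ultimately show "has_bochner_integral M (\<lambda>w. (\<Sum>i<N. a i * X w i) * cnj (\<Sum>i<N. a i * X w i)) (\<Sum>i<N. \<Sum>j<N. a i * K i j * cnj (a j))"
    by simp
qed

lemma wick_quadratic:
  assumes M: "prob_space M" and w: "wick N M X K" and K: "opb N K k"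
  shows "msq M (\<lambda>\<omega>. (\<Sum>i<N. \<Sum>j<N. B i j * cnj (X \<omega> i) * X \<omega> j)
           - (\<Sum>i<N. \<Sum>j<N. B i j * K j i)) \<le> ennreal (k\<^sup>2 * frob N B)"
proof -
  interpret prob_space M by fact
  define Q where "Q \<omega> = (\<Sum>i<N. \<Sum>j<N. B i j * cnj (X \<omega> i) * X \<omega> j)" for \<omega>
  define m where "m = (\<Sum>i<N. \<Sum>j<N. B i j * K j i)"
  define D where "D = (\<Sum>i<N. \<Sum>j<N. \<Sum>k<N. \<Sum>l<N. B i j * cnj (B k l) * (K j l * K k i))"
  have w2: "has_bochner_integral M (\<lambda>\<omega>. X \<omega> i * cnj (X \<omega> j)) (K i j)" if "i < N" "j < N" for i j
    using w that unfolding wick_def by blast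
  have w4: "has_bochner_integral M (\<lambda>\<omega>. X \<omega> i * X \<omega> k * cnj (X \<omega> j) * cnj (X \<omega> l)) (K i j * K k l + K i l * K k j)"
    if "i < N" "j < N" "k < N" "l < N" for i j k l
    using w that unfolding wick_def by blast
  have Q: "has_bochner_integral M Q m"
  proof -
    have "has_bochner_integral M (\<lambda>\<omega>. \<Sum>i<N. \<Sum>j<N. B i j * (X \<omega> j * cnj (X \<omega> i))) m"
      unfolding m_def by (intro has_bochner_integral_sum has_bochner_integral_mult_right w2) auto
    then show ?thesis unfolding Q_def by (simp add: mult_ac)
  qed
  have QQ: "has_bochner_integral M (\<lambda>\<omega>. Q \<omega> * cnj (Q \<omega>)) (m * cnj m + D)"
  proof -
    have "has_bochner_integral M (\<lambda>\<omega>. \<Sum>i<N. \<Sum>j<N. \<Sum>k<N. \<Sum>l<N. (B i j * cnj (B k l)) * (X \<omega> j * X \<omega> k * cnj (X \<omega> i) * cnj (X \<omega> l)))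
       (\<Sum>i<N. \<Sum>j<N. \<Sum>k<N. \<Sum>l<N. (B i j * cnj (B k l)) * (K j i * K k l + K j l * K k i))"
      by (intro has_bochner_integral_sum has_bochner_integral_mult_right w4) auto
    moreover have "(\<Sum>i<N. \<Sum>j<N. \<Sum>k<N. \<Sum>l<N. (B i j * cnj (B k l)) * (X \<omega> j * X \<omega> k * cnj (X \<omega> i) * cnj (X \<omega> l))) = Q \<omega> * cnj (Q \<omega>)" for \<omega>
      unfolding Q_def cnj_sum sum_distrib_right unfolding sum_distrib_left
      by (intro sum.cong refl) (simp add: mult_ac)
    moreover have "(\<Sum>i<N. \<Sum>j<N. \<Sum>k<N. \<Sum>l<N. (B i j * cnj (B k l)) * (K j i * K k l + K j l * K k i)) = m * cnj m + D"
    proof -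
      have "m * cnj m = (\<Sum>i<N. \<Sum>j<N. \<Sum>k<N. \<Sum>l<N. (B i j * cnj (B k l)) * (K j i * K k l))"
        unfolding m_def cnj_sum sum_distrib_right unfolding sum_distrib_left
      proof (intro sum.cong refl)
        fix i j k l assume "k \<in> {..<N}" "l \<in> {..<N}"
        then have "K k l = cnj (K l k)" using wick_hermitian[OF w, of l k] by simp
        then show "B i j * K j i * cnj (B k l * K l k) = B i j * cnj (B k l) * (K j i * K k l)"
          by (simp add: mult_ac)
      qed
      then show ?thesis unfolding D_def by (simp add: distrib_left sum.distrib)
    qed
    ultimately show ?thesis by simp
  qed
  have "has_bochner_integral M (\<lambda>\<omega>. (Q \<omega> * cnj (Q \<omega>) - Q \<omega> * cnj m) - (m * cnj (Q \<omega>) - m * cnj m)) ((m * cnj m + D - m * cnj m) - (m * cnj m - m * cnj m))"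
  proof (intro has_bochner_integral_diff QQ)
    show "has_bochner_integral M (\<lambda>\<omega>. Q \<omega> * cnj m) (m * cnj m)"
      by (rule has_bochner_integral_mult_left) (rule Q)
    show "has_bochner_integral M (\<lambda>\<omega>. m * cnj (Q \<omega>)) (m * cnj m)"
      by (rule has_bochner_integral_mult_right) (rule has_bochner_integral_cnj[OF Q])
    show "has_bochner_integral M (\<lambda>\<omega>. m * cnj m) (m * cnj m)"
      by (simp add: has_bochner_integral_iff prob_space)
  qed
  moreover have "(Q \<omega> * cnj (Q \<omega>) - Q \<omega> * cnj m) - (m * cnj (Q \<omega>) - m * cnj m) = (Q \<omega> - m) * cnj (Q \<omega> - m)" for \<omega>
    by (simp add: algebra_simps)
  ultimately have "has_bochner_integral M (\<lambda>\<omega>. (Q \<omega> - m) * cnj (Q \<omega> - m)) D" by simp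
  from nn_integral_has_bochner_integral[OF has_bochner_integral_norm_square[OF this]]
  have "msq M (\<lambda>\<omega>. Q \<omega> - m) = ennreal (Re D)" by simp
  moreover have "Re D \<le> k\<^sup>2 * frob N B"
  proof -
    define U where "U = (\<lambda>i l. \<Sum>j<N. B i j * K j l)"
    define V where "V = (\<lambda>i l. \<Sum>j<N. K i j * B j l)"
    have "D = (\<Sum>i<N. \<Sum>l<N. U i l * cnj (V i l))"
    proof -
      have "(\<Sum>j<N. \<Sum>k<N. \<Sum>l<N. B i j * cnj (B k l) * (K j l * K k i)) = (\<Sum>l<N. U i l * cnj (V i l))" if i: "i < N" for i
      proof -
        have "(\<Sum>j<N. \<Sum>k<N. \<Sum>l<N. B i j * cnj (B k l) * (K j l * K k i)) = (\<Sum>j<N. \<Sum>l<N. \<Sum>k<N. B i j * cnj (B k l) * (K j l * K k i))"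
          by (intro sum.cong refl sum.swap)
        also have "\<dots> = (\<Sum>l<N. \<Sum>j<N. \<Sum>k<N. B i j * cnj (B k l) * (K j l * K k i))"
          by (rule sum.swap)
        also have "\<dots> = (\<Sum>l<N. U i l * cnj (V i l))"
        proof (intro sum.cong refl)
          fix l
          show "(\<Sum>j<N. \<Sum>k<N. B i j * cnj (B k l) * (K j l * K k i)) = U i l * cnj (V i l)"
            unfolding U_def V_def cnj_sum sum_product
          proof (intro sum.cong refl)
            fix j k assume "k \<in> {..<N}"
            then have "K k i = cnj (K i k)" using wick_hermitian[OF w, of i k] i by simp
            then show "B i j * cnj (B k l) * (K j l * K k i) = B i j * K j l * cnj (K i k * B k l)"
              by (simp add: mult_ac)
          qed
        qed
        finally show ?thesis .
      qed
      then show ?thesis unfolding D_def by simp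
    qed
    then have "Re D = (\<Sum>i<N. \<Sum>l<N. Re (U i l * cnj (V i l)))" by simp
    also have "\<dots> \<le> (\<Sum>i<N. \<Sum>l<N. ((cmod (U i l))\<^sup>2 + (cmod (V i l))\<^sup>2) / 2)"
    proof (intro sum_mono)
      fix i l
      have "Re (U i l * cnj (V i l)) \<le> cmod (U i l) * cmod (V i l)"
        using complex_Re_le_cmod[of "U i l * cnj (V i l)"] by (simp add: norm_mult)
      also have "\<dots> \<le> ((cmod (U i l))\<^sup>2 + (cmod (V i l))\<^sup>2) / 2"
        using sum_squares_bound[of "cmod (U i l)" "cmod (V i l)"] by simp
      finally show "Re (U i l * cnj (V i l)) \<le> ((cmod (U i l))\<^sup>2 + (cmod (V i l))\<^sup>2) / 2" .
    qed
    also have "\<dots> = (frob N U + frob N V) / 2"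
      by (simp add: frob_def sqn_def sum.distrib sum_divide_distrib add_divide_distrib)
    also have "\<dots> \<le> (k\<^sup>2 * frob N B + k\<^sup>2 * frob N B) / 2"
      unfolding U_def V_def by (intro divide_right_mono add_mono frob_mult_left frob_mult_right K) simp
    finally show ?thesis by (simp add: mult.commute)
  qed
  ultimately show ?thesis unfolding Q_def m_def by (simp add: ennreal_leI)
qed

lemma CN_moments:
  assumes "0 \<le> v"
  shows "has_bochner_integral (CN v) (\<lambda>z. (cmod z)\<^sup>2) v"
    "has_bochner_integral (CN v) (\<lambda>z. (cmod z) ^ 4) (2 * v\<^sup>2)"
    "has_bochner_integral (CN v) (\<lambda>z. z) 0"
proof -
  have tr: "has_bochner_integral (CN v) f x"
    if [measurable]: "f \<in> borel_measurable borel" and "has_bochner_integral (CN 1) (\<lambda>z. f (complex_of_real (sqrt v) * z)) x"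
    for f :: "complex \<Rightarrow> 'x::{banach, second_countable_topology}" and x
    unfolding CN_scale[OF assms] using that(2) by (simp add: has_bochner_integral_iff integrable_distr_eq integral_distr)
  have s4: "sqrt v ^ 4 = v\<^sup>2" using assms
    by (metis power2_eq_square power4_eq_xxxx mult.assoc real_sqrt_pow2)
  show "has_bochner_integral (CN v) (\<lambda>z. (cmod z)\<^sup>2) v"
    using has_bochner_integral_mult_right[OF CN1_moments(3), of v] assms
    by (intro tr) (simp_all add: norm_mult power_mult_distrib)
  show "has_bochner_integral (CN v) (\<lambda>z. (cmod z) ^ 4) (2 * v\<^sup>2)"
    using has_bochner_integral_mult_right[OF CN1_moments(4), of "v\<^sup>2"] assms
    by (intro tr) (simp_all add: norm_mult power_mult_distrib s4 mult.commute)
  show "has_bochner_integral (CN v) (\<lambda>z. z) 0"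
    using has_bochner_integral_mult_right[OF CN1_moments(1), of "complex_of_real (sqrt v)"]
    by (intro tr) simp_all
qed

lemma polar4:
  fixes x y :: complex
  shows "Re ((x * cnj y)\<^sup>2) = (cmod (x + y) ^ 4 + cmod (x - y) ^ 4 - cmod (x + \<i> * y) ^ 4 - cmod (x - \<i> * y) ^ 4) / 8"
proof -
  define P where "P = (cmod x)\<^sup>2 + (cmod y)\<^sup>2"
  define w where "w = x * cnj y"
  have c4: "cmod z ^ 4 = ((cmod z)\<^sup>2)\<^sup>2" for z
    by (simp add: power_mult[symmetric])
  have e: "(cmod (x + y))\<^sup>2 = P + 2 * Re w" "(cmod (x - y))\<^sup>2 = P - 2 * Re w"
    "(cmod (x + \<i> * y))\<^sup>2 = P + 2 * Im w" "(cmod (x - \<i> * y))\<^sup>2 = P - 2 * Im w"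
    unfolding P_def w_def cmod_power2 by (simp_all add: power2_eq_square algebra_simps)
  have "Re (w\<^sup>2) = ((P + 2 * Re w)\<^sup>2 + (P - 2 * Re w)\<^sup>2 - (P + 2 * Im w)\<^sup>2 - (P - 2 * Im w)\<^sup>2) / 8"
    by (simp add: power2_eq_square algebra_simps)
  then show ?thesis unfolding c4 e w_def .
qed

lemma polar2:
  fixes x y :: complex
  shows "x * cnj y = (complex_of_real ((cmod (x + y))\<^sup>2) - complex_of_real ((cmod (x - y))\<^sup>2)
    + \<i> * complex_of_real ((cmod (x + \<i> * y))\<^sup>2) - \<i> * complex_of_real ((cmod (x - \<i> * y))\<^sup>2)) / 4"
  unfolding cmod_power2 by (simp add: complex_eq_iff power2_eq_square algebra_simps)

definition sesq :: "nat \<Rightarrow> (nat \<Rightarrow> nat \<Rightarrow> complex) \<Rightarrow> (nat \<Rightarrow> complex) \<Rightarrow> (nat \<Rightarrow> complex) \<Rightarrow> complex" where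
  "sesq N K c e = (\<Sum>i<N. \<Sum>j<N. c i * K i j * cnj (e j))"

lemma sesq_add_left: "sesq N K (\<lambda>i. c i + c' i) e = sesq N K c e + sesq N K c' e"
  by (simp add: sesq_def sum.distrib distrib_right)

lemma sesq_add_right: "sesq N K c (\<lambda>i. e i + e' i) = sesq N K c e + sesq N K c e'"
  by (simp add: sesq_def sum.distrib distrib_left)

lemma sesq_scale_left: "sesq N K (\<lambda>i. s * c i) e = s * sesq N K c e"
  by (simp add: sesq_def sum_distrib_left mult_ac)

lemma sesq_scale_right: "sesq N K c (\<lambda>i. s * e i) = cnj s * sesq N K c e"
  by (simp add: sesq_def sum_distrib_left mult_ac)

lemma sesq_hermitian:
  assumes real: "\<And>c. Im (sesq N K c c) = 0"
  shows "sesq N K e c = cnj (sesq N K c e)"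
proof -
  have "Im (sesq N K c e + sesq N K e c) = 0"
    using real[of "\<lambda>i. c i + e i"] real[of c] real[of e] by (simp add: sesq_add_left sesq_add_right)
  moreover have "Im (cnj \<i> * sesq N K c e + \<i> * sesq N K e c) = 0"
    using real[of "\<lambda>i. c i + \<i> * e i"] real[of c] real[of e]
    by (simp add: sesq_add_left sesq_add_right sesq_scale_left[of N K \<i>] sesq_scale_right[of N K _ \<i>])
  ultimately show ?thesis by (simp add: complex_eq_iff)
qed

lemma sesq_unit:
  assumes "i < N" "j < N"
  shows "sesq N K (\<lambda>m. if m = i then 1 else 0) (\<lambda>m. if m = j then 1 else 0) = K i j"
  using assms by (simp add: sesq_def if_distrib[of "\<lambda>z. z * _"] if_distrib[of "\<lambda>z. _ * z"] if_distrib[of cnj] cong: if_cong)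

lemma cspace_component:
  assumes "X \<in> M \<rightarrow>\<^sub>M cspace N" "i < N"
  shows "(\<lambda>w. X w i) \<in> borel_measurable M"
  using measurable_compose[OF assms(1) measurable_component_singleton[of i "{..<N}" "\<lambda>_. borel"]] assms(2) by simp

lemma complex_normal_linear:
  assumes X: "complex_normal N M X K" and K: "psd N K"
  defines "k \<equiv> \<lambda>i j. K $$ (i, j)"
  shows "has_bochner_integral M (\<lambda>w. (cmod (\<Sum>i<N. c i * X w i))\<^sup>2) (Re (sesq N k c c))"
    and "has_bochner_integral M (\<lambda>w. (cmod (\<Sum>i<N. c i * X w i)) ^ 4) (2 * (Re (sesq N k c c))\<^sup>2)"
proof -
  define a where "a = Matrix.vec N (\<lambda>i. cnj (c i))"
  have a: "a \<in> carrier_vec N" by (simp add: a_def)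
  have Kc: "K \<in> carrier_mat N N" using K by (simp add: psd_def)
  have Xm: "X \<in> M \<rightarrow>\<^sub>M cspace N" using X by (simp add: complex_normal_def)
  have Lm: "(\<lambda>w. \<Sum>i<N. c i * X w i) \<in> borel_measurable M"
    by (intro borel_measurable_sum borel_measurable_times borel_measurable_const cspace_component[OF Xm]) simp
  have L: "Matrix.vec N (X w) \<bullet>c a = (\<Sum>i<N. c i * X w i)" for w
    unfolding cscalar_prod_sum[OF a] by (intro sum.cong refl) (simp add: a_def mult.commute)
  have q: "(K *\<^sub>v a) \<bullet>c a = sesq N k c c"
    unfolding quad_form_sum[OF Kc a] sesq_def k_def by (intro sum.cong refl) (simp add: a_def)
  have law: "distr M borel (\<lambda>w. \<Sum>i<N. c i * X w i) = CN (Re (sesq N k c c))"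
    using X[unfolded complex_normal_def, THEN conjunct2, rule_format, OF a] unfolding L q .
  have nn: "0 \<le> Re (sesq N k c c)"
    using psd_quad[OF K, of c] unfolding sesq_def k_def by (simp add: less_eq_complex_def)
  have tr: "has_bochner_integral M (\<lambda>w. f (\<Sum>i<N. c i * X w i)) x"
    if [measurable]: "f \<in> borel_measurable borel" and "has_bochner_integral (CN (Re (sesq N k c c))) f x" for f and x :: real
    using that(2) Lm unfolding law[symmetric] by (simp add: has_bochner_integral_iff integrable_distr_eq integral_distr)
  show "has_bochner_integral M (\<lambda>w. (cmod (\<Sum>i<N. c i * X w i))\<^sup>2) (Re (sesq N k c c))"
    by (rule tr[OF _ CN_moments(1)[OF nn]]) simp
  show "has_bochner_integral M (\<lambda>w. (cmod (\<Sum>i<N. c i * X w i)) ^ 4) (2 * (Re (sesq N k c c))\<^sup>2)"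
    by (rule tr[OF _ CN_moments(2)[OF nn]]) simp
qed

lemma wick_complex_normal:
  assumes X: "complex_normal N M X K" and K: "psd N K"
  shows "wick N M X (\<lambda>i j. K $$ (i, j))"
proof -
  define k where "k = (\<lambda>i j. K $$ (i, j))"
  define S where "S = sesq N k"
  define L where "L c w = (\<Sum>i<N. c i * X w i)" for c w
  note lin2 = complex_normal_linear(1)[OF X K, folded k_def S_def, folded L_def]
  note lin4 = complex_normal_linear(2)[OF X K, folded k_def S_def, folded L_def]
  have real: "Im (S c c) = 0" for c
    using psd_quad[OF K, of c] unfolding S_def sesq_def k_def by (simp add: less_eq_complex_def)
  have herm: "S e c = cnj (S c e)" for c e
    using sesq_hermitian[of N k] real unfolding S_def by blast
  have L_add: "L (\<lambda>i. c i + s * e i) w = L c w + s * L e w" for c e s w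
    unfolding L_def sum_distrib_left sum.distrib[symmetric] by (intro sum.cong refl) (simp add: algebra_simps)
  have L_scale: "L (\<lambda>i. s * e i) w = s * L e w" for e s w
    unfolding L_def by (simp add: sum_distrib_left mult_ac)
  have S_add: "Re (S (\<lambda>i. c i + s * e i) (\<lambda>i. c i + s * e i)) = Re (S c c) + (cmod s)\<^sup>2 * Re (S e e) + 2 * Re (cnj s * S c e)" for c e s
  proof -
    have "S (\<lambda>i. c i + s * e i) (\<lambda>i. c i + s * e i) = S c c + cnj s * S c e + s * cnj (S c e) + (s * cnj s) * S e e"
      unfolding S_def sesq_add_left sesq_add_right sesq_scale_left sesq_scale_right
      using herm[of e c] unfolding S_def by (simp add: algebra_simps)
    also have "s * cnj s = complex_of_real ((cmod s)\<^sup>2)" by (rule complex_norm_square[symmetric])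
    finally show ?thesis using real[of e] by (simp add: algebra_simps)
  qed
  have L1: "L (\<lambda>i. c i + e i) w = L c w + L e w" "L (\<lambda>i. c i - e i) w = L c w - L e w" for c e w
    using L_add[of c 1 e] L_add[of c "-1" e] by simp_all
  have two: "has_bochner_integral M (\<lambda>w. L c w * cnj (L e w)) (S c e)" for c e
  proof -
    have "has_bochner_integral M (\<lambda>w. (complex_of_real ((cmod (L (\<lambda>i. c i + 1 * e i) w))\<^sup>2) - complex_of_real ((cmod (L (\<lambda>i. c i + (-1) * e i) w))\<^sup>2)
     + \<i> * complex_of_real ((cmod (L (\<lambda>i. c i + \<i> * e i) w))\<^sup>2) - \<i> * complex_of_real ((cmod (L (\<lambda>i. c i + (-\<i>) * e i) w))\<^sup>2)) / 4)
     ((complex_of_real (Re (S (\<lambda>i. c i + 1 * e i) (\<lambda>i. c i + 1 * e i))) - complex_of_real (Re (S (\<lambda>i. c i + (-1) * e i) (\<lambda>i. c i + (-1) * e i)))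
     + \<i> * complex_of_real (Re (S (\<lambda>i. c i + \<i> * e i) (\<lambda>i. c i + \<i> * e i))) - \<i> * complex_of_real (Re (S (\<lambda>i. c i + (-\<i>) * e i) (\<lambda>i. c i + (-\<i>) * e i)))) / 4)"
      by (intro has_bochner_integral_divide_zero has_bochner_integral_add has_bochner_integral_diff has_bochner_integral_mult_right has_bochner_integral_complex_of_real lin2)
    moreover have "(complex_of_real ((cmod (L (\<lambda>i. c i + 1 * e i) w))\<^sup>2) - complex_of_real ((cmod (L (\<lambda>i. c i + (-1) * e i) w))\<^sup>2)
     + \<i> * complex_of_real ((cmod (L (\<lambda>i. c i + \<i> * e i) w))\<^sup>2) - \<i> * complex_of_real ((cmod (L (\<lambda>i. c i + (-\<i>) * e i) w))\<^sup>2)) / 4 = L c w * cnj (L e w)" for w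
      unfolding polar2 L_add by simp
    moreover have "(complex_of_real (Re (S (\<lambda>i. c i + 1 * e i) (\<lambda>i. c i + 1 * e i))) - complex_of_real (Re (S (\<lambda>i. c i + (-1) * e i) (\<lambda>i. c i + (-1) * e i)))
     + \<i> * complex_of_real (Re (S (\<lambda>i. c i + \<i> * e i) (\<lambda>i. c i + \<i> * e i))) - \<i> * complex_of_real (Re (S (\<lambda>i. c i + (-\<i>) * e i) (\<lambda>i. c i + (-\<i>) * e i)))) / 4 = S c e"
      unfolding S_add by (simp add: complex_eq_iff)
    ultimately show ?thesis by simp
  qed
  have re4: "has_bochner_integral M (\<lambda>w. Re ((L c w * cnj (L e w))\<^sup>2)) (2 * Re ((S c e)\<^sup>2))" for c e
  proof -
    define A where "A = Re (S c c) + Re (S e e)"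
    have "has_bochner_integral M (\<lambda>w. (cmod (L (\<lambda>i. c i + 1 * e i) w) ^ 4 + cmod (L (\<lambda>i. c i + (-1) * e i) w) ^ 4
        - cmod (L (\<lambda>i. c i + \<i> * e i) w) ^ 4 - cmod (L (\<lambda>i. c i + (-\<i>) * e i) w) ^ 4) / 8)
      ((2 * (A + 2 * Re (S c e))\<^sup>2 + 2 * (A - 2 * Re (S c e))\<^sup>2 - 2 * (A + 2 * Im (S c e))\<^sup>2 - 2 * (A - 2 * Im (S c e))\<^sup>2) / 8)"
    proof (intro has_bochner_integral_divide_zero has_bochner_integral_add has_bochner_integral_diff)
      show "has_bochner_integral M (\<lambda>w. cmod (L (\<lambda>i. c i + 1 * e i) w) ^ 4) (2 * (A + 2 * Re (S c e))\<^sup>2)"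
        using lin4[of "\<lambda>i. c i + 1 * e i"] unfolding S_add by (simp add: A_def)
      show "has_bochner_integral M (\<lambda>w. cmod (L (\<lambda>i. c i + (-1) * e i) w) ^ 4) (2 * (A - 2 * Re (S c e))\<^sup>2)"
        using lin4[of "\<lambda>i. c i + (-1) * e i"] unfolding S_add by (simp add: A_def)
      show "has_bochner_integral M (\<lambda>w. cmod (L (\<lambda>i. c i + \<i> * e i) w) ^ 4) (2 * (A + 2 * Im (S c e))\<^sup>2)"
        using lin4[of "\<lambda>i. c i + \<i> * e i"] unfolding S_add by (simp add: A_def)
      show "has_bochner_integral M (\<lambda>w. cmod (L (\<lambda>i. c i + (-\<i>) * e i) w) ^ 4) (2 * (A - 2 * Im (S c e))\<^sup>2)"
        using lin4[of "\<lambda>i. c i + (-\<i>) * e i"] unfolding S_add by (simp add: A_def)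
    qed
    moreover have "(2 * (A + 2 * Re (S c e))\<^sup>2 + 2 * (A - 2 * Re (S c e))\<^sup>2 - 2 * (A + 2 * Im (S c e))\<^sup>2 - 2 * (A - 2 * Im (S c e))\<^sup>2) / 8 = 2 * Re ((S c e)\<^sup>2)"
      by (simp add: power2_eq_square field_simps)
    moreover have "(cmod (L (\<lambda>i. c i + 1 * e i) w) ^ 4 + cmod (L (\<lambda>i. c i + (-1) * e i) w) ^ 4
        - cmod (L (\<lambda>i. c i + \<i> * e i) w) ^ 4 - cmod (L (\<lambda>i. c i + (-\<i>) * e i) w) ^ 4) / 8 = Re ((L c w * cnj (L e w))\<^sup>2)" for w
      unfolding polar4 L_add by simp
    ultimately show ?thesis by simp
  qed
  have sq: "has_bochner_integral M (\<lambda>w. (L c w * cnj (L e w))\<^sup>2) (2 * (S c e)\<^sup>2)" for c e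
  proof -
    define u where "u = cis (pi / 4)"
    have u2: "u\<^sup>2 = \<i>" by (simp add: u_def power2_eq_square cis_mult)
    then have u2': "(cnj u)\<^sup>2 = - \<i>" by (metis complex_cnj_power complex_cnj_i)
    have "has_bochner_integral M (\<lambda>w. Re ((L c w * cnj (L (\<lambda>i. u * e i) w))\<^sup>2)) (2 * Re ((S c (\<lambda>i. u * e i))\<^sup>2))"
      by (rule re4)
    moreover have "Re ((L c w * cnj (L (\<lambda>i. u * e i) w))\<^sup>2) = Im ((L c w * cnj (L e w))\<^sup>2)" for w
    proof -
      have "(L c w * cnj (L (\<lambda>i. u * e i) w))\<^sup>2 = (cnj u)\<^sup>2 * (L c w * cnj (L e w))\<^sup>2"
        unfolding L_scale by (simp add: power_mult_distrib)
      then show ?thesis unfolding u2' by simp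
    qed
    moreover have "Re ((S c (\<lambda>i. u * e i))\<^sup>2) = Im ((S c e)\<^sup>2)"
      unfolding S_def sesq_scale_right power_mult_distrib u2' by simp
    ultimately have im4: "has_bochner_integral M (\<lambda>w. Im ((L c w * cnj (L e w))\<^sup>2)) (2 * Im ((S c e)\<^sup>2))"
      by simp
    have "has_bochner_integral M (\<lambda>w. complex_of_real (Re ((L c w * cnj (L e w))\<^sup>2)) + \<i> * complex_of_real (Im ((L c w * cnj (L e w))\<^sup>2)))
       (complex_of_real (2 * Re ((S c e)\<^sup>2)) + \<i> * complex_of_real (2 * Im ((S c e)\<^sup>2)))"
      by (intro has_bochner_integral_add has_bochner_integral_mult_right has_bochner_integral_complex_of_real re4 im4)
    moreover have "complex_of_real (Re z) + \<i> * complex_of_real (Im z) = z" for z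
      by (simp add: complex_eq_iff)
    moreover have "complex_of_real (2 * Re z) + \<i> * complex_of_real (2 * Im z) = 2 * z" for z
      by (simp add: complex_eq_iff)
    ultimately show ?thesis by simp
  qed
  have four: "has_bochner_integral M (\<lambda>w. L c w * L c' w * cnj (L e w) * cnj (L e' w)) (S c e * S c' e' + S c e' * S c' e)" for c c' e e'
  proof -
    let ?p = "\<lambda>f g i. f i + g i :: complex" and ?m = "\<lambda>f g i. f i - g i :: complex"
    have "has_bochner_integral M (\<lambda>w. ((L (?p c c') w * cnj (L (?p e e') w))\<^sup>2 - (L (?m c c') w * cnj (L (?p e e') w))\<^sup>2
       - (L (?p c c') w * cnj (L (?m e e') w))\<^sup>2 + (L (?m c c') w * cnj (L (?m e e') w))\<^sup>2) / 16)
      ((2 * (S (?p c c') (?p e e'))\<^sup>2 - 2 * (S (?m c c') (?p e e'))\<^sup>2 - 2 * (S (?p c c') (?m e e'))\<^sup>2 + 2 * (S (?m c c') (?m e e'))\<^sup>2) / 16)"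
      by (intro has_bochner_integral_divide_zero has_bochner_integral_add has_bochner_integral_diff sq)
    moreover have "((L (?p c c') w * cnj (L (?p e e') w))\<^sup>2 - (L (?m c c') w * cnj (L (?p e e') w))\<^sup>2
       - (L (?p c c') w * cnj (L (?m e e') w))\<^sup>2 + (L (?m c c') w * cnj (L (?m e e') w))\<^sup>2) / 16
       = L c w * L c' w * cnj (L e w) * cnj (L e' w)" for w
      unfolding L1 by (simp add: power2_eq_square algebra_simps)
    moreover have "(2 * (S (?p c c') (?p e e'))\<^sup>2 - 2 * (S (?m c c') (?p e e'))\<^sup>2 - 2 * (S (?p c c') (?m e e'))\<^sup>2 + 2 * (S (?m c c') (?m e e'))\<^sup>2) / 16
       = S c e * S c' e' + S c e' * S c' e"
    proof -
      have Sp: "S (?p a b) f = S a f + S b f" "S f (?p a b) = S f a + S f b" for a b f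
        unfolding S_def by (simp_all add: sesq_add_left sesq_add_right)
      have Sm: "S (?m a b) f = S a f - S b f" "S f (?m a b) = S f a - S f b" for a b f
        using sesq_add_left[of N k a "\<lambda>i. (-1) * b i" f] sesq_scale_left[of N k "-1" b f]
          sesq_add_right[of N k f a "\<lambda>i. (-1) * b i"] sesq_scale_right[of N k f "-1" b]
        unfolding S_def by simp_all
      show ?thesis unfolding Sp Sm by (simp add: power2_eq_square field_simps)
    qed
    ultimately show ?thesis by simp
  qed
  have Lu: "L (\<lambda>m. if m = i then 1 else 0) w = X w i" if "i < N" for i w
    using that by (simp add: L_def if_distrib[of "\<lambda>z. z * _"] cong: if_cong)
  have Su: "S (\<lambda>m. if m = i then 1 else 0) (\<lambda>m. if m = j then 1 else 0) = K $$ (i, j)" if "i < N" "j < N" for i j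
    unfolding S_def sesq_unit[OF that] k_def ..
  show ?thesis
    unfolding wick_def
  proof (intro conjI allI impI)
    fix i j assume "i < N" "j < N"
    with two[of "\<lambda>m. if m = i then 1 else 0" "\<lambda>m. if m = j then 1 else 0"]
    show "has_bochner_integral M (\<lambda>w. X w i * cnj (X w j)) (K $$ (i, j))"
      by (simp only: Lu Su)
  next
    fix i j k l assume "i < N" "j < N" "k < N" "l < N"
    with four[of "\<lambda>m. if m = i then 1 else 0" "\<lambda>m. if m = k then 1 else 0" "\<lambda>m. if m = j then 1 else 0" "\<lambda>m. if m = l then 1 else 0"]
    show "has_bochner_integral M (\<lambda>w. X w i * X w k * cnj (X w j) * cnj (X w l)) (K $$ (i, j) * K $$ (k, l) + K $$ (i, l) * K $$ (k, j))"
      by (simp only: Lu Su)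
  qed
qed

section \<open>Conditional laws of the disturbance\<close>

lemma CN_vec_in_prob_algebra: "PiM {..<N} (\<lambda>i. CN (v i)) \<in> space (prob_algebra (cspace N))"
  by (simp add: space_prob_algebra prob_space_PiM prob_space_CN)

lemma CN_in_prob_algebra: "CN v \<in> space (prob_algebra borel)"
  by (simp add: space_prob_algebra prob_space_CN)

lemma measurable_PiM_CN:
  assumes u: "u \<in> C \<rightarrow>\<^sub>M cspace N" and k: "0 \<le> k"
  shows "(\<lambda>c. PiM {..<N} (\<lambda>i. CN (k * (cmod (u c i))\<^sup>2))) \<in> C \<rightarrow>\<^sub>M prob_algebra (cspace N)"
proof -
  have "PiM {..<N} (\<lambda>i. CN (k * (cmod (u c i))\<^sup>2)) =
      distr (CN_vec N) (cspace N) (\<lambda>g. \<lambda>i\<in>{..<N}. complex_of_real (sqrt (k * (cmod (u c i))\<^sup>2)) * g i)" for c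
    by (rule PiM_CN_scale) (simp add: k)
  moreover have "(\<lambda>c. distr (CN_vec N) (cspace N) (\<lambda>g. \<lambda>i\<in>{..<N}. complex_of_real (sqrt (k * (cmod (u c i))\<^sup>2)) * g i)) \<in> C \<rightarrow>\<^sub>M prob_algebra (cspace N)"
  proof (rule measurable_distr_prob_space2)
    show "(\<lambda>c. CN_vec N) \<in> C \<rightarrow>\<^sub>M prob_algebra (cspace N)"
      by (rule measurable_const) (rule CN_vec_in_prob_algebra)
    have "(\<lambda>x. \<lambda>i\<in>{..<N}. complex_of_real (sqrt (k * (cmod (u (fst x) i))\<^sup>2)) * snd x i) \<in> C \<Otimes>\<^sub>M cspace N \<rightarrow>\<^sub>M cspace N"
    proof (rule measurable_restrict)
      fix i assume i: "i \<in> {..<N}"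
      have a: "(\<lambda>x. u (fst x) i) \<in> borel_measurable (C \<Otimes>\<^sub>M cspace N)"
        using i by (intro cspace_component[of _ _ N] measurable_compose[OF measurable_fst u]) simp
      have b: "(\<lambda>x. snd x i) \<in> borel_measurable (C \<Otimes>\<^sub>M cspace N)"
        using i by (intro cspace_component[of _ _ N] measurable_snd) simp
      show "(\<lambda>x. complex_of_real (sqrt (k * (cmod (u (fst x) i))\<^sup>2)) * snd x i) \<in> borel_measurable (C \<Otimes>\<^sub>M cspace N)"
        using a b by simp
    qed
    then show "(\<lambda>(c, g). \<lambda>i\<in>{..<N}. complex_of_real (sqrt (k * (cmod (u c i))\<^sup>2)) * g i) \<in> C \<Otimes>\<^sub>M cspace N \<rightarrow>\<^sub>M cspace N"
      by (simp add: split_beta')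
  qed
  ultimately show ?thesis by simp
qed

lemma measurable_disturb_law:
  assumes "u \<in> C \<rightarrow>\<^sub>M cspace N" "L \<in> C \<rightarrow>\<^sub>M prob_algebra (cspace N)" "0 \<le> kappa_r P * p_UE P"
  shows "(\<lambda>c. disturb_law P N (u c) (L c)) \<in> C \<rightarrow>\<^sub>M prob_algebra (disturb_space N)"
  unfolding disturb_law_def
  by (intro measurable_pair_prob measurable_PiM_CN measurable_const CN_in_prob_algebra CN_vec_in_prob_algebra assms)

context
  fixes A :: "'a measure" and B :: "'b measure" and C :: "'c measure" and D :: "'d measure"
  assumes sf: "sigma_finite_measure A" "sigma_finite_measure B" "sigma_finite_measure C" "sigma_finite_measure D"
begin

lemma nn_integral_pair4_2:
  assumes G: "G \<in> borel_measurable (A \<Otimes>\<^sub>M B \<Otimes>\<^sub>M C \<Otimes>\<^sub>M D)"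
  shows "(\<integral>\<^sup>+w. G w \<partial>(A \<Otimes>\<^sub>M B \<Otimes>\<^sub>M C \<Otimes>\<^sub>M D)) =
    (\<integral>\<^sup>+a. \<integral>\<^sup>+cd. \<integral>\<^sup>+b. G (a, b, cd) \<partial>B \<partial>(C \<Otimes>\<^sub>M D) \<partial>A)"
proof -
  interpret CD: sigma_finite_measure "C \<Otimes>\<^sub>M D" by (intro sigma_finite_pair_measure sf)
  interpret BCD: sigma_finite_measure "B \<Otimes>\<^sub>M C \<Otimes>\<^sub>M D" by (intro sigma_finite_pair_measure sf)
  interpret B_CD: pair_sigma_finite B "C \<Otimes>\<^sub>M D" 
    unfolding pair_sigma_finite_def using sf CD.sigma_finite_measure_axioms by blast
  have "(\<integral>\<^sup>+w. G w \<partial>(A \<Otimes>\<^sub>M B \<Otimes>\<^sub>M C \<Otimes>\<^sub>M D)) = (\<integral>\<^sup>+a. \<integral>\<^sup>+w. G (a, w) \<partial>(B \<Otimes>\<^sub>M C \<Otimes>\<^sub>M D) \<partial>A)"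
    using BCD.nn_integral_fst[OF G] by simp
  also have "\<dots> = (\<integral>\<^sup>+a. \<integral>\<^sup>+cd. \<integral>\<^sup>+b. G (a, b, cd) \<partial>B \<partial>(C \<Otimes>\<^sub>M D) \<partial>A)"
  proof (rule nn_integral_cong)
    fix a assume "a \<in> space A"
    then have "(\<lambda>w. G (a, w)) \<in> borel_measurable (B \<Otimes>\<^sub>M C \<Otimes>\<^sub>M D)"
      using measurable_compose[OF measurable_Pair1' G] by blast
    from B_CD.nn_integral_snd[of "\<lambda>w. G (a, w)"] this
    show "(\<integral>\<^sup>+w. G (a, w) \<partial>(B \<Otimes>\<^sub>M C \<Otimes>\<^sub>M D)) = (\<integral>\<^sup>+cd. \<integral>\<^sup>+b. G (a, b, cd) \<partial>B \<partial>(C \<Otimes>\<^sub>M D))"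
      by (simp add: split_beta')
  qed
  finally show ?thesis .
qed

lemma nn_integral_pair4_3:
  assumes G: "G \<in> borel_measurable (A \<Otimes>\<^sub>M B \<Otimes>\<^sub>M C \<Otimes>\<^sub>M D)"
  shows "(\<integral>\<^sup>+w. G w \<partial>(A \<Otimes>\<^sub>M B \<Otimes>\<^sub>M C \<Otimes>\<^sub>M D)) =
    (\<integral>\<^sup>+a. \<integral>\<^sup>+b. \<integral>\<^sup>+d. \<integral>\<^sup>+c. G (a, b, c, d) \<partial>C \<partial>D \<partial>B \<partial>A)"
proof -
  interpret CD: sigma_finite_measure "C \<Otimes>\<^sub>M D" by (intro sigma_finite_pair_measure sf)
  interpret BCD: sigma_finite_measure "B \<Otimes>\<^sub>M C \<Otimes>\<^sub>M D" by (intro sigma_finite_pair_measure sf)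
  interpret C_D: pair_sigma_finite C D
    unfolding pair_sigma_finite_def using sf by blast
  have "(\<integral>\<^sup>+w. G w \<partial>(A \<Otimes>\<^sub>M B \<Otimes>\<^sub>M C \<Otimes>\<^sub>M D)) = (\<integral>\<^sup>+a. \<integral>\<^sup>+w. G (a, w) \<partial>(B \<Otimes>\<^sub>M C \<Otimes>\<^sub>M D) \<partial>A)"
    using BCD.nn_integral_fst[OF G] by simp
  also have "\<dots> = (\<integral>\<^sup>+a. \<integral>\<^sup>+b. \<integral>\<^sup>+d. \<integral>\<^sup>+c. G (a, b, c, d) \<partial>C \<partial>D \<partial>B \<partial>A)"
  proof (rule nn_integral_cong)
    fix a assume "a \<in> space A"
    then have Ga: "(\<lambda>w. G (a, w)) \<in> borel_measurable (B \<Otimes>\<^sub>M C \<Otimes>\<^sub>M D)"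
      using measurable_compose[OF measurable_Pair1' G] by blast
    have "(\<integral>\<^sup>+w. G (a, w) \<partial>(B \<Otimes>\<^sub>M C \<Otimes>\<^sub>M D)) = (\<integral>\<^sup>+b. \<integral>\<^sup>+cd. G (a, b, cd) \<partial>(C \<Otimes>\<^sub>M D) \<partial>B)"
      using CD.nn_integral_fst[OF Ga] by simp
    also have "\<dots> = (\<integral>\<^sup>+b. \<integral>\<^sup>+d. \<integral>\<^sup>+c. G (a, b, c, d) \<partial>C \<partial>D \<partial>B)"
    proof (rule nn_integral_cong)
      fix b assume "b \<in> space B"
      then have "(\<lambda>w. G (a, b, w)) \<in> borel_measurable (C \<Otimes>\<^sub>M D)"
        using measurable_compose[OF measurable_Pair1' Ga] by blast
      from C_D.nn_integral_snd[of "\<lambda>w. G (a, b, w)"] this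
      show "(\<integral>\<^sup>+cd. G (a, b, cd) \<partial>(C \<Otimes>\<^sub>M D)) = (\<integral>\<^sup>+d. \<integral>\<^sup>+c. G (a, b, c, d) \<partial>C \<partial>D)"
        by (simp add: split_beta')
    qed
    finally show "(\<integral>\<^sup>+w. G (a, w) \<partial>(B \<Otimes>\<^sub>M C \<Otimes>\<^sub>M D)) = (\<integral>\<^sup>+b. \<integral>\<^sup>+d. \<integral>\<^sup>+c. G (a, b, c, d) \<partial>C \<partial>D \<partial>B)" .
  qed
  finally show ?thesis .
qed

end

lemma nn_integral_PiM_CN_linear:
  fixes N :: nat
  assumes v: "\<And>i. i < N \<Longrightarrow> 0 \<le> v i"
  shows "msq (PiM {..<N} (\<lambda>i. CN (v i))) (\<lambda>x. \<Sum>i<N. a i * x i) = ennreal (\<Sum>i<N. (cmod (a i))\<^sup>2 * v i)"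
proof -
  let ?r = "\<lambda>g. \<lambda>i\<in>{..<N}. complex_of_real (sqrt (v i)) * g i"
  have E: "PiM {..<N} (\<lambda>i. CN (v i)) = distr (CN_vec N) (cspace N) ?r"
    by (rule PiM_CN_scale) (rule v)
  have rm: "?r \<in> CN_vec N \<rightarrow>\<^sub>M cspace N"
    by (intro measurable_restrict borel_measurable_times borel_measurable_const measurable_component_singleton[of _ _ "\<lambda>_. CN 1", unfolded measurable_cong_sets[OF refl sets_CN]]) 
  have fm: "(\<lambda>x. ennreal ((cmod (\<Sum>i<N. a i * x i))\<^sup>2)) \<in> borel_measurable (cspace N)"
    by measurable
  have "msq (PiM {..<N} (\<lambda>i. CN (v i))) (\<lambda>x. \<Sum>i<N. a i * x i)
    = msq (CN_vec N) (\<lambda>g. \<Sum>i<N. a i * ?r g i)"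
    unfolding E by (rule nn_integral_distr[OF rm]) (use fm in simp)
  also have "\<dots> = msq (CN_vec N) (\<lambda>g. \<Sum>i<N. (a i * complex_of_real (sqrt (v i))) * g i)"
    by (intro nn_integral_cong arg_cong[where f=ennreal] arg_cong[where f="\<lambda>z. (cmod z)\<^sup>2"] sum.cong) auto
  also have "\<dots> = ennreal (Re (\<Sum>i<N. \<Sum>j<N. (a i * complex_of_real (sqrt (v i))) * (if i = j then 1 else 0) * cnj (a j * complex_of_real (sqrt (v j)))))"
    by (rule nn_integral_has_bochner_integral[OF wick_linear[OF wick_CN_vec]]) simp
  also have "(\<Sum>i<N. \<Sum>j<N. (a i * complex_of_real (sqrt (v i))) * (if i = j then 1 else 0) * cnj (a j * complex_of_real (sqrt (v j))))
      = (\<Sum>i<N. complex_of_real ((cmod (a i))\<^sup>2 * v i))"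
  proof (intro sum.cong refl)
    fix i assume i: "i \<in> {..<N}"
    have "(\<Sum>j<N. (a i * complex_of_real (sqrt (v i))) * (if i = j then 1 else 0) * cnj (a j * complex_of_real (sqrt (v j))))
      = (a i * cnj (a i)) * complex_of_real (sqrt (v i) * sqrt (v i))"
    proof -
      have "(\<Sum>j<N. (a i * complex_of_real (sqrt (v i))) * (if i = j then 1 else 0) * cnj (a j * complex_of_real (sqrt (v j))))
        = (\<Sum>j<N. if i = j then a i * complex_of_real (sqrt (v i)) * cnj (a i * complex_of_real (sqrt (v i))) else 0)"
        by (intro sum.cong refl) simp
      also have "\<dots> = a i * complex_of_real (sqrt (v i)) * cnj (a i * complex_of_real (sqrt (v i)))"
        using i by simp
      finally show ?thesis by (simp only: complex_cnj_mult complex_cnj_complex_of_real of_real_mult mult_ac)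
    qed
    also have "\<dots> = complex_of_real ((cmod (a i))\<^sup>2) * complex_of_real (v i)"
      using v[of i] i unfolding complex_norm_square[symmetric] by simp
    also have "\<dots> = complex_of_real ((cmod (a i))\<^sup>2 * v i)" by (rule of_real_mult[symmetric])
    finally show "(\<Sum>j<N. (a i * complex_of_real (sqrt (v i))) * (if i = j then 1 else 0) * cnj (a j * complex_of_real (sqrt (v j))))
      = complex_of_real ((cmod (a i))\<^sup>2 * v i)" .
  qed
  finally show ?thesis by (simp del: of_real_mult of_real_power flip: of_real_sum)
qed

lemma nn_integral_PiM_CN_quadratic:
  fixes N :: nat
  assumes v: "\<And>i. i < N \<Longrightarrow> 0 \<le> v i"
  shows "msq (PiM {..<N} (\<lambda>i. CN (v i))) (\<lambda>x. (\<Sum>i<N. \<Sum>j<N. B i j * cnj (x i) * x j) - (\<Sum>i<N. B i i * complex_of_real (v i)))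
    \<le> ennreal (\<Sum>i<N. \<Sum>j<N. (cmod (B i j))\<^sup>2 * (v i * v j))"
proof -
  let ?r = "\<lambda>g. \<lambda>i\<in>{..<N}. complex_of_real (sqrt (v i)) * g i"
  have E: "PiM {..<N} (\<lambda>i. CN (v i)) = distr (CN_vec N) (cspace N) ?r"
    by (rule PiM_CN_scale) (rule v)
  define B' where "B' i j = B i j * complex_of_real (sqrt (v i) * sqrt (v j))" for i j
  have rm: "?r \<in> CN_vec N \<rightarrow>\<^sub>M cspace N"
    by (intro measurable_restrict borel_measurable_times borel_measurable_const measurable_component_singleton[of _ _ "\<lambda>_. CN 1", unfolded measurable_cong_sets[OF refl sets_CN]]) 
  have xm: "(\<lambda>x. x i) \<in> borel_measurable (cspace N)" if "i \<in> {..<N}" for i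
    using that by (rule measurable_component_singleton)
  have xm': "(\<lambda>x. cnj (x i)) \<in> borel_measurable (cspace N)" if "i \<in> {..<N}" for i
    using measurable_compose[OF xm[OF that] borel_measurable_cnj] .
  have qm: "(\<lambda>x. (\<Sum>i<N. \<Sum>j<N. B i j * cnj (x i) * x j) - (\<Sum>i<N. B i i * complex_of_real (v i))) \<in> borel_measurable (cspace N)"
    by (intro borel_measurable_diff borel_measurable_sum borel_measurable_times borel_measurable_const xm xm')
  have fm: "(\<lambda>x. ennreal ((cmod ((\<Sum>i<N. \<Sum>j<N. B i j * cnj (x i) * x j) - (\<Sum>i<N. B i i * complex_of_real (v i))))\<^sup>2)) \<in> borel_measurable (cspace N)"
    using qm by measurable
  have "msq (PiM {..<N} (\<lambda>i. CN (v i))) (\<lambda>x. (\<Sum>i<N. \<Sum>j<N. B i j * cnj (x i) * x j) - (\<Sum>i<N. B i i * complex_of_real (v i)))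
    = msq (CN_vec N) (\<lambda>g. (\<Sum>i<N. \<Sum>j<N. B i j * cnj (?r g i) * ?r g j) - (\<Sum>i<N. B i i * complex_of_real (v i)))"
    unfolding E by (rule nn_integral_distr[OF rm]) (use fm in simp)
  also have "\<dots> = msq (CN_vec N) (\<lambda>g. (\<Sum>i<N. \<Sum>j<N. B' i j * cnj (g i) * g j) - (\<Sum>i<N. \<Sum>j<N. B' i j * (if j = i then 1 else 0)))"
  proof (rule nn_integral_cong)
    fix g :: cvec
    have "(\<Sum>i<N. \<Sum>j<N. B i j * cnj (?r g i) * ?r g j) = (\<Sum>i<N. \<Sum>j<N. B' i j * cnj (g i) * g j)"
      by (intro sum.cong refl) (simp add: B'_def mult_ac)
    moreover have "(\<Sum>i<N. \<Sum>j<N. B' i j * (if j = i then 1 else 0)) = (\<Sum>i<N. B i i * complex_of_real (v i))"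
      using v by (intro sum.cong refl) (simp add: B'_def if_distrib[of "\<lambda>z. _ * z"] flip: of_real_mult cong: if_cong)
    ultimately show "ennreal ((cmod ((\<Sum>i<N. \<Sum>j<N. B i j * cnj (?r g i) * ?r g j) - (\<Sum>i<N. B i i * complex_of_real (v i))))\<^sup>2)
      = ennreal ((cmod ((\<Sum>i<N. \<Sum>j<N. B' i j * cnj (g i) * g j) - (\<Sum>i<N. \<Sum>j<N. B' i j * (if j = i then 1 else 0))))\<^sup>2)"
      by simp
  qed
  also have "\<dots> \<le> ennreal (1\<^sup>2 * frob N B')"
  proof (rule wick_quadratic[OF _ wick_CN_vec])
    show "prob_space (CN_vec N)" by (intro prob_space_PiM prob_space_CN)
    show "opb N (\<lambda>i j. if i = j then 1 else 0) 1" by (rule opb_diag) auto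
  qed
  also have "1\<^sup>2 * frob N B' = (\<Sum>i<N. \<Sum>j<N. (cmod (B i j))\<^sup>2 * (v i * v j))"
    unfolding frob_def sqn_def B'_def mult_1 power_one using v
    by (intro sum.cong refl) (simp add: norm_mult power_mult_distrib)
  finally show ?thesis .
qed

lemma has_cond_mean_add:
  assumes "has_cond_mean M K X Y c" "has_cond_mean M K X Z d" and X: "X \<in> M \<rightarrow>\<^sub>M K"
  shows "has_cond_mean M K X (\<lambda>w. Y w + Z w) (c + d)"
proof -
  have i: "integrable M (\<lambda>w. indicat_real B (X w) *\<^sub>R Y w)" if "integrable M Y" "B \<in> sets K" for Y :: "_ \<Rightarrow> complex" and B
  proof -
    have "integrable M (\<lambda>w. indicat_real (X -` B \<inter> space M) w *\<^sub>R Y w)"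
      using that measurable_sets[OF X] by (intro integrable_mult_indicator) auto
    also have "?this \<longleftrightarrow> ?thesis" by (intro Bochner_Integration.integrable_cong refl) (auto simp: indicator_def)
    finally show ?thesis .
  qed
  show ?thesis using assms i unfolding has_cond_mean_def
    by (auto simp: scaleR_add_right)
qed

lemma has_cond_mean_mult:
  assumes "has_cond_mean M K X Y c"
  shows "has_cond_mean M K X (\<lambda>w. s * Y w) (s * c)"
  using assms unfolding has_cond_mean_def
  by (auto simp flip: mult_scaleR_right)

lemma cond_mean_nonneg:
  fixes Y :: "'a \<Rightarrow> real" and f :: "'x \<Rightarrow> complex"
  assumes M: "prob_space M" and X: "X \<in> M \<rightarrow>\<^sub>M K"
    and Y: "has_cond_mean M K X (\<lambda>w. complex_of_real (Y w)) (complex_of_real c)" and nn: "\<And>w. 0 \<le> Y w"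
    and f: "f \<in> borel_measurable K" and fi: "integrable M (\<lambda>w. f (X w))"
  shows "has_bochner_integral M (\<lambda>w. complex_of_real (Y w) * f (X w)) (complex_of_real c * (\<integral>w. f (X w) \<partial>M))"
proof -
  interpret prob_space M by fact
  have Yi: "integrable M Y" using Y unfolding has_cond_mean_def complex_of_real_integrable_eq by blast
  then have Ym: "Y \<in> borel_measurable M" by simp
  have Yc: "(\<integral>w. indicat_real B (X w) * Y w \<partial>M) = measure M (X -` B \<inter> space M) * c" if "B \<in> sets K" for B
  proof -
    have "(\<integral>w. complex_of_real (indicat_real B (X w) * Y w) \<partial>M) = complex_of_real (measure M (X -` B \<inter> space M) * c)"
      using Y that unfolding has_cond_mean_def by (simp add: scaleR_conv_of_real)
    then show ?thesis by (simp only: integral_complex_of_real of_real_eq_iff)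
  qed
  have c0: "0 \<le> c"
  proof -
    have "c = (\<integral>w. indicat_real (space K) (X w) * Y w \<partial>M)"
    proof -
      have "X -` space K \<inter> space M = space M" using measurable_space[OF X] by auto
      then show ?thesis using Yc[OF sets.top] prob_space by simp
    qed
    also have "\<dots> \<ge> 0" using nn by (intro integral_nonneg_AE) auto
    finally show ?thesis .
  qed
  have eq: "distr (density M (\<lambda>w. ennreal (Y w))) K X = density (distr M K X) (\<lambda>_. ennreal c)"
  proof (rule measure_eqI)
    fix B assume "B \<in> sets (distr (density M (\<lambda>w. ennreal (Y w))) K X)"
    then have B: "B \<in> sets K" by simp
    have XB: "X -` B \<inter> space M \<in> sets M" using X B by (rule measurable_sets)
    have "emeasure (distr (density M (\<lambda>w. ennreal (Y w))) K X) B = emeasure (density M (\<lambda>w. ennreal (Y w))) (X -` B \<inter> space M)"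
      using X B by (subst emeasure_distr) auto
    also have "\<dots> = (\<integral>\<^sup>+w. ennreal (Y w) * indicator (X -` B \<inter> space M) w \<partial>M)"
      using XB Ym by (intro emeasure_density) auto
    also have "\<dots> = (\<integral>\<^sup>+w. ennreal (indicat_real B (X w) * Y w) \<partial>M)"
      by (intro nn_integral_cong) (auto simp: indicator_def)
    also have "\<dots> = ennreal (\<integral>w. indicat_real B (X w) * Y w \<partial>M)"
    proof (rule nn_integral_eq_integral)
      have "integrable M (\<lambda>w. indicat_real (X -` B \<inter> space M) w *\<^sub>R Y w)"
        using Yi XB by (intro integrable_mult_indicator)
      also have "?this \<longleftrightarrow> integrable M (\<lambda>w. indicat_real B (X w) * Y w)" by (intro Bochner_Integration.integrable_cong refl) (auto simp: indicator_def)
      finally show "integrable M (\<lambda>w. indicat_real B (X w) * Y w)" .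
    qed (use nn in auto)
    also have "\<dots> = ennreal c * emeasure M (X -` B \<inter> space M)"
      unfolding Yc[OF B] using c0 by (simp add: emeasure_eq_measure ennreal_mult' mult.commute)
    also have "\<dots> = emeasure (density (distr M K X) (\<lambda>_. ennreal c)) B"
      using X B by (simp add: emeasure_density_const emeasure_distr)
    finally show "emeasure (distr (density M (\<lambda>w. ennreal (Y w))) K X) B = emeasure (density (distr M K X) (\<lambda>_. ennreal c)) B" .
  qed simp
  have fX: "(\<lambda>w. f (X w)) \<in> borel_measurable M" using X f by (rule measurable_compose)
  have "integrable (density (distr M K X) (\<lambda>_. ennreal c)) f"
    using fi X f c0 by (subst integrable_density) (auto simp: integrable_distr_eq)
  then have i1: "integrable M (\<lambda>w. complex_of_real (Y w) * f (X w))"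
    unfolding eq[symmetric] using X f fX Ym nn
    by (subst (asm) integrable_distr_eq) (auto simp: integrable_density scaleR_conv_of_real)
  have "(\<integral>w. complex_of_real (Y w) * f (X w) \<partial>M) = integral\<^sup>L (distr (density M (\<lambda>w. ennreal (Y w))) K X) f"
    using X f fX Ym nn by (subst integral_distr) (auto simp: integral_density scaleR_conv_of_real)
  also have "\<dots> = complex_of_real c * (\<integral>w. f (X w) \<partial>M)"
    unfolding eq using X f c0 by (subst integral_density) (auto simp: integral_distr scaleR_conv_of_real)
  finally show ?thesis using i1 by (simp add: has_bochner_integral_iff)
qed

lemma borel_measurable_cnj' : "f \<in> borel_measurable M \<Longrightarrow> (\<lambda>x. cnj (f x)) \<in> borel_measurable M"
  by (rule measurable_compose[OF _ borel_measurable_cnj])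

lemma borel_measurable_ennreal_norm2:
  "f \<in> borel_measurable M \<Longrightarrow> (\<lambda>x. ennreal ((cmod (f x))\<^sup>2)) \<in> borel_measurable M"
  by measurable

lemmas meas_intros = borel_measurable_sum borel_measurable_times borel_measurable_const
  borel_measurable_diff borel_measurable_add borel_measurable_cnj' borel_measurable_ennreal_norm2

lemma nn_integral_sum_le:
  fixes g :: "'i \<Rightarrow> 'a \<Rightarrow> real"
  assumes "\<And>j. j \<in> J \<Longrightarrow> g j \<in> borel_measurable M" "\<And>j w. j \<in> J \<Longrightarrow> 0 \<le> g j w" "\<And>j. j \<in> J \<Longrightarrow> 0 \<le> C j"
    "\<And>j. j \<in> J \<Longrightarrow> (\<integral>\<^sup>+w. ennreal (g j w) \<partial>M) \<le> ennreal (C j)"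
  shows "(\<integral>\<^sup>+w. ennreal (\<Sum>j\<in>J. g j w) \<partial>M) \<le> ennreal (\<Sum>j\<in>J. C j)"
proof -
  have "(\<integral>\<^sup>+w. ennreal (\<Sum>j\<in>J. g j w) \<partial>M) = (\<integral>\<^sup>+w. (\<Sum>j\<in>J. ennreal (g j w)) \<partial>M)"
    using assms(2) by (intro nn_integral_cong) (simp add: sum_ennreal)
  also have "\<dots> = (\<Sum>j\<in>J. \<integral>\<^sup>+w. ennreal (g j w) \<partial>M)"
    using assms(1) by (intro nn_integral_sum) auto
  also have "\<dots> \<le> (\<Sum>j\<in>J. ennreal (C j))" by (intro sum_mono assms)
  also have "\<dots> = ennreal (\<Sum>j\<in>J. C j)" using assms(3) by (rule sum_ennreal)
  finally show ?thesis .
qed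

lemma nn_integral_cmult_le:
  fixes g :: "'a \<Rightarrow> real"
  assumes "g \<in> borel_measurable M" "0 \<le> c" "(\<integral>\<^sup>+w. ennreal (g w) \<partial>M) \<le> ennreal C"
  shows "(\<integral>\<^sup>+w. ennreal (c * g w) \<partial>M) \<le> ennreal (c * C)"
proof -
  have "(\<integral>\<^sup>+w. ennreal (c * g w) \<partial>M) = ennreal c * (\<integral>\<^sup>+w. ennreal (g w) \<partial>M)"
    using assms by (subst nn_integral_cmult[symmetric]) (auto simp: ennreal_mult')
  also have "\<dots> \<le> ennreal (c * C)" unfolding ennreal_mult'[OF assms(2)] by (intro mult_left_mono assms) simp
  finally show ?thesis .
qed

locale uplink_sys =
  fixes P :: params and N :: nat and U :: "('a, 'c, 'b, 'u) uplink"
  assumes params: "valid_params P" and N1: "1 \<le> N" and model: "uplink_model P N U"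
begin

definition "er w = fst (snd (disturbance U w))"
definition "nr w = fst (snd (snd (disturbance U w)))"
abbreviation "h \<equiv> channel U"
abbreviation "R i j \<equiv> cov_R U $$ (i, j)"
abbreviation "S i j \<equiv> cov_S U $$ (i, j)"
definition "kp = kappa_r P * p_UE P"
abbreviation "full \<equiv> chans U \<Otimes>\<^sub>M disturb_space N"
definition "er_law c = PiM {..<N} (\<lambda>i. CN (kp * (cmod (user U c i))\<^sup>2))"
abbreviation "nr_law \<equiv> PiM {..<N} (\<lambda>_. CN (sigma2 P))"

lemma p_pos: "0 < p_UE P"
proof -
  have "pilot P \<noteq> 0" "(cmod (pilot P))\<^sup>2 = p_UE P" using params by (auto simp: valid_params_def)
  then show ?thesis by (metis zero_less_norm_iff zero_less_power)
qed

lemma kp_nonneg: "0 \<le> kp"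
  using params p_pos by (simp add: kp_def valid_params_def)

lemma sigma2_pos: "0 < sigma2 P"
  using params by (simp add: valid_params_def)

lemma prob_M: "prob_space (prb U)" and psd_R: "psd N (cov_R U)" and psd_S: "psd N (cov_S U)"
  and chan_meas: "chan U \<in> prb U \<rightarrow>\<^sub>M chans U" and user_meas: "user U \<in> chans U \<rightarrow>\<^sub>M cspace N"
  and normal_h: "complex_normal N (prb U) h (cov_R U)"
  and dist_meas: "disturbance U \<in> prb U \<rightarrow>\<^sub>M disturb_space N"
  and pilot_meas: "pilot_interf U \<in> chans U \<rightarrow>\<^sub>M prob_algebra (cspace N)"
  and joint_law: "distr (prb U) full (\<lambda>w. (chan U w, disturbance U w)) =
       distr (prb U) (chans U) (chan U) \<bind>
         (\<lambda>c. distr (disturb_law P N (user U c) (pilot_interf U c)) full (Pair c))"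
  and ni_cov: "\<And>i j. i < N \<Longrightarrow> j < N \<Longrightarrow> has_cond_mean (prb U) (cspace N) h
        (\<lambda>w. interf U w i * cnj (interf U w j)) (S i j)"
  using model unfolding uplink_model_def by (elim conjE, blast)+

sublocale M: prob_space "prb U" by (rule prob_M)

lemma law_eq: "disturb_law P N (user U c) L = CN (kappa_t P * p_UE P) \<Otimes>\<^sub>M er_law c \<Otimes>\<^sub>M nr_law \<Otimes>\<^sub>M L"
  by (simp add: disturb_law_def er_law_def kp_def)

lemma sets_er_law [simp, measurable_cong]: "sets (er_law c) = sets (cspace N)"
  unfolding er_law_def by (rule sets_CN_PiM)

lemma prob_er_law: "prob_space (er_law c)" and prob_nr_law: "prob_space nr_law"
  unfolding er_law_def by (intro prob_space_PiM prob_space_CN)+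

lemma pilot_interf_prob:
  assumes "c \<in> space (chans U)"
  shows "prob_space (pilot_interf U c)" "sets (pilot_interf U c) = sets (cspace N)"
  using measurable_space[OF pilot_meas assms] by (auto simp: space_prob_algebra)

lemma law_meas: "(\<lambda>c. disturb_law P N (user U c) (pilot_interf U c)) \<in> chans U \<rightarrow>\<^sub>M prob_algebra (disturb_space N)"
  using kp_nonneg by (intro measurable_disturb_law user_meas pilot_meas) (simp add: kp_def)

lemma sets_law:
  assumes "c \<in> space (chans U)"
  shows "sets (disturb_law P N (user U c) (pilot_interf U c)) = sets (disturb_space N)"
  using measurable_space[OF law_meas assms] by (auto simp: space_prob_algebra)

lemma joint_meas: "(\<lambda>w. (chan U w, disturbance U w)) \<in> prb U \<rightarrow>\<^sub>M full"
  using chan_meas dist_meas by (rule measurable_Pair)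

lemma nn_integral_disintegrate:
  assumes F: "F \<in> borel_measurable full"
  shows "(\<integral>\<^sup>+\<omega>. F (chan U \<omega>, disturbance U \<omega>) \<partial>prb U) =
    (\<integral>\<^sup>+\<omega>. (\<integral>\<^sup>+w. F (chan U \<omega>, w) \<partial>disturb_law P N (user U (chan U \<omega>)) (pilot_interf U (chan U \<omega>))) \<partial>prb U)"
proof -
  let ?law = "\<lambda>c. disturb_law P N (user U c) (pilot_interf U c)"
  have k: "(\<lambda>c. distr (?law c) full (Pair c)) \<in> chans U \<rightarrow>\<^sub>M subprob_algebra full"
    by (rule measurable_distr2[OF _ measurable_prob_algebraD[OF law_meas]]) simp
  have inner: "(\<integral>\<^sup>+x. F x \<partial>distr (?law c) full (Pair c)) = (\<integral>\<^sup>+w. F (c, w) \<partial>?law c)" if c: "c \<in> space (chans U)" for c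
  proof (rule nn_integral_distr)
    show "Pair c \<in> ?law c \<rightarrow>\<^sub>M full"
      unfolding measurable_cong_sets[OF sets_law[OF c] refl] using c by (rule measurable_Pair1')
  qed (use F in simp)
  have im: "(\<lambda>c. \<integral>\<^sup>+x. F x \<partial>distr (?law c) full (Pair c)) \<in> borel_measurable (chans U)"
    by (rule measurable_compose[OF k nn_integral_measurable_subprob_algebra[OF F]])
  have "(\<integral>\<^sup>+\<omega>. F (chan U \<omega>, disturbance U \<omega>) \<partial>prb U) = (\<integral>\<^sup>+x. F x \<partial>distr (prb U) full (\<lambda>\<omega>. (chan U \<omega>, disturbance U \<omega>)))"
    by (rule nn_integral_distr[OF joint_meas, symmetric]) (use F in simp)
  also have "\<dots> = (\<integral>\<^sup>+c. (\<integral>\<^sup>+x. F x \<partial>distr (?law c) full (Pair c)) \<partial>distr (prb U) (chans U) (chan U))"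
    unfolding joint_law by (rule nn_integral_bind[OF F]) (use k in simp)
  also have "\<dots> = (\<integral>\<^sup>+\<omega>. (\<integral>\<^sup>+x. F x \<partial>distr (?law (chan U \<omega>)) full (Pair (chan U \<omega>))) \<partial>prb U)"
    by (rule nn_integral_distr[OF chan_meas]) (use im in simp)
  also have "\<dots> = (\<integral>\<^sup>+\<omega>. (\<integral>\<^sup>+w. F (chan U \<omega>, w) \<partial>?law (chan U \<omega>)) \<partial>prb U)"
    by (intro nn_integral_cong inner measurable_space[OF chan_meas])
  finally show ?thesis .
qed

lemma sigma_finite_laws:
  assumes "c \<in> space (chans U)"
  shows "sigma_finite_measure (CN v)" "sigma_finite_measure (er_law c')" "sigma_finite_measure nr_law" "sigma_finite_measure (pilot_interf U c)"
  by (intro prob_space_imp_sigma_finite prob_space_CN prob_er_law prob_nr_law pilot_interf_prob(1)[OF assms])+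

lemma section_meas:
  assumes "F \<in> borel_measurable full" "c \<in> space (chans U)"
  shows "(\<lambda>w. F (c, w)) \<in> borel_measurable (CN (kappa_t P * p_UE P) \<Otimes>\<^sub>M er_law c \<Otimes>\<^sub>M nr_law \<Otimes>\<^sub>M pilot_interf U c)"
  unfolding law_eq[symmetric] measurable_cong_sets[OF sets_law[OF assms(2)] refl]
  using measurable_compose[OF measurable_Pair1'[OF assms(2)] assms(1)] .

lemma er_integrate_le:
  assumes F: "F \<in> borel_measurable full" and G: "(\<lambda>x. G (fst x) (fst (snd x)) (fst (snd (snd (snd x)))) (snd (snd (snd (snd x))))) \<in> borel_measurable full"
    and le: "\<And>c et nr ni. c \<in> space (chans U) \<Longrightarrow> (\<integral>\<^sup>+e. F (c, et, e, nr, ni) \<partial>er_law c) \<le> G c et nr ni"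
  shows "(\<integral>\<^sup>+\<omega>. F (chan U \<omega>, disturbance U \<omega>) \<partial>prb U) \<le> (\<integral>\<^sup>+\<omega>. G (chan U \<omega>) (eta_t U \<omega>) (nr \<omega>) (interf U \<omega>) \<partial>prb U)"
proof -
  let ?G = "\<lambda>x. G (fst x) (fst (snd x)) (fst (snd (snd (snd x)))) (snd (snd (snd (snd x))))"
  have "(\<integral>\<^sup>+\<omega>. F (chan U \<omega>, disturbance U \<omega>) \<partial>prb U) \<le> (\<integral>\<^sup>+\<omega>. ?G (chan U \<omega>, disturbance U \<omega>) \<partial>prb U)"
    unfolding nn_integral_disintegrate[OF F] nn_integral_disintegrate[OF G] law_eq
  proof (rule nn_integral_mono)
    fix \<omega> assume "\<omega> \<in> space (prb U)"
    then have c: "chan U \<omega> \<in> space (chans U)" by (rule measurable_space[OF chan_meas])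
    show "(\<integral>\<^sup>+w. F (chan U \<omega>, w) \<partial>(CN (kappa_t P * p_UE P) \<Otimes>\<^sub>M er_law (chan U \<omega>) \<Otimes>\<^sub>M nr_law \<Otimes>\<^sub>M pilot_interf U (chan U \<omega>)))
      \<le> (\<integral>\<^sup>+w. ?G (chan U \<omega>, w) \<partial>(CN (kappa_t P * p_UE P) \<Otimes>\<^sub>M er_law (chan U \<omega>) \<Otimes>\<^sub>M nr_law \<Otimes>\<^sub>M pilot_interf U (chan U \<omega>)))"
      unfolding nn_integral_pair4_2[OF sigma_finite_laws(1-3)[OF c] sigma_finite_laws(4)[OF c] section_meas[OF F c]]
        nn_integral_pair4_2[OF sigma_finite_laws(1-3)[OF c] sigma_finite_laws(4)[OF c] section_meas[OF G c]]
      using le[OF c, of _ "fst y" "snd y" for y] prob_space.emeasure_space_1[OF prob_er_law]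
      by - (rule nn_integral_mono, rule nn_integral_mono, simp add: split_beta')
  qed
  then show ?thesis by (simp add: eta_t_def nr_def interf_def)
qed

lemma nr_integrate_le:
  assumes F: "F \<in> borel_measurable full" and G: "(\<lambda>x. G (fst x) (fst (snd x)) (fst (snd (snd x))) (snd (snd (snd (snd x))))) \<in> borel_measurable full"
    and le: "\<And>c et er ni. c \<in> space (chans U) \<Longrightarrow> (\<integral>\<^sup>+e. F (c, et, er, e, ni) \<partial>nr_law) \<le> G c et er ni"
  shows "(\<integral>\<^sup>+\<omega>. F (chan U \<omega>, disturbance U \<omega>) \<partial>prb U) \<le> (\<integral>\<^sup>+\<omega>. G (chan U \<omega>) (eta_t U \<omega>) (er \<omega>) (interf U \<omega>) \<partial>prb U)"
proof -
  let ?G = "\<lambda>x. G (fst x) (fst (snd x)) (fst (snd (snd x))) (snd (snd (snd (snd x))))"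
  have "(\<integral>\<^sup>+\<omega>. F (chan U \<omega>, disturbance U \<omega>) \<partial>prb U) \<le> (\<integral>\<^sup>+\<omega>. ?G (chan U \<omega>, disturbance U \<omega>) \<partial>prb U)"
    unfolding nn_integral_disintegrate[OF F] nn_integral_disintegrate[OF G] law_eq
  proof (rule nn_integral_mono)
    fix \<omega> assume "\<omega> \<in> space (prb U)"
    then have c: "chan U \<omega> \<in> space (chans U)" by (rule measurable_space[OF chan_meas])
    show "(\<integral>\<^sup>+w. F (chan U \<omega>, w) \<partial>(CN (kappa_t P * p_UE P) \<Otimes>\<^sub>M er_law (chan U \<omega>) \<Otimes>\<^sub>M nr_law \<Otimes>\<^sub>M pilot_interf U (chan U \<omega>)))
      \<le> (\<integral>\<^sup>+w. ?G (chan U \<omega>, w) \<partial>(CN (kappa_t P * p_UE P) \<Otimes>\<^sub>M er_law (chan U \<omega>) \<Otimes>\<^sub>M nr_law \<Otimes>\<^sub>M pilot_interf U (chan U \<omega>)))"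
      unfolding nn_integral_pair4_3[OF sigma_finite_laws(1-3)[OF c] sigma_finite_laws(4)[OF c] section_meas[OF F c]]
        nn_integral_pair4_3[OF sigma_finite_laws(1-3)[OF c] sigma_finite_laws(4)[OF c] section_meas[OF G c]]
      using le[OF c] prob_space.emeasure_space_1[OF prob_nr_law]
      by - (rule nn_integral_mono, rule nn_integral_mono, rule nn_integral_mono, simp)
  qed
  then show ?thesis by (simp add: eta_t_def er_def interf_def)
qed

lemma et_integrate:
  assumes f: "f \<in> borel_measurable borel" and G: "(\<lambda>x. G (fst x) (snd (snd x))) \<in> borel_measurable full"
  shows "(\<integral>\<^sup>+\<omega>. f (eta_t U \<omega>) * G (chan U \<omega>) (snd (disturbance U \<omega>)) \<partial>prb U) =
    (\<integral>\<^sup>+z. f z \<partial>CN (kappa_t P * p_UE P)) * (\<integral>\<^sup>+\<omega>. G (chan U \<omega>) (snd (disturbance U \<omega>)) \<partial>prb U)"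
proof -
  let ?G = "\<lambda>x. G (fst x) (snd (snd x))"
  let ?law = "\<lambda>c. disturb_law P N (user U c) (pilot_interf U c)"
  have fG: "(\<lambda>x. f (fst (snd x)) * ?G x) \<in> borel_measurable full"
    by (intro borel_measurable_times_ennreal G measurable_compose[OF _ f]) measurable
  have Gm: "(\<lambda>\<omega>. \<integral>\<^sup>+w. ?G (chan U \<omega>, w) \<partial>?law (chan U \<omega>)) \<in> borel_measurable (prb U)"
    by (intro measurable_compose[OF chan_meas] nn_integral_measurable_subprob_algebra2[where N="disturb_space N"]
       measurable_prob_algebraD[OF law_meas]) (use G in \<open>simp add: split_beta'\<close>)
  have "(\<integral>\<^sup>+\<omega>. f (eta_t U \<omega>) * G (chan U \<omega>) (snd (disturbance U \<omega>)) \<partial>prb U)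
      = (\<integral>\<^sup>+\<omega>. (\<integral>\<^sup>+w. f (fst w) * ?G (chan U \<omega>, w) \<partial>?law (chan U \<omega>)) \<partial>prb U)"
    using nn_integral_disintegrate[OF fG] by (simp add: eta_t_def)
  also have "\<dots> = (\<integral>\<^sup>+\<omega>. (\<integral>\<^sup>+z. f z \<partial>CN (kappa_t P * p_UE P)) * (\<integral>\<^sup>+w. ?G (chan U \<omega>, w) \<partial>?law (chan U \<omega>)) \<partial>prb U)"
  proof (rule nn_integral_cong)
    fix \<omega> assume "\<omega> \<in> space (prb U)"
    then have c: "chan U \<omega> \<in> space (chans U)" by (rule measurable_space[OF chan_meas])
    let ?A = "CN (kappa_t P * p_UE P)" and ?B = "er_law (chan U \<omega>) \<Otimes>\<^sub>M nr_law \<Otimes>\<^sub>M pilot_interf U (chan U \<omega>)"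
    interpret B: prob_space ?B
      by (intro prob_space_pair prob_er_law prob_nr_law pilot_interf_prob(1)[OF c])
    have g: "(\<lambda>w. G (chan U \<omega>) (snd w)) \<in> borel_measurable (?A \<Otimes>\<^sub>M ?B)"
      using section_meas[OF G c] by simp
    have fg: "(\<lambda>w. f (fst w) * G (chan U \<omega>) (snd w)) \<in> borel_measurable (?A \<Otimes>\<^sub>M ?B)"
      using section_meas[OF fG c] by simp
    have g2: "G (chan U \<omega>) \<in> borel_measurable ?B"
      using measurable_compose[OF measurable_Pair1'[of 0 ?A ?B] g] by simp
    have "(\<integral>\<^sup>+w. f (fst w) * G (chan U \<omega>) (snd w) \<partial>(?A \<Otimes>\<^sub>M ?B)) = (\<integral>\<^sup>+z. \<integral>\<^sup>+w. f z * G (chan U \<omega>) w \<partial>?B \<partial>?A)"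
      using B.nn_integral_fst[OF fg] by simp
    also have "\<dots> = (\<integral>\<^sup>+z. f z * (\<integral>\<^sup>+w. G (chan U \<omega>) w \<partial>?B) \<partial>?A)"
      by (intro nn_integral_cong nn_integral_cmult g2)
    also have "\<dots> = (\<integral>\<^sup>+z. f z \<partial>?A) * (\<integral>\<^sup>+w. G (chan U \<omega>) w \<partial>?B)"
      using f by (intro nn_integral_multc) simp
    also have "(\<integral>\<^sup>+w. G (chan U \<omega>) w \<partial>?B) = (\<integral>\<^sup>+w. G (chan U \<omega>) (snd w) \<partial>(?A \<Otimes>\<^sub>M ?B))"
      using B.nn_integral_fst[OF g] by (simp add: CN.emeasure_space_1[of "kappa_t P * p_UE P", simplified])
    finally show "(\<integral>\<^sup>+w. f (fst w) * ?G (chan U \<omega>, w) \<partial>?law (chan U \<omega>)) = (\<integral>\<^sup>+z. f z \<partial>?A) * (\<integral>\<^sup>+w. ?G (chan U \<omega>, w) \<partial>?law (chan U \<omega>))"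
      unfolding law_eq by simp
  qed
  also have "\<dots> = (\<integral>\<^sup>+z. f z \<partial>CN (kappa_t P * p_UE P)) * (\<integral>\<^sup>+\<omega>. (\<integral>\<^sup>+w. ?G (chan U \<omega>, w) \<partial>?law (chan U \<omega>)) \<partial>prb U)"
    by (rule nn_integral_cmult[OF Gm])
  also have "(\<integral>\<^sup>+\<omega>. (\<integral>\<^sup>+w. ?G (chan U \<omega>, w) \<partial>?law (chan U \<omega>)) \<partial>prb U) = (\<integral>\<^sup>+\<omega>. G (chan U \<omega>) (snd (disturbance U \<omega>)) \<partial>prb U)"
    using nn_integral_disintegrate[OF G] by simp
  finally show ?thesis .
qed

lemma wick_h: "wick N (prb U) h R"
  by (rule wick_complex_normal[OF normal_h psd_R])

lemma h_meas: "h \<in> prb U \<rightarrow>\<^sub>M cspace N"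
  using normal_h by (simp add: complex_normal_def)

lemma ni_linear:
  assumes a: "\<And>i. i < N \<Longrightarrow> a i \<in> borel_measurable (cspace N)"
    and ai: "\<And>i. i < N \<Longrightarrow> integrable (prb U) (\<lambda>w. (cmod (a i (h w)))\<^sup>2)"
    and S: "opb N S s"
  shows "msq (prb U) (\<lambda>w. \<Sum>i<N. a i (h w) * interf U w i)
    \<le> ennreal (s * (\<Sum>i<N. \<integral>w. (cmod (a i (h w)))\<^sup>2 \<partial>prb U))"
proof -
  let ?n = "interf U"
  have am: "(\<lambda>w. a i (h w)) \<in> borel_measurable (prb U)" if "i < N" for i
    using measurable_compose[OF h_meas a[OF that]] .
  have aa: "integrable (prb U) (\<lambda>w. a i (h w) * cnj (a j (h w)))" if "i < N" "j < N" for i j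
  proof (rule Bochner_Integration.integrable_bound)
    show "integrable (prb U) (\<lambda>w. (cmod (a i (h w)))\<^sup>2 + (cmod (a j (h w)))\<^sup>2)" using ai that by simp
    show "(\<lambda>w. a i (h w) * cnj (a j (h w))) \<in> borel_measurable (prb U)" using that by (intro meas_intros am)
    have "x * y \<le> x\<^sup>2 + y\<^sup>2" for x y :: real
      using sum_squares_bound[of x y] zero_le_power2[of x] zero_le_power2[of y] by linarith
    then show "AE w in prb U. norm (a i (h w) * cnj (a j (h w))) \<le> norm ((cmod (a i (h w)))\<^sup>2 + (cmod (a j (h w)))\<^sup>2)"
      by (intro AE_I2) (simp add: norm_mult)
  qed
  have pol: "has_bochner_integral (prb U) (\<lambda>w. complex_of_real ((cmod (?n w i + z * ?n w j))\<^sup>2) * f (h w))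
     ((S i i + cnj z * S i j + (z * S j i + z * cnj z * S j j)) * (\<integral>w. f (h w) \<partial>prb U))"
    if ij: "i < N" "j < N" and f: "f \<in> borel_measurable (cspace N)" "integrable (prb U) (\<lambda>w. f (h w))" for i j z f
  proof -
    let ?c = "S i i + cnj z * S i j + (z * S j i + z * cnj z * S j j)"
    have e: "?n w i * cnj (?n w i) + cnj z * (?n w i * cnj (?n w j)) + (z * (?n w j * cnj (?n w i)) + z * cnj z * (?n w j * cnj (?n w j)))
       = complex_of_real ((cmod (?n w i + z * ?n w j))\<^sup>2)" for w
      unfolding complex_norm_square by (simp add: algebra_simps)
    have cm: "has_cond_mean (prb U) (cspace N) h (\<lambda>w. complex_of_real ((cmod (?n w i + z * ?n w j))\<^sup>2)) ?c"
      unfolding e[symmetric] by (intro has_cond_mean_add has_cond_mean_mult ni_cov ij h_meas)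
    have sp: "h -` space (cspace N) \<inter> space (prb U) = space (prb U)"
      using measurable_space[OF h_meas] by auto
    have hs: "h w \<in> space (cspace N)" if "w \<in> space (prb U)" for w
      using measurable_space[OF h_meas that] .
    have "(\<integral>w. indicat_real (space (cspace N)) (h w) *\<^sub>R complex_of_real ((cmod (?n w i + z * ?n w j))\<^sup>2) \<partial>prb U) = ?c"
      using cm unfolding has_cond_mean_def by (auto dest!: bspec[OF _ sets.top] simp: sp M.prob_space)
    also have "(\<integral>w. indicat_real (space (cspace N)) (h w) *\<^sub>R complex_of_real ((cmod (?n w i + z * ?n w j))\<^sup>2) \<partial>prb U)
       = (\<integral>w. complex_of_real ((cmod (?n w i + z * ?n w j))\<^sup>2) \<partial>prb U)"
      by (intro Bochner_Integration.integral_cong refl) (use hs in \<open>auto simp: indicator_def\<close>)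
    finally have cr: "?c = complex_of_real (Re ?c)"
      unfolding integral_complex_of_real by (metis Re_complex_of_real)
    have cm': "has_cond_mean (prb U) (cspace N) h (\<lambda>w. complex_of_real ((cmod (?n w i + z * ?n w j))\<^sup>2)) (complex_of_real (Re ?c))"
      by (rule subst[where P="has_cond_mean (prb U) (cspace N) h (\<lambda>w. complex_of_real ((cmod (?n w i + z * ?n w j))\<^sup>2))", OF cr cm])
    have "has_bochner_integral (prb U) (\<lambda>w. complex_of_real ((cmod (?n w i + z * ?n w j))\<^sup>2) * f (h w))
        (complex_of_real (Re ?c) * (\<integral>w. f (h w) \<partial>prb U))"
      by (rule cond_mean_nonneg[OF prob_M h_meas cm']) (simp_all add: f)
    then show ?thesis unfolding cr[symmetric] .
  qed
  have prod: "has_bochner_integral (prb U) (\<lambda>w. ?n w i * cnj (?n w j) * f (h w)) (S i j * (\<integral>w. f (h w) \<partial>prb U))"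
    if ij: "i < N" "j < N" and f: "f \<in> borel_measurable (cspace N)" "integrable (prb U) (\<lambda>w. f (h w))" for i j f
  proof -
    let ?m = "\<integral>w. f (h w) \<partial>prb U"
    let ?c = "\<lambda>z. S i i + cnj z * S i j + (z * S j i + z * cnj z * S j j)"
    let ?Y = "\<lambda>z w. complex_of_real ((cmod (?n w i + z * ?n w j))\<^sup>2) * f (h w)"
    have "has_bochner_integral (prb U) (\<lambda>w. (?Y 1 w - ?Y (-1) w + \<i> * ?Y \<i> w - \<i> * ?Y (-\<i>) w) / 4)
       ((?c 1 * ?m - ?c (-1) * ?m + \<i> * (?c \<i> * ?m) - \<i> * (?c (-\<i>) * ?m)) / 4)"
      by (intro has_bochner_integral_divide_zero has_bochner_integral_add has_bochner_integral_diff has_bochner_integral_mult_right pol ij f)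
    moreover have "(?Y 1 w - ?Y (-1) w + \<i> * ?Y \<i> w - \<i> * ?Y (-\<i>) w) / 4 = ?n w i * cnj (?n w j) * f (h w)" for w
      unfolding polar2[of "?n w i" "?n w j"] by (simp add: algebra_simps)
    moreover have "(?c 1 * ?m - ?c (-1) * ?m + \<i> * (?c \<i> * ?m) - \<i> * (?c (-\<i>) * ?m)) / 4 = S i j * ?m"
      by (simp add: field_simps)
    ultimately show ?thesis by simp
  qed
  define D where "D = (\<Sum>i<N. \<Sum>j<N. S i j * (\<integral>w. a i (h w) * cnj (a j (h w)) \<partial>prb U))"
  have "has_bochner_integral (prb U) (\<lambda>w. \<Sum>i<N. \<Sum>j<N. ?n w i * cnj (?n w j) * (a i (h w) * cnj (a j (h w)))) D"
    unfolding D_def by (intro has_bochner_integral_sum prod aa meas_intros a) auto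
  moreover have "(\<Sum>i<N. \<Sum>j<N. ?n w i * cnj (?n w j) * (a i (h w) * cnj (a j (h w))))
     = (\<Sum>i<N. a i (h w) * ?n w i) * cnj (\<Sum>i<N. a i (h w) * ?n w i)" for w
    unfolding cnj_sum sum_product by (intro sum.cong refl) (simp add: mult_ac)
  ultimately have "has_bochner_integral (prb U) (\<lambda>w. (\<Sum>i<N. a i (h w) * ?n w i) * cnj (\<Sum>i<N. a i (h w) * ?n w i)) D"
    by simp
  from nn_integral_has_bochner_integral[OF has_bochner_integral_norm_square[OF this]]
  have "msq (prb U) (\<lambda>w. \<Sum>i<N. a i (h w) * ?n w i) = ennreal (Re D)" by simp
  also have "Re D \<le> s * (\<Sum>i<N. \<integral>w. (cmod (a i (h w)))\<^sup>2 \<partial>prb U)"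
  proof -
    have hb: "has_bochner_integral (prb U) (\<lambda>w. \<Sum>i<N. \<Sum>j<N. S i j * (a i (h w) * cnj (a j (h w)))) D"
      unfolding D_def by (intro has_bochner_integral_sum has_bochner_integral_mult_right has_bochner_integral_integrable aa) auto
    have "D = (\<integral>w. (\<Sum>i<N. \<Sum>j<N. S i j * (a i (h w) * cnj (a j (h w)))) \<partial>prb U)"
      using hb by (simp add: has_bochner_integral_iff)
    also have "Re \<dots> = (\<integral>w. Re (\<Sum>i<N. \<Sum>j<N. S i j * (a i (h w) * cnj (a j (h w)))) \<partial>prb U)"
      using hb by (intro integral_Re[symmetric]) (simp add: has_bochner_integral_iff)
    also have "\<dots> \<le> (\<integral>w. s * (\<Sum>i<N. (cmod (a i (h w)))\<^sup>2) \<partial>prb U)"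
    proof (rule integral_mono)
      show "integrable (prb U) (\<lambda>w. Re (\<Sum>i<N. \<Sum>j<N. S i j * (a i (h w) * cnj (a j (h w)))))"
        using hb by (intro integrable_Re) (simp add: has_bochner_integral_iff)
      show "integrable (prb U) (\<lambda>w. s * (\<Sum>i<N. (cmod (a i (h w)))\<^sup>2))"
        by (intro integrable_mult_right Bochner_Integration.integrable_sum ai) auto
      fix w
      have "(\<Sum>i<N. \<Sum>j<N. S i j * (a i (h w) * cnj (a j (h w)))) = (\<Sum>i<N. \<Sum>j<N. a i (h w) * S i j * cnj (a j (h w)))"
        by (intro sum.cong refl) (simp add: mult_ac)
      then show "Re (\<Sum>i<N. \<Sum>j<N. S i j * (a i (h w) * cnj (a j (h w)))) \<le> s * (\<Sum>i<N. (cmod (a i (h w)))\<^sup>2)"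
        using opb_quad[OF S, of "\<lambda>i. a i (h w)"] complex_Re_le_cmod[of "\<Sum>i<N. \<Sum>j<N. a i (h w) * S i j * cnj (a j (h w))"]
        by (simp only: sqn_def)
    qed
    also have "\<dots> = s * (\<Sum>i<N. \<integral>w. (cmod (a i (h w)))\<^sup>2 \<partial>prb U)"
      using ai by (simp add: Bochner_Integration.integral_sum)
    finally show ?thesis .
  qed
  finally show ?thesis by (simp add: ennreal_leI)
qed

end

section \<open>Second moments of forms in channel and disturbance\<close>

lemma borel_measurable_norm2:
  "f \<in> borel_measurable M \<Longrightarrow> (\<lambda>x. (cmod (f x))\<^sup>2) \<in> borel_measurable M"
  by measurable

lemma borel_measurable_ennreal':
  "f \<in> borel_measurable M \<Longrightarrow> (\<lambda>x. ennreal (f x)) \<in> borel_measurable M"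
  by measurable

lemma borel_measurable_complex_of_real':
  "f \<in> borel_measurable M \<Longrightarrow> (\<lambda>x. complex_of_real (f x)) \<in> borel_measurable M"
  by measurable

lemma borel_measurable_cmod':
  "f \<in> borel_measurable M \<Longrightarrow> (\<lambda>x. cmod (f x)) \<in> borel_measurable M"
  by measurable

lemma cmod_sum_cnj: "cmod (\<Sum>i<N. c i * cnj (x i)) = cmod (\<Sum>i<(N::nat). cnj (c i) * x i)"
proof -
  have "(\<Sum>i<N. c i * cnj (x i)) = cnj (\<Sum>i<N. cnj (c i) * x i)" by (simp add: cnj_sum)
  then show ?thesis by (simp only: complex_mod_cnj)
qed

lemma sqn_unit: "j < N \<Longrightarrow> sqn N (\<lambda>i. if i = j then 1 else 0) = 1"
  by (simp add: sqn_def if_distrib[of "\<lambda>z. (cmod z)\<^sup>2"] cong: if_cong)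

lemma frob_columns: "(\<Sum>j<N. sqn N (\<lambda>i. B i j)) = frob N B"
  using frob_transpose[of N B] by (simp add: frob_def)

context uplink_sys
begin

lemma full_meas:
  shows full_meas_et: "(\<lambda>x. fst (snd x)) \<in> borel_measurable full"
    and full_meas_h: "i < N \<Longrightarrow> (\<lambda>x. user U (fst x) i) \<in> borel_measurable full"
    and full_meas_er: "i < N \<Longrightarrow> (\<lambda>x. fst (snd (snd x)) i) \<in> borel_measurable full"
    and full_meas_nr: "i < N \<Longrightarrow> (\<lambda>x. fst (snd (snd (snd x))) i) \<in> borel_measurable full"
    and full_meas_ni: "i < N \<Longrightarrow> (\<lambda>x. snd (snd (snd (snd x))) i) \<in> borel_measurable full"
proof -
  show "(\<lambda>x. fst (snd x)) \<in> borel_measurable full" by measurable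
  show "(\<lambda>x. user U (fst x) i) \<in> borel_measurable full" if "i < N"
    by (rule cspace_component[OF measurable_compose[OF measurable_fst user_meas] that])
  have s: "snd \<in> full \<rightarrow>\<^sub>M disturb_space N" by (rule measurable_snd)
  have s1: "(\<lambda>x. snd (snd x)) \<in> full \<rightarrow>\<^sub>M cspace N \<Otimes>\<^sub>M cspace N \<Otimes>\<^sub>M cspace N" by (rule measurable_compose[OF s measurable_snd])
  have s2: "(\<lambda>x. snd (snd (snd x))) \<in> full \<rightarrow>\<^sub>M cspace N \<Otimes>\<^sub>M cspace N" by (rule measurable_compose[OF s1 measurable_snd])
  show "(\<lambda>x. fst (snd (snd x)) i) \<in> borel_measurable full" if "i < N"
    by (rule cspace_component[OF measurable_compose[OF s1 measurable_fst] that])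
  show "(\<lambda>x. fst (snd (snd (snd x))) i) \<in> borel_measurable full" if "i < N"
    by (rule cspace_component[OF measurable_compose[OF s2 measurable_fst] that])
  show "(\<lambda>x. snd (snd (snd (snd x))) i) \<in> borel_measurable full" if "i < N"
    by (rule cspace_component[OF measurable_compose[OF s2 measurable_snd] that])
qed

lemma h_meas_i: "i < N \<Longrightarrow> (\<lambda>w. h w i) \<in> borel_measurable (prb U)"
  by (rule cspace_component[OF h_meas])
lemma eta_meas: "eta_t U \<in> borel_measurable (prb U)"
  using measurable_compose[OF joint_meas full_meas_et] by (simp add: eta_t_def[abs_def])
lemma er_meas_i: "i < N \<Longrightarrow> (\<lambda>w. er w i) \<in> borel_measurable (prb U)"
  using measurable_compose[OF joint_meas full_meas_er] by (simp add: er_def)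
lemma nr_meas_i: "i < N \<Longrightarrow> (\<lambda>w. nr w i) \<in> borel_measurable (prb U)"
  using measurable_compose[OF joint_meas full_meas_nr] by (simp add: nr_def)
lemma ni_meas_i: "i < N \<Longrightarrow> (\<lambda>w. interf U w i) \<in> borel_measurable (prb U)"
  using measurable_compose[OF joint_meas full_meas_ni] by (simp add: interf_def)

lemmas comp_meas = h_meas_i er_meas_i nr_meas_i ni_meas_i
lemmas all_meas = meas_intros borel_measurable_norm2 borel_measurable_ennreal' full_meas_et full_meas_h full_meas_er full_meas_nr full_meas_ni
  h_meas_i er_meas_i nr_meas_i ni_meas_i

end

locale uplink_bounds = uplink_sys P N U for P N U +
  fixes r s :: real
  assumes R_bound: "opb N R r" and S_bound: "opb N S s"
begin

lemma r_nonneg: "0 \<le> r" and s_nonneg: "0 \<le> s"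
  using opb_nonneg R_bound S_bound by blast+

lemma Re_sesq_le: "Re (sesq N R c c) \<le> r * sqn N c" "0 \<le> Re (sesq N R c c)"
  using opb_quad[OF R_bound, of c] complex_Re_le_cmod[of "sesq N R c c"] psd_quad[OF psd_R, of c]
  by (auto simp: sesq_def less_eq_complex_def)

lemma h_moment2:
  shows "integrable (prb U) (\<lambda>w. (cmod (\<Sum>i<N. c i * cnj (h w i)))\<^sup>2)"
    "(\<integral>w. (cmod (\<Sum>i<N. c i * cnj (h w i)))\<^sup>2 \<partial>prb U) \<le> r * sqn N c"
    "msq (prb U) (\<lambda>w. \<Sum>i<N. c i * cnj (h w i)) \<le> ennreal (r * sqn N c)"
proof -
  have hb: "has_bochner_integral (prb U) (\<lambda>w. (cmod (\<Sum>i<N. c i * cnj (h w i)))\<^sup>2) (Re (sesq N R (\<lambda>i. cnj (c i)) (\<lambda>i. cnj (c i))))"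
    unfolding cmod_sum_cnj by (rule complex_normal_linear(1)[OF normal_h psd_R])
  have le: "Re (sesq N R (\<lambda>i. cnj (c i)) (\<lambda>i. cnj (c i))) \<le> r * sqn N c"
    using Re_sesq_le(1)[of "\<lambda>i. cnj (c i)"] by simp
  show "integrable (prb U) (\<lambda>w. (cmod (\<Sum>i<N. c i * cnj (h w i)))\<^sup>2)"
    "(\<integral>w. (cmod (\<Sum>i<N. c i * cnj (h w i)))\<^sup>2 \<partial>prb U) \<le> r * sqn N c"
    using hb le by (simp_all add: has_bochner_integral_iff)
  show "msq (prb U) (\<lambda>w. \<Sum>i<N. c i * cnj (h w i)) \<le> ennreal (r * sqn N c)"
    using nn_integral_has_bochner_integral[OF hb] le by (simp add: ennreal_leI)
qed

lemma h_moment4: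
  "(\<integral>\<^sup>+w. ennreal ((cmod (\<Sum>i<N. c i * cnj (h w i))) ^ 4) \<partial>prb U) \<le> ennreal (2 * (r * sqn N c)\<^sup>2)"
proof -
  have hb: "has_bochner_integral (prb U) (\<lambda>w. (cmod (\<Sum>i<N. c i * cnj (h w i))) ^ 4) (2 * (Re (sesq N R (\<lambda>i. cnj (c i)) (\<lambda>i. cnj (c i))))\<^sup>2)"
    unfolding cmod_sum_cnj by (rule complex_normal_linear(2)[OF normal_h psd_R])
  have le: "(Re (sesq N R (\<lambda>i. cnj (c i)) (\<lambda>i. cnj (c i))))\<^sup>2 \<le> (r * sqn N c)\<^sup>2"
    using Re_sesq_le[of "\<lambda>i. cnj (c i)"] by (intro power_mono) auto
  show ?thesis using nn_integral_has_bochner_integral[OF hb] le by (simp add: ennreal_leI)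
qed

lemma h_unit: "j < N \<Longrightarrow> (\<Sum>i<N. (if i = j then 1 else 0) * cnj (h w i)) = cnj (h w j)"
  by (simp add: if_distrib[of "\<lambda>z. z * _"] cong: if_cong)

lemma h_entry2:
  assumes "j < N"
  shows "integrable (prb U) (\<lambda>w. (cmod (h w j))\<^sup>2)" "(\<integral>w. (cmod (h w j))\<^sup>2 \<partial>prb U) \<le> r"
    "msq (prb U) (\<lambda>w. h w j) \<le> ennreal r"
    "(\<integral>\<^sup>+w. ennreal ((cmod (h w j)) ^ 4) \<partial>prb U) \<le> ennreal (2 * r\<^sup>2)"
  using h_moment2[of "\<lambda>i. if i = j then 1 else 0"] h_moment4[of "\<lambda>i. if i = j then 1 else 0"]
  unfolding h_unit[OF assms] sqn_unit[OF assms] by simp_all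

lemma er_linear:
  "msq (prb U) (\<lambda>w. \<Sum>i<N. c i * cnj (er w i)) \<le> ennreal (kp * (r * sqn N c))"
proof -
  let ?F = "\<lambda>x. ennreal ((cmod (\<Sum>i<N. cnj (c i) * fst (snd (snd x)) i))\<^sup>2)"
  have F: "?F \<in> borel_measurable full" by (intro all_meas) auto
  have G: "(\<lambda>x. ennreal (\<Sum>i<N. (cmod (cnj (c i)))\<^sup>2 * (kp * (cmod (user U (fst x) i))\<^sup>2))) \<in> borel_measurable full"
    by (intro all_meas) auto
  have "(\<integral>\<^sup>+w. ?F (chan U w, disturbance U w) \<partial>prb U) \<le> (\<integral>\<^sup>+w. ennreal (\<Sum>i<N. (cmod (cnj (c i)))\<^sup>2 * (kp * (cmod (user U (chan U w) i))\<^sup>2)) \<partial>prb U)"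
    by (rule er_integrate_le[OF F G]) (simp add: er_law_def nn_integral_PiM_CN_linear kp_nonneg)
  also have "\<dots> \<le> ennreal (\<Sum>i<N. (cmod (cnj (c i)))\<^sup>2 * (kp * r))"
    using h_entry2(3) kp_nonneg r_nonneg unfolding channel_def[symmetric]
    by (intro nn_integral_sum_le nn_integral_cmult_le all_meas) auto
  also have "(\<Sum>i<N. (cmod (cnj (c i)))\<^sup>2 * (kp * r)) = kp * (r * sqn N c)"
    by (simp add: sqn_def sum_distrib_left sum_distrib_right mult_ac)
  finally show ?thesis unfolding cmod_sum_cnj by (simp add: er_def)
qed

context
  fixes B :: "nat \<Rightarrow> nat \<Rightarrow> complex" and b :: real
  assumes B: "opb N B b"
begin

lemma frob_B: "frob N B \<le> real N * b\<^sup>2"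
  by (rule frob_le[OF B])

lemma column_B: "j < N \<Longrightarrow> sqn N (\<lambda>i. B i j) \<le> b\<^sup>2"
  using opb_row[OF opb_transpose[OF B]] .

lemma quad_er:
  "msq (prb U) (\<lambda>w. (\<Sum>i<N. \<Sum>j<N. B i j * cnj (er w i) * er w j)
      - (\<Sum>i<N. B i i * complex_of_real (kp * (cmod (h w i))\<^sup>2))) \<le> ennreal (2 * kp\<^sup>2 * r\<^sup>2 * (real N * b\<^sup>2))"
proof -
  let ?F = "\<lambda>x. ennreal ((cmod ((\<Sum>i<N. \<Sum>j<N. B i j * cnj (fst (snd (snd x)) i) * fst (snd (snd x)) j)
      - (\<Sum>i<N. B i i * complex_of_real (kp * (cmod (user U (fst x) i))\<^sup>2))))\<^sup>2)"
  have F: "?F \<in> borel_measurable full"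
    by (intro all_meas borel_measurable_complex_of_real') auto
  have G: "(\<lambda>x. ennreal (\<Sum>i<N. \<Sum>j<N. (cmod (B i j))\<^sup>2 * ((kp * (cmod (user U (fst x) i))\<^sup>2) * (kp * (cmod (user U (fst x) j))\<^sup>2)))) \<in> borel_measurable full"
    by (intro all_meas) auto
  have "(\<integral>\<^sup>+w. ?F (chan U w, disturbance U w) \<partial>prb U) \<le> (\<integral>\<^sup>+w. ennreal (\<Sum>i<N. \<Sum>j<N. (cmod (B i j))\<^sup>2 * ((kp * (cmod (user U (chan U w) i))\<^sup>2) * (kp * (cmod (user U (chan U w) j))\<^sup>2))) \<partial>prb U)"
    using nn_integral_PiM_CN_quadratic[of N "\<lambda>i. kp * (cmod (user U c i))\<^sup>2" B for c] kp_nonneg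
    by (intro er_integrate_le[OF F G]) (simp add: er_law_def)
  also have "\<dots> \<le> ennreal (\<Sum>i<N. \<Sum>j<N. (cmod (B i j))\<^sup>2 * (kp\<^sup>2 * (1/2 * (2 * r\<^sup>2 + 2 * r\<^sup>2))))"
  proof -
    have "(kp * x\<^sup>2) * (kp * y\<^sup>2) \<le> kp\<^sup>2 * (1/2 * (x ^ 4 + y ^ 4))" for x y :: real
    proof -
      have "2 * x\<^sup>2 * y\<^sup>2 \<le> (x\<^sup>2)\<^sup>2 + (y\<^sup>2)\<^sup>2" by (rule sum_squares_bound)
      then have "x\<^sup>2 * y\<^sup>2 \<le> 1/2 * (x ^ 4 + y ^ 4)" by simp
      from mult_left_mono[OF this, of "kp\<^sup>2"] show ?thesis by (simp add: power2_eq_square mult_ac)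
    qed
    then have "(\<integral>\<^sup>+w. ennreal (\<Sum>i<N. \<Sum>j<N. (cmod (B i j))\<^sup>2 * ((kp * (cmod (h w i))\<^sup>2) * (kp * (cmod (h w j))\<^sup>2))) \<partial>prb U)
      \<le> (\<integral>\<^sup>+w. ennreal (\<Sum>i<N. \<Sum>j<N. (cmod (B i j))\<^sup>2 * (kp\<^sup>2 * (1/2 * (\<Sum>k\<in>{True, False}. cmod (h w (if k then i else j)) ^ 4)))) \<partial>prb U)"
      by (intro nn_integral_mono ennreal_leI sum_mono mult_left_mono) auto
    also have "\<dots> \<le> ennreal (\<Sum>i<N. \<Sum>j<N. (cmod (B i j))\<^sup>2 * (kp\<^sup>2 * (1/2 * (\<Sum>k\<in>{True, False}. 2 * r\<^sup>2))))"
      using h_entry2(4) by (intro nn_integral_sum_le nn_integral_cmult_le all_meas borel_measurable_power borel_measurable_cmod') (auto intro!: sum_nonneg)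
    finally show ?thesis by (simp add: channel_def)
  qed
  also have "(\<Sum>i<N. \<Sum>j<N. (cmod (B i j))\<^sup>2 * (kp\<^sup>2 * (1/2 * (2 * r\<^sup>2 + 2 * r\<^sup>2)))) = 2 * kp\<^sup>2 * r\<^sup>2 * frob N B"
    by (simp add: frob_def sqn_def sum_distrib_left sum_distrib_right mult_ac)
  also have "\<dots> \<le> 2 * kp\<^sup>2 * r\<^sup>2 * (real N * b\<^sup>2)" by (intro mult_left_mono frob_B) auto
  finally show ?thesis by (simp add: er_def channel_def ennreal_leI)
qed

lemma quad_diag:
  "msq (prb U) (\<lambda>w. (\<Sum>i<N. B i i * complex_of_real (kp * (cmod (h w i))\<^sup>2))
      - complex_of_real kp * (\<Sum>i<N. B i i * R i i)) \<le> ennreal (kp\<^sup>2 * (r\<^sup>2 * (real N * b\<^sup>2)))"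
proof -
  define D where "D i j = (if i = j then B i i else 0)" for i j
  have eq: "(\<Sum>i<N. B i i * complex_of_real (kp * (cmod (h w i))\<^sup>2)) - complex_of_real kp * (\<Sum>i<N. B i i * R i i)
     = complex_of_real kp * ((\<Sum>i<N. \<Sum>j<N. D i j * cnj (h w i) * h w j) - (\<Sum>i<N. \<Sum>j<N. D i j * R j i))" for w
  proof -
    have "(\<Sum>j<N. D i j * cnj (h w i) * h w j) = B i i * complex_of_real ((cmod (h w i))\<^sup>2)" if "i < N" for i
    proof -
      have "(\<Sum>j<N. D i j * cnj (h w i) * h w j) = (\<Sum>j<N. if i = j then B i i * (h w i * cnj (h w i)) else 0)"
        by (intro sum.cong refl) (simp add: D_def mult_ac)
      then show ?thesis using that unfolding complex_norm_square by simp
    qed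
    moreover have "(\<Sum>j<N. D i j * R j i) = B i i * R i i" if "i < N" for i
      using that by (simp add: D_def if_distrib[of "\<lambda>z. z * _"] cong: if_cong)
    ultimately show ?thesis
      by (simp add: right_diff_distrib sum_distrib_left mult_ac del: of_real_power)
  qed
  have "(\<integral>\<^sup>+w. ennreal (kp\<^sup>2 * (cmod ((\<Sum>i<N. \<Sum>j<N. D i j * cnj (h w i) * h w j) - (\<Sum>i<N. \<Sum>j<N. D i j * R j i)))\<^sup>2) \<partial>prb U)
    \<le> ennreal (kp\<^sup>2 * (r\<^sup>2 * frob N D))"
    by (intro nn_integral_cmult_le wick_quadratic prob_M wick_h R_bound all_meas) auto
  also have "frob N D \<le> real N * b\<^sup>2"
  proof (rule frob_le)
    show "opb N D b" unfolding D_def[abs_def] using opb_entry[OF B] opb_nonneg[OF B] by (intro opb_diag) auto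
  qed
  then have "ennreal (kp\<^sup>2 * (r\<^sup>2 * frob N D)) \<le> ennreal (kp\<^sup>2 * (r\<^sup>2 * (real N * b\<^sup>2)))"
    by (intro ennreal_leI mult_left_mono) auto
  finally show ?thesis unfolding eq norm_mult power_mult_distrib by simp
qed

lemma quad_nr:
  "msq (prb U) (\<lambda>w. (\<Sum>i<N. \<Sum>j<N. B i j * cnj (nr w i) * nr w j)
      - (\<Sum>i<N. B i i * complex_of_real (sigma2 P))) \<le> ennreal ((sigma2 P)\<^sup>2 * (real N * b\<^sup>2))"
proof -
  let ?F = "\<lambda>x. ennreal ((cmod ((\<Sum>i<N. \<Sum>j<N. B i j * cnj (fst (snd (snd (snd x))) i) * fst (snd (snd (snd x))) j)
      - (\<Sum>i<N. B i i * complex_of_real (sigma2 P))))\<^sup>2)"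
  let ?c = "\<Sum>i<N. \<Sum>j<N. (cmod (B i j))\<^sup>2 * (sigma2 P * sigma2 P)"
  have F: "?F \<in> borel_measurable full"
    by (intro all_meas) auto
  have "(\<integral>\<^sup>+w. ?F (chan U w, disturbance U w) \<partial>prb U) \<le> (\<integral>\<^sup>+w. ennreal ?c \<partial>prb U)"
    using nn_integral_PiM_CN_quadratic[of N "\<lambda>i. sigma2 P" B] sigma2_pos
    by (intro nr_integrate_le[OF F, of "\<lambda>_ _ _ _. ennreal ?c"]) auto
  also have "\<dots> = ennreal ((sigma2 P)\<^sup>2 * frob N B)"
    by (simp add: M.emeasure_space_1 frob_def sqn_def sum_distrib_left sum_distrib_right power2_eq_square mult_ac)
  also have "\<dots> \<le> ennreal ((sigma2 P)\<^sup>2 * (real N * b\<^sup>2))" by (intro ennreal_leI mult_left_mono frob_B) auto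
  finally show ?thesis by (simp add: nr_def)
qed

lemma cross_er_nr:
  "msq (prb U) (\<lambda>w. \<Sum>j<N. (\<Sum>i<N. B i j * cnj (er w i)) * nr w j)
     \<le> ennreal (sigma2 P * (kp * (r * (real N * b\<^sup>2))))"
proof -
  let ?F = "\<lambda>x. ennreal ((cmod (\<Sum>j<N. (\<Sum>i<N. B i j * cnj (fst (snd (snd x)) i)) * fst (snd (snd (snd x))) j))\<^sup>2)"
  have F: "?F \<in> borel_measurable full" by (intro all_meas) auto
  have G: "(\<lambda>x. ennreal (\<Sum>j<N. (cmod (\<Sum>i<N. B i j * cnj (fst (snd (snd x)) i)))\<^sup>2 * sigma2 P)) \<in> borel_measurable full"
    by (intro all_meas) auto
  have "(\<integral>\<^sup>+w. ?F (chan U w, disturbance U w) \<partial>prb U) \<le> (\<integral>\<^sup>+w. ennreal (\<Sum>j<N. (cmod (\<Sum>i<N. B i j * cnj (er w i)))\<^sup>2 * sigma2 P) \<partial>prb U)"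
    using sigma2_pos by (intro nr_integrate_le[OF F G]) (simp add: nn_integral_PiM_CN_linear)
  also have "\<dots> = (\<integral>\<^sup>+w. ennreal (\<Sum>j<N. sigma2 P * (cmod (\<Sum>i<N. B i j * cnj (er w i)))\<^sup>2) \<partial>prb U)"
    by (simp only: mult.commute)
  also have "\<dots> \<le> ennreal (\<Sum>j<N. sigma2 P * (kp * (r * sqn N (\<lambda>i. B i j))))"
    using sigma2_pos kp_nonneg r_nonneg by (intro nn_integral_sum_le nn_integral_cmult_le er_linear all_meas) auto
  also have "(\<Sum>j<N. sigma2 P * (kp * (r * sqn N (\<lambda>i. B i j)))) = sigma2 P * (kp * (r * frob N B))"
    unfolding frob_columns[symmetric] by (simp add: sum_distrib_left)
  also have "ennreal \<dots> \<le> ennreal (sigma2 P * (kp * (r * (real N * b\<^sup>2))))"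
    using sigma2_pos kp_nonneg r_nonneg by (intro ennreal_leI mult_left_mono frob_B) auto
  finally show ?thesis by (simp add: er_def nr_def)
qed

lemma cross_ni_er:
  "msq (prb U) (\<lambda>w. \<Sum>i<N. (\<Sum>j<N. cnj (B i j * interf U w j)) * er w i)
     \<le> ennreal (kp * (s * (r * (real N * b\<^sup>2))))"
proof -
  let ?F = "\<lambda>x. ennreal ((cmod (\<Sum>i<N. (\<Sum>j<N. cnj (B i j * snd (snd (snd (snd x))) j)) * fst (snd (snd x)) i))\<^sup>2)"
  have F: "?F \<in> borel_measurable full" by (intro all_meas) auto
  have G: "(\<lambda>x. ennreal (\<Sum>i<N. (cmod (\<Sum>j<N. cnj (B i j * snd (snd (snd (snd x))) j)))\<^sup>2 * (kp * (cmod (user U (fst x) i))\<^sup>2))) \<in> borel_measurable full"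
    by (intro all_meas) auto
  have "(\<integral>\<^sup>+w. ?F (chan U w, disturbance U w) \<partial>prb U) \<le> (\<integral>\<^sup>+w. ennreal (\<Sum>i<N. (cmod (\<Sum>j<N. cnj (B i j * interf U w j)))\<^sup>2 * (kp * (cmod (user U (chan U w) i))\<^sup>2)) \<partial>prb U)"
    using kp_nonneg by (intro er_integrate_le[OF F G]) (simp add: er_law_def nn_integral_PiM_CN_linear)
  also have "\<dots> = (\<integral>\<^sup>+w. ennreal (\<Sum>i<N. kp * (cmod (\<Sum>j<N. (h w i * B i j) * interf U w j))\<^sup>2) \<partial>prb U)"
  proof (intro nn_integral_cong arg_cong[where f=ennreal] sum.cong refl)
    fix w i
    have "(\<Sum>j<N. cnj (B i j * interf U w j)) = cnj (\<Sum>j<N. B i j * interf U w j)" by (simp only: cnj_sum)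
    moreover have "(\<Sum>j<N. (h w i * B i j) * interf U w j) = h w i * (\<Sum>j<N. B i j * interf U w j)"
      by (simp only: sum_distrib_left mult.assoc)
    ultimately show "(cmod (\<Sum>j<N. cnj (B i j * interf U w j)))\<^sup>2 * (kp * (cmod (user U (chan U w) i))\<^sup>2)
       = kp * (cmod (\<Sum>j<N. (h w i * B i j) * interf U w j))\<^sup>2"
      by (simp only: complex_mod_cnj norm_mult power_mult_distrib channel_def mult_ac)
  qed
  also have "\<dots> \<le> ennreal (\<Sum>i<N. kp * (s * (r * sqn N (B i))))"
  proof (intro nn_integral_sum_le nn_integral_cmult_le all_meas)
    fix i assume i: "i \<in> {..<N}"
    have a: "(\<lambda>x. x i * B i j) \<in> borel_measurable (cspace N)" for j
      using i by (intro borel_measurable_times borel_measurable_const measurable_component_singleton)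
    have ai: "integrable (prb U) (\<lambda>w. (cmod (h w i * B i j))\<^sup>2)" for j
      using h_entry2(1)[of i] i by (simp add: norm_mult power_mult_distrib)
    have "msq (prb U) (\<lambda>w. \<Sum>j<N. (h w i * B i j) * interf U w j)
        \<le> ennreal (s * (\<Sum>j<N. \<integral>w. (cmod (h w i * B i j))\<^sup>2 \<partial>prb U))"
      by (rule ni_linear[OF a ai S_bound])
    also have "(\<Sum>j<N. \<integral>w. (cmod (h w i * B i j))\<^sup>2 \<partial>prb U) = (\<integral>w. (cmod (h w i))\<^sup>2 \<partial>prb U) * sqn N (B i)"
      by (simp add: norm_mult power_mult_distrib sqn_def sum_distrib_left)
    also have "ennreal (s * \<dots>) \<le> ennreal (s * (r * sqn N (B i)))"
      using h_entry2(2)[of i] i s_nonneg by (intro ennreal_leI mult_left_mono mult_right_mono) auto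
    finally show "msq (prb U) (\<lambda>w. \<Sum>j<N. (h w i * B i j) * interf U w j) \<le> ennreal (s * (r * sqn N (B i)))" .
  qed (use kp_nonneg s_nonneg r_nonneg in auto)
  also have "(\<Sum>i<N. kp * (s * (r * sqn N (B i)))) = kp * (s * (r * frob N B))"
    by (simp add: frob_def sum_distrib_left)
  also have "ennreal \<dots> \<le> ennreal (kp * (s * (r * (real N * b\<^sup>2))))"
    using kp_nonneg s_nonneg r_nonneg by (intro ennreal_leI mult_left_mono frob_B) auto
  finally show ?thesis by (simp add: er_def interf_def)
qed

lemma cross_ni_nr:
  "msq (prb U) (\<lambda>w. \<Sum>i<N. (\<Sum>j<N. cnj (B i j * interf U w j)) * nr w i)
     \<le> ennreal (sigma2 P * (s * (real N * b\<^sup>2)))"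
proof -
  let ?F = "\<lambda>x. ennreal ((cmod (\<Sum>i<N. (\<Sum>j<N. cnj (B i j * snd (snd (snd (snd x))) j)) * fst (snd (snd (snd x))) i))\<^sup>2)"
  have F: "?F \<in> borel_measurable full" by (intro all_meas) auto
  have G: "(\<lambda>x. ennreal (\<Sum>i<N. (cmod (\<Sum>j<N. cnj (B i j * snd (snd (snd (snd x))) j)))\<^sup>2 * sigma2 P)) \<in> borel_measurable full"
    by (intro all_meas) auto
  have "(\<integral>\<^sup>+w. ?F (chan U w, disturbance U w) \<partial>prb U) \<le> (\<integral>\<^sup>+w. ennreal (\<Sum>i<N. (cmod (\<Sum>j<N. cnj (B i j * interf U w j)))\<^sup>2 * sigma2 P) \<partial>prb U)"
    using sigma2_pos by (intro nr_integrate_le[OF F G]) (simp add: nn_integral_PiM_CN_linear)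
  also have "\<dots> = (\<integral>\<^sup>+w. ennreal (\<Sum>i<N. sigma2 P * (cmod (\<Sum>j<N. B i j * interf U w j))\<^sup>2) \<partial>prb U)"
  proof (intro nn_integral_cong arg_cong[where f=ennreal] sum.cong refl)
    fix w i
    have "(\<Sum>j<N. cnj (B i j * interf U w j)) = cnj (\<Sum>j<N. B i j * interf U w j)" by (simp only: cnj_sum)
    then show "(cmod (\<Sum>j<N. cnj (B i j * interf U w j)))\<^sup>2 * sigma2 P = sigma2 P * (cmod (\<Sum>j<N. B i j * interf U w j))\<^sup>2"
      by (simp only: complex_mod_cnj mult_ac)
  qed
  also have "\<dots> \<le> ennreal (\<Sum>i<N. sigma2 P * (s * sqn N (B i)))"
  proof (intro nn_integral_sum_le nn_integral_cmult_le all_meas)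
    fix i
    show "msq (prb U) (\<lambda>w. \<Sum>j<N. B i j * interf U w j) \<le> ennreal (s * sqn N (B i))"
      using ni_linear[of "\<lambda>j _. B i j", OF _ _ S_bound] by (simp add: M.prob_space sqn_def)
  qed (use sigma2_pos s_nonneg in auto)
  also have "(\<Sum>i<N. sigma2 P * (s * sqn N (B i))) = sigma2 P * (s * frob N B)"
    by (simp add: frob_def sum_distrib_left)
  also have "ennreal \<dots> \<le> ennreal (sigma2 P * (s * (real N * b\<^sup>2)))"
    using sigma2_pos s_nonneg by (intro ennreal_leI mult_left_mono frob_B) auto
  finally show ?thesis by (simp add: nr_def interf_def)
qed

context
  fixes f :: "complex \<Rightarrow> complex" and F2 :: real
  assumes f: "f \<in> borel_measurable borel" and F2: "0 \<le> F2"
    and f2: "msq (CN (kappa_t P * p_UE P)) f \<le> ennreal F2"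
begin

lemma et_factor:
  assumes G: "(\<lambda>x. G (fst x) (snd (snd x))) \<in> borel_measurable full"
    and le: "(\<integral>\<^sup>+w. ennreal (G (chan U w) (snd (disturbance U w))) \<partial>prb U) \<le> ennreal C"
  shows "(\<integral>\<^sup>+w. ennreal ((cmod (f (eta_t U w)))\<^sup>2 * G (chan U w) (snd (disturbance U w))) \<partial>prb U) \<le> ennreal (F2 * C)"
proof -
  have "(\<integral>\<^sup>+w. ennreal ((cmod (f (eta_t U w)))\<^sup>2 * G (chan U w) (snd (disturbance U w))) \<partial>prb U)
    = msq (CN (kappa_t P * p_UE P)) f * (\<integral>\<^sup>+w. ennreal (G (chan U w) (snd (disturbance U w))) \<partial>prb U)"
    using f G by (subst et_integrate[symmetric]) (auto simp: ennreal_mult' intro!: all_meas)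
  also have "\<dots> \<le> ennreal F2 * ennreal C" by (rule mult_mono[OF f2 le]) auto
  finally show ?thesis using F2 by (simp add: ennreal_mult')
qed

lemma quad_h:
  "msq (prb U) (\<lambda>\<omega>. f (eta_t U \<omega>) * ((\<Sum>i<N. \<Sum>j<N. B i j * cnj (h \<omega> i) * h \<omega> j) - (\<Sum>i<N. \<Sum>j<N. B i j * R j i)))
     \<le> ennreal (F2 * (r\<^sup>2 * (real N * b\<^sup>2)))"
proof -
  let ?G = "\<lambda>c (w :: cvec \<times> cvec \<times> cvec). (cmod ((\<Sum>i<N. \<Sum>j<N. B i j * cnj (user U c i) * user U c j) - (\<Sum>i<N. \<Sum>j<N. B i j * R j i)))\<^sup>2"
  have "(\<integral>\<^sup>+\<omega>. ennreal ((cmod (f (eta_t U \<omega>)))\<^sup>2 * ?G (chan U \<omega>) (snd (disturbance U \<omega>))) \<partial>prb U) \<le> ennreal (F2 * (r\<^sup>2 * (real N * b\<^sup>2)))"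
  proof (rule et_factor)
    show "(\<lambda>x. ?G (fst x) (snd (snd x))) \<in> borel_measurable full" by (intro all_meas) auto
    have "(\<integral>\<^sup>+\<omega>. ennreal (?G (chan U \<omega>) (snd (disturbance U \<omega>))) \<partial>prb U) \<le> ennreal (r\<^sup>2 * frob N B)"
      using wick_quadratic[OF prob_M wick_h R_bound, of B] by (simp add: channel_def)
    also have "\<dots> \<le> ennreal (r\<^sup>2 * (real N * b\<^sup>2))" by (intro ennreal_leI mult_left_mono frob_B) auto
    finally show "(\<integral>\<^sup>+\<omega>. ennreal (?G (chan U \<omega>) (snd (disturbance U \<omega>))) \<partial>prb U) \<le> ennreal (r\<^sup>2 * (real N * b\<^sup>2))" .
  qed
  then show ?thesis by (simp add: norm_mult power_mult_distrib channel_def)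
qed

lemma cross_h_er:
  "msq (prb U) (\<lambda>\<omega>. f (eta_t U \<omega>) * (\<Sum>j<N. (\<Sum>i<N. B i j * cnj (h \<omega> i)) * er \<omega> j))
     \<le> ennreal (F2 * (kp * (real N * (r\<^sup>2 * (b ^ 4 + 1)))))"
proof -
  let ?F = "\<lambda>x. ennreal ((cmod (f (fst (snd x)) * (\<Sum>j<N. (\<Sum>i<N. B i j * cnj (user U (fst x) i)) * fst (snd (snd x)) j)))\<^sup>2)"
  let ?H = "\<lambda>c (w :: cvec \<times> cvec \<times> cvec). \<Sum>j<N. (cmod (\<Sum>i<N. B i j * cnj (user U c i)))\<^sup>2 * (kp * (cmod (user U c j))\<^sup>2)"
  have fm: "(\<lambda>x. f (fst (snd x))) \<in> borel_measurable full" by (rule measurable_compose[OF full_meas_et f])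
  have F: "?F \<in> borel_measurable full" by (intro all_meas fm) auto
  have H: "(\<lambda>x. ?H (fst x) (snd (snd x))) \<in> borel_measurable full" by (intro all_meas) auto
  have G: "(\<lambda>x. ennreal ((cmod (f (fst (snd x))))\<^sup>2 * ?H (fst x) undefined)) \<in> borel_measurable full"
    by (intro all_meas fm) auto
  have "(\<integral>\<^sup>+\<omega>. ?F (chan U \<omega>, disturbance U \<omega>) \<partial>prb U) \<le> (\<integral>\<^sup>+\<omega>. ennreal ((cmod (f (eta_t U \<omega>)))\<^sup>2 * ?H (chan U \<omega>) undefined) \<partial>prb U)"
  proof (rule er_integrate_le[OF F G])
    fix c et nr ni
    have e: "f et * (\<Sum>j<N. X j * e j) = (\<Sum>j<N. (f et * X j) * e j)" for X e
      by (simp add: sum_distrib_left mult.assoc)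
    have "(\<integral>\<^sup>+e. ?F (c, et, e, nr, ni) \<partial>er_law c) = ennreal (\<Sum>j<N. (cmod (f et * (\<Sum>i<N. B i j * cnj (user U c i))))\<^sup>2 * (kp * (cmod (user U c j))\<^sup>2))"
      using kp_nonneg unfolding fst_conv snd_conv e er_law_def by (intro nn_integral_PiM_CN_linear) simp
    also have "(\<Sum>j<N. (cmod (f et * (\<Sum>i<N. B i j * cnj (user U c i))))\<^sup>2 * (kp * (cmod (user U c j))\<^sup>2)) = (cmod (f et))\<^sup>2 * ?H c undefined"
      unfolding sum_distrib_left[of "(cmod (f et))\<^sup>2" _ "{..<N}"] by (intro sum.cong refl) (simp only: norm_mult power_mult_distrib mult_ac)
    finally show "(\<integral>\<^sup>+e. ?F (c, et, e, nr, ni) \<partial>er_law c) \<le> ennreal ((cmod (f et))\<^sup>2 * ?H c undefined)" by simp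
  qed
  also have "\<dots> \<le> ennreal (F2 * (kp * (real N * (r\<^sup>2 * (b ^ 4 + 1)))))"
  proof (rule et_factor[OF H])
    have young: "x\<^sup>2 * (kp * y\<^sup>2) \<le> kp * (1/2 * (x ^ 4 + y ^ 4))" for x y :: real
    proof -
      have "2 * x\<^sup>2 * y\<^sup>2 \<le> (x\<^sup>2)\<^sup>2 + (y\<^sup>2)\<^sup>2" by (rule sum_squares_bound)
      then have "x\<^sup>2 * y\<^sup>2 \<le> 1/2 * (x ^ 4 + y ^ 4)" by simp
      from mult_left_mono[OF this kp_nonneg] show ?thesis by (simp add: mult_ac)
    qed
    define c where "c = (\<lambda>k j i. if k then B i j else if i = j then 1 else 0)"
    have c: "(\<Sum>i<N. c True j i * cnj (h \<omega> i)) = (\<Sum>i<N. B i j * cnj (h \<omega> i))" "j < N \<Longrightarrow> (\<Sum>i<N. c False j i * cnj (h \<omega> i)) = cnj (h \<omega> j)" for j \<omega>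
      using h_unit[of j \<omega>] by (simp_all add: c_def)
    have "(\<integral>\<^sup>+\<omega>. ennreal (?H (chan U \<omega>) (snd (disturbance U \<omega>))) \<partial>prb U)
      \<le> (\<integral>\<^sup>+\<omega>. ennreal (\<Sum>j<N. kp * (1/2 * (\<Sum>k\<in>{True, False}. cmod (\<Sum>i<N. c k j i * cnj (h \<omega> i)) ^ 4))) \<partial>prb U)"
    proof (intro nn_integral_mono ennreal_leI sum_mono)
      fix \<omega> j assume "j \<in> {..<N}"
      then show "(cmod (\<Sum>i<N. B i j * cnj (user U (chan U \<omega>) i)))\<^sup>2 * (kp * (cmod (user U (chan U \<omega>) j))\<^sup>2)
        \<le> kp * (1/2 * (\<Sum>k\<in>{True, False}. cmod (\<Sum>i<N. c k j i * cnj (h \<omega> i)) ^ 4))"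
        using young[of "cmod (\<Sum>i<N. B i j * cnj (h \<omega> i))" "cmod (h \<omega> j)"] c[of j \<omega>] by (simp add: channel_def)
    qed
    also have "\<dots> \<le> ennreal (\<Sum>j<N. kp * (1/2 * (\<Sum>k\<in>{True, False}. 2 * (r * sqn N (c k j))\<^sup>2)))"
      using kp_nonneg by (intro nn_integral_sum_le nn_integral_cmult_le h_moment4 borel_measurable_sum borel_measurable_times borel_measurable_const borel_measurable_power borel_measurable_cmod' borel_measurable_cnj' h_meas_i) (auto intro!: sum_nonneg mult_nonneg_nonneg)
    also have "(\<Sum>j<N. kp * (1/2 * (\<Sum>k\<in>{True, False}. 2 * (r * sqn N (c k j))\<^sup>2))) \<le> (\<Sum>j<N. kp * (r\<^sup>2 * (b ^ 4 + 1)))"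
    proof (intro sum_mono mult_left_mono kp_nonneg)
      fix j assume j: "j \<in> {..<N}"
      have "c True j = (\<lambda>i. B i j)" "c False j = (\<lambda>i. if i = j then 1 else 0)" by (auto simp: c_def)
      then have "(sqn N (c True j))\<^sup>2 \<le> (b\<^sup>2)\<^sup>2" "sqn N (c False j) = 1"
        using power_mono[OF column_B[of j] sqn_nonneg, of 2] sqn_unit[of j N] j by simp_all
      then have "r\<^sup>2 * (sqn N (c True j))\<^sup>2 \<le> r\<^sup>2 * (b\<^sup>2)\<^sup>2" "sqn N (c False j) = 1" by (auto intro!: mult_left_mono simp del: power_mult)
      then show "1/2 * (\<Sum>k\<in>{True, False}. 2 * (r * sqn N (c k j))\<^sup>2) \<le> r\<^sup>2 * (b ^ 4 + 1)"
        by (simp add: power_mult_distrib distrib_left)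
    qed
    also have "(\<Sum>j<N. kp * (r\<^sup>2 * (b ^ 4 + 1))) = kp * (real N * (r\<^sup>2 * (b ^ 4 + 1)))" by simp
    finally show "(\<integral>\<^sup>+\<omega>. ennreal (?H (chan U \<omega>) (snd (disturbance U \<omega>))) \<partial>prb U) \<le> ennreal (kp * (real N * (r\<^sup>2 * (b ^ 4 + 1))))"
      by (simp add: ennreal_leI)
  qed
  finally show ?thesis by (simp add: er_def channel_def eta_t_def)
qed

lemma cross_h_nr:
  "msq (prb U) (\<lambda>\<omega>. f (eta_t U \<omega>) * (\<Sum>j<N. (\<Sum>i<N. B i j * cnj (h \<omega> i)) * nr \<omega> j))
     \<le> ennreal (F2 * (sigma2 P * (r * (real N * b\<^sup>2))))"
proof -
  let ?F = "\<lambda>x. ennreal ((cmod (f (fst (snd x)) * (\<Sum>j<N. (\<Sum>i<N. B i j * cnj (user U (fst x) i)) * fst (snd (snd (snd x))) j)))\<^sup>2)"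
  let ?H = "\<lambda>c (w :: cvec \<times> cvec \<times> cvec). \<Sum>j<N. sigma2 P * (cmod (\<Sum>i<N. B i j * cnj (user U c i)))\<^sup>2"
  have fm: "(\<lambda>x. f (fst (snd x))) \<in> borel_measurable full" by (rule measurable_compose[OF full_meas_et f])
  have F: "?F \<in> borel_measurable full" by (intro all_meas fm) auto
  have H: "(\<lambda>x. ?H (fst x) (snd (snd x))) \<in> borel_measurable full" by (intro all_meas) auto
  have G: "(\<lambda>x. ennreal ((cmod (f (fst (snd x))))\<^sup>2 * ?H (fst x) undefined)) \<in> borel_measurable full"
    by (intro all_meas fm) auto
  have "(\<integral>\<^sup>+\<omega>. ?F (chan U \<omega>, disturbance U \<omega>) \<partial>prb U) \<le> (\<integral>\<^sup>+\<omega>. ennreal ((cmod (f (eta_t U \<omega>)))\<^sup>2 * ?H (chan U \<omega>) undefined) \<partial>prb U)"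
  proof (rule nr_integrate_le[OF F G])
    fix c et er ni
    have e: "f et * (\<Sum>j<N. X j * e j) = (\<Sum>j<N. (f et * X j) * e j)" for X e
      by (simp add: sum_distrib_left mult.assoc)
    have "(\<integral>\<^sup>+e. ?F (c, et, er, e, ni) \<partial>nr_law) = ennreal (\<Sum>j<N. (cmod (f et * (\<Sum>i<N. B i j * cnj (user U c i))))\<^sup>2 * sigma2 P)"
      using sigma2_pos unfolding fst_conv snd_conv e by (intro nn_integral_PiM_CN_linear) simp
    also have "(\<Sum>j<N. (cmod (f et * (\<Sum>i<N. B i j * cnj (user U c i))))\<^sup>2 * sigma2 P) = (cmod (f et))\<^sup>2 * ?H c undefined"
      unfolding sum_distrib_left[of "(cmod (f et))\<^sup>2" _ "{..<N}"] by (intro sum.cong refl) (simp only: norm_mult power_mult_distrib mult_ac)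
    finally show "(\<integral>\<^sup>+e. ?F (c, et, er, e, ni) \<partial>nr_law) \<le> ennreal ((cmod (f et))\<^sup>2 * ?H c undefined)" by simp
  qed
  also have "\<dots> \<le> ennreal (F2 * (sigma2 P * (r * (real N * b\<^sup>2))))"
  proof (rule et_factor[OF H])
    have "(\<integral>\<^sup>+\<omega>. ennreal (?H (chan U \<omega>) (snd (disturbance U \<omega>))) \<partial>prb U) \<le> ennreal (\<Sum>j<N. sigma2 P * (r * sqn N (\<lambda>i. B i j)))"
      using sigma2_pos r_nonneg unfolding channel_def[symmetric] by (intro nn_integral_sum_le nn_integral_cmult_le h_moment2 all_meas) auto
    also have "(\<Sum>j<N. sigma2 P * (r * sqn N (\<lambda>i. B i j))) = sigma2 P * (r * frob N B)"
      unfolding frob_columns[symmetric] by (simp add: sum_distrib_left)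
    also have "ennreal \<dots> \<le> ennreal (sigma2 P * (r * (real N * b\<^sup>2)))"
      using sigma2_pos r_nonneg by (intro ennreal_leI mult_left_mono frob_B) auto
    finally show "(\<integral>\<^sup>+\<omega>. ennreal (?H (chan U \<omega>) (snd (disturbance U \<omega>))) \<partial>prb U) \<le> ennreal (sigma2 P * (r * (real N * b\<^sup>2)))" .
  qed
  finally show ?thesis by (simp add: nr_def channel_def eta_t_def)
qed

lemma cross_h_ni:
  "msq (prb U) (\<lambda>\<omega>. f (eta_t U \<omega>) * (\<Sum>j<N. (\<Sum>i<N. B i j * cnj (h \<omega> i)) * interf U \<omega> j))
     \<le> ennreal (F2 * (s * (r * (real N * b\<^sup>2))))"
proof -
  let ?G = "\<lambda>c (w :: cvec \<times> cvec \<times> cvec). (cmod (\<Sum>j<N. (\<Sum>i<N. B i j * cnj (user U c i)) * snd (snd w) j))\<^sup>2"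
  have "(\<integral>\<^sup>+\<omega>. ennreal ((cmod (f (eta_t U \<omega>)))\<^sup>2 * ?G (chan U \<omega>) (snd (disturbance U \<omega>))) \<partial>prb U) \<le> ennreal (F2 * (s * (r * (real N * b\<^sup>2))))"
  proof (rule et_factor)
    show "(\<lambda>x. ?G (fst x) (snd (snd x))) \<in> borel_measurable full" by (intro all_meas) auto
    have a: "(\<lambda>x. \<Sum>i<N. B i j * cnj (x i)) \<in> borel_measurable (cspace N)" for j
      by (intro meas_intros measurable_component_singleton) auto
    have "msq (prb U) (\<lambda>\<omega>. \<Sum>j<N. (\<Sum>i<N. B i j * cnj (h \<omega> i)) * interf U \<omega> j)
      \<le> ennreal (s * (\<Sum>j<N. \<integral>\<omega>. (cmod (\<Sum>i<N. B i j * cnj (h \<omega> i)))\<^sup>2 \<partial>prb U))"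
      by (rule ni_linear[OF a h_moment2(1) S_bound])
    also have "\<dots> \<le> ennreal (s * (\<Sum>j<N. r * sqn N (\<lambda>i. B i j)))"
      using s_nonneg by (intro ennreal_leI mult_left_mono sum_mono h_moment2(2))
    also have "(\<Sum>j<N. r * sqn N (\<lambda>i. B i j)) = r * frob N B"
      unfolding frob_columns[symmetric] by (simp add: sum_distrib_left)
    also have "ennreal (s * \<dots>) \<le> ennreal (s * (r * (real N * b\<^sup>2)))"
      using s_nonneg r_nonneg by (intro ennreal_leI mult_left_mono frob_B) auto
    finally show "(\<integral>\<^sup>+\<omega>. ennreal (?G (chan U \<omega>) (snd (disturbance U \<omega>))) \<partial>prb U) \<le> ennreal (s * (r * (real N * b\<^sup>2)))"
      by (simp add: channel_def interf_def)
  qed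
  then show ?thesis by (simp add: norm_mult power_mult_distrib channel_def interf_def)
qed

end

end

end

section \<open>The matrices of the estimator\<close>

lemma mat_mult_sum:
  assumes "X \<in> carrier_mat N N" "Y \<in> carrier_mat N N" "i < N" "j < N"
  shows "(X * Y) $$ (i, j) = (\<Sum>k<N. X $$ (i, k) * Y $$ (k, j))"
  using assms by (auto simp: scalar_prod_def lessThan_atLeast0 intro!: sum.cong)

lemma psd_hermitian:
  assumes "psd N K" "i < N" "j < N"
  shows "K $$ (j, i) = cnj (K $$ (i, j))"
proof -
  have "Im (sesq N (\<lambda>i j. K $$ (i, j)) c c) = 0" for c
    using psd_quad[OF assms(1), of c] by (simp add: sesq_def less_eq_complex_def)
  from sesq_hermitian[OF this] show ?thesis
    using sesq_unit[OF assms(2,3), of "\<lambda>i j. K $$ (i, j)"] sesq_unit[OF assms(3,2), of "\<lambda>i j. K $$ (i, j)"] by metis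
qed

lemma sesq_add_kernel: "sesq N (\<lambda>i j. K i j + L i j) c e = sesq N K c e + sesq N L c e"
  by (simp add: sesq_def sum.distrib distrib_left distrib_right)

lemma sesq_scale_kernel: "sesq N (\<lambda>i j. a * K i j) c e = a * sesq N K c e"
  by (simp add: sesq_def sum_distrib_left mult_ac)

lemma sesq_cong: "(\<And>i j. i < N \<Longrightarrow> j < N \<Longrightarrow> K i j = L i j) \<Longrightarrow> sesq N K c e = sesq N L c e"
  by (simp add: sesq_def)

lemma sesq_diag: "sesq N (\<lambda>i j. if i = j then d i else 0) c c = (\<Sum>i<N. d i * complex_of_real ((cmod (c i))\<^sup>2))"
proof -
  have "(\<Sum>j<N. c i * (if i = j then d i else 0) * cnj (c j)) = d i * complex_of_real ((cmod (c i))\<^sup>2)" if "i < N" for i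
  proof -
    have "(\<Sum>j<N. c i * (if i = j then d i else 0) * cnj (c j)) = (\<Sum>j<N. if i = j then d i * (c i * cnj (c i)) else 0)"
      by (intro sum.cong refl) (simp add: mult_ac)
    then show ?thesis using that unfolding complex_norm_square by simp
  qed
  then show ?thesis unfolding sesq_def by (intro sum.cong refl) auto
qed

lemma sesq_app: "sesq N K c c = (\<Sum>i<N. c i * app N K (\<lambda>j. cnj (c j)) i)"
  by (simp add: sesq_def app_def sum_distrib_left mult.assoc)

lemma complex_of_real_nonneg: "0 \<le> x \<Longrightarrow> 0 \<le> complex_of_real x"
  by (simp add: less_eq_complex_def)

context uplink_sys
begin

abbreviation "d \<equiv> pilot P"
abbreviation "Zm \<equiv> Zbar P N U"
abbreviation "Wm \<equiv> minv Zm"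
abbreviation "Psim \<equiv> Psi P N U"
definition "A i j = lmmse P N U $$ (i, j)"

lemma d_nz: "d \<noteq> 0" and d_norm: "(cmod d)\<^sup>2 = p_UE P" and kt_nonneg: "0 \<le> kappa_t P"
  using params by (auto simp: valid_params_def)

lemma R_carrier: "cov_R U \<in> carrier_mat N N" and S_carrier: "cov_S U \<in> carrier_mat N N"
  using psd_R psd_S by (simp_all add: psd_def)

lemma Psi_carrier: "Psim \<in> carrier_mat N N" and Z_carrier: "Zm \<in> carrier_mat N N"
  using R_carrier S_carrier by (auto simp: Psi_def Zbar_def diag_part_def)

lemma Psi_entry:
  assumes "i < N" "j < N"
  shows "Psim $$ (i, j) = (if i = j then complex_of_real kp * R i i + complex_of_real (sigma2 P) else 0) + S i j"
  using assms R_carrier S_carrier by (auto simp: Psi_def diag_part_def kp_def)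

lemma Z_entry:
  assumes "i < N" "j < N"
  shows "Zm $$ (i, j) = complex_of_real (p_UE P * (1 + kappa_t P)) * R i j + Psim $$ (i, j)"
  using assms R_carrier S_carrier by (auto simp: Zbar_def Psi_def diag_part_def)

lemma R_diag: "i < N \<Longrightarrow> 0 \<le> R i i"
  using psd_quad[OF psd_R, of "\<lambda>m. if m = i then 1 else 0"] sesq_unit[of i N i R] by (simp add: sesq_def)

lemma sesq_R_nonneg: "0 \<le> sesq N R c c" and sesq_S_nonneg: "0 \<le> sesq N S c c"
  using psd_quad[OF psd_R, of c] psd_quad[OF psd_S, of c] by (simp_all add: sesq_def)

lemma sesq_Psi: "complex_of_real (sigma2 P * sqn N c) \<le> sesq N (\<lambda>i j. Psim $$ (i, j)) c c"
proof -
  have "sesq N (\<lambda>i j. Psim $$ (i, j)) c c = (\<Sum>i<N. (complex_of_real kp * R i i + complex_of_real (sigma2 P)) * complex_of_real ((cmod (c i))\<^sup>2)) + sesq N S c c"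
    unfolding sesq_diag[symmetric] sesq_add_kernel[symmetric] by (intro sesq_cong) (simp add: Psi_entry)
  also have "\<dots> = (\<Sum>i<N. complex_of_real kp * R i i * complex_of_real ((cmod (c i))\<^sup>2)) + complex_of_real (sigma2 P * sqn N c) + sesq N S c c"
    by (simp add: sqn_def sum.distrib distrib_right sum_distrib_left del: of_real_power)
  also have "\<dots> \<ge> 0 + complex_of_real (sigma2 P * sqn N c) + 0"
    using kp_nonneg by (intro add_mono sesq_S_nonneg sum_nonneg mult_nonneg_nonneg order_refl complex_of_real_nonneg R_diag) auto
  finally show ?thesis by simp
qed

lemma sesq_Z: "complex_of_real (sigma2 P * sqn N c) \<le> sesq N (\<lambda>i j. Zm $$ (i, j)) c c"
proof -
  have "sesq N (\<lambda>i j. Zm $$ (i, j)) c c = complex_of_real (p_UE P * (1 + kappa_t P)) * sesq N R c c + sesq N (\<lambda>i j. Psim $$ (i, j)) c c"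
    unfolding sesq_scale_kernel[symmetric] sesq_add_kernel[symmetric] by (intro sesq_cong) (simp add: Z_entry)
  also have "\<dots> \<ge> 0 + complex_of_real (sigma2 P * sqn N c)"
    using p_pos kt_nonneg by (intro add_mono sesq_Psi mult_nonneg_nonneg sesq_R_nonneg complex_of_real_nonneg) auto
  finally show ?thesis by simp
qed

lemma Z_lower: "(sigma2 P)\<^sup>2 * sqn N x \<le> sqn N (app N (\<lambda>i j. Zm $$ (i, j)) x)"
proof -
  let ?y = "app N (\<lambda>i j. Zm $$ (i, j)) x"
  have "sigma2 P * sqn N x \<le> Re (sesq N (\<lambda>i j. Zm $$ (i, j)) (\<lambda>i. cnj (x i)) (\<lambda>i. cnj (x i)))"
    using sesq_Z[of "\<lambda>i. cnj (x i)"] by (simp add: less_eq_complex_def)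
  also have "\<dots> \<le> cmod (\<Sum>i<N. cnj (x i) * ?y i)"
    unfolding sesq_app complex_cnj_cnj by (rule complex_Re_le_cmod)
  finally have "(sigma2 P * sqn N x)\<^sup>2 \<le> (cmod (\<Sum>i<N. cnj (x i) * ?y i))\<^sup>2"
    using sigma2_pos by (intro power_mono) auto
  also have "\<dots> \<le> sqn N x * sqn N ?y"
    using sum_Cauchy_Schwarz_complex[of "\<lambda>i. cnj (x i)" ?y N] by simp
  finally have "(sigma2 P)\<^sup>2 * sqn N x * sqn N x \<le> sqn N ?y * sqn N x"
    by (simp add: power2_eq_square mult_ac)
  then show ?thesis
    using sqn_nonneg[of N x] by (cases "sqn N x = 0") (auto simp: mult_le_cancel_right)
qed

lemma W_inverse: "Wm \<in> carrier_mat N N" "Zm * Wm = 1\<^sub>m N" "Wm * Zm = 1\<^sub>m N"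
proof -
  have "det Zm \<noteq> 0"
  proof
    assume "det Zm = 0"
    then obtain v where v: "v \<in> carrier_vec N" "v \<noteq> 0\<^sub>v N" "Zm *\<^sub>v v = 0\<^sub>v N"
      using det_0_iff_vec_prod_zero_field[OF Z_carrier] by blast
    have "app N (\<lambda>i j. Zm $$ (i, j)) (\<lambda>j. v $ j) i = 0" if "i < N" for i
      using mult_mat_vec_index_sum[OF Z_carrier v(1) that] v(3) that by simp
    then have "sqn N (app N (\<lambda>i j. Zm $$ (i, j)) (\<lambda>j. v $ j)) = 0" by (simp add: sqn_def)
    then have "(sigma2 P)\<^sup>2 * sqn N (\<lambda>j. v $ j) \<le> 0" using Z_lower[of "\<lambda>j. v $ j"] by simp
    then have "sqn N (\<lambda>j. v $ j) \<le> 0" using sigma2_pos by (simp add: mult_le_0_iff)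
    then have "sqn N (\<lambda>j. v $ j) = 0" by (intro antisym) simp_all
    then have "\<forall>i<N. v $ i = 0" by (simp add: sqn_def sum_nonneg_eq_0_iff)
    then show False using v(1,2) by (auto intro!: eq_vecI)
  qed
  from det_non_zero_imp_unit[OF Z_carrier this, of "()"] mat_inverse(1)[OF Z_carrier, of "()"]
  obtain B where "mat_inverse Zm = Some B" by (cases "mat_inverse Zm") auto
  with mat_inverse(2)[OF Z_carrier this]
  show "Wm \<in> carrier_mat N N" "Zm * Wm = 1\<^sub>m N" "Wm * Zm = 1\<^sub>m N" by (simp_all add: minv_def)
qed

lemma W_bound: "opb N (\<lambda>i j. Wm $$ (i, j)) (1 / sigma2 P)"
proof -
  have "sqn N (app N (\<lambda>i j. Wm $$ (i, j)) y) \<le> (1 / sigma2 P)\<^sup>2 * sqn N y" for y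
  proof -
    have "app N (\<lambda>i j. Zm $$ (i, j)) (app N (\<lambda>i j. Wm $$ (i, j)) y) i = y i" if "i < N" for i
    proof -
      have "app N (\<lambda>i j. Zm $$ (i, j)) (app N (\<lambda>i j. Wm $$ (i, j)) y) i = (\<Sum>k<N. (\<Sum>j<N. Zm $$ (i, j) * Wm $$ (j, k)) * y k)"
        unfolding app_def sum_distrib_left sum_distrib_right by (subst sum.swap) (simp add: mult_ac)
      also have "\<dots> = (\<Sum>k<N. (1\<^sub>m N) $$ (i, k) * y k)"
        using that by (intro sum.cong refl) (simp add: mat_mult_sum[OF Z_carrier W_inverse(1), symmetric] W_inverse(2))
      also have "\<dots> = y i" using that by (simp add: if_distrib[of "\<lambda>z. z * _"] cong: if_cong)
      finally show ?thesis .
    qed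
    then have "sqn N (app N (\<lambda>i j. Zm $$ (i, j)) (app N (\<lambda>i j. Wm $$ (i, j)) y)) = sqn N y" by (simp add: sqn_def)
    then have "(sigma2 P)\<^sup>2 * sqn N (app N (\<lambda>i j. Wm $$ (i, j)) y) \<le> sqn N y"
      using Z_lower[of "app N (\<lambda>i j. Wm $$ (i, j)) y"] by simp
    then show ?thesis using sigma2_pos by (simp add: power_divide field_simps)
  qed
  then show ?thesis using sigma2_pos by (simp add: opb_def)
qed

lemma lmmse_carrier: "lmmse P N U \<in> carrier_mat N N"
  using R_carrier W_inverse(1) by (simp add: lmmse_def)

lemma A_entry:
  assumes "i < N" "k < N"
  shows "A i k = cnj d * (\<Sum>j<N. R i j * Wm $$ (j, k))"
proof -
  have "cov_R U * Wm \<in> carrier_mat N N" using R_carrier W_inverse(1) by simp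
  then have "(cnj d \<cdot>\<^sub>m (cov_R U * Wm)) $$ (i, k) = cnj d * (cov_R U * Wm) $$ (i, k)"
    using assms by (intro index_smult_mat) auto
  then show ?thesis using mat_mult_sum[OF R_carrier W_inverse(1) assms] by (simp add: A_def lmmse_def)
qed

lemma A_Z:
  assumes "i < N" "k < N"
  shows "(\<Sum>j<N. A i j * Zm $$ (j, k)) = cnj d * R i k"
proof -
  have RW: "cov_R U * Wm \<in> carrier_mat N N" using R_carrier W_inverse(1) by simp
  have "lmmse P N U * Zm = cnj d \<cdot>\<^sub>m ((cov_R U * Wm) * Zm)"
    unfolding lmmse_def by (rule mult_smult_assoc_mat[OF RW Z_carrier])
  also have "(cov_R U * Wm) * Zm = cov_R U"
    using assoc_mult_mat[OF R_carrier W_inverse(1) Z_carrier] W_inverse(3) R_carrier by simp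
  finally have "(lmmse P N U * Zm) $$ (i, k) = cnj d * R i k" using assms R_carrier by simp
  then show ?thesis using mat_mult_sum[OF lmmse_carrier Z_carrier assms] by (simp add: A_def)
qed

definition "qA K = (\<Sum>i<N. sesq N K (A i) (A i))"
definition "alpha = Re (qA R)"
definition "beta = Re (qA (\<lambda>i j. Psim $$ (i, j)))"
definition "tau = Re (mtrace (cov_R U - err_cov P N U))"
definition "rwr = (\<Sum>i<N. \<Sum>j<N. \<Sum>k<N. R i j * Wm $$ (j, k) * R k i)"

lemma qA_R: "qA R = complex_of_real alpha" and alpha_nonneg: "0 \<le> alpha"
proof -
  have "0 \<le> qA R" unfolding qA_def by (intro sum_nonneg sesq_R_nonneg)
  then show "qA R = complex_of_real alpha" "0 \<le> alpha" by (auto simp: alpha_def less_eq_complex_def complex_eq_iff)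
qed

lemma qA_Psi: "qA (\<lambda>i j. Psim $$ (i, j)) = complex_of_real beta" and beta_ge: "sigma2 P * frob N A \<le> beta"
proof -
  have "(\<Sum>i<N. complex_of_real (sigma2 P * sqn N (A i))) \<le> qA (\<lambda>i j. Psim $$ (i, j))" unfolding qA_def by (intro sum_mono sesq_Psi)
  moreover have "(\<Sum>i<N. complex_of_real (sigma2 P * sqn N (A i))) = complex_of_real (sigma2 P * frob N A)"
    by (simp add: frob_def sum_distrib_left)
  ultimately show "qA (\<lambda>i j. Psim $$ (i, j)) = complex_of_real beta" "sigma2 P * frob N A \<le> beta"
    by (auto simp: beta_def less_eq_complex_def complex_eq_iff)
qed

lemma qA_Z: "qA (\<lambda>i j. Zm $$ (i, j)) = complex_of_real (p_UE P * (1 + kappa_t P) * alpha + beta)"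
proof -
  have "qA (\<lambda>i j. Zm $$ (i, j)) = complex_of_real (p_UE P * (1 + kappa_t P)) * qA R + qA (\<lambda>i j. Psim $$ (i, j))"
    unfolding qA_def sum_distrib_left sum.distrib[symmetric]
    unfolding sesq_scale_kernel[symmetric] sesq_add_kernel[symmetric]
    by (intro sum.cong refl sesq_cong) (simp add: Z_entry)
  then show ?thesis by (simp add: qA_R qA_Psi)
qed

lemma qA_Z_rwr: "qA (\<lambda>i j. Zm $$ (i, j)) = complex_of_real (p_UE P) * cnj rwr"
proof -
  have "sesq N (\<lambda>i j. Zm $$ (i, j)) (A i) (A i) = complex_of_real (p_UE P) * (\<Sum>j<N. \<Sum>k<N. cnj (R i j * Wm $$ (j, k) * R k i))"
    if i: "i < N" for i
  proof -
    have "sesq N (\<lambda>i j. Zm $$ (i, j)) (A i) (A i) = (\<Sum>k<N. (\<Sum>j<N. A i j * Zm $$ (j, k)) * cnj (A i k))"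
      unfolding sesq_def sum_distrib_right by (rule sum.swap)
    also have "\<dots> = (\<Sum>k<N. complex_of_real (p_UE P) * (\<Sum>j<N. cnj (R i j * Wm $$ (j, k) * R k i)))"
    proof (intro sum.cong refl)
      fix k assume "k \<in> {..<N}"
      then have k: "k < N" by simp
      have "(\<Sum>j<N. A i j * Zm $$ (j, k)) * cnj (A i k) = (d * cnj d) * (R i k * cnj (\<Sum>j<N. R i j * Wm $$ (j, k)))"
        unfolding A_Z[OF i k] A_entry[OF i k] by (simp add: mult_ac)
      also have "d * cnj d = complex_of_real (p_UE P)"
        unfolding complex_norm_square[symmetric] d_norm ..
      also have "R i k = cnj (R k i)" using psd_hermitian[OF psd_R k i] .
      also have "cnj (R k i) * cnj (\<Sum>j<N. R i j * Wm $$ (j, k)) = (\<Sum>j<N. cnj (R i j * Wm $$ (j, k) * R k i))"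
        by (simp add: cnj_sum sum_distrib_left mult_ac)
      finally show "(\<Sum>j<N. A i j * Zm $$ (j, k)) * cnj (A i k) = complex_of_real (p_UE P) * (\<Sum>j<N. cnj (R i j * Wm $$ (j, k) * R k i))" .
    qed
    also have "\<dots> = complex_of_real (p_UE P) * (\<Sum>j<N. \<Sum>k<N. cnj (R i j * Wm $$ (j, k) * R k i))"
      unfolding sum_distrib_left[symmetric] by (subst sum.swap) simp
    finally show ?thesis .
  qed
  then show ?thesis unfolding qA_def rwr_def by (simp add: sum_distrib_left cnj_sum del: complex_cnj_mult)
qed

lemma trace_R_C: "mtrace (cov_R U - err_cov P N U) = complex_of_real (p_UE P) * rwr"
proof -
  have RW: "cov_R U * Wm \<in> carrier_mat N N" using R_carrier W_inverse(1) by simp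
  have RWR: "cov_R U * Wm * cov_R U \<in> carrier_mat N N" using RW R_carrier by simp
  have e: "(cov_R U * Wm * cov_R U) $$ (i, i) = (\<Sum>j<N. \<Sum>k<N. R i j * Wm $$ (j, k) * R k i)" if "i < N" for i
  proof -
    have "(cov_R U * Wm * cov_R U) $$ (i, i) = (\<Sum>k<N. (\<Sum>j<N. R i j * Wm $$ (j, k)) * R k i)"
      unfolding mat_mult_sum[OF RW R_carrier that that] using that
      by (intro sum.cong refl) (simp add: mat_mult_sum[OF R_carrier W_inverse(1)])
    also have "\<dots> = (\<Sum>j<N. \<Sum>k<N. R i j * Wm $$ (j, k) * R k i)"
      unfolding sum_distrib_right by (rule sum.swap)
    finally show ?thesis .
  qed
  have dimE: "err_cov P N U \<in> carrier_mat N N" using RWR R_carrier by (auto simp: err_cov_def)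
  have "mtrace (cov_R U - err_cov P N U) = (\<Sum>i<N. (cov_R U - err_cov P N U) $$ (i, i))"
    unfolding mtrace_def using dimE R_carrier by simp
  also have "\<dots> = (\<Sum>i<N. complex_of_real (p_UE P) * (cov_R U * Wm * cov_R U) $$ (i, i))"
    using dimE R_carrier RWR by (intro sum.cong refl) (simp add: err_cov_def)
  also have "\<dots> = complex_of_real (p_UE P) * rwr"
    unfolding rwr_def sum_distrib_left[symmetric] by (simp add: e)
  finally show ?thesis .
qed

lemma tau_eq: "tau = p_UE P * (1 + kappa_t P) * alpha + beta" and rwr_eq: "complex_of_real (p_UE P) * rwr = complex_of_real tau"
proof -
  have c: "complex_of_real (p_UE P) * cnj rwr = complex_of_real (p_UE P * (1 + kappa_t P) * alpha + beta)"
    using qA_Z qA_Z_rwr by simp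
  have "complex_of_real (p_UE P) * rwr = complex_of_real (p_UE P * (1 + kappa_t P) * alpha + beta)"
    using arg_cong[OF c, of cnj] by (simp only: complex_cnj_mult complex_cnj_complex_of_real complex_cnj_cnj)
  moreover from this have "tau = p_UE P * (1 + kappa_t P) * alpha + beta"
    unfolding tau_def trace_R_C by (simp only: Re_complex_of_real)
  ultimately show "tau = p_UE P * (1 + kappa_t P) * alpha + beta" "complex_of_real (p_UE P) * rwr = complex_of_real tau" by simp_all
qed

lemma trace_A_R: "(\<Sum>i<N. \<Sum>j<N. A i j * R j i) = complex_of_real tau / d"
proof -
  have "(\<Sum>i<N. \<Sum>k<N. A i k * R k i) = cnj d * rwr"
  proof -
    have "(\<Sum>k<N. A i k * R k i) = cnj d * (\<Sum>j<N. \<Sum>k<N. R i j * Wm $$ (j, k) * R k i)" if "i < N" for i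
    proof -
      have "(\<Sum>k<N. A i k * R k i) = (\<Sum>k<N. \<Sum>j<N. cnj d * (R i j * Wm $$ (j, k) * R k i))"
        using that by (intro sum.cong refl) (simp add: A_entry sum_distrib_left sum_distrib_right mult_ac)
      also have "\<dots> = cnj d * (\<Sum>j<N. \<Sum>k<N. R i j * Wm $$ (j, k) * R k i)"
        by (subst sum.swap) (simp add: sum_distrib_left)
      finally show ?thesis .
    qed
    then show ?thesis unfolding rwr_def by (simp add: sum_distrib_left)
  qed
  also have "\<dots> = (d * cnj d) * rwr / d" using d_nz by simp
  also have "d * cnj d = complex_of_real (p_UE P)"
    unfolding complex_norm_square[symmetric] d_norm ..
  finally show ?thesis by (simp add: rwr_eq)
qed

lemma mat_adjoint_entry:
  assumes "X \<in> carrier_mat N N" "i < N" "j < N"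
  shows "mat_adjoint X $$ (i, j) = cnj (X $$ (j, i))"
  using assms by (simp add: mat_adjoint_def mat_of_rows_index)

lemma phi_eq:
  "phi P N U w = (1 + inverse d * eta_t U w) * complex_of_real (sqrt tau)
     / complex_of_real (sqrt ((cmod (d + eta_t U w))\<^sup>2 * alpha + beta))"
proof -
  let ?L = "lmmse P N U"
  let ?x = "complex_of_real ((cmod (d + eta_t U w))\<^sup>2)"
  let ?K = "?x \<cdot>\<^sub>m cov_R U + Psim"
  have K: "?K \<in> carrier_mat N N" using R_carrier Psi_carrier by simp
  have Ad: "mat_adjoint ?L \<in> carrier_mat N N" using mat_of_rows_carrier(1)[of N "map conjugate (cols ?L)"] carrier_matD[OF lmmse_carrier]
    by (simp add: mat_adjoint_def)
  have LK: "?L * ?K \<in> carrier_mat N N" using lmmse_carrier K by simp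
  have "mtrace (?L * ?K * mat_adjoint ?L) = (\<Sum>i<N. (?L * ?K * mat_adjoint ?L) $$ (i, i))"
    unfolding mtrace_def using lmmse_carrier by simp
  also have "\<dots> = (\<Sum>i<N. sesq N (\<lambda>j k. ?K $$ (j, k)) (A i) (A i))"
  proof (intro sum.cong refl)
    fix i assume "i \<in> {..<N}"
    then have i: "i < N" by simp
    have "(?L * ?K * mat_adjoint ?L) $$ (i, i) = (\<Sum>k<N. (\<Sum>j<N. A i j * ?K $$ (j, k)) * cnj (A i k))"
      unfolding mat_mult_sum[OF LK Ad i i] A_def using i
      by (intro sum.cong refl arg_cong2[where f="(*)"]) (simp_all only: mat_mult_sum[OF lmmse_carrier K] mat_adjoint_entry[OF lmmse_carrier] lessThan_iff)
    also have "\<dots> = sesq N (\<lambda>j k. ?K $$ (j, k)) (A i) (A i)"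
      unfolding sesq_def sum_distrib_right by (rule sum.swap)
    finally show "(?L * ?K * mat_adjoint ?L) $$ (i, i) = sesq N (\<lambda>j k. ?K $$ (j, k)) (A i) (A i)" .
  qed
  also have "\<dots> = ?x * qA R + qA (\<lambda>i j. Psim $$ (i, j))"
    unfolding qA_def sum_distrib_left sum.distrib[symmetric]
    unfolding sesq_scale_kernel[symmetric] sesq_add_kernel[symmetric]
    using R_carrier Psi_carrier by (intro sum.cong refl sesq_cong) simp
  also have "\<dots> = complex_of_real ((cmod (d + eta_t U w))\<^sup>2 * alpha + beta)"
    unfolding qA_R qA_Psi by simp
  finally show ?thesis unfolding phi_def tau_def[symmetric] by (simp only: Re_complex_of_real)
qed

lemma tau_ge_beta: "beta \<le> tau"
  unfolding tau_eq using p_pos kt_nonneg alpha_nonneg by simp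

end

context uplink_bounds
begin

lemma A_bound: "opb N A (cmod d * (r * (1 / sigma2 P)))"
proof -
  have "opb N (\<lambda>i k. cnj d * (\<Sum>j<N. R i j * Wm $$ (j, k))) (cmod (cnj d) * (r * (1 / sigma2 P)))"
    by (intro opb_scale opb_mult R_bound W_bound)
  then have "opb N A (cmod (cnj d) * (r * (1 / sigma2 P)))" by (rule opb_cong) (simp add: A_entry)
  then show ?thesis by simp
qed

definition "zb = p_UE P * (1 + kappa_t P) * r + ((kp * r + sigma2 P) + s)"

lemma Z_bound: "opb N (\<lambda>i j. Zm $$ (i, j)) zb"
proof -
  have a: "0 \<le> p_UE P * (1 + kappa_t P)" using p_pos kt_nonneg by simp
  have "opb N (\<lambda>i j. complex_of_real (p_UE P * (1 + kappa_t P)) * R i j) (cmod (complex_of_real (p_UE P * (1 + kappa_t P))) * r)"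
    by (rule opb_scale[OF R_bound])
  then have "opb N (\<lambda>i j. complex_of_real (p_UE P * (1 + kappa_t P)) * R i j) (p_UE P * (1 + kappa_t P) * r)"
    unfolding norm_of_real using a by simp
  moreover have "opb N (\<lambda>i j. if i = j then complex_of_real kp * R i i + complex_of_real (sigma2 P) else 0) (kp * r + sigma2 P)"
  proof (rule opb_diag)
    fix i assume i: "i < N"
    have "cmod (complex_of_real kp * R i i + complex_of_real (sigma2 P)) \<le> cmod (complex_of_real kp * R i i) + cmod (complex_of_real (sigma2 P))"
      by (rule norm_triangle_ineq)
    also have "\<dots> \<le> kp * r + sigma2 P"
      using opb_entry[OF R_bound i i] kp_nonneg sigma2_pos by (simp add: norm_mult mult_left_mono)
    finally show "cmod (complex_of_real kp * R i i + complex_of_real (sigma2 P)) \<le> kp * r + sigma2 P" .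
  qed (use kp_nonneg r_nonneg sigma2_pos in simp)
  ultimately have "opb N (\<lambda>i j. complex_of_real (p_UE P * (1 + kappa_t P)) * R i j
     + ((if i = j then complex_of_real kp * R i i + complex_of_real (sigma2 P) else 0) + S i j)) zb"
    unfolding zb_def by (intro opb_add S_bound)
  then show ?thesis by (rule opb_cong) (simp add: Z_entry Psi_entry)
qed

lemma frob_A_lower: "p_UE P * frob N R \<le> zb\<^sup>2 * frob N A"
proof -
  have "frob N (\<lambda>i k. \<Sum>j<N. A i j * Zm $$ (j, k)) = (\<Sum>i<N. sqn N (\<lambda>k. cnj d * R i k))"
    unfolding frob_def by (intro sum.cong refl sqn_cong) (simp add: A_Z)
  also have "\<dots> = p_UE P * frob N R"
    unfolding sqn_scale by (simp add: frob_def d_norm sum_distrib_left)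
  finally show ?thesis using frob_mult_right[OF Z_bound, of A] by simp
qed

lemma frob_R_lower: "(Re (mtrace (cov_R U)))\<^sup>2 \<le> real N * frob N R"
proof -
  have "mtrace (cov_R U) = (\<Sum>i<N. R i i * 1)" unfolding mtrace_def using R_carrier by simp
  then have "(cmod (mtrace (cov_R U)))\<^sup>2 \<le> sqn N (\<lambda>i. R i i) * sqn N (\<lambda>i. 1)"
    using sum_Cauchy_Schwarz_complex[of "\<lambda>i. R i i" "\<lambda>i. 1" N] by simp
  also have "sqn N (\<lambda>i. 1) = real N" by (simp add: sqn_def)
  also have "sqn N (\<lambda>i. R i i) \<le> frob N R"
    unfolding frob_def sqn_def by (intro sum_mono member_le_sum) auto
  then have "sqn N (\<lambda>i. R i i) * real N \<le> real N * frob N R"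
    by (subst mult.commute) (rule mult_left_mono, simp_all)
  finally have "(cmod (mtrace (cov_R U)))\<^sup>2 \<le> real N * frob N R" .
  moreover have "(Re (mtrace (cov_R U)))\<^sup>2 \<le> (cmod (mtrace (cov_R U)))\<^sup>2"
    by (simp add: cmod_power2)
  ultimately show ?thesis by linarith
qed

lemma beta_lower:
  assumes "c * real N \<le> Re (mtrace (cov_R U))" "0 < c" "0 < zb"
  shows "sigma2 P * p_UE P * c\<^sup>2 / zb\<^sup>2 * real N \<le> beta"
proof -
  have N: "0 < real N" using N1 by simp
  have "(c * real N)\<^sup>2 \<le> (Re (mtrace (cov_R U)))\<^sup>2"
    using assms N by (intro power_mono) auto
  also have "\<dots> \<le> real N * frob N R" by (rule frob_R_lower)
  finally have "c\<^sup>2 * real N \<le> frob N R" using N by (simp add: power2_eq_square mult_ac)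
  then have "p_UE P * (c\<^sup>2 * real N) \<le> zb\<^sup>2 * frob N A"
    using p_pos by (intro order_trans[OF mult_left_mono frob_A_lower]) auto
  then have "p_UE P * (c\<^sup>2 * real N) / zb\<^sup>2 \<le> frob N A"
    using assms(3) by (simp add: divide_le_eq mult.commute)
  then have "sigma2 P * (p_UE P * (c\<^sup>2 * real N) / zb\<^sup>2) \<le> sigma2 P * frob N A" using sigma2_pos by (intro mult_left_mono) auto
  also note beta_ge
  finally show ?thesis by (simp add: mult_ac)
qed

lemma tau_upper:
  assumes "opb N A a"
  shows "tau \<le> zb * (real N * a\<^sup>2)"
proof -
  have "tau = Re (qA (\<lambda>i j. Zm $$ (i, j)))" unfolding qA_Z tau_eq[symmetric] by simp
  also have "\<dots> = (\<Sum>i<N. Re (sesq N (\<lambda>i j. Zm $$ (i, j)) (A i) (A i)))" by (simp add: qA_def)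
  also have "\<dots> \<le> (\<Sum>i<N. zb * sqn N (A i))"
    using opb_quad[OF Z_bound] complex_Re_le_cmod unfolding sesq_def by (intro sum_mono) (meson order_trans)
  also have "\<dots> = zb * frob N A" by (simp add: frob_def sum_distrib_left)
  also have "\<dots> \<le> zb * (real N * a\<^sup>2)" using opb_nonneg[OF Z_bound] by (intro mult_left_mono frob_le assms)
  finally show ?thesis .
qed

end

section \<open>Concentration of the combined gain\<close>

definition l2 :: "'a measure \<Rightarrow> ('a \<Rightarrow> complex) \<Rightarrow> real \<Rightarrow> bool" where
  "l2 M f a \<longleftrightarrow> f \<in> borel_measurable M \<and> 0 < a \<and> msq M f \<le> ennreal (a\<^sup>2)"

lemma l2_add:
  assumes "l2 M f a" "l2 M g b"
  shows "l2 M (\<lambda>w. f w + g w) (a + b)"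
proof -
  have fm: "f \<in> borel_measurable M" and gm: "g \<in> borel_measurable M" and a: "0 < a" and b: "0 < b" using assms by (auto simp: l2_def)
  have pw: "(cmod (x + y))\<^sup>2 \<le> (1 + b / a) * (cmod x)\<^sup>2 + (1 + a / b) * (cmod y)\<^sup>2" for x y :: complex
  proof -
    have "0 \<le> (b * cmod x - a * cmod y)\<^sup>2 / (a * b)" using a b by (intro divide_nonneg_pos) auto
    also have "\<dots> = b / a * (cmod x)\<^sup>2 + a / b * (cmod y)\<^sup>2 - 2 * cmod x * cmod y"
      using a b by (simp add: power2_diff field_simps power2_eq_square)
    finally have "2 * cmod x * cmod y \<le> b / a * (cmod x)\<^sup>2 + a / b * (cmod y)\<^sup>2" by simp
    moreover have "(cmod (x + y))\<^sup>2 \<le> (cmod x + cmod y)\<^sup>2" by (intro power_mono norm_triangle_ineq) simp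
    ultimately show ?thesis by (simp add: power2_sum distrib_right)
  qed
  have "msq M (\<lambda>w. f w + g w)
    \<le> (\<integral>\<^sup>+w. ennreal (1 + b / a) * ennreal ((cmod (f w))\<^sup>2) + ennreal (1 + a / b) * ennreal ((cmod (g w))\<^sup>2) \<partial>M)"
    using a b by (intro nn_integral_mono) (auto simp flip: ennreal_mult' ennreal_plus intro!: ennreal_leI pw)
  also have "\<dots> = ennreal (1 + b / a) * msq M f + ennreal (1 + a / b) * msq M g"
    using fm gm by (subst nn_integral_add) (auto simp: nn_integral_cmult)
  also have "\<dots> \<le> ennreal (1 + b / a) * ennreal (a\<^sup>2) + ennreal (1 + a / b) * ennreal (b\<^sup>2)"
    using assms by (intro add_mono mult_left_mono) (auto simp: l2_def)
  also have "\<dots> = ennreal ((1 + b / a) * a\<^sup>2 + (1 + a / b) * b\<^sup>2)"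
    using a b by (simp flip: ennreal_mult' ennreal_plus)
  also have "(1 + b / a) * a\<^sup>2 + (1 + a / b) * b\<^sup>2 = (a + b)\<^sup>2"
    using a b by (simp add: field_simps power2_eq_square)
  finally show ?thesis using fm gm a b by (simp add: l2_def)
qed

lemma l2_norm_cong:
  assumes "l2 M f a" "g \<in> borel_measurable M" "\<And>w. cmod (g w) = cmod (f w)"
  shows "l2 M g a"
  using assms by (simp add: l2_def)

lemma l2I:
  assumes "f \<in> borel_measurable M" "0 < a" "msq M f \<le> ennreal C" "C \<le> a\<^sup>2"
  shows "l2 M f a"
  using assms order_trans[OF assms(3) ennreal_leI[OF assms(4)]] by (simp add: l2_def)

definition bil :: "nat \<Rightarrow> (nat \<Rightarrow> nat \<Rightarrow> complex) \<Rightarrow> (nat \<Rightarrow> complex) \<Rightarrow> (nat \<Rightarrow> complex) \<Rightarrow> complex" where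
  "bil N C x y = (\<Sum>i<N. \<Sum>j<N. C i j * cnj (x i) * y j)"

lemma bil_add_left: "bil N C (\<lambda>i. x i + x' i) y = bil N C x y + bil N C x' y"
  by (simp add: bil_def sum.distrib distrib_left distrib_right)

lemma bil_add_right: "bil N C x (\<lambda>i. y i + y' i) = bil N C x y + bil N C x y'"
  by (simp add: bil_def sum.distrib distrib_left)

lemma bil_scale_left: "bil N C (\<lambda>i. a * x i) y = cnj a * bil N C x y"
  by (simp add: bil_def sum_distrib_left mult_ac)

lemma bil_scale_right: "bil N C x (\<lambda>i. a * y i) = a * bil N C x y"
  by (simp add: bil_def sum_distrib_left mult_ac)

lemma bil_columns: "bil N C x y = (\<Sum>j<N. (\<Sum>i<N. C i j * cnj (x i)) * y j)"
  unfolding bil_def sum_distrib_right by (rule sum.swap)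

lemma bil_rows: "cnj (bil N C x y) = (\<Sum>i<N. (\<Sum>j<N. cnj (C i j * y j)) * x i)"
  unfolding bil_def cnj_sum sum_distrib_right by (intro sum.cong refl) (simp add: mult_ac)

lemma bil_hermitian:
  assumes "\<And>i j. i < N \<Longrightarrow> j < N \<Longrightarrow> C j i = cnj (C i j)"
  shows "bil N C y x = cnj (bil N C x y)"
proof -
  have "bil N C y x = (\<Sum>i<N. \<Sum>j<N. C j i * cnj (y j) * x i)" unfolding bil_def by (rule sum.swap)
  also have "\<dots> = cnj (bil N C x y)"
    unfolding bil_def cnj_sum
  proof (intro sum.cong refl)
    fix i j assume "i \<in> {..<N}" "j \<in> {..<N}"
    then have "C j i = cnj (C i j)" using assms by blast
    then show "C j i * cnj (y j) * x i = cnj (C i j * cnj (x i) * y j)" by (simp add: mult_ac)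
  qed
  finally show ?thesis .
qed

lemma bil_square:
  assumes "\<And>i j. i < N \<Longrightarrow> j < N \<Longrightarrow> C j i = cnj (C i j)"
  shows "bil N C (\<lambda>i. x1 i + x2 i + x3 i + x4 i) (\<lambda>i. x1 i + x2 i + x3 i + x4 i) =
    bil N C x1 x1 + bil N C x2 x2 + bil N C x3 x3 + bil N C x4 x4
    + (bil N C x1 x2 + cnj (bil N C x1 x2)) + (bil N C x1 x3 + cnj (bil N C x1 x3)) + (bil N C x1 x4 + cnj (bil N C x1 x4))
    + (bil N C x2 x3 + cnj (bil N C x2 x3)) + (bil N C x2 x4 + cnj (bil N C x2 x4)) + (bil N C x3 x4 + cnj (bil N C x3 x4))"
  unfolding bil_add_left bil_add_right
  using bil_hermitian[OF assms, where y=x2 and x=x1] bil_hermitian[OF assms, where y=x3 and x=x1] bil_hermitian[OF assms, where y=x4 and x=x1]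
    bil_hermitian[OF assms, where y=x3 and x=x2] bil_hermitian[OF assms, where y=x4 and x=x2] bil_hermitian[OF assms, where y=x4 and x=x3]
  by simp

text \<open>Normalised so that both numerators and denominators are O(1); \<open>q\<close> controls the first factor through Cauchy--Schwarz.\<close>

lemma ratio_bound:
  fixes X u0 :: complex
  assumes X: "(cmod X)\<^sup>2 \<le> q * t * X2" and X2: "0 \<le> X2" and t: "0 < t" and q: "0 \<le> q" and c0: "0 < c0" and r0: "c0 \<le> r0"
  shows "(cmod (X / complex_of_real (sqrt X2) / complex_of_real (sqrt t) - u0 / complex_of_real (sqrt r0)))\<^sup>2
      \<le> 2 * (cmod (X / complex_of_real t - u0))\<^sup>2 / c0 + 2 * q * (X2 / t - r0)\<^sup>2 / c0\<^sup>2"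
    and "(cmod (X / complex_of_real (sqrt X2) / complex_of_real (sqrt t)))\<^sup>2 \<le> q"
    and "(cmod (X / complex_of_real (sqrt X2) / complex_of_real (sqrt t) - u0 / complex_of_real (sqrt r0)))\<^sup>2 \<le> 2 * q + 2 * (cmod u0)\<^sup>2 / c0"
proof -
  define Y where "Y = X / complex_of_real (sqrt X2) / complex_of_real (sqrt t)"
  define r where "r = X2 / t"
  define u where "u = X / complex_of_real t"
  have r0p: "0 < r0" using c0 r0 by simp
  have r: "0 \<le> r" using X2 t by (simp add: r_def)
  have Yr: "Y * complex_of_real (sqrt r) = u"
  proof (cases "X2 = 0")
    case True
    then have "X = 0" using X by simp
    then show ?thesis by (simp add: Y_def u_def)
  next
    case False
    have "complex_of_real (sqrt t) * complex_of_real (sqrt t) = complex_of_real t"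
      using t by (simp flip: of_real_mult)
    then show ?thesis using False t X2 by (simp add: Y_def u_def r_def real_sqrt_divide field_simps)
  qed
  show Yq: "(cmod (X / complex_of_real (sqrt X2) / complex_of_real (sqrt t)))\<^sup>2 \<le> q"
  proof (cases "X2 = 0")
    case True then show ?thesis using q by simp
  next
    case False
    then have "0 < X2" using X2 by simp
    then have "(cmod (X / complex_of_real (sqrt X2) / complex_of_real (sqrt t)))\<^sup>2 = (cmod X)\<^sup>2 / (X2 * t)"
      using t by (simp add: norm_divide norm_mult power_divide power_mult_distrib)
    then show ?thesis using X t \<open>0 < X2\<close> by (simp add: divide_le_eq mult_ac)
  qed
  have eq: "Y - u0 / complex_of_real (sqrt r0) = (u - u0) / complex_of_real (sqrt r0) + Y * complex_of_real ((sqrt r0 - sqrt r) / sqrt r0)"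
  proof -
    have "Y * complex_of_real ((sqrt r0 - sqrt r) / sqrt r0) = Y - u / complex_of_real (sqrt r0)"
      unfolding Yr[symmetric] using r0p by (simp add: field_simps)
    then show ?thesis by (simp add: diff_divide_distrib)
  qed
  have two: "(cmod (a + b))\<^sup>2 \<le> 2 * (cmod a)\<^sup>2 + 2 * (cmod b)\<^sup>2" for a b :: complex
  proof -
    have "(cmod (a + b))\<^sup>2 \<le> (cmod a + cmod b)\<^sup>2" by (intro power_mono norm_triangle_ineq) simp
    also have "\<dots> \<le> 2 * (cmod a)\<^sup>2 + 2 * (cmod b)\<^sup>2"
      using sum_squares_bound[of "cmod a" "cmod b"] by (simp add: power2_sum)
    finally show ?thesis .
  qed
  have sq: "((sqrt r0 - sqrt r) / sqrt r0)\<^sup>2 \<le> (r - r0)\<^sup>2 / c0\<^sup>2"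
  proof -
    have "(sqrt r0 - sqrt r) * (sqrt r0 + sqrt r) = r0 - r"
      using r r0p by (simp add: algebra_simps)
    then have "\<bar>r0 - r\<bar> = \<bar>sqrt r0 - sqrt r\<bar> * (sqrt r0 + sqrt r)"
      using r r0p by (metis abs_mult abs_of_nonneg add_nonneg_nonneg less_imp_le real_sqrt_ge_zero)
    moreover have "\<bar>sqrt r0 - sqrt r\<bar> * sqrt r0 \<le> \<bar>sqrt r0 - sqrt r\<bar> * (sqrt r0 + sqrt r)"
      using r by (intro mult_left_mono) auto
    ultimately have "\<bar>sqrt r0 - sqrt r\<bar> * sqrt r0 \<le> \<bar>r0 - r\<bar>" by simp
    then have "(\<bar>sqrt r0 - sqrt r\<bar> * sqrt r0)\<^sup>2 \<le> \<bar>r0 - r\<bar>\<^sup>2" using r0p by (intro power_mono) auto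
    then have "(sqrt r0 - sqrt r)\<^sup>2 * r0 \<le> (r - r0)\<^sup>2"
      using r0p by (simp add: power_mult_distrib power2_commute[of r0 r])
    then have "(sqrt r0 - sqrt r)\<^sup>2 * r0 / r0\<^sup>2 \<le> (r - r0)\<^sup>2 / r0\<^sup>2" by (rule divide_right_mono) simp
    moreover have "((sqrt r0 - sqrt r) / sqrt r0)\<^sup>2 = (sqrt r0 - sqrt r)\<^sup>2 * r0 / r0\<^sup>2"
      using r0p unfolding power_divide by (simp add: power2_eq_square)
    ultimately have "((sqrt r0 - sqrt r) / sqrt r0)\<^sup>2 \<le> (r - r0)\<^sup>2 / r0\<^sup>2" by simp
    also have "\<dots> \<le> (r - r0)\<^sup>2 / c0\<^sup>2" using c0 r0 by (intro divide_left_mono power_mono mult_pos_pos zero_less_power) auto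
    finally show ?thesis .
  qed
  have "(cmod (X / complex_of_real (sqrt X2) / complex_of_real (sqrt t) - u0 / complex_of_real (sqrt r0)))\<^sup>2 \<le> 2 * (cmod ((u - u0) / complex_of_real (sqrt r0)))\<^sup>2 + 2 * (cmod (Y * complex_of_real ((sqrt r0 - sqrt r) / sqrt r0)))\<^sup>2"
    unfolding Y_def[symmetric] eq by (rule two)
  also have "\<dots> \<le> 2 * ((cmod (u - u0))\<^sup>2 / c0) + 2 * (q * ((r - r0)\<^sup>2 / c0\<^sup>2))"
  proof (intro add_mono mult_left_mono)
    show "(cmod ((u - u0) / complex_of_real (sqrt r0)))\<^sup>2 \<le> (cmod (u - u0))\<^sup>2 / c0"
      using r0p c0 r0 by (simp add: norm_divide power_divide divide_left_mono)
    have "(cmod (Y * complex_of_real ((sqrt r0 - sqrt r) / sqrt r0)))\<^sup>2 = (cmod Y)\<^sup>2 * ((sqrt r0 - sqrt r) / sqrt r0)\<^sup>2"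
      unfolding norm_mult norm_of_real power_mult_distrib power2_abs ..
    also have "\<dots> \<le> q * ((r - r0)\<^sup>2 / c0\<^sup>2)" using Yq[folded Y_def] sq q by (intro mult_mono) auto
    finally show "(cmod (Y * complex_of_real ((sqrt r0 - sqrt r) / sqrt r0)))\<^sup>2 \<le> q * ((r - r0)\<^sup>2 / c0\<^sup>2)" .
  qed simp_all
  finally show "(cmod (X / complex_of_real (sqrt X2) / complex_of_real (sqrt t) - u0 / complex_of_real (sqrt r0)))\<^sup>2 \<le> 2 * (cmod (X / complex_of_real t - u0))\<^sup>2 / c0 + 2 * q * (X2 / t - r0)\<^sup>2 / c0\<^sup>2" by (simp add: u_def r_def)
  have "(cmod (X / complex_of_real (sqrt X2) / complex_of_real (sqrt t) - u0 / complex_of_real (sqrt r0)))\<^sup>2 \<le> 2 * (cmod Y)\<^sup>2 + 2 * (cmod (- (u0 / complex_of_real (sqrt r0))))\<^sup>2"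
    using two[of Y "- (u0 / complex_of_real (sqrt r0))"] by (simp add: Y_def)
  also have "\<dots> \<le> 2 * q + 2 * ((cmod u0)\<^sup>2 / c0)"
    using Yq[folded Y_def] r0p c0 r0 by (intro add_mono mult_left_mono) (simp_all add: norm_divide power_divide divide_left_mono)
  finally show "(cmod (X / complex_of_real (sqrt X2) / complex_of_real (sqrt t) - u0 / complex_of_real (sqrt r0)))\<^sup>2 \<le> 2 * q + 2 * (cmod u0)\<^sup>2 / c0" by simp
qed

text \<open>Off the event \<open>q \<le> m + 1\<close> the crude bound is paid for by \<open>(q - m)\<^sup>2 \<ge> 1\<close>.\<close>

lemma ratio_bound_truncated:
  fixes L :: real
  assumes "L \<le> 2 * U / c0 + 2 * q * V / c0\<^sup>2" "L \<le> 2 * q + 2 * x / c0" "0 \<le> U" "0 \<le> V" "0 \<le> x" "0 \<le> q" "0 \<le> m" "0 < c0"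
  shows "L \<le> 2 / c0 * U + 2 * (m + 1) / c0\<^sup>2 * V + 2 * (m + 1) * (q - m)\<^sup>2 + 2 / c0 * (x * (q - m)\<^sup>2)"
proof (cases "q \<le> m + 1")
  case True
  have "2 * q * V / c0\<^sup>2 \<le> 2 * (m + 1) / c0\<^sup>2 * V"
    using True assms by (simp add: divide_right_mono mult_right_mono)
  then have "L \<le> 2 / c0 * U + 2 * (m + 1) / c0\<^sup>2 * V" using assms(1) by simp
  moreover have "0 \<le> 2 * (m + 1) * (q - m)\<^sup>2" "0 \<le> 2 / c0 * (x * (q - m)\<^sup>2)" using assms by auto
  ultimately show ?thesis by linarith
next
  case False
  define y where "y = q - m"
  have y: "1 \<le> y" using False by (simp add: y_def)
  have y2: "y \<le> y\<^sup>2" "1 \<le> y\<^sup>2" using y by (auto simp: power2_eq_square mult_le_cancel_left1 intro: order_trans[OF y])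
  have "q = m + y" by (simp add: y_def)
  also have "\<dots> \<le> m * y\<^sup>2 + y\<^sup>2" using y2 assms by (intro add_mono) (auto simp: mult_le_cancel_left1)
  finally have "2 * q \<le> 2 * (m + 1) * y\<^sup>2" by (simp add: algebra_simps)
  moreover have "2 * x / c0 \<le> 2 / c0 * (x * y\<^sup>2)"
  proof -
    have "x \<le> x * y\<^sup>2" using y2 assms by (auto simp: mult_le_cancel_left1)
    then show ?thesis using assms by (simp add: divide_right_mono)
  qed
  moreover have "0 \<le> 2 / c0 * U" "0 \<le> 2 * (m + 1) / c0\<^sup>2 * V" using assms by auto
  ultimately show ?thesis using assms(2) unfolding y_def[symmetric] by linarith
qed

locale uplink_rho = uplink_sys P N U for P N U +
  fixes \<rho> K :: real
  assumes rho1: "1 \<le> \<rho>" and R_rho: "opb N R \<rho>" and S_rho: "opb N S \<rho>" and kp_rho: "kp \<le> \<rho>" and sigma_rho: "sigma2 P \<le> \<rho>"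
    and A_rho: "opb N A \<rho>" and C4: "1 + 8 * ((p_UE P)\<^sup>2 + 2 * (kappa_t P * p_UE P)\<^sup>2) \<le> \<rho>"
    and K_rho: "K \<le> \<rho>" and quad: "interf_quadratic_bound N U K"
begin

sublocale uplink_bounds P N U \<rho> \<rho>
  using R_rho S_rho by unfold_locales

definition "Delta = 2 * \<rho> ^ 6 * sqrt (real N)"
definition "B i j = (\<Sum>k<N. cnj (A k i) * A k j)"
definition "s w = d + eta_t U w"

lemma Delta_pos: "0 < Delta"
  using rho1 N1 by (simp add: Delta_def)

lemma Delta_sq: "2 * \<rho> ^ 12 * real N \<le> Delta\<^sup>2"
  using rho1 by (simp add: Delta_def power_mult_distrib power_mult[symmetric])

lemma rho_power: "k \<le> 12 \<Longrightarrow> \<rho> ^ k \<le> \<rho> ^ 12"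
  using rho1 by (intro power_increasing) auto

lemma B_bound: "opb N B (\<rho> * \<rho>)"
  unfolding B_def[abs_def] by (rule opb_mult[OF opb_adjoint[OF A_rho] A_rho])

lemma B_hermitian: "B j i = cnj (B i j)"
  by (simp add: B_def cnj_sum mult.commute)

lemma trace_B: "(\<Sum>i<N. \<Sum>j<N. B i j * L j i) = qA L"
proof -
  have "(\<Sum>i<N. \<Sum>j<N. B i j * L j i) = (\<Sum>i<N. \<Sum>k<N. \<Sum>j<N. A k j * L j i * cnj (A k i))"
  proof (rule sum.cong[OF refl])
    fix i
    have "(\<Sum>j<N. B i j * L j i) = (\<Sum>j<N. \<Sum>k<N. A k j * L j i * cnj (A k i))"
      unfolding B_def sum_distrib_right by (simp only: mult_ac)
    also have "\<dots> = (\<Sum>k<N. \<Sum>j<N. A k j * L j i * cnj (A k i))" by (rule sum.swap)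
    finally show "(\<Sum>j<N. B i j * L j i) = (\<Sum>k<N. \<Sum>j<N. A k j * L j i * cnj (A k i))" .
  qed
  also have "\<dots> = (\<Sum>k<N. \<Sum>i<N. \<Sum>j<N. A k j * L j i * cnj (A k i))" by (rule sum.swap)
  also have "\<dots> = qA L" unfolding qA_def sesq_def by (intro sum.cong refl sum.swap)
  finally show ?thesis .
qed

lemma trace_B_Psi:
  "complex_of_real beta = complex_of_real kp * (\<Sum>i<N. B i i * R i i) + (\<Sum>i<N. B i i * complex_of_real (sigma2 P)) + (\<Sum>i<N. \<Sum>j<N. B i j * S j i)"
proof -
  have "(\<Sum>i<N. \<Sum>j<N. B i j * Psim $$ (j, i)) = (\<Sum>i<N. B i i * (complex_of_real kp * R i i + complex_of_real (sigma2 P)) + (\<Sum>j<N. B i j * S j i))"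
  proof (intro sum.cong refl)
    fix i assume i: "i \<in> {..<N}"
    have "(\<Sum>j<N. B i j * Psim $$ (j, i)) = (\<Sum>j<N. (if i = j then B i i * (complex_of_real kp * R i i + complex_of_real (sigma2 P)) else 0) + B i j * S j i)"
      using i by (intro sum.cong refl) (auto simp: Psi_entry distrib_left)
    then show "(\<Sum>j<N. B i j * Psim $$ (j, i)) = B i i * (complex_of_real kp * R i i + complex_of_real (sigma2 P)) + (\<Sum>j<N. B i j * S j i)"
      using i by (simp add: sum.distrib)
  qed
  then show ?thesis unfolding qA_Psi[symmetric] trace_B[symmetric]
    by (simp add: sum.distrib distrib_left sum_distrib_left mult_ac)
qed

lemma l2_Delta:
  assumes "f \<in> borel_measurable (prb U)" "msq (prb U) f \<le> ennreal C" "C \<le> 2 * \<rho> ^ 12 * real N"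
  shows "l2 (prb U) f Delta"
  using l2I[OF assms(1) Delta_pos assms(2)] Delta_sq assms(3) by linarith

lemma rho_bound:
  assumes "C \<le> a * \<rho> ^ k * real N" "k \<le> 12" "0 \<le> a" "a \<le> 2"
  shows "C \<le> 2 * \<rho> ^ 12 * real N"
proof -
  have "a * \<rho> ^ k * real N \<le> 2 * \<rho> ^ 12 * real N"
    using assms rho_power[OF assms(2)] rho1 by (intro mult_mono mult_right_mono mult_nonneg_nonneg) auto
  then show ?thesis using assms by linarith
qed

lemma s_moments:
  "msq (CN (kappa_t P * p_UE P)) (\<lambda>z. complex_of_real ((cmod (d + z))\<^sup>2)) \<le> ennreal \<rho>"
  "msq (CN (kappa_t P * p_UE P)) (\<lambda>z. d + z) \<le> ennreal \<rho>"
  "msq (CN (kappa_t P * p_UE P)) (\<lambda>z. cnj (d + z)) \<le> ennreal \<rho>"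
  "(\<integral>\<^sup>+z. ennreal ((cmod 1)\<^sup>2) \<partial>CN (kappa_t P * p_UE P)) \<le> ennreal \<rho>"
proof -
  let ?v = "kappa_t P * p_UE P"
  have v: "0 \<le> ?v" using kt_nonneg p_pos by simp
  have pw: "(cmod (d + z)) ^ 4 \<le> 8 * ((p_UE P)\<^sup>2 + (cmod z) ^ 4)" for z
  proof -
    have sq: "(x + y)\<^sup>2 \<le> 2 * (x\<^sup>2 + y\<^sup>2)" for x y :: real
      using sum_squares_bound[of x y] by (simp add: power2_sum)
    have "(cmod (d + z))\<^sup>2 \<le> (cmod d + cmod z)\<^sup>2" by (intro power_mono norm_triangle_ineq) simp
    also have "\<dots> \<le> 2 * (p_UE P + (cmod z)\<^sup>2)" using sq[of "cmod d" "cmod z"] by (simp add: d_norm)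
    finally have "((cmod (d + z))\<^sup>2)\<^sup>2 \<le> (2 * (p_UE P + (cmod z)\<^sup>2))\<^sup>2" by (intro power_mono) auto
    also have "\<dots> = 4 * (p_UE P + (cmod z)\<^sup>2)\<^sup>2" unfolding power_mult_distrib by simp
    also have "\<dots> \<le> 4 * (2 * ((p_UE P)\<^sup>2 + ((cmod z)\<^sup>2)\<^sup>2))" by (intro mult_left_mono sq) simp
    finally show ?thesis by simp
  qed
  have int: "(\<integral>\<^sup>+z. ennreal (1 + 8 * ((p_UE P)\<^sup>2 + (cmod z) ^ 4)) \<partial>CN ?v) = ennreal (1 + 8 * ((p_UE P)\<^sup>2 + 2 * ?v\<^sup>2))"
  proof (rule nn_integral_has_bochner_integral)
    have c: "has_bochner_integral (CN ?v) (\<lambda>z. a) a" for a :: real by (simp add: has_bochner_integral_iff)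
    show "has_bochner_integral (CN ?v) (\<lambda>z. 1 + 8 * ((p_UE P)\<^sup>2 + (cmod z) ^ 4)) (1 + 8 * ((p_UE P)\<^sup>2 + 2 * ?v\<^sup>2))"
      by (intro has_bochner_integral_add has_bochner_integral_mult_right c CN_moments v)
  qed auto
  have le: "(\<integral>\<^sup>+z. ennreal (g z) \<partial>CN ?v) \<le> ennreal \<rho>" if "\<And>z. g z \<le> 1 + (cmod (d + z)) ^ 4" for g
  proof -
    have "(\<integral>\<^sup>+z. ennreal (g z) \<partial>CN ?v) \<le> (\<integral>\<^sup>+z. ennreal (1 + 8 * ((p_UE P)\<^sup>2 + (cmod z) ^ 4)) \<partial>CN ?v)"
      using that pw by (intro nn_integral_mono ennreal_leI) (meson add_left_mono order_trans)
    also have "\<dots> \<le> ennreal \<rho>" unfolding int using C4 by (intro ennreal_leI) simp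
    finally show ?thesis .
  qed
  have x2: "x\<^sup>2 \<le> 1 + x ^ 4" for x :: real
  proof -
    have "0 \<le> (x\<^sup>2 - 1)\<^sup>2" by simp
    then have "2 * x\<^sup>2 \<le> x ^ 4 + 1" by (simp add: power2_diff)
    then show ?thesis using zero_le_power2[of x] by linarith
  qed
  show "msq (CN ?v) (\<lambda>z. complex_of_real ((cmod (d + z))\<^sup>2)) \<le> ennreal \<rho>"
    by (rule le) (simp add: norm_power)
  show "msq (CN ?v) (\<lambda>z. d + z) \<le> ennreal \<rho>" by (rule le[OF x2])
  show "msq (CN ?v) (\<lambda>z. cnj (d + z)) \<le> ennreal \<rho>" unfolding complex_mod_cnj by (rule le[OF x2])
  show "(\<integral>\<^sup>+z. ennreal ((cmod 1)\<^sup>2) \<partial>CN ?v) \<le> ennreal \<rho>" by (rule le) simp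
qed

lemma s_fun_meas:
  "(\<lambda>z. complex_of_real ((cmod (d + z))\<^sup>2)) \<in> borel_measurable borel" "(\<lambda>z. d + z) \<in> borel_measurable borel"
  "(\<lambda>z. cnj (d + z)) \<in> borel_measurable borel" "(\<lambda>z::complex. 1::complex) \<in> borel_measurable borel"
  by (simp_all add: borel_measurable_cnj' borel_measurable_complex_of_real' borel_measurable_norm2)

lemma bil_meas:
  assumes "\<And>i. i < N \<Longrightarrow> (\<lambda>w. x w i) \<in> borel_measurable M" "\<And>i. i < N \<Longrightarrow> (\<lambda>w. y w i) \<in> borel_measurable M"
  shows "(\<lambda>w. bil N C (x w) (y w)) \<in> borel_measurable M"
  unfolding bil_def by (intro meas_intros assms) auto

lemma s_meas: "s \<in> borel_measurable (prb U)"
  unfolding s_def[abs_def] by (intro meas_intros eta_meas)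

lemma rho_nn: "0 \<le> \<rho>" using rho1 by simp

lemma A_terms:
  "l2 (prb U) (\<lambda>w. s w * (bil N A (h w) (h w) - complex_of_real tau / d)) Delta"
  "l2 (prb U) (\<lambda>w. bil N A (h w) (er w)) Delta"
  "l2 (prb U) (\<lambda>w. bil N A (h w) (nr w)) Delta"
  "l2 (prb U) (\<lambda>w. bil N A (h w) (interf U w)) Delta"
proof -
  show "l2 (prb U) (\<lambda>w. s w * (bil N A (h w) (h w) - complex_of_real tau / d)) Delta"
  proof (rule l2_Delta)
    show "msq (prb U) (\<lambda>w. s w * (bil N A (h w) (h w) - complex_of_real tau / d)) \<le> ennreal (\<rho> * (\<rho>\<^sup>2 * (real N * \<rho>\<^sup>2)))"
      using quad_h[OF A_rho s_fun_meas(2) rho_nn s_moments(2)] unfolding trace_A_R bil_def s_def .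
    show "\<rho> * (\<rho>\<^sup>2 * (real N * \<rho>\<^sup>2)) \<le> 2 * \<rho> ^ 12 * real N"
      by (intro rho_bound[of _ 1 5]) (simp_all add: power_numeral_reduce mult_ac)
  qed (intro meas_intros s_meas bil_meas comp_meas, assumption+)
  show "l2 (prb U) (\<lambda>w. bil N A (h w) (nr w)) Delta"
  proof (rule l2_Delta)
    show "msq (prb U) (\<lambda>w. bil N A (h w) (nr w)) \<le> ennreal (\<rho> * (sigma2 P * (\<rho> * (real N * \<rho>\<^sup>2))))"
      using cross_h_nr[OF A_rho s_fun_meas(4) rho_nn s_moments(4)] unfolding bil_columns by simp
    have "\<rho> * (sigma2 P * (\<rho> * (real N * \<rho>\<^sup>2))) \<le> \<rho> * (\<rho> * (\<rho> * (real N * \<rho>\<^sup>2)))"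
      using sigma_rho rho_nn by (intro mult_left_mono mult_right_mono) auto
    then show "\<rho> * (sigma2 P * (\<rho> * (real N * \<rho>\<^sup>2))) \<le> 2 * \<rho> ^ 12 * real N"
      by (intro rho_bound[of _ 1 5]) (simp_all add: power_numeral_reduce mult_ac)
  qed (intro bil_meas comp_meas, assumption+)
  show "l2 (prb U) (\<lambda>w. bil N A (h w) (interf U w)) Delta"
  proof (rule l2_Delta)
    show "msq (prb U) (\<lambda>w. bil N A (h w) (interf U w)) \<le> ennreal (\<rho> * (\<rho> * (\<rho> * (real N * \<rho>\<^sup>2))))"
      using cross_h_ni[OF A_rho s_fun_meas(4) rho_nn s_moments(4)] unfolding bil_columns by simp
    show "\<rho> * (\<rho> * (\<rho> * (real N * \<rho>\<^sup>2))) \<le> 2 * \<rho> ^ 12 * real N"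
      by (intro rho_bound[of _ 1 5]) (simp_all add: power_numeral_reduce mult_ac)
  qed (intro bil_meas comp_meas, assumption+)
  show "l2 (prb U) (\<lambda>w. bil N A (h w) (er w)) Delta"
  proof (rule l2_Delta)
    show "msq (prb U) (\<lambda>w. bil N A (h w) (er w)) \<le> ennreal (\<rho> * (kp * (real N * (\<rho>\<^sup>2 * (\<rho> ^ 4 + 1)))))"
      using cross_h_er[OF A_rho s_fun_meas(4) rho_nn s_moments(4)] unfolding bil_columns by simp
    have "\<rho> * (kp * (real N * (\<rho>\<^sup>2 * (\<rho> ^ 4 + 1)))) \<le> \<rho> * (\<rho> * (real N * (\<rho>\<^sup>2 * (\<rho> ^ 4 + \<rho> ^ 4))))"
      using kp_rho kp_nonneg rho_nn one_le_power[OF rho1, of 4] by (intro mult_left_mono mult_mono mult_nonneg_nonneg) auto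
    also have "\<dots> = 2 * \<rho> ^ 8 * real N" by (simp add: power_numeral_reduce)
    finally show "\<rho> * (kp * (real N * (\<rho>\<^sup>2 * (\<rho> ^ 4 + 1)))) \<le> 2 * \<rho> ^ 12 * real N"
      by (intro rho_bound[of _ 2 8]) simp_all
  qed (intro bil_meas comp_meas, assumption+)
qed

lemma B_cross_terms:
  "l2 (prb U) (\<lambda>w. bil N B (\<lambda>i. s w * h w i) (er w)) Delta"
  "l2 (prb U) (\<lambda>w. bil N B (\<lambda>i. s w * h w i) (nr w)) Delta"
  "l2 (prb U) (\<lambda>w. bil N B (\<lambda>i. s w * h w i) (interf U w)) Delta"
  "l2 (prb U) (\<lambda>w. bil N B (er w) (nr w)) Delta"
  "l2 (prb U) (\<lambda>w. bil N B (er w) (interf U w)) Delta"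
  "l2 (prb U) (\<lambda>w. bil N B (nr w) (interf U w)) Delta"
proof -
  show "l2 (prb U) (\<lambda>w. bil N B (\<lambda>i. s w * h w i) (er w)) Delta"
    unfolding bil_scale_left
  proof (rule l2_Delta)
    show "msq (prb U) (\<lambda>w. cnj (s w) * bil N B (h w) (er w)) \<le> ennreal (\<rho> * (kp * (real N * (\<rho>\<^sup>2 * ((\<rho> * \<rho>) ^ 4 + 1)))))"
      using cross_h_er[OF B_bound s_fun_meas(3) rho_nn s_moments(3)] unfolding bil_columns s_def .
    have "\<rho> * (kp * (real N * (\<rho>\<^sup>2 * ((\<rho> * \<rho>) ^ 4 + 1)))) \<le> \<rho> * (\<rho> * (real N * (\<rho>\<^sup>2 * ((\<rho> * \<rho>) ^ 4 + (\<rho> * \<rho>) ^ 4))))"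
      using kp_rho kp_nonneg rho_nn one_le_power[of "\<rho> * \<rho>" 4] rho1 mult_mono[OF rho1 rho1]
      by (intro mult_left_mono mult_mono mult_nonneg_nonneg) auto
    also have "\<dots> = 2 * \<rho> ^ 12 * real N" by (simp add: power_numeral_reduce)
    finally show "\<rho> * (kp * (real N * (\<rho>\<^sup>2 * ((\<rho> * \<rho>) ^ 4 + 1)))) \<le> 2 * \<rho> ^ 12 * real N" .
  qed (intro meas_intros s_meas bil_meas comp_meas, assumption+)
  show "l2 (prb U) (\<lambda>w. bil N B (\<lambda>i. s w * h w i) (nr w)) Delta"
    unfolding bil_scale_left
  proof (rule l2_Delta)
    show "msq (prb U) (\<lambda>w. cnj (s w) * bil N B (h w) (nr w)) \<le> ennreal (\<rho> * (sigma2 P * (\<rho> * (real N * (\<rho> * \<rho>)\<^sup>2))))"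
      using cross_h_nr[OF B_bound s_fun_meas(3) rho_nn s_moments(3)] unfolding bil_columns s_def .
    have "\<rho> * (sigma2 P * (\<rho> * (real N * (\<rho> * \<rho>)\<^sup>2))) \<le> \<rho> * (\<rho> * (\<rho> * (real N * (\<rho> * \<rho>)\<^sup>2)))"
      using sigma_rho rho_nn by (intro mult_left_mono mult_right_mono) auto
    then show "\<rho> * (sigma2 P * (\<rho> * (real N * (\<rho> * \<rho>)\<^sup>2))) \<le> 2 * \<rho> ^ 12 * real N"
      by (intro rho_bound[of _ 1 7]) (simp_all add: power_numeral_reduce mult_ac)
  qed (intro meas_intros s_meas bil_meas comp_meas, assumption+)
  show "l2 (prb U) (\<lambda>w. bil N B (\<lambda>i. s w * h w i) (interf U w)) Delta"
    unfolding bil_scale_left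
  proof (rule l2_Delta)
    show "msq (prb U) (\<lambda>w. cnj (s w) * bil N B (h w) (interf U w)) \<le> ennreal (\<rho> * (\<rho> * (\<rho> * (real N * (\<rho> * \<rho>)\<^sup>2))))"
      using cross_h_ni[OF B_bound s_fun_meas(3) rho_nn s_moments(3)] unfolding bil_columns s_def .
    show "\<rho> * (\<rho> * (\<rho> * (real N * (\<rho> * \<rho>)\<^sup>2))) \<le> 2 * \<rho> ^ 12 * real N"
      by (intro rho_bound[of _ 1 7]) (simp_all add: power_numeral_reduce mult_ac)
  qed (intro meas_intros s_meas bil_meas comp_meas, assumption+)
  show "l2 (prb U) (\<lambda>w. bil N B (er w) (nr w)) Delta"
  proof (rule l2_Delta)
    show "msq (prb U) (\<lambda>w. bil N B (er w) (nr w)) \<le> ennreal (sigma2 P * (kp * (\<rho> * (real N * (\<rho> * \<rho>)\<^sup>2))))"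
      using cross_er_nr[OF B_bound] unfolding bil_columns .
    have "sigma2 P * (kp * (\<rho> * (real N * (\<rho> * \<rho>)\<^sup>2))) \<le> \<rho> * (\<rho> * (\<rho> * (real N * (\<rho> * \<rho>)\<^sup>2)))"
      using sigma_rho sigma2_pos kp_rho kp_nonneg rho_nn by (intro mult_mono mult_nonneg_nonneg) auto
    then show "sigma2 P * (kp * (\<rho> * (real N * (\<rho> * \<rho>)\<^sup>2))) \<le> 2 * \<rho> ^ 12 * real N"
      by (intro rho_bound[of _ 1 7]) (simp_all add: power_numeral_reduce mult_ac)
  qed (intro bil_meas comp_meas, assumption+)
  show "l2 (prb U) (\<lambda>w. bil N B (er w) (interf U w)) Delta"
  proof (rule l2_Delta)
    show "msq (prb U) (\<lambda>w. bil N B (er w) (interf U w)) \<le> ennreal (kp * (\<rho> * (\<rho> * (real N * (\<rho> * \<rho>)\<^sup>2))))"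
      using cross_ni_er[OF B_bound] unfolding bil_rows[symmetric] complex_mod_cnj .
    have "kp * (\<rho> * (\<rho> * (real N * (\<rho> * \<rho>)\<^sup>2))) \<le> \<rho> * (\<rho> * (\<rho> * (real N * (\<rho> * \<rho>)\<^sup>2)))"
      using kp_rho rho_nn by (intro mult_right_mono) auto
    then show "kp * (\<rho> * (\<rho> * (real N * (\<rho> * \<rho>)\<^sup>2))) \<le> 2 * \<rho> ^ 12 * real N"
      by (intro rho_bound[of _ 1 7]) (simp_all add: power_numeral_reduce mult_ac)
  qed (intro bil_meas comp_meas, assumption+)
  show "l2 (prb U) (\<lambda>w. bil N B (nr w) (interf U w)) Delta"
  proof (rule l2_Delta)
    show "msq (prb U) (\<lambda>w. bil N B (nr w) (interf U w)) \<le> ennreal (sigma2 P * (\<rho> * (real N * (\<rho> * \<rho>)\<^sup>2)))"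
      using cross_ni_nr[OF B_bound] unfolding bil_rows[symmetric] complex_mod_cnj .
    have "sigma2 P * (\<rho> * (real N * (\<rho> * \<rho>)\<^sup>2)) \<le> \<rho> * (\<rho> * (real N * (\<rho> * \<rho>)\<^sup>2))"
      using sigma_rho rho_nn by (intro mult_right_mono) auto
    then show "sigma2 P * (\<rho> * (real N * (\<rho> * \<rho>)\<^sup>2)) \<le> 2 * \<rho> ^ 12 * real N"
      by (intro rho_bound[of _ 1 6]) (simp_all add: power_numeral_reduce mult_ac)
  qed (intro bil_meas comp_meas, assumption+)
qed

lemma B_quad_terms:
  "l2 (prb U) (\<lambda>w. complex_of_real ((cmod (s w))\<^sup>2) * (bil N B (h w) (h w) - complex_of_real alpha)) Delta"
  "l2 (prb U) (\<lambda>w. bil N B (er w) (er w) - (\<Sum>i<N. B i i * complex_of_real (kp * (cmod (h w i))\<^sup>2))) Delta"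
  "l2 (prb U) (\<lambda>w. (\<Sum>i<N. B i i * complex_of_real (kp * (cmod (h w i))\<^sup>2)) - complex_of_real kp * (\<Sum>i<N. B i i * R i i)) Delta"
  "l2 (prb U) (\<lambda>w. bil N B (nr w) (nr w) - (\<Sum>i<N. B i i * complex_of_real (sigma2 P))) Delta"
  "l2 (prb U) (\<lambda>w. bil N B (interf U w) (interf U w) - (\<Sum>i<N. \<Sum>j<N. B i j * S j i)) Delta"
proof -
  have kp2: "kp\<^sup>2 \<le> \<rho>\<^sup>2" using kp_rho kp_nonneg by (intro power_mono) auto
  have si2: "(sigma2 P)\<^sup>2 \<le> \<rho>\<^sup>2" using sigma_rho sigma2_pos by (intro power_mono) auto
  have dm: "(\<lambda>w. \<Sum>i<N. B i i * complex_of_real (kp * (cmod (h w i))\<^sup>2)) \<in> borel_measurable (prb U)"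
    by (intro meas_intros borel_measurable_complex_of_real' borel_measurable_norm2 h_meas_i) simp
  show "l2 (prb U) (\<lambda>w. complex_of_real ((cmod (s w))\<^sup>2) * (bil N B (h w) (h w) - complex_of_real alpha)) Delta"
  proof (rule l2_Delta)
    show "msq (prb U) (\<lambda>w. complex_of_real ((cmod (s w))\<^sup>2) * (bil N B (h w) (h w) - complex_of_real alpha)) \<le> ennreal (\<rho> * (\<rho>\<^sup>2 * (real N * (\<rho> * \<rho>)\<^sup>2)))"
      using quad_h[OF B_bound s_fun_meas(1) rho_nn s_moments(1)] unfolding trace_B qA_R bil_def s_def .
    show "\<rho> * (\<rho>\<^sup>2 * (real N * (\<rho> * \<rho>)\<^sup>2)) \<le> 2 * \<rho> ^ 12 * real N"
      by (intro rho_bound[of _ 1 7]) (simp_all add: power_numeral_reduce mult_ac)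
  qed (intro meas_intros borel_measurable_complex_of_real' borel_measurable_norm2 s_meas bil_meas comp_meas, assumption+)
  show "l2 (prb U) (\<lambda>w. bil N B (er w) (er w) - (\<Sum>i<N. B i i * complex_of_real (kp * (cmod (h w i))\<^sup>2))) Delta"
  proof (rule l2_Delta)
    show "msq (prb U) (\<lambda>w. bil N B (er w) (er w) - (\<Sum>i<N. B i i * complex_of_real (kp * (cmod (h w i))\<^sup>2))) \<le> ennreal (2 * kp\<^sup>2 * \<rho>\<^sup>2 * (real N * (\<rho> * \<rho>)\<^sup>2))"
      using quad_er[OF B_bound] unfolding bil_def .
    have "2 * kp\<^sup>2 * \<rho>\<^sup>2 * (real N * (\<rho> * \<rho>)\<^sup>2) \<le> 2 * \<rho>\<^sup>2 * \<rho>\<^sup>2 * (real N * (\<rho> * \<rho>)\<^sup>2)"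
      using kp2 rho_nn by (intro mult_right_mono mult_left_mono) auto
    also have "\<dots> = 2 * \<rho> ^ 8 * real N" by (simp add: power_numeral_reduce)
    finally show "2 * kp\<^sup>2 * \<rho>\<^sup>2 * (real N * (\<rho> * \<rho>)\<^sup>2) \<le> 2 * \<rho> ^ 12 * real N"
      by (intro rho_bound[of _ 2 8]) simp_all
  qed (intro borel_measurable_diff bil_meas comp_meas dm, assumption+)
  show "l2 (prb U) (\<lambda>w. (\<Sum>i<N. B i i * complex_of_real (kp * (cmod (h w i))\<^sup>2)) - complex_of_real kp * (\<Sum>i<N. B i i * R i i)) Delta"
  proof (rule l2_Delta[OF _ quad_diag[OF B_bound]])
    have "kp\<^sup>2 * (\<rho>\<^sup>2 * (real N * (\<rho> * \<rho>)\<^sup>2)) \<le> \<rho>\<^sup>2 * (\<rho>\<^sup>2 * (real N * (\<rho> * \<rho>)\<^sup>2))"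
      using kp2 rho_nn by (intro mult_right_mono) auto
    then show "kp\<^sup>2 * (\<rho>\<^sup>2 * (real N * (\<rho> * \<rho>)\<^sup>2)) \<le> 2 * \<rho> ^ 12 * real N"
      by (intro rho_bound[of _ 1 8]) (simp_all add: power_numeral_reduce mult_ac)
  qed (intro borel_measurable_diff borel_measurable_const dm)
  show "l2 (prb U) (\<lambda>w. bil N B (nr w) (nr w) - (\<Sum>i<N. B i i * complex_of_real (sigma2 P))) Delta"
  proof (rule l2_Delta)
    show "msq (prb U) (\<lambda>w. bil N B (nr w) (nr w) - (\<Sum>i<N. B i i * complex_of_real (sigma2 P))) \<le> ennreal ((sigma2 P)\<^sup>2 * (real N * (\<rho> * \<rho>)\<^sup>2))"
      using quad_nr[OF B_bound] unfolding bil_def .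
    have "(sigma2 P)\<^sup>2 * (real N * (\<rho> * \<rho>)\<^sup>2) \<le> \<rho>\<^sup>2 * (real N * (\<rho> * \<rho>)\<^sup>2)"
      using si2 rho_nn by (intro mult_right_mono) auto
    then show "(sigma2 P)\<^sup>2 * (real N * (\<rho> * \<rho>)\<^sup>2) \<le> 2 * \<rho> ^ 12 * real N"
      by (intro rho_bound[of _ 1 6]) (simp_all add: power_numeral_reduce mult_ac)
  qed (intro borel_measurable_diff borel_measurable_const bil_meas comp_meas, assumption+)
  show "l2 (prb U) (\<lambda>w. bil N B (interf U w) (interf U w) - (\<Sum>i<N. \<Sum>j<N. B i j * S j i)) Delta"
  proof (rule l2_Delta)
    define Bm where "Bm = Matrix.mat N N (\<lambda>(i, j). B i j)"
    have Bm: "Bm \<in> carrier_mat N N" by (simp add: Bm_def)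
    have Bij: "Bm $$ (i, j) = B i j" if "i < N" "j < N" for i j using that by (simp add: Bm_def)
    have "opb N (\<lambda>i j. Bm $$ (i, j)) (\<rho> * \<rho>)" using B_bound by (rule opb_cong) (simp add: Bij)
    then have sp: "spectral_norm Bm \<le> \<rho> * \<rho>" by (rule opb_spectral_norm(2)[OF Bm N1])
    have sp0: "0 \<le> spectral_norm Bm" by (rule opb_nonneg[OF opb_spectral_norm(1)[OF Bm N1]])
    have q: "(Bm *\<^sub>v Matrix.vec N x) \<bullet>c Matrix.vec N x = bil N B x x" for x
    proof -
      have "(Bm *\<^sub>v Matrix.vec N x) \<bullet>c Matrix.vec N x = (\<Sum>i<N. (Bm *\<^sub>v Matrix.vec N x) $ i * cnj (x i))"
        using cscalar_prod_sum[of "Matrix.vec N x" N "Bm *\<^sub>v Matrix.vec N x"] by simp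
      also have "\<dots> = (\<Sum>i<N. (\<Sum>j<N. B i j * x j) * cnj (x i))"
        by (intro sum.cong refl arg_cong2[where f="(*)"]) (simp_all add: mult_mat_vec_index_sum[OF Bm] app_def Bij)
      also have "\<dots> = bil N B x x" unfolding bil_def sum_distrib_right by (intro sum.cong refl) (simp add: mult_ac)
      finally show ?thesis .
    qed
    have t: "mtrace (Bm * cov_S U) = (\<Sum>i<N. \<Sum>j<N. B i j * S j i)"
    proof -
      have "dim_row (Bm * cov_S U) = N" using Bm by simp
      then show ?thesis unfolding mtrace_def
        by (intro sum.cong) (simp_all add: mat_mult_sum[OF Bm S_carrier] Bij del: index_mult_mat)
    qed
    have "msq (prb U) (\<lambda>w. bil N B (interf U w) (interf U w) - (\<Sum>i<N. \<Sum>j<N. B i j * S j i)) \<le> ennreal (K * real N * (spectral_norm Bm)\<^sup>2)"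
      using quad Bm unfolding interf_quadratic_bound_def q[symmetric] t[symmetric] by blast
    also have "\<dots> \<le> ennreal (\<rho> * real N * (\<rho> * \<rho>)\<^sup>2)"
      using K_rho sp sp0 rho_nn by (intro ennreal_leI order_trans[OF mult_right_mono[OF mult_right_mono[OF K_rho]] mult_left_mono[OF power_mono[OF sp sp0]]]) auto
    finally show "msq (prb U) (\<lambda>w. bil N B (interf U w) (interf U w) - (\<Sum>i<N. \<Sum>j<N. B i j * S j i)) \<le> ennreal (\<rho> * real N * (\<rho> * \<rho>)\<^sup>2)" .
    show "\<rho> * real N * (\<rho> * \<rho>)\<^sup>2 \<le> 2 * \<rho> ^ 12 * real N"
      by (intro rho_bound[of _ 1 5]) (simp_all add: power_numeral_reduce mult_ac)
  qed (intro borel_measurable_diff borel_measurable_const bil_meas comp_meas, assumption+)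
qed

end

lemma nn_integral_add_le:
  fixes f g :: "'a \<Rightarrow> real"
  assumes "f \<in> borel_measurable M" "g \<in> borel_measurable M" "\<And>w. 0 \<le> f w" "\<And>w. 0 \<le> g w" "0 \<le> C" "0 \<le> D"
    "(\<integral>\<^sup>+w. ennreal (f w) \<partial>M) \<le> ennreal C" "(\<integral>\<^sup>+w. ennreal (g w) \<partial>M) \<le> ennreal D"
  shows "(\<integral>\<^sup>+w. ennreal (f w + g w) \<partial>M) \<le> ennreal (C + D)"
  using assms by (simp add: nn_integral_add add_mono)

lemma bil_cong:
  assumes "\<And>i. i < N \<Longrightarrow> x i = x' i" "\<And>i. i < N \<Longrightarrow> y i = y' i"
  shows "bil N C x y = bil N C x' y'"
  unfolding bil_def using assms by (intro sum.cong refl) auto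

lemma integrable_from_nn:
  fixes f :: "'a \<Rightarrow> real"
  assumes "f \<in> borel_measurable M" "\<And>w. 0 \<le> f w" "(\<integral>\<^sup>+w. ennreal (f w) \<partial>M) \<le> ennreal C" "0 \<le> C"
  shows "integrable M f" "(\<integral>w. f w \<partial>M) \<le> C"
proof -
  have "(\<integral>\<^sup>+w. ennreal (f w) \<partial>M) < \<infinity>" using assms(3) by (rule order.strict_trans1) simp
  then show i: "integrable M f" using assms(1,2) by (intro integrableI_nonneg) auto
  have "ennreal (\<integral>w. f w \<partial>M) = (\<integral>\<^sup>+w. ennreal (f w) \<partial>M)"
    using i assms(2) by (intro nn_integral_eq_integral[symmetric]) auto
  then have "ennreal (\<integral>w. f w \<partial>M) \<le> ennreal C" using assms(3) by (simp only:)
  then show "(\<integral>w. f w \<partial>M) \<le> C" by (simp only: ennreal_le_iff[OF assms(4)])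
qed

lemma abs_integral_le:
  fixes f g :: "'a \<Rightarrow> real"
  assumes "integrable M g" "\<And>w. w \<in> space M \<Longrightarrow> \<bar>f w\<bar> \<le> g w"
  shows "\<bar>\<integral>w. f w \<partial>M\<bar> \<le> (\<integral>w. g w \<partial>M)"
proof (cases "integrable M f")
  case True
  have "\<bar>\<integral>w. f w \<partial>M\<bar> \<le> (\<integral>w. \<bar>f w\<bar> \<partial>M)" by (rule integral_abs_bound)
  also have "\<dots> \<le> (\<integral>w. g w \<partial>M)" using True assms by (intro integral_mono) auto
  finally show ?thesis .
next
  case False
  have "0 \<le> (\<integral>w. g w \<partial>M)"
    using assms(2) by (intro Bochner_Integration.integral_nonneg) (meson abs_ge_zero order_trans)
  then show ?thesis using not_integrable_integral_eq[OF False] by simp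
qed

lemma mean_square_comparison:
  fixes f g :: "'a \<Rightarrow> complex"
  assumes "prob_space M" and f: "f \<in> borel_measurable M" and g: "g \<in> borel_measurable M" and \<delta>: "0 < \<delta>" and b: "0 < b"
    and fg: "msq M (\<lambda>w. f w - g w) \<le> ennreal (\<delta>\<^sup>2)"
    and gb: "msq M g \<le> ennreal (b\<^sup>2)"
  shows "\<bar>(cmod (\<integral>w. f w \<partial>M))\<^sup>2 - (cmod (\<integral>w. g w \<partial>M))\<^sup>2\<bar> \<le> \<delta> * (2 * b + \<delta>)"
    and "\<bar>(\<integral>w. (cmod (f w))\<^sup>2 \<partial>M) - (\<integral>w. (cmod (g w))\<^sup>2 \<partial>M)\<bar> \<le> \<delta> * (2 * b + \<delta>)"
    and "integrable M g" and "integrable M (\<lambda>w. (cmod (g w))\<^sup>2)"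
proof -
  interpret prob_space M by fact
  have u: "integrable M (\<lambda>w. (cmod (f w - g w))\<^sup>2)" "(\<integral>w. (cmod (f w - g w))\<^sup>2 \<partial>M) \<le> \<delta>\<^sup>2"
    using integrable_from_nn[OF _ _ fg zero_le_power2] f g by auto
  have v: "integrable M (\<lambda>w. (cmod (g w))\<^sup>2)" "(\<integral>w. (cmod (g w))\<^sup>2 \<partial>M) \<le> b\<^sup>2"
    using integrable_from_nn[OF _ _ gb zero_le_power2] g by auto
  show "integrable M (\<lambda>w. (cmod (g w))\<^sup>2)" by (rule v)
  have young: "2 * x * y \<le> (t / r) * x\<^sup>2 + (r / t) * y\<^sup>2" if "0 < t" "0 < r" for x y t r :: real
  proof -
    have "0 \<le> (t * x - r * y)\<^sup>2 / (t * r)" using that by (intro divide_nonneg_pos) auto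
    also have "\<dots> = (t / r) * x\<^sup>2 + (r / t) * y\<^sup>2 - 2 * x * y"
      using that by (simp add: power2_diff field_simps power2_eq_square)
    finally show ?thesis by simp
  qed
  have norm_l1: "integrable M e \<and> cmod (\<integral>w. e w \<partial>M) \<le> a"
    if e: "e \<in> borel_measurable M" and ei: "integrable M (\<lambda>w. (cmod (e w))\<^sup>2)" "(\<integral>w. (cmod (e w))\<^sup>2 \<partial>M) \<le> a\<^sup>2" and a: "0 < a" for e :: "'a \<Rightarrow> complex" and a
  proof -
    have le: "cmod (e w) \<le> ((cmod (e w))\<^sup>2 / a + a) / 2" for w
      using young[of 1 a "cmod (e w)" 1] a by simp
    have i: "integrable M (\<lambda>w. ((cmod (e w))\<^sup>2 / a + a) / 2)" using ei by simp
    have ie: "integrable M e"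
      using e le by (intro Bochner_Integration.integrable_bound[OF i]) (auto intro!: AE_I2 intro: order_trans[OF _ abs_ge_self])
    have "cmod (\<integral>w. e w \<partial>M) \<le> (\<integral>w. cmod (e w) \<partial>M)" by (rule integral_norm_bound)
    also have "\<dots> \<le> (\<integral>w. ((cmod (e w))\<^sup>2 / a + a) / 2 \<partial>M)" using le ie i by (intro integral_mono) auto
    also have "\<dots> = ((\<integral>w. (cmod (e w))\<^sup>2 \<partial>M) / a + a) / 2" using ei by (simp add: prob_space)
    also have "\<dots> \<le> (a\<^sup>2 / a + a) / 2" using ei a by (intro divide_right_mono add_right_mono) auto
    also have "\<dots> = a" using a by (simp add: power2_eq_square)
    finally show ?thesis using ie by simp
  qed
  have d1: "integrable M (\<lambda>w. f w - g w)" "cmod (\<integral>w. f w - g w \<partial>M) \<le> \<delta>"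
    using norm_l1[OF _ u \<delta>] f g by auto
  have g1: "integrable M g" "cmod (\<integral>w. g w \<partial>M) \<le> b" using norm_l1[OF g v b] by auto
  show "integrable M g" by (rule g1)
  have fi: "integrable M f" using Bochner_Integration.integrable_add[OF d1(1) g1(1)] by simp
  let ?F = "cmod (\<integral>w. f w \<partial>M)" and ?G = "cmod (\<integral>w. g w \<partial>M)"
  have "\<bar>?F - ?G\<bar> \<le> \<delta>"
    using norm_triangle_ineq3[of "\<integral>w. f w \<partial>M" "\<integral>w. g w \<partial>M"] d1(2) fi g1(1) by simp
  then have FG: "?F \<le> ?G + \<delta>" "?G \<le> ?F + \<delta>" by linarith+
  have "\<bar>?F\<^sup>2 - ?G\<^sup>2\<bar> = \<bar>?F - ?G\<bar> * (?F + ?G)"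
    by (simp add: power2_eq_square square_diff_square_factored abs_mult)
  also have "\<dots> \<le> \<delta> * (2 * b + \<delta>)"
    using \<open>\<bar>?F - ?G\<bar> \<le> \<delta>\<close> FG g1(2) \<delta> by (intro mult_mono) auto
  finally show "\<bar>?F\<^sup>2 - ?G\<^sup>2\<bar> \<le> \<delta> * (2 * b + \<delta>)" .
  let ?H = "\<lambda>w. (1 + b / \<delta>) * (cmod (f w - g w))\<^sup>2 + (\<delta> / b) * (cmod (g w))\<^sup>2"
  have pw: "\<bar>(cmod (f w))\<^sup>2 - (cmod (g w))\<^sup>2\<bar> \<le> ?H w" for w
  proof -
    let ?u = "cmod (f w - g w)" and ?v = "cmod (g w)"
    have a: "\<bar>cmod (f w) - ?v\<bar> \<le> ?u" by (rule norm_triangle_ineq3)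
    have "\<bar>(cmod (f w))\<^sup>2 - ?v\<^sup>2\<bar> = \<bar>cmod (f w) - ?v\<bar> * (cmod (f w) + ?v)"
      by (simp add: power2_eq_square square_diff_square_factored abs_mult)
    also have "\<dots> \<le> ?u * (?u + 2 * ?v)" using a by (intro mult_mono) auto
    also have "\<dots> = ?u\<^sup>2 + 2 * ?u * ?v" by (simp add: power2_eq_square algebra_simps)
    also have "\<dots> \<le> ?H w" using young[OF b \<delta>, of ?u ?v] by (simp add: distrib_right)
    finally show ?thesis .
  qed
  have Hi: "integrable M ?H" using u v by simp
  have f2: "integrable M (\<lambda>w. (cmod (f w))\<^sup>2)"
  proof (rule Bochner_Integration.integrable_bound[OF Bochner_Integration.integrable_add[OF Hi v(1)]])
    show "AE w in M. norm ((cmod (f w))\<^sup>2) \<le> norm (?H w + (cmod (g w))\<^sup>2)"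
      using pw by (intro AE_I2) (simp, smt (verit))
  qed (use f in simp)
  have "\<bar>(\<integral>w. (cmod (f w))\<^sup>2 \<partial>M) - (\<integral>w. (cmod (g w))\<^sup>2 \<partial>M)\<bar> = \<bar>\<integral>w. (cmod (f w))\<^sup>2 - (cmod (g w))\<^sup>2 \<partial>M\<bar>"
    using f2 v by simp
  also have "\<dots> \<le> (\<integral>w. ?H w \<partial>M)" by (rule abs_integral_le[OF Hi pw])
  also have "\<dots> = (1 + b / \<delta>) * (\<integral>w. (cmod (f w - g w))\<^sup>2 \<partial>M) + (\<delta> / b) * (\<integral>w. (cmod (g w))\<^sup>2 \<partial>M)"
    using u v by simp
  also have "\<dots> \<le> (1 + b / \<delta>) * \<delta>\<^sup>2 + (\<delta> / b) * b\<^sup>2"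
    using u v \<delta> b by (intro add_mono mult_left_mono) auto
  also have "\<dots> = \<delta> * (2 * b + \<delta>)" using \<delta> b by (simp add: field_simps power2_eq_square)
  finally show "\<bar>(\<integral>w. (cmod (f w))\<^sup>2 \<partial>M) - (\<integral>w. (cmod (g w))\<^sup>2 \<partial>M)\<bar> \<le> \<delta> * (2 * b + \<delta>)" .
qed

context uplink_sys
begin

definition "hh w = app N A (received N (h w) d (disturbance U w))"
definition "X1 w = bil N A (h w) (received N (h w) d (disturbance U w))"
definition "X2 w = sqn N (hh w)"

lemma received_entry:
  "i < N \<Longrightarrow> received N (h w) d (disturbance U w) i = (d + eta_t U w) * h w i + er w i + nr w i + interf U w i"
  by (simp add: received_def eta_t_def er_def nr_def interf_def split_beta' mult.commute)

lemma hhat_carrier: "hhat P N U w \<in> carrier_vec N"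
  using lmmse_carrier by (simp add: hhat_def mult_mat_vec_def)

lemma hhat_entry: "i < N \<Longrightarrow> hhat P N U w $ i = hh w i"
  unfolding hhat_def hh_def
  by (subst mult_mat_vec_index_sum[OF lmmse_carrier]) (auto simp: app_def A_def)

lemma vnorm_hhat: "vnorm (hhat P N U w) = sqrt (X2 w)"
  unfolding vnorm_sqn[OF hhat_carrier] X2_def by (intro arg_cong[where f=sqrt] sqn_cong) (simp add: hhat_entry)

lemma X1_eq: "X1 w = (\<Sum>i<N. cnj (h w i) * hh w i)"
  unfolding X1_def bil_def hh_def app_def sum_distrib_left by (intro sum.cong refl) (simp add: mult_ac)

lemma X1_X2: "(cmod (X1 w))\<^sup>2 \<le> sqn N (h w) * X2 w"
  using sum_Cauchy_Schwarz_complex[of "\<lambda>i. cnj (h w i)" "hh w" N] by (simp add: X1_eq X2_def)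

lemma X2_nonneg: "0 \<le> X2 w"
  by (simp add: X2_def)

lemma mrc_carrier: "mrc P N U w \<in> carrier_vec N"
  using hhat_carrier by (simp add: mrc_def)

lemma mrc_entry: "i < N \<Longrightarrow> mrc P N U w $ i = hh w i / complex_of_real (sqrt (X2 w))"
  using hhat_carrier[of w] by (simp add: mrc_def vnorm_hhat hhat_entry)

lemma mrc_inner: "mrc P N U w \<bullet>c hvec N U w = X1 w / complex_of_real (sqrt (X2 w))"
proof -
  have "mrc P N U w \<bullet>c hvec N U w = (\<Sum>i<N. mrc P N U w $ i * cnj (hvec N U w $ i))"
    by (rule cscalar_prod_sum) (simp add: hvec_def)
  also have "\<dots> = (\<Sum>i<N. cnj (h w i) * hh w i) / complex_of_real (sqrt (X2 w))"
    unfolding sum_divide_distrib by (intro sum.cong refl) (simp add: mrc_entry hvec_def mult.commute)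
  finally show ?thesis by (simp add: X1_eq)
qed

lemma mrc_sqn: "sqn N (\<lambda>i. mrc P N U w $ i) \<le> 1"
proof -
  have "sqn N (\<lambda>i. mrc P N U w $ i) = sqn N (\<lambda>i. complex_of_real (1 / sqrt (X2 w)) * hh w i)"
    by (rule sqn_cong) (simp add: mrc_entry)
  also have "\<dots> = (1 / sqrt (X2 w))\<^sup>2 * X2 w"
    unfolding sqn_scale X2_def[symmetric] norm_of_real power2_abs ..
  also have "\<dots> \<le> 1" using X2_nonneg[of w] by (simp add: power_divide)
  finally show ?thesis .
qed

lemma mrc_entry_le: "i < N \<Longrightarrow> (cmod (mrc P N U w $ i))\<^sup>2 \<le> 1"
  using mrc_sqn[of w] member_le_sum[of i "{..<N}" "\<lambda>i. (cmod (mrc P N U w $ i))\<^sup>2"] by (simp add: sqn_def)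

lemma received_meas: "i < N \<Longrightarrow> (\<lambda>w. received N (h w) d (disturbance U w) i) \<in> borel_measurable (prb U)"
  by (simp only: received_entry) (intro meas_intros eta_meas comp_meas)

lemma hh_meas: "(\<lambda>w. hh w i) \<in> borel_measurable (prb U)"
  unfolding hh_def app_def by (intro meas_intros received_meas) simp

lemma X2_meas: "X2 \<in> borel_measurable (prb U)"
  unfolding X2_def[abs_def] sqn_def by (intro borel_measurable_sum borel_measurable_norm2 hh_meas)

lemma X1_meas: "X1 \<in> borel_measurable (prb U)"
  unfolding X1_eq[abs_def] by (intro meas_intros comp_meas hh_meas) simp

lemma mrc_meas: "i < N \<Longrightarrow> (\<lambda>w. mrc P N U w $ i) \<in> borel_measurable (prb U)"
  unfolding mrc_entry using hh_meas X2_meas by simp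

end

context uplink_rho
begin

lemma X1_approx: "l2 (prb U) (\<lambda>w. X1 w - s w * (complex_of_real tau / d)) (4 * Delta)"
proof -
  have "X1 w - s w * (complex_of_real tau / d) = s w * (bil N A (h w) (h w) - complex_of_real tau / d)
     + bil N A (h w) (er w) + bil N A (h w) (nr w) + bil N A (h w) (interf U w)" for w
  proof -
    have "X1 w = bil N A (h w) (\<lambda>i. s w * h w i + er w i + nr w i + interf U w i)"
      unfolding X1_def by (rule bil_cong) (simp_all add: received_entry s_def)
    then show ?thesis unfolding bil_add_right bil_scale_right by (simp add: algebra_simps)
  qed
  then show ?thesis using l2_add[OF l2_add[OF l2_add[OF A_terms(1,2)] A_terms(3)] A_terms(4)] by simp
qed

lemma X2_bil: "complex_of_real (X2 w) = bil N B (received N (h w) d (disturbance U w)) (received N (h w) d (disturbance U w))"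
proof -
  let ?z = "received N (h w) d (disturbance U w)"
  have "complex_of_real (X2 w) = (\<Sum>k<N. \<Sum>i<N. \<Sum>j<N. cnj (A k i) * A k j * cnj (?z i) * ?z j)"
    unfolding X2_def sqn_complex
  proof (intro sum.cong refl)
    fix k
    have "hh w k * cnj (hh w k) = (\<Sum>i<N. cnj (A k i * ?z i)) * (\<Sum>j<N. A k j * ?z j)"
      unfolding hh_def app_def cnj_sum by (rule mult.commute)
    also have "\<dots> = (\<Sum>i<N. \<Sum>j<N. cnj (A k i) * A k j * cnj (?z i) * ?z j)"
      unfolding sum_product by (intro sum.cong refl) (simp add: mult_ac)
    finally show "hh w k * cnj (hh w k) = (\<Sum>i<N. \<Sum>j<N. cnj (A k i) * A k j * cnj (?z i) * ?z j)" .
  qed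
  also have "\<dots> = (\<Sum>i<N. \<Sum>k<N. \<Sum>j<N. cnj (A k i) * A k j * cnj (?z i) * ?z j)" by (rule sum.swap)
  also have "\<dots> = (\<Sum>i<N. \<Sum>j<N. \<Sum>k<N. cnj (A k i) * A k j * cnj (?z i) * ?z j)" by (intro sum.cong refl sum.swap)
  also have "\<dots> = bil N B ?z ?z" unfolding bil_def B_def sum_distrib_right ..
  finally show ?thesis .
qed

lemma X2_approx: "l2 (prb U) (\<lambda>w. complex_of_real (X2 w - ((cmod (s w))\<^sup>2 * alpha + beta))) (17 * Delta)"
proof -
  let ?n = "interf U"
  define e where "e k w = (if k = (0::nat) then bil N B (\<lambda>i. s w * h w i) (er w) else if k = 1 then bil N B (\<lambda>i. s w * h w i) (nr w)
    else if k = 2 then bil N B (\<lambda>i. s w * h w i) (?n w) else if k = 3 then bil N B (er w) (nr w)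
    else if k = 4 then bil N B (er w) (?n w) else bil N B (nr w) (?n w))" for k w
  have el: "l2 (prb U) (e k) Delta" for k unfolding e_def[abs_def]
    by (cases "k = 0"; cases "k = 1"; cases "k = 2"; cases "k = 3"; cases "k = 4"; simp add: B_cross_terms)
  have ec: "l2 (prb U) (\<lambda>w. e k w + cnj (e k w)) (Delta + Delta)" for k
  proof (rule l2_add[OF el l2_norm_cong[OF el]])
    show "(\<lambda>w. cnj (e k w)) \<in> borel_measurable (prb U)" using el[of k] by (intro borel_measurable_cnj') (simp add: l2_def)
  qed simp
  define q1 where "q1 w = complex_of_real ((cmod (s w))\<^sup>2) * (bil N B (h w) (h w) - complex_of_real alpha)" for w
  define q2 where "q2 w = bil N B (er w) (er w) - (\<Sum>i<N. B i i * complex_of_real (kp * (cmod (h w i))\<^sup>2))" for w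
  define q3 where "q3 w = (\<Sum>i<N. B i i * complex_of_real (kp * (cmod (h w i))\<^sup>2)) - complex_of_real kp * (\<Sum>i<N. B i i * R i i)" for w
  define q4 where "q4 w = bil N B (nr w) (nr w) - (\<Sum>i<N. B i i * complex_of_real (sigma2 P))" for w
  define q5 where "q5 w = bil N B (?n w) (?n w) - (\<Sum>i<N. \<Sum>j<N. B i j * S j i)" for w
  have q: "l2 (prb U) q1 Delta" "l2 (prb U) q2 Delta" "l2 (prb U) q3 Delta" "l2 (prb U) q4 Delta" "l2 (prb U) q5 Delta"
    unfolding q1_def[abs_def] q2_def[abs_def] q3_def[abs_def] q4_def[abs_def] q5_def[abs_def] by (rule B_quad_terms)+
  have "complex_of_real (X2 w - ((cmod (s w))\<^sup>2 * alpha + beta)) =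
     q1 w + q2 w + q3 w + q4 w + q5 w + (e 0 w + cnj (e 0 w)) + (e 1 w + cnj (e 1 w)) + (e 2 w + cnj (e 2 w))
     + (e 3 w + cnj (e 3 w)) + (e 4 w + cnj (e 4 w)) + (e 5 w + cnj (e 5 w))" for w
  proof -
    let ?z = "\<lambda>i. s w * h w i + er w i + nr w i + ?n w i"
    have "complex_of_real (X2 w) = bil N B ?z ?z"
      unfolding X2_bil by (rule bil_cong) (simp_all add: received_entry s_def)
    moreover have "bil N B (\<lambda>i. s w * h w i) (\<lambda>i. s w * h w i) = complex_of_real ((cmod (s w))\<^sup>2) * bil N B (h w) (h w)"
      unfolding bil_scale_left bil_scale_right complex_norm_square by simp
    ultimately have X: "complex_of_real (X2 w) = complex_of_real ((cmod (s w))\<^sup>2) * bil N B (h w) (h w) + bil N B (er w) (er w) + bil N B (nr w) (nr w) + bil N B (?n w) (?n w)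
       + (e 0 w + cnj (e 0 w)) + (e 1 w + cnj (e 1 w)) + (e 2 w + cnj (e 2 w))
       + (e 3 w + cnj (e 3 w)) + (e 4 w + cnj (e 4 w)) + (e 5 w + cnj (e 5 w))"
      unfolding bil_square[OF B_hermitian] by (simp add: e_def)
    have "complex_of_real (X2 w - ((cmod (s w))\<^sup>2 * alpha + beta)) = complex_of_real (X2 w) - (complex_of_real ((cmod (s w))\<^sup>2) * complex_of_real alpha + complex_of_real beta)"
      by simp
    then show ?thesis unfolding X trace_B_Psi q1_def q2_def q3_def q4_def q5_def by (simp add: right_diff_distrib)
  qed
  moreover have "l2 (prb U) (\<lambda>w. q1 w + q2 w + q3 w + q4 w + q5 w + (e 0 w + cnj (e 0 w)) + (e 1 w + cnj (e 1 w)) + (e 2 w + cnj (e 2 w))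
     + (e 3 w + cnj (e 3 w)) + (e 4 w + cnj (e 4 w)) + (e 5 w + cnj (e 5 w)))
     (Delta + Delta + Delta + Delta + Delta + (Delta + Delta) + (Delta + Delta) + (Delta + Delta) + (Delta + Delta) + (Delta + Delta) + (Delta + Delta))"
    by (rule l2_add[OF l2_add[OF l2_add[OF l2_add[OF l2_add[OF l2_add[OF l2_add[OF l2_add[OF l2_add[OF l2_add[OF q(1) q(2)] q(3)] q(4)] q(5)] ec[of 0]] ec[of 1]] ec[of 2]] ec[of 3]] ec[of 4]] ec[of 5]])
  ultimately show ?thesis by simp
qed

lemma h_norm_quad:
  "msq (prb U) (\<lambda>w. s w * complex_of_real (sqn N (h w) - Re (mtrace (cov_R U)))) \<le> ennreal (\<rho> ^ 3 * real N)" (is ?A)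
  "msq (prb U) (\<lambda>w. complex_of_real (sqn N (h w) - Re (mtrace (cov_R U)))) \<le> ennreal (\<rho> ^ 3 * real N)" (is ?B)
proof -
  define I where "I i j = (if i = j then 1 else 0 :: complex)" for i j :: nat
  have I: "opb N I 1" unfolding I_def[abs_def] by (rule opb_diag) auto
  have q: "(\<Sum>i<N. \<Sum>j<N. I i j * cnj (h w i) * h w j) = complex_of_real (sqn N (h w))" for w
    unfolding sqn_complex
  proof (intro sum.cong refl)
    fix i assume i: "i \<in> {..<N}"
    have "(\<Sum>j<N. I i j * cnj (h w i) * h w j) = (\<Sum>j<N. if i = j then h w i * cnj (h w i) else 0)"
      by (intro sum.cong refl) (simp add: I_def)
    then show "(\<Sum>j<N. I i j * cnj (h w i) * h w j) = h w i * cnj (h w i)" using i by simp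
  qed
  have t: "(\<Sum>i<N. \<Sum>j<N. I i j * R j i) = complex_of_real (Re (mtrace (cov_R U)))"
  proof -
    have "(\<Sum>i<N. \<Sum>j<N. I i j * R j i) = (\<Sum>i<N. R i i)"
      unfolding I_def by (intro sum.cong refl) (simp add: if_distrib[of "\<lambda>z. z * _"] cong: if_cong)
    also have "\<dots> = mtrace (cov_R U)" unfolding mtrace_def using R_carrier by simp
    also have "\<dots> = complex_of_real (Re (mtrace (cov_R U)))"
    proof -
      have "0 \<le> mtrace (cov_R U)" unfolding mtrace_def using R_carrier R_diag by (intro sum_nonneg) simp
      then show ?thesis by (simp add: less_eq_complex_def complex_eq_iff)
    qed
    finally show ?thesis .
  qed
  have e: "\<rho> * (\<rho>\<^sup>2 * (real N * 1\<^sup>2)) = \<rho> ^ 3 * real N" by (simp add: power_numeral_reduce)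
  show ?A using quad_h[OF I s_fun_meas(2) rho_nn s_moments(2)] unfolding q t e s_def of_real_diff .
  show ?B using quad_h[OF I s_fun_meas(4) rho_nn s_moments(4)] unfolding q t e of_real_diff by simp
qed

end

locale uplink_limit = uplink_rho P N U \<rho> K for P N U \<rho> K +
  fixes c :: real
  assumes c_pos: "0 < c" and beta_c: "c * real N \<le> beta" and tau_rho: "tau \<le> \<rho> * real N"
begin

definition "c0 = c / \<rho>"
definition "Y w = (mrc P N U w \<bullet>c hvec N U w) / complex_of_real (sqrt tau)"
definition "r0 w = ((cmod (s w))\<^sup>2 * alpha + beta) / tau"
definition "G = (2 / c0 * (64 * \<rho> ^ 12) + 2 * (\<rho> / c + 1) / c0\<^sup>2 * (1156 * \<rho> ^ 12) + 2 * (\<rho> / c + 1) * \<rho> ^ 3 + 2 / c0 * (\<rho> ^ 3 / p_UE P)) / c\<^sup>2"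

lemma N_pos: "0 < real N" using N1 by simp
lemma rho_pos: "0 < \<rho>" using rho1 by simp
lemma c0_pos: "0 < c0" using c_pos rho_pos by (simp add: c0_def)
lemma tau_lower: "c * real N \<le> tau" using beta_c tau_ge_beta by simp
lemma tau_pos: "0 < tau" using tau_lower c_pos N_pos by (meson less_le_trans mult_pos_pos)

lemma r0_lower: "c0 \<le> r0 w"
proof -
  have "c * tau \<le> c * (\<rho> * real N)" using tau_rho c_pos by (intro mult_left_mono) auto
  also have "\<dots> \<le> \<rho> * beta" using mult_left_mono[OF beta_c, of \<rho>] rho_pos by (simp add: mult_ac)
  also have "\<dots> \<le> \<rho> * ((cmod (s w))\<^sup>2 * alpha + beta)" using rho_pos alpha_nonneg by (intro mult_left_mono) auto
  finally show ?thesis using tau_pos rho_pos by (simp add: c0_def r0_def field_simps)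
qed

lemma phi_r0: "phi P N U w = s w / d / complex_of_real (sqrt (r0 w))"
proof -
  have "1 + inverse d * eta_t U w = s w / d" using d_nz by (simp add: s_def field_simps)
  then show ?thesis unfolding phi_eq r0_def s_def[symmetric] using tau_pos by (simp add: real_sqrt_divide)
qed

lemma Y_eq: "Y w = X1 w / complex_of_real (sqrt (X2 w)) / complex_of_real (sqrt tau)"
  by (simp add: Y_def mrc_inner)

lemma Y_meas: "Y \<in> borel_measurable (prb U)"
  unfolding Y_eq[abs_def] using X1_meas X2_meas by simp

lemma phi_meas: "phi P N U \<in> borel_measurable (prb U)"
  unfolding phi_r0[abs_def] r0_def using s_meas by simp

lemma Y_phi: "msq (prb U) (\<lambda>w. Y w - phi P N U w) \<le> ennreal (G / real N)"
proof -
  define m where "m = Re (mtrace (cov_R U)) / tau"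
  define q where "q w = sqn N (h w) / tau" for w
  define T1 where "T1 w = X1 w - s w * (complex_of_real tau / d)" for w
  define T2 where "T2 w = complex_of_real (X2 w - ((cmod (s w))\<^sup>2 * alpha + beta))" for w
  define T3 where "T3 w = complex_of_real (sqn N (h w) - Re (mtrace (cov_R U)))" for w
  define T4 where "T4 w = s w * complex_of_real (sqn N (h w) - Re (mtrace (cov_R U)))" for w
  define C1 where "C1 = \<rho> / c + 1"
  define k where "k = 1 / (c * real N)\<^sup>2"
  have trR: "0 \<le> Re (mtrace (cov_R U))" "Re (mtrace (cov_R U)) \<le> real N * \<rho>"
  proof -
    have mt: "mtrace (cov_R U) = (\<Sum>i<N. R i i)" unfolding mtrace_def using R_carrier by simp
    show "0 \<le> Re (mtrace (cov_R U))" unfolding mt Re_sum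
      by (intro sum_nonneg) (use R_diag in \<open>simp add: less_eq_complex_def\<close>)
    have "Re (R i i) \<le> \<rho>" if "i < N" for i
      using opb_entry[OF R_rho that that] complex_Re_le_cmod[of "R i i"] by linarith
    then show "Re (mtrace (cov_R U)) \<le> real N * \<rho>" unfolding mt Re_sum
      using sum_bounded_above[of "{..<N}" "\<lambda>i. Re (R i i)" \<rho>] by simp
  qed
  have m0: "0 \<le> m" using trR tau_pos by (simp add: m_def)
  have mC: "m + 1 \<le> C1"
  proof -
    have "c * Re (mtrace (cov_R U)) \<le> c * (real N * \<rho>)" using trR c_pos by (intro mult_left_mono) auto
    also have "\<dots> \<le> \<rho> * tau" using mult_left_mono[OF tau_lower, of \<rho>] rho_pos by (simp add: mult_ac)
    finally show ?thesis using c_pos tau_pos by (simp add: m_def C1_def field_simps)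
  qed
  have k0: "0 \<le> k" by (simp add: k_def)
  have kt: "1 / tau\<^sup>2 \<le> k"
    unfolding k_def using tau_lower c_pos N_pos tau_pos by (intro divide_left_mono power_mono mult_pos_pos zero_less_power) auto
  have sc: "x / tau\<^sup>2 \<le> k * x" if "0 \<le> x" for x using mult_right_mono[OF kt that] by simp
  have pw: "(cmod (Y w - phi P N U w))\<^sup>2 \<le> 2 / c0 * (k * (cmod (T1 w))\<^sup>2) + 2 * C1 / c0\<^sup>2 * (k * (cmod (T2 w))\<^sup>2)
      + (2 * C1 * (k * (cmod (T3 w))\<^sup>2) + 2 / c0 * (k / p_UE P * (cmod (T4 w))\<^sup>2))" for w
  proof -
    have q0: "0 \<le> q w" using tau_pos by (simp add: q_def)
    have XX: "(cmod (X1 w))\<^sup>2 \<le> q w * tau * X2 w" using X1_X2[of w] tau_pos by (simp add: q_def)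
    define Uu where "Uu = (cmod (X1 w / complex_of_real tau - s w / d))\<^sup>2"
    define V where "V = (X2 w / tau - r0 w)\<^sup>2"
    define x where "x = (cmod (s w / d))\<^sup>2"
    have n0: "0 \<le> Uu" "0 \<le> V" "0 \<le> x" by (simp_all add: Uu_def V_def x_def)
    have "(cmod (Y w - phi P N U w))\<^sup>2 \<le> 2 / c0 * Uu + 2 * (m + 1) / c0\<^sup>2 * V + 2 * (m + 1) * (q w - m)\<^sup>2 + 2 / c0 * (x * (q w - m)\<^sup>2)"
      unfolding Y_eq phi_r0
      by (rule ratio_bound_truncated[OF ratio_bound(1)[where ?u0.0="s w / d", OF XX X2_nonneg tau_pos q0 c0_pos r0_lower[of w], folded Uu_def V_def]
          ratio_bound(3)[where ?u0.0="s w / d", OF XX X2_nonneg tau_pos q0 c0_pos r0_lower[of w], folded x_def] n0 q0 m0 c0_pos])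
    also have "\<dots> \<le> 2 / c0 * Uu + 2 * C1 / c0\<^sup>2 * V + 2 * C1 * (q w - m)\<^sup>2 + 2 / c0 * (x * (q w - m)\<^sup>2)"
      using mC m0 n0 c0_pos by (intro add_mono mult_right_mono divide_right_mono order_refl) auto
    also have "Uu = (cmod (T1 w))\<^sup>2 / tau\<^sup>2"
    proof -
      have "X1 w / complex_of_real tau - s w / d = T1 w / complex_of_real tau"
        using tau_pos d_nz by (simp add: T1_def field_simps)
      then show ?thesis by (simp add: Uu_def norm_divide power_divide)
    qed
    also have "V = (cmod (T2 w))\<^sup>2 / tau\<^sup>2"
    proof -
      have "X2 w / tau - r0 w = (X2 w - ((cmod (s w))\<^sup>2 * alpha + beta)) / tau"
        by (simp add: r0_def diff_divide_distrib)
      then show ?thesis unfolding V_def T2_def norm_of_real power2_abs power_divide[symmetric] by simp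
    qed
    also have "x * (q w - m)\<^sup>2 = (cmod (T4 w))\<^sup>2 / p_UE P / tau\<^sup>2"
    proof -
      have "q w - m = (sqn N (h w) - Re (mtrace (cov_R U))) / tau" by (simp add: q_def m_def diff_divide_distrib)
      then have "(q w - m)\<^sup>2 = (sqn N (h w) - Re (mtrace (cov_R U)))\<^sup>2 / tau\<^sup>2" by (simp add: power_divide)
      moreover have "x = (cmod (s w))\<^sup>2 / p_UE P" by (simp add: x_def norm_divide power_divide d_norm)
      ultimately show ?thesis unfolding T4_def norm_mult norm_of_real power_mult_distrib power2_abs by simp
    qed
    also have "(q w - m)\<^sup>2 = (cmod (T3 w))\<^sup>2 / tau\<^sup>2"
    proof -
      have "q w - m = (sqn N (h w) - Re (mtrace (cov_R U))) / tau" by (simp add: q_def m_def diff_divide_distrib)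
      then show ?thesis unfolding T3_def norm_of_real power2_abs by (simp add: power_divide)
    qed
    also have "2 / c0 * ((cmod (T1 w))\<^sup>2 / tau\<^sup>2) + 2 * C1 / c0\<^sup>2 * ((cmod (T2 w))\<^sup>2 / tau\<^sup>2) + 2 * C1 * ((cmod (T3 w))\<^sup>2 / tau\<^sup>2) + 2 / c0 * ((cmod (T4 w))\<^sup>2 / p_UE P / tau\<^sup>2)
      \<le> 2 / c0 * (k * (cmod (T1 w))\<^sup>2) + 2 * C1 / c0\<^sup>2 * (k * (cmod (T2 w))\<^sup>2) + 2 * C1 * (k * (cmod (T3 w))\<^sup>2) + 2 / c0 * (k * ((cmod (T4 w))\<^sup>2 / p_UE P))"
      using c0_pos mC m0 p_pos by (intro add_mono mult_left_mono sc) auto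
    finally show ?thesis by (simp add: add.assoc)
  qed
  have T: "T1 \<in> borel_measurable (prb U)" "T2 \<in> borel_measurable (prb U)" "T3 \<in> borel_measurable (prb U)" "T4 \<in> borel_measurable (prb U)"
  proof -
    show "T1 \<in> borel_measurable (prb U)" using X1_approx by (simp add: l2_def T1_def[abs_def])
    show "T2 \<in> borel_measurable (prb U)" using X2_approx by (simp add: l2_def T2_def[abs_def])
    have "(\<lambda>w. sqn N (h w)) \<in> borel_measurable (prb U)"
      unfolding sqn_def by (intro borel_measurable_sum borel_measurable_norm2 h_meas_i) simp
    then show T3: "T3 \<in> borel_measurable (prb U)"
      unfolding T3_def[abs_def] by (intro borel_measurable_complex_of_real' borel_measurable_diff borel_measurable_const)
    have "T4 = (\<lambda>w. s w * T3 w)" by (simp add: T4_def[abs_def] T3_def)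
    then show "T4 \<in> borel_measurable (prb U)" using borel_measurable_times[OF s_meas T3] by simp
  qed
  have Tb: "msq (prb U) T1 \<le> ennreal ((4 * Delta)\<^sup>2)"
    "msq (prb U) T2 \<le> ennreal ((17 * Delta)\<^sup>2)"
    "msq (prb U) T3 \<le> ennreal (\<rho> ^ 3 * real N)"
    "msq (prb U) T4 \<le> ennreal (\<rho> ^ 3 * real N)"
    using X1_approx X2_approx h_norm_quad unfolding l2_def T1_def T2_def T3_def T4_def by blast+
  have C1: "0 \<le> C1" using mC m0 by simp
  have "msq (prb U) (\<lambda>w. Y w - phi P N U w) \<le> (\<integral>\<^sup>+w. ennreal (2 / c0 * (k * (cmod (T1 w))\<^sup>2) + 2 * C1 / c0\<^sup>2 * (k * (cmod (T2 w))\<^sup>2)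
      + (2 * C1 * (k * (cmod (T3 w))\<^sup>2) + 2 / c0 * (k / p_UE P * (cmod (T4 w))\<^sup>2))) \<partial>prb U)"
    by (intro nn_integral_mono ennreal_leI pw)
  also have "\<dots> \<le> ennreal (2 / c0 * (k * (4 * Delta)\<^sup>2) + 2 * C1 / c0\<^sup>2 * (k * (17 * Delta)\<^sup>2)
      + (2 * C1 * (k * (\<rho> ^ 3 * real N)) + 2 / c0 * (k / p_UE P * (\<rho> ^ 3 * real N))))"
    using c0_pos C1 k0 p_pos rho_pos
    by (intro nn_integral_add_le nn_integral_cmult_le Tb borel_measurable_add borel_measurable_times borel_measurable_const borel_measurable_norm2 T) auto
  also have "2 / c0 * (k * (4 * Delta)\<^sup>2) + 2 * C1 / c0\<^sup>2 * (k * (17 * Delta)\<^sup>2)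
      + (2 * C1 * (k * (\<rho> ^ 3 * real N)) + 2 / c0 * (k / p_UE P * (\<rho> ^ 3 * real N))) = G / real N"
  proof -
    have D: "Delta\<^sup>2 = 4 * \<rho> ^ 12 * real N" by (simp add: Delta_def power_mult_distrib power_mult[symmetric])
    have kN: "k * real N = 1 / c\<^sup>2 / real N" using N_pos by (simp add: k_def power2_eq_square)
    have "2 / c0 * (k * (4 * Delta)\<^sup>2) + 2 * C1 / c0\<^sup>2 * (k * (17 * Delta)\<^sup>2)
      + (2 * C1 * (k * (\<rho> ^ 3 * real N)) + 2 / c0 * (k / p_UE P * (\<rho> ^ 3 * real N)))
      = (2 / c0 * (64 * \<rho> ^ 12) + 2 * C1 / c0\<^sup>2 * (1156 * \<rho> ^ 12) + 2 * C1 * \<rho> ^ 3 + 2 / c0 * (\<rho> ^ 3 / p_UE P)) * (k * real N)"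
      unfolding power_mult_distrib D by (simp add: algebra_simps)
    then show ?thesis unfolding kN G_def C1_def by simp
  qed
  finally show ?thesis .
qed

lemma G_pos: "0 < G"
proof -
  have C1: "0 < 2 * (\<rho> / c + 1)" using rho_pos c_pos by (simp add: add_pos_pos)
  have p: "0 < 2 / c0 * (64 * \<rho> ^ 12)" "0 < 2 * (\<rho> / c + 1) / c0\<^sup>2 * (1156 * \<rho> ^ 12)"
    "0 < 2 * (\<rho> / c + 1) * \<rho> ^ 3" "0 < 2 / c0 * (\<rho> ^ 3 / p_UE P)"
    using c0_pos rho_pos p_pos C1 by (simp_all only: mult_pos_pos divide_pos_pos zero_less_power zero_less_numeral)
  show ?thesis unfolding G_def
    by (rule divide_pos_pos[OF add_pos_pos[OF add_pos_pos[OF add_pos_pos[OF p(1) p(2)] p(3)] p(4)] zero_less_power[OF c_pos]])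
qed

end

section \<open>Comparison with the limit variable\<close>

lemma emeasure_distr_nn_integral:
  assumes f: "f \<in> M \<rightarrow>\<^sub>M N" and A: "A \<in> sets N"
  shows "emeasure (distr M N f) A = (\<integral>\<^sup>+x. indicator A (f x) \<partial>M)"
  using nn_integral_distr[OF f, of "indicator A"] A by simp

lemma nn_integral_std_normal_uminus:
  assumes [measurable]: "F \<in> borel_measurable borel"
  shows "(\<integral>\<^sup>+x. F (- x) \<partial>std_normal) = (\<integral>\<^sup>+x. F x \<partial>std_normal)"
proof -
  have m: "(\<lambda>x. F (- x)) \<in> borel_measurable lborel" by simp
  have "(\<integral>\<^sup>+x. F x \<partial>std_normal) = (\<integral>\<^sup>+x. ennreal (std_normal_density x) * F x \<partial>lborel)"
    by (subst nn_integral_density) auto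
  also have "\<dots> = (\<integral>\<^sup>+x. ennreal (std_normal_density (- x)) * F (- x) \<partial>lborel)"
    by (subst nn_integral_real_affine[where c="-1" and t=0]) auto
  also have "\<dots> = (\<integral>\<^sup>+x. ennreal (std_normal_density x) * F (- x) \<partial>lborel)"
    by (simp add: normal_density_def)
  also have "\<dots> = (\<integral>\<^sup>+x. F (- x) \<partial>std_normal)"
    using m by (subst nn_integral_density) auto
  finally show ?thesis by simp
qed

lemma CN_uminus: "distr (CN v) borel uminus = CN v"
proof (rule measure_eqI)
  fix A assume "A \<in> sets (distr (CN v) borel uminus)"
  then have A: "A \<in> sets borel" by simp
  let ?a = "sqrt (v / 2)"
  have i: "indicator A \<in> borel_measurable (borel :: complex measure)" using A by simp
  have i': "(\<lambda>z. indicator A (- z) :: ennreal) \<in> borel_measurable (borel :: complex measure)"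
    by (rule measurable_compose[OF _ i]) simp
  have mC: "(\<lambda>x. Complex (p * x) (q * y)) \<in> borel_measurable borel" "(\<lambda>y. Complex (p * x) (q * y)) \<in> borel_measurable borel" for p q x y :: real
    unfolding Complex_eq by simp_all
  have m1: "(\<lambda>y. indicator A (Complex (p * x) (q * y)) :: ennreal) \<in> borel_measurable borel" for p q x
    by (rule measurable_compose[OF mC(2) i])
  have m2: "(\<lambda>x. \<integral>\<^sup>+y. indicator A (Complex (?a * x) (?a * y)) \<partial>std_normal) \<in> borel_measurable borel"
  proof -
    have "(\<lambda>(x, y). indicator A (Complex (?a * x) (?a * y)) :: ennreal) \<in> borel_measurable (borel \<Otimes>\<^sub>M std_normal)"
      using measurable_compose[OF measurable_Complex_pair[of ?a ?a] i] by (simp add: split_beta' cong: measurable_cong_sets)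
    then show ?thesis by (rule std_normal.borel_measurable_nn_integral)
  qed
  have "emeasure (distr (CN v) borel uminus) A = (\<integral>\<^sup>+z. indicator A (- z) \<partial>CN v)"
    using A by (intro emeasure_distr_nn_integral) auto
  also have "\<dots> = (\<integral>\<^sup>+x. \<integral>\<^sup>+y. indicator A (Complex (?a * (- x)) (?a * (- y))) \<partial>std_normal \<partial>std_normal)"
    unfolding nn_integral_CN[OF i'] by (intro nn_integral_cong arg_cong[where f="indicator A"]) (simp add: complex_eq_iff)
  also have "\<dots> = (\<integral>\<^sup>+x. \<integral>\<^sup>+y. indicator A (Complex (?a * (- x)) (?a * y)) \<partial>std_normal \<partial>std_normal)"
    by (intro nn_integral_cong nn_integral_std_normal_uminus[of "\<lambda>y. indicator A (Complex (?a * (- x)) (?a * y))" for x]) (rule m1)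
  also have "\<dots> = (\<integral>\<^sup>+x. \<integral>\<^sup>+y. indicator A (Complex (?a * x) (?a * y)) \<partial>std_normal \<partial>std_normal)"
    by (rule nn_integral_std_normal_uminus[OF m2])
  also have "\<dots> = emeasure (CN v) A"
    unfolding nn_integral_CN[OF i, symmetric] using A by simp
  finally show "emeasure (distr (CN v) borel uminus) A = emeasure (CN v) A" .
qed simp

lemma CN_ball_pos:
  assumes r: "0 < r" and v: "0 \<le> v"
  shows "0 < measure (CN v) {z. cmod z \<le> r}"
proof -
  define a where "a = sqrt (v / 2)"
  define e where "e = r / (2 * (a + 1))"
  have a: "0 \<le> a" using v by (simp add: a_def)
  have e: "0 < e" using r a by (simp add: e_def)
  have ae: "2 * (a * e) \<le> r" using r a by (simp add: e_def field_simps)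
  let ?B = "{-e<..<e}"
  have B: "emeasure std_normal ?B \<noteq> 0"
  proof
    assume "emeasure std_normal ?B = 0"
    then have "(\<integral>\<^sup>+x. ennreal (std_normal_density x) * indicator ?B x \<partial>lborel) = 0"
      by (subst (asm) emeasure_density) auto
    then have "AE x in lborel. ennreal (std_normal_density x) * indicator ?B x = 0"
      by (subst (asm) nn_integral_0_iff_AE) auto
    moreover have "\<not> std_normal_density x \<le> 0" for x using normal_density_pos[of 1 0 x] by simp
    ultimately have "AE x in lborel. x \<notin> ?B"
      by (auto simp: indicator_def ennreal_eq_0_iff elim!: eventually_mono split: if_splits)
    then have "emeasure lborel ?B = 0" by (subst (asm) AE_iff_measurable[of ?B]) auto
    then show False using e by simp
  qed
  have m: "(\<lambda>(x, y). Complex (a * x) (a * y)) \<in> std_normal \<Otimes>\<^sub>M std_normal \<rightarrow>\<^sub>M borel"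
    using measurable_Complex_pair[of a a] by (simp cong: measurable_cong_sets)
  have S: "{z. cmod z \<le> r} \<in> sets borel" by measurable
  have "emeasure std_normal ?B * emeasure std_normal ?B = emeasure (std_normal \<Otimes>\<^sub>M std_normal) (?B \<times> ?B)"
    by (rule std_normal.emeasure_pair_measure_Times[symmetric]) auto
  also have "\<dots> \<le> emeasure (std_normal \<Otimes>\<^sub>M std_normal) ((\<lambda>(x, y). Complex (a * x) (a * y)) -` {z. cmod z \<le> r} \<inter> space (std_normal \<Otimes>\<^sub>M std_normal))"
  proof (rule emeasure_mono)
    show "?B \<times> ?B \<subseteq> (\<lambda>(x, y). Complex (a * x) (a * y)) -` {z. cmod z \<le> r} \<inter> space (std_normal \<Otimes>\<^sub>M std_normal)"
    proof
      fix w assume "w \<in> ?B \<times> ?B"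
      then obtain x y where w: "w = (x, y)" and xy: "\<bar>x\<bar> \<le> e" "\<bar>y\<bar> \<le> e" by auto
      have "cmod (Complex (a * x) (a * y)) \<le> \<bar>a * x\<bar> + \<bar>a * y\<bar>" using cmod_le[of "Complex (a * x) (a * y)"] by simp
      also have "\<dots> \<le> a * e + a * e" using xy a by (simp only: abs_mult) (intro add_mono mult_mono, auto)
      finally show "w \<in> (\<lambda>(x, y). Complex (a * x) (a * y)) -` {z. cmod z \<le> r} \<inter> space (std_normal \<Otimes>\<^sub>M std_normal)"
        using ae by (simp add: w space_pair_measure)
    qed
    show "(\<lambda>(x, y). Complex (a * x) (a * y)) -` {z. cmod z \<le> r} \<inter> space (std_normal \<Otimes>\<^sub>M std_normal) \<in> sets (std_normal \<Otimes>\<^sub>M std_normal)"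
      using m S by (rule measurable_sets)
  qed
  also have "\<dots> = emeasure (CN v) {z. cmod z \<le> r}"
    unfolding CN_def a_def[symmetric] using m S by (rule emeasure_distr[symmetric])
  finally have "emeasure (CN v) {z. cmod z \<le> r} \<noteq> 0" using B by (metis le_zero_eq mult_eq_0_iff)
  then show ?thesis by (simp add: CN.emeasure_eq_measure zero_less_measure_iff)
qed

text \<open>The vector field \<open>x / sqrt (a |x|\<^sup>2 + b)\<close> is the gradient of a convex even function; pairing \<open>w\<close> with \<open>- w\<close>
  uses its monotonicity.\<close>

lemma paired_nonneg:
  fixes w :: complex
  assumes a: "0 \<le> a" and b: "0 < b"
  shows "0 \<le> Re (1 + w) / sqrt ((cmod (1 + w))\<^sup>2 * a + b) + Re (1 - w) / sqrt ((cmod (1 - w))\<^sup>2 * a + b)"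
proof -
  have key: "(Re w - 1) / sqrt ((cmod (1 - w))\<^sup>2 * a + b) \<le> (1 + Re w) / sqrt ((cmod (1 + w))\<^sup>2 * a + b)"
    if u: "1 < Re w" for w :: complex
  proof -
    define S where "S = (cmod (1 + w))\<^sup>2 * a + b"
    define T where "T = (cmod (1 - w))\<^sup>2 * a + b"
    have ST: "0 < S" "0 < T" using a b by (auto simp: S_def T_def intro!: add_nonneg_pos)
    have "(1 + Re w)\<^sup>2 * T - (Re w - 1)\<^sup>2 * S = 4 * Re w * b + 4 * Re w * (Im w)\<^sup>2 * a"
      unfolding S_def T_def cmod_power2 by (simp add: power2_eq_square algebra_simps)
    also have "\<dots> \<ge> 0" using u a b by (intro add_nonneg_nonneg mult_nonneg_nonneg) auto
    finally have "(Re w - 1)\<^sup>2 * S \<le> (1 + Re w)\<^sup>2 * T" by simp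
    then have "((Re w - 1) * sqrt S)\<^sup>2 \<le> ((1 + Re w) * sqrt T)\<^sup>2"
      using ST by (simp add: power_mult_distrib)
    then have "(Re w - 1) * sqrt S \<le> (1 + Re w) * sqrt T"
      by (rule power2_le_imp_le) (use u ST in auto)
    then show ?thesis unfolding S_def[symmetric] T_def[symmetric] using ST by (simp add: field_simps)
  qed
  consider "1 < Re w" | "1 < Re (- w)" | "\<bar>Re w\<bar> \<le> 1" by fastforce
  then show ?thesis
  proof cases
    case 1 from key[OF this] show ?thesis by (simp add: diff_divide_distrib add_divide_distrib)
  next
    case 2 from key[OF this] show ?thesis by (simp add: diff_divide_distrib add_divide_distrib)
  next
    case 3
    have "0 \<le> (cmod (1 + w))\<^sup>2 * a + b" "0 \<le> (cmod (1 - w))\<^sup>2 * a + b" using a b by auto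
    with 3 show ?thesis by (intro add_nonneg_nonneg divide_nonneg_nonneg) auto
  qed
qed

context uplink_sys
begin

lemma eta_law: "distr (prb U) borel (eta_t U) = CN (kappa_t P * p_UE P)"
proof (rule measure_eqI)
  fix X assume "X \<in> sets (distr (prb U) borel (eta_t U))"
  then have X: "X \<in> sets borel" by simp
  have "emeasure (distr (prb U) borel (eta_t U)) X = (\<integral>\<^sup>+w. indicator X (eta_t U w) * 1 \<partial>prb U)"
    using X eta_meas by (subst emeasure_distr) (auto simp: nn_integral_indicator[symmetric] simp del: nn_integral_indicator intro!: nn_integral_cong split: split_indicator)
  also have "\<dots> = (\<integral>\<^sup>+z. indicator X z \<partial>CN (kappa_t P * p_UE P)) * (\<integral>\<^sup>+w. 1 \<partial>prb U)"
    using X by (intro et_integrate) auto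
  also have "\<dots> = emeasure (CN (kappa_t P * p_UE P)) X" using X by (simp add: M.emeasure_space_1)
  finally show "emeasure (distr (prb U) borel (eta_t U)) X = emeasure (CN (kappa_t P * p_UE P)) X" .
qed simp

end

context uplink_limit
begin

lemma phi_mean_lower:
  assumes int: "integrable (prb U) (phi P N U)"
  shows "measure (CN (kappa_t P * p_UE P)) {z. cmod z \<le> cmod d / 2} / 3 \<le> cmod (\<integral>\<omega>. phi P N U \<omega> \<partial>prb U)"
proof -
  let ?v = "kappa_t P * p_UE P"
  let ?S = "{z. cmod z \<le> cmod d / 2}"
  define f where "f z = (1 + inverse d * z) * complex_of_real (sqrt tau) / complex_of_real (sqrt ((cmod (d + z))\<^sup>2 * alpha + beta))" for z
  define H where "H z = Re (f z)" for z
  have fm: "f \<in> borel_measurable borel" unfolding f_def by simp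
  then have Hm: "H \<in> borel_measurable borel" unfolding H_def[abs_def] by simp
  have ph: "phi P N U = (\<lambda>\<omega>. f (eta_t U \<omega>))" by (simp add: fun_eq_iff phi_eq f_def)
  have fi: "integrable (CN ?v) f"
    unfolding eta_law[symmetric] using int eta_meas fm by (simp add: integrable_distr_eq ph)
  have Hi: "integrable (CN ?v) H" unfolding H_def[abs_def] using fi by simp
  have "(\<integral>\<omega>. phi P N U \<omega> \<partial>prb U) = (\<integral>z. f z \<partial>CN ?v)"
    unfolding eta_law[symmetric] ph using eta_meas fm by (simp add: integral_distr)
  then have RE: "Re (\<integral>\<omega>. phi P N U \<omega> \<partial>prb U) = (\<integral>z. H z \<partial>CN ?v)"
    unfolding H_def using fi by simp
  have um: "uminus \<in> CN ?v \<rightarrow>\<^sub>M (borel :: complex measure)" by (simp cong: measurable_cong_sets)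
  have Hi': "integrable (CN ?v) (\<lambda>z. H (- z))" and Hu: "(\<integral>z. H (- z) \<partial>CN ?v) = (\<integral>z. H z \<partial>CN ?v)"
  proof -
    have "integrable (distr (CN ?v) borel uminus) H" unfolding CN_uminus by (rule Hi)
    then show "integrable (CN ?v) (\<lambda>z. H (- z))" using um Hm by (simp add: integrable_distr_eq)
    have "(\<integral>z. H z \<partial>distr (CN ?v) borel uminus) = (\<integral>z. H (- z) \<partial>CN ?v)" using um Hm by (simp add: integral_distr)
    then show "(\<integral>z. H (- z) \<partial>CN ?v) = (\<integral>z. H z \<partial>CN ?v)" by (simp add: CN_uminus)
  qed
  have bpos: "0 < beta" using beta_c c_pos N_pos by (meson less_le_trans mult_pos_pos)
  have Hz: "H z = sqrt tau * (Re (1 + z / d) / sqrt ((cmod (1 + z / d))\<^sup>2 * (p_UE P * alpha) + beta))" for z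
  proof -
    have "d + z = d * (1 + z / d)" using d_nz by (simp add: field_simps)
    then have "(cmod (d + z))\<^sup>2 = p_UE P * (cmod (1 + z / d))\<^sup>2" by (simp only: norm_mult power_mult_distrib d_norm)
    then have "sqrt ((cmod (d + z))\<^sup>2 * alpha + beta) = sqrt ((cmod (1 + z / d))\<^sup>2 * (p_UE P * alpha) + beta)" by (simp add: mult_ac)
    then show ?thesis unfolding H_def f_def Re_divide_of_real by (simp add: divide_inverse mult_ac)
  qed
  have pa: "0 \<le> p_UE P * alpha" using p_pos alpha_nonneg by simp
  have pair: "0 \<le> H z + H (- z)" for z
    using paired_nonneg[OF pa bpos, of "z / d"] tau_pos unfolding Hz
    by (simp only: distrib_left[symmetric] minus_divide_left[symmetric] diff_conv_add_uminus[symmetric]) (simp add: zero_le_mult_iff)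
  have third: "1 / 3 \<le> H z" if "cmod z \<le> cmod d / 2" for z
  proof -
    define w where "w = z / d"
    have w: "cmod w \<le> 1 / 2" using that d_nz by (simp add: w_def norm_divide field_simps)
    have "Re (1 + w) \<ge> 1 / 2" using abs_Re_le_cmod[of w] w by auto
    have "cmod (1 + w) \<le> 3 / 2" using norm_triangle_ineq[of 1 w] w by simp
    then have "(cmod (1 + w))\<^sup>2 \<le> (3 / 2)\<^sup>2" by (intro power_mono) auto
    then have "(cmod (1 + w))\<^sup>2 * (p_UE P * alpha) + beta \<le> (3 / 2)\<^sup>2 * (p_UE P * alpha) + (3 / 2)\<^sup>2 * beta"
      using pa bpos by (intro add_mono mult_right_mono) (auto simp: power2_eq_square)
    also have "\<dots> = (3 / 2)\<^sup>2 * (p_UE P * alpha + beta)" by (simp add: distrib_left)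
    also have "\<dots> \<le> (3 / 2)\<^sup>2 * tau"
      unfolding tau_eq using p_pos kt_nonneg alpha_nonneg by (intro mult_left_mono) (auto simp: algebra_simps)
    finally have "sqrt ((cmod (1 + w))\<^sup>2 * (p_UE P * alpha) + beta) \<le> sqrt ((3 / 2)\<^sup>2 * tau)" by (rule real_sqrt_le_mono)
    also have "\<dots> = 3 / 2 * sqrt tau" unfolding real_sqrt_mult by simp
    finally have le: "sqrt ((cmod (1 + w))\<^sup>2 * (p_UE P * alpha) + beta) \<le> 3 / 2 * sqrt tau" .
    have pos: "0 < sqrt ((cmod (1 + w))\<^sup>2 * (p_UE P * alpha) + beta)" using pa bpos by (intro real_sqrt_gt_zero add_nonneg_pos) auto
    have st: "0 < sqrt tau" using tau_pos by simp
    have "1 / 3 = sqrt tau * ((1 / 2) / (3 / 2 * sqrt tau))" using st by simp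
    also have "\<dots> \<le> sqrt tau * (Re (1 + w) / sqrt ((cmod (1 + w))\<^sup>2 * (p_UE P * alpha) + beta))"
      using \<open>Re (1 + w) \<ge> 1 / 2\<close> le pos st by (intro mult_left_mono frac_le) auto
    finally show ?thesis unfolding Hz w_def[symmetric] .
  qed
  have S: "?S \<in> sets borel" by measurable
  have "(2 / 3) * measure (CN ?v) ?S = (\<integral>z. (2 / 3) * indicat_real ?S z \<partial>CN ?v)"
    using S by simp
  also have "\<dots> \<le> (\<integral>z. H z + H (- z) \<partial>CN ?v)"
  proof (rule integral_mono)
    show "integrable (CN ?v) (\<lambda>z. (2 / 3) * indicat_real ?S z)"
      using S by (intro integrable_mult_right integrable_real_indicator) (auto simp: CN.emeasure_eq_measure)
    show "integrable (CN ?v) (\<lambda>z. H z + H (- z))" using Hi Hi' by simp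
    fix z
    show "(2 / 3) * indicat_real ?S z \<le> H z + H (- z)"
      using pair[of z] third[of z] third[of "- z"] by (auto simp: indicator_def)
  qed
  also have "\<dots> = 2 * (\<integral>z. H z \<partial>CN ?v)" using Hi Hi' Hu by simp
  finally show ?thesis using RE complex_Re_le_cmod[of "\<integral>\<omega>. phi P N U \<omega> \<partial>prb U"] by simp
qed

lemma phi_second_moment:
  "msq (prb U) (\<lambda>w. phi P N U w) \<le> ennreal (\<rho> / (p_UE P * c0))"
proof -
  have pw: "(cmod (phi P N U w))\<^sup>2 \<le> 1 / (p_UE P * c0) * (cmod (d + eta_t U w))\<^sup>2" for w
  proof -
    have r: "0 < r0 w" using r0_lower[of w] c0_pos by simp
    have "(cmod (phi P N U w))\<^sup>2 = (cmod (s w))\<^sup>2 / p_UE P / r0 w"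
      unfolding phi_r0 norm_divide norm_of_real power_divide power2_abs d_norm using r by simp
    also have "\<dots> \<le> (cmod (s w))\<^sup>2 / p_UE P / c0"
      using r r0_lower[of w] c0_pos p_pos by (intro divide_left_mono) auto
    finally show ?thesis by (simp add: s_def)
  qed
  have sm: "(\<lambda>w. (cmod (d + eta_t U w))\<^sup>2) \<in> borel_measurable (prb U)" by (intro borel_measurable_norm2 meas_intros eta_meas)
  have "msq (prb U) (\<lambda>w. phi P N U w) \<le> (\<integral>\<^sup>+w. ennreal (1 / (p_UE P * c0) * (cmod (d + eta_t U w))\<^sup>2) \<partial>prb U)"
    by (intro nn_integral_mono ennreal_leI pw)
  also have "\<dots> \<le> ennreal (1 / (p_UE P * c0) * \<rho>)"
  proof (rule nn_integral_cmult_le[OF sm])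
    have "msq (prb U) (\<lambda>w. d + eta_t U w) = msq (CN (kappa_t P * p_UE P)) (\<lambda>z. d + z)"
      unfolding eta_law[symmetric] by (rule nn_integral_distr[OF eta_meas, symmetric]) simp
    then show "msq (prb U) (\<lambda>w. d + eta_t U w) \<le> ennreal \<rho>" using s_moments(2) by simp
  qed (use p_pos c0_pos in simp)
  finally show ?thesis by simp
qed

lemma impairment_term:
  "0 \<le> (\<Sum>i<N. \<integral>w. (cmod (hvec N U w $ i))\<^sup>2 * (cmod (mrc P N U w $ i))\<^sup>2 \<partial>prb U)"
  "(\<Sum>i<N. \<integral>w. (cmod (hvec N U w $ i))\<^sup>2 * (cmod (mrc P N U w $ i))\<^sup>2 \<partial>prb U) \<le> sqrt (real N) * ((2 * \<rho>\<^sup>2 + 1) / 2)"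
proof -
  let ?t = "\<lambda>i w. (cmod (h w i))\<^sup>2 * (cmod (mrc P N U w $ i))\<^sup>2"
  have hv: "hvec N U w $ i = h w i" if "i < N" for i w using that by (simp add: hvec_def)
  show "0 \<le> (\<Sum>i<N. \<integral>w. (cmod (hvec N U w $ i))\<^sup>2 * (cmod (mrc P N U w $ i))\<^sup>2 \<partial>prb U)"
    by (intro sum_nonneg Bochner_Integration.integral_nonneg) auto
  define n where "n = sqrt (real N)"
  have n: "0 < n" "n * n = real N" using N_pos by (auto simp: n_def)
  have ti: "integrable (prb U) (?t i)" if i: "i < N" for i
  proof (rule Bochner_Integration.integrable_bound[OF h_entry2(1)[OF i]])
    show "?t i \<in> borel_measurable (prb U)" by (intro borel_measurable_times borel_measurable_norm2 h_meas_i mrc_meas i)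
    show "AE w in prb U. norm (?t i w) \<le> norm ((cmod (h w i))\<^sup>2)"
      using mrc_entry_le[OF i] by (intro AE_I2) (simp add: mult_left_le)
  qed
  have h4: "integrable (prb U) (\<lambda>w. cmod (h w i) ^ 4)" "(\<integral>w. cmod (h w i) ^ 4 \<partial>prb U) \<le> 2 * \<rho>\<^sup>2" if i: "i < N" for i
    using integrable_from_nn[OF _ _ h_entry2(4)[OF i]] h_meas_i[OF i] by auto
  have "(\<Sum>i<N. \<integral>w. (cmod (hvec N U w $ i))\<^sup>2 * (cmod (mrc P N U w $ i))\<^sup>2 \<partial>prb U) = (\<integral>w. (\<Sum>i<N. ?t i w) \<partial>prb U)"
    using ti by (subst Bochner_Integration.integral_sum) (auto simp: hv)
  also have "\<dots> \<le> (\<integral>w. (\<Sum>i<N. cmod (h w i) ^ 4) / (2 * n) + n / 2 \<partial>prb U)"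
  proof (rule integral_mono)
    show "integrable (prb U) (\<lambda>w. \<Sum>i<N. ?t i w)" using ti by (intro Bochner_Integration.integrable_sum) auto
    show "integrable (prb U) (\<lambda>w. (\<Sum>i<N. cmod (h w i) ^ 4) / (2 * n) + n / 2)"
      using h4(1) by (intro Bochner_Integration.integrable_add integrable_divide Bochner_Integration.integrable_sum) auto
    fix w
    have am: "x * y \<le> x\<^sup>2 / (2 * n) + n / 2 * y\<^sup>2" for x y :: real
    proof -
      have "0 \<le> (x - n * y)\<^sup>2 / (2 * n)" using n by (intro divide_nonneg_pos) auto
      also have "\<dots> = x\<^sup>2 / (2 * n) + n / 2 * y\<^sup>2 - x * y"
        using n by (simp add: power2_diff field_simps power2_eq_square)
      finally show ?thesis by simp
    qed
    have "(\<Sum>i<N. ?t i w) \<le> (\<Sum>i<N. ((cmod (h w i))\<^sup>2)\<^sup>2 / (2 * n) + n / 2 * ((cmod (mrc P N U w $ i))\<^sup>2)\<^sup>2)"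
      by (intro sum_mono am)
    also have "\<dots> \<le> (\<Sum>i<N. cmod (h w i) ^ 4 / (2 * n) + n / 2 * (cmod (mrc P N U w $ i))\<^sup>2)"
    proof (intro sum_mono add_mono mult_left_mono)
      fix i assume "i \<in> {..<N}"
      then have "(cmod (mrc P N U w $ i))\<^sup>2 \<le> 1" by (intro mrc_entry_le) simp
      then show "((cmod (mrc P N U w $ i))\<^sup>2)\<^sup>2 \<le> (cmod (mrc P N U w $ i))\<^sup>2"
        by (subst power2_eq_square) (rule mult_left_le, auto)
    qed (use n in auto)
    also have "\<dots> = (\<Sum>i<N. cmod (h w i) ^ 4) / (2 * n) + n / 2 * sqn N (\<lambda>i. mrc P N U w $ i)"
      by (simp add: sum.distrib sum_divide_distrib sum_distrib_left sqn_def)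
    also have "\<dots> \<le> (\<Sum>i<N. cmod (h w i) ^ 4) / (2 * n) + n / 2"
      using mult_left_mono[OF mrc_sqn[of w], of "n / 2"] n by simp
    finally show "(\<Sum>i<N. ?t i w) \<le> (\<Sum>i<N. cmod (h w i) ^ 4) / (2 * n) + n / 2" .
  qed
  also have "\<dots> = (\<Sum>i<N. \<integral>w. cmod (h w i) ^ 4 \<partial>prb U) / (2 * n) + n / 2"
    using h4(1) by (subst Bochner_Integration.integral_add)
      (auto simp: M.prob_space Bochner_Integration.integral_sum intro!: integrable_divide Bochner_Integration.integrable_sum)
  also have "\<dots> \<le> (\<Sum>i<N. 2 * \<rho>\<^sup>2) / (2 * n) + n / 2"
    using h4(2) n by (intro add_mono divide_right_mono sum_mono order_refl) auto
  also have "\<dots> = n * ((2 * \<rho>\<^sup>2 + 1) / 2)" using n by (simp add: field_simps flip: n(2))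
  finally show "(\<Sum>i<N. \<integral>w. (cmod (hvec N U w $ i))\<^sup>2 * (cmod (mrc P N U w $ i))\<^sup>2 \<partial>prb U) \<le> sqrt (real N) * ((2 * \<rho>\<^sup>2 + 1) / 2)"
    by (simp add: n_def)
qed

end

context uplink_sys
begin

lemma cov_Q_carrier: "c \<in> space (chans U) \<Longrightarrow> cov_Q U c \<in> carrier_mat N N"
  and cov_Q_integrable: "integrable (prb U) (\<lambda>w. spectral_norm (cov_Q U (chan U w)))"
  using model unfolding uplink_model_def by blast+

lemma mrc_quad_le:
  assumes w: "w \<in> space (prb U)"
  shows "\<bar>Re (((cov_Q U (chan U w) + complex_of_real (sigma2 P) \<cdot>\<^sub>m 1\<^sub>m N) *\<^sub>v mrc P N U w) \<bullet>c mrc P N U w)\<bar>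
    \<le> spectral_norm (cov_Q U (chan U w)) + sigma2 P"
proof -
  let ?Q = "cov_Q U (chan U w)" and ?v = "mrc P N U w"
  let ?K = "?Q + complex_of_real (sigma2 P) \<cdot>\<^sub>m 1\<^sub>m N"
  have Q: "?Q \<in> carrier_mat N N" by (rule cov_Q_carrier[OF measurable_space[OF chan_meas w]])
  have K: "?K \<in> carrier_mat N N" using Q by simp
  have qb: "opb N (\<lambda>i j. ?Q $$ (i, j)) (spectral_norm ?Q)" by (rule opb_spectral_norm(1)[OF Q N1])
  have "opb N (\<lambda>i j. ?Q $$ (i, j) + (if i = j then complex_of_real (sigma2 P) else 0)) (spectral_norm ?Q + sigma2 P)"
    using sigma2_pos by (intro opb_add qb opb_diag) auto
  then have kb: "opb N (\<lambda>i j. ?K $$ (i, j)) (spectral_norm ?Q + sigma2 P)"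
    by (rule opb_cong) (use Q in auto)
  have "cmod ((?K *\<^sub>v ?v) \<bullet>c ?v) \<le> (spectral_norm ?Q + sigma2 P) * sqn N (\<lambda>i. ?v $ i)"
    unfolding quad_form_sum[OF K mrc_carrier] using opb_quad[OF kb, of "\<lambda>i. cnj (?v $ i)"] by simp
  also have "\<dots> \<le> spectral_norm ?Q + sigma2 P"
    using mrc_sqn[of w] opb_nonneg[OF kb] by (intro mult_left_le) auto
  finally show ?thesis using abs_Re_le_cmod order_trans by blast
qed

lemma interference_term:
  "\<bar>\<integral>w. Re (((cov_Q U (chan U w) + complex_of_real (sigma2 P) \<cdot>\<^sub>m 1\<^sub>m N) *\<^sub>v mrc P N U w) \<bullet>c mrc P N U w) \<partial>prb U\<bar>
    \<le> (\<integral>w. spectral_norm (cov_Q U (chan U w)) \<partial>prb U) + sigma2 P"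
proof -
  have "\<bar>\<integral>w. Re (((cov_Q U (chan U w) + complex_of_real (sigma2 P) \<cdot>\<^sub>m 1\<^sub>m N) *\<^sub>v mrc P N U w) \<bullet>c mrc P N U w) \<partial>prb U\<bar>
    \<le> (\<integral>w. spectral_norm (cov_Q U (chan U w)) + sigma2 P \<partial>prb U)"
    using cov_Q_integrable by (intro abs_integral_le mrc_quad_le) auto
  also have "\<dots> = (\<integral>w. spectral_norm (cov_Q U (chan U w)) \<partial>prb U) + sigma2 P"
    using cov_Q_integrable by (simp add: M.prob_space)
  finally show ?thesis .
qed

definition "sig = (cmod (\<integral>w. mrc P N U w \<bullet>c hvec N U w \<partial>prb U))\<^sup>2"
definition "den = (1 + kappa_t P) * (\<integral>w. (cmod (mrc P N U w \<bullet>c hvec N U w))\<^sup>2 \<partial>prb U) - sig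
   + kappa_r P * (\<Sum>i<N. \<integral>w. (cmod (hvec N U w $ i))\<^sup>2 * (cmod (mrc P N U w $ i))\<^sup>2 \<partial>prb U)
   + (\<integral>w. Re (((cov_Q U (chan U w) + complex_of_real (sigma2 P) \<cdot>\<^sub>m 1\<^sub>m N) *\<^sub>v mrc P N U w) \<bullet>c mrc P N U w) \<partial>prb U) / p_UE P"

lemma capacity_lower_eq: "capacity_lower P N U (mrc P N U) = real (T_data P) / real (T_coher P) * log 2 (1 + sig / den)"
  unfolding capacity_lower_def sig_def den_def ..

end

context uplink_limit
begin

definition "bphi = sqrt (\<rho> / (p_UE P * c0))"
definition "C_err = sqrt G * (2 * bphi + sqrt G)"

lemma bphi_pos: "0 < bphi" using rho_pos p_pos c0_pos by (simp add: bphi_def)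

lemma comparison:
  "\<bar>sig / tau - (cmod (\<integral>w. phi P N U w \<partial>prb U))\<^sup>2\<bar> \<le> C_err / sqrt (real N)"
  "\<bar>(\<integral>w. (cmod (mrc P N U w \<bullet>c hvec N U w))\<^sup>2 \<partial>prb U) / tau - (\<integral>w. (cmod (phi P N U w))\<^sup>2 \<partial>prb U)\<bar> \<le> C_err / sqrt (real N)"
  "integrable (prb U) (phi P N U)" "integrable (prb U) (\<lambda>w. (cmod (phi P N U w))\<^sup>2)"
proof -
  let ?\<delta> = "sqrt (G / real N)"
  have \<delta>: "0 < ?\<delta>" using G_pos N_pos by simp
  have a: "msq (prb U) (\<lambda>w. Y w - phi P N U w) \<le> ennreal (?\<delta>\<^sup>2)"
    using Y_phi G_pos N_pos by simp
  have b: "msq (prb U) (\<lambda>w. phi P N U w) \<le> ennreal (bphi\<^sup>2)"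
    using phi_second_moment rho_pos p_pos c0_pos by (simp add: bphi_def)
  note m = mean_square_comparison[OF prob_M Y_meas phi_meas \<delta> bphi_pos a b]
  have "?\<delta> * (2 * bphi + ?\<delta>) \<le> ?\<delta> * (2 * bphi + sqrt G)"
  proof -
    have "G / real N \<le> G" using G_pos N1 by (simp add: divide_le_eq)
    then have "?\<delta> \<le> sqrt G" by (rule real_sqrt_le_mono)
    then show ?thesis using \<delta> by (intro mult_left_mono) auto
  qed
  also have "\<dots> = C_err / sqrt (real N)" by (simp add: C_err_def real_sqrt_divide)
  finally have e: "?\<delta> * (2 * bphi + ?\<delta>) \<le> C_err / sqrt (real N)" .
  have st: "sqrt tau * sqrt tau = tau" using tau_pos by simp
  have "(cmod (\<integral>w. Y w \<partial>prb U))\<^sup>2 = sig / tau"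
    unfolding Y_def sig_def using tau_pos by (simp add: norm_divide power_divide)
  then show "\<bar>sig / tau - (cmod (\<integral>w. phi P N U w \<partial>prb U))\<^sup>2\<bar> \<le> C_err / sqrt (real N)"
    using m(1) e by simp
  have "(\<integral>w. (cmod (Y w))\<^sup>2 \<partial>prb U) = (\<integral>w. (cmod (mrc P N U w \<bullet>c hvec N U w))\<^sup>2 \<partial>prb U) / tau"
    unfolding Y_def using tau_pos by (simp add: norm_divide power_divide)
  then show "\<bar>(\<integral>w. (cmod (mrc P N U w \<bullet>c hvec N U w))\<^sup>2 \<partial>prb U) / tau - (\<integral>w. (cmod (phi P N U w))\<^sup>2 \<partial>prb U)\<bar> \<le> C_err / sqrt (real N)"
    using m(2) e by simp
  show "integrable (prb U) (phi P N U)" "integrable (prb U) (\<lambda>w. (cmod (phi P N U w))\<^sup>2)" by (rule m(3,4))+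
qed

lemma den_comparison:
  "\<bar>den / tau - ((1 + kappa_t P) * (\<integral>\<omega>. (cmod (phi P N U \<omega>))\<^sup>2 \<partial>prb U) - (cmod (\<integral>\<omega>. phi P N U \<omega> \<partial>prb U))\<^sup>2)\<bar>
    \<le> ((2 + kappa_t P) * C_err + kappa_r P * (2 * \<rho>\<^sup>2 + 1) / (2 * c)) / sqrt (real N)
      + ((\<integral>\<omega>. spectral_norm (cov_Q U (chan U \<omega>)) \<partial>prb U) + sigma2 P) / (p_UE P * c * real N)"
proof -
  define E2 where "E2 = (\<integral>\<omega>. (cmod (mrc P N U \<omega> \<bullet>c hvec N U \<omega>))\<^sup>2 \<partial>prb U)"
  define F2 where "F2 = (\<integral>\<omega>. (cmod (phi P N U \<omega>))\<^sup>2 \<partial>prb U)"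
  define F1 where "F1 = (cmod (\<integral>\<omega>. phi P N U \<omega> \<partial>prb U))\<^sup>2"
  define T3 where "T3 = (\<Sum>i<N. \<integral>\<omega>. (cmod (hvec N U \<omega> $ i))\<^sup>2 * (cmod (mrc P N U \<omega> $ i))\<^sup>2 \<partial>prb U)"
  define T4 where "T4 = (\<integral>\<omega>. Re (((cov_Q U (chan U \<omega>) + complex_of_real (sigma2 P) \<cdot>\<^sub>m 1\<^sub>m N) *\<^sub>v mrc P N U \<omega>) \<bullet>c mrc P N U \<omega>) \<partial>prb U)"
  define Qb where "Qb = (\<integral>\<omega>. spectral_norm (cov_Q U (chan U \<omega>)) \<partial>prb U) + sigma2 P"
  have kr: "0 \<le> kappa_r P" using params by (simp add: valid_params_def)
  have "den / tau - ((1 + kappa_t P) * F2 - F1) = (1 + kappa_t P) * (E2 / tau - F2) - (sig / tau - F1) + kappa_r P * (T3 / tau) + T4 / (p_UE P * tau)"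
    unfolding den_def E2_def[symmetric] T3_def[symmetric] T4_def[symmetric]
    by (simp add: add_divide_distrib diff_divide_distrib right_diff_distrib)
  also have "\<bar>\<dots>\<bar> \<le> (1 + kappa_t P) * \<bar>E2 / tau - F2\<bar> + \<bar>sig / tau - F1\<bar> + kappa_r P * (T3 / tau) + \<bar>T4\<bar> / (p_UE P * tau)"
  proof -
    have "0 \<le> T3 / tau" using impairment_term(1) tau_pos by (simp add: T3_def)
    then have "\<bar>kappa_r P * (T3 / tau)\<bar> = kappa_r P * (T3 / tau)" using kr by (intro abs_of_nonneg mult_nonneg_nonneg)
    moreover have "\<bar>(1 + kappa_t P) * (E2 / tau - F2)\<bar> = (1 + kappa_t P) * \<bar>E2 / tau - F2\<bar>" using kt_nonneg by (simp add: abs_mult)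
    moreover have "\<bar>T4 / (p_UE P * tau)\<bar> = \<bar>T4\<bar> / (p_UE P * tau)" using p_pos tau_pos by (simp add: abs_mult)
    moreover have "\<bar>u - v + w + z\<bar> \<le> \<bar>u\<bar> + \<bar>v\<bar> + \<bar>w\<bar> + \<bar>z\<bar>" for u v w z :: real by linarith
    ultimately show ?thesis by metis
  qed
  also have "\<dots> \<le> (1 + kappa_t P) * (C_err / sqrt (real N)) + C_err / sqrt (real N) + kappa_r P * ((2 * \<rho>\<^sup>2 + 1) / (2 * c) / sqrt (real N)) + Qb / (p_UE P * c * real N)"
  proof (intro add_mono mult_left_mono kr)
    show "\<bar>E2 / tau - F2\<bar> \<le> C_err / sqrt (real N)" "\<bar>sig / tau - F1\<bar> \<le> C_err / sqrt (real N)"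
      using comparison(1,2) by (simp_all add: E2_def F2_def F1_def)
    define w where "w = sqrt (real N)"
    have w: "0 < w" "real N = w * w" using N_pos by (auto simp: w_def)
    have "T3 / tau \<le> sqrt (real N) * ((2 * \<rho>\<^sup>2 + 1) / 2) / (c * real N)"
      using impairment_term(2) tau_lower c_pos N_pos tau_pos by (intro frac_le) (auto simp: T3_def)
    also have "\<dots> = (2 * \<rho>\<^sup>2 + 1) / (2 * c) / sqrt (real N)"
      unfolding w_def[symmetric] unfolding w(2) using w(1) c_pos by (simp add: field_simps)
    finally show "T3 / tau \<le> (2 * \<rho>\<^sup>2 + 1) / (2 * c) / sqrt (real N)" .
    have "p_UE P * (c * real N) \<le> p_UE P * tau" using tau_lower p_pos by (intro mult_left_mono) auto
    then show "\<bar>T4\<bar> / (p_UE P * tau) \<le> Qb / (p_UE P * c * real N)"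
      using interference_term p_pos c_pos N_pos by (intro frac_le) (auto simp: T4_def Qb_def mult.assoc)
  qed (use kt_nonneg in simp)
  also have "\<dots> = ((2 + kappa_t P) * C_err + kappa_r P * (2 * \<rho>\<^sup>2 + 1) / (2 * c)) / sqrt (real N) + Qb / (p_UE P * c * real N)"
  proof -
    have "(1 + k) * (e / w) + e / w + l * (x / y / w) = ((2 + k) * e + l * x / y) / w" for k e w l x y :: real
      by (simp add: add_divide_distrib distrib_right)
    then show ?thesis by metis
  qed
  finally show ?thesis by (simp add: F1_def F2_def Qb_def)
qed

end

section \<open>Shifted Gaussian laws\<close>

lemma linear_second_moment:
  assumes "\<And>i j. i < N \<Longrightarrow> j < N \<Longrightarrow> has_bochner_integral M (\<lambda>w. X w i * cnj (X w j)) (K i j)"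
  shows "has_bochner_integral M (\<lambda>w. (cmod (\<Sum>i<(N::nat). a i * X w i))\<^sup>2)
    (Re (\<Sum>i<N. \<Sum>j<N. a i * K i j * cnj (a j)))"
proof (rule has_bochner_integral_norm_square)
  have "has_bochner_integral M (\<lambda>w. \<Sum>i<N. \<Sum>j<N. (a i * cnj (a j)) * (X w i * cnj (X w j)))
     (\<Sum>i<N. \<Sum>j<N. (a i * cnj (a j)) * K i j)"
    by (intro has_bochner_integral_sum has_bochner_integral_mult_right assms) auto
  moreover have "(\<Sum>i<N. \<Sum>j<N. (a i * cnj (a j)) * (X w i * cnj (X w j))) = (\<Sum>i<N. a i * X w i) * cnj (\<Sum>i<N. a i * X w i)" for w
    unfolding cnj_sum sum_product by (intro sum.cong refl) (simp add: mult_ac)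
  moreover have "(\<Sum>i<N. \<Sum>j<N. (a i * cnj (a j)) * K i j) = (\<Sum>i<N. \<Sum>j<N. a i * K i j * cnj (a j))"
    by (intro sum.cong refl) (simp add: mult_ac)
  ultimately show "has_bochner_integral M (\<lambda>w. (\<Sum>i<N. a i * X w i) * cnj (\<Sum>i<N. a i * X w i)) (\<Sum>i<N. \<Sum>j<N. a i * K i j * cnj (a j))"
    by simp
qed

lemma nn_integral_std_normal_shift:
  assumes F[measurable]: "F \<in> borel_measurable borel"
  shows "(\<integral>\<^sup>+x. F (m + x) \<partial>std_normal) = (\<integral>\<^sup>+x. F x * ennreal (exp (m * x - m\<^sup>2 / 2)) \<partial>std_normal)"
proof -
  have "(\<integral>\<^sup>+x. F (m + x) \<partial>std_normal) = (\<integral>\<^sup>+x. ennreal (std_normal_density x) * F (m + x) \<partial>lborel)"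
    by (subst nn_integral_density) auto
  also have "\<dots> = (\<integral>\<^sup>+x. ennreal (std_normal_density (- m + x)) * F x \<partial>lborel)"
    by (subst nn_integral_real_affine[where c=1 and t="- m"]) auto
  also have "\<dots> = (\<integral>\<^sup>+x. ennreal (std_normal_density x) * (F x * ennreal (exp (m * x - m\<^sup>2 / 2))) \<partial>lborel)"
  proof (intro nn_integral_cong)
    fix x
    have "std_normal_density (- m + x) = std_normal_density x * exp (m * x - m\<^sup>2 / 2)"
      by (simp add: normal_density_def exp_add[symmetric] power2_eq_square field_simps)
    then show "ennreal (std_normal_density (- m + x)) * F x = ennreal (std_normal_density x) * (F x * ennreal (exp (m * x - m\<^sup>2 / 2)))"
      by (simp add: ennreal_mult mult_ac)
  qed
  also have "\<dots> = (\<integral>\<^sup>+x. F x * ennreal (exp (m * x - m\<^sup>2 / 2)) \<partial>std_normal)"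
    by (subst nn_integral_density) auto
  finally show ?thesis .
qed

lemma measurable_Complex' [measurable]:
  "f \<in> borel_measurable M \<Longrightarrow> g \<in> borel_measurable M \<Longrightarrow> (\<lambda>x. Complex (f x) (g x)) \<in> borel_measurable M"
  unfolding Complex_eq by simp

lemma CN_shift:
  assumes v: "0 < v"
  shows "distr (CN v) borel (\<lambda>z. m + z) = density (CN v) (\<lambda>z. ennreal (exp ((2 * Re (cnj m * z) - (cmod m)\<^sup>2) / v)))"
proof (rule measure_eqI)
  fix A assume "A \<in> sets (distr (CN v) borel (\<lambda>z. m + z))"
  then have A[measurable]: "A \<in> sets borel" by simp
  define a where "a = sqrt (v / 2)"
  have a: "0 < a" "a * a = v / 2" using v by (auto simp: a_def)
  define p where "p = Re m / a"
  define q where "q = Im m / a"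
  have m: "m = Complex (a * p) (a * q)" using a by (simp add: p_def q_def complex_eq_iff)
  let ?F = "\<lambda>z. indicator A z :: ennreal"
  have "emeasure (distr (CN v) borel (\<lambda>z. m + z)) A = (\<integral>\<^sup>+z. ?F (m + z) \<partial>CN v)"
    using A by (intro emeasure_distr_nn_integral) auto
  also have "\<dots> = (\<integral>\<^sup>+x. \<integral>\<^sup>+y. ?F (Complex (a * (p + x)) (a * (q + y))) \<partial>std_normal \<partial>std_normal)"
    unfolding a_def[symmetric] by (subst nn_integral_CN) (auto simp: a_def[symmetric] m distrib_left plus_complex.ctr intro!: nn_integral_cong arg_cong[where f="indicator A"])
  also have "\<dots> = (\<integral>\<^sup>+x. \<integral>\<^sup>+y. ?F (Complex (a * (p + x)) (a * y)) * ennreal (exp (q * y - q\<^sup>2 / 2)) \<partial>std_normal \<partial>std_normal)"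
    by (intro nn_integral_cong nn_integral_std_normal_shift[of "\<lambda>y. ?F (Complex (a * (p + x)) (a * y))" for x]) measurable
  also have "\<dots> = (\<integral>\<^sup>+x. (\<integral>\<^sup>+y. ?F (Complex (a * x) (a * y)) * ennreal (exp (q * y - q\<^sup>2 / 2)) \<partial>std_normal) * ennreal (exp (p * x - p\<^sup>2 / 2)) \<partial>std_normal)"
    by (rule nn_integral_std_normal_shift[of "\<lambda>x. \<integral>\<^sup>+y. ?F (Complex (a * x) (a * y)) * ennreal (exp (q * y - q\<^sup>2 / 2)) \<partial>std_normal"]) measurable
  also have "\<dots> = (\<integral>\<^sup>+x. \<integral>\<^sup>+y. ?F (Complex (a * x) (a * y)) * ennreal (exp (q * y - q\<^sup>2 / 2)) * ennreal (exp (p * x - p\<^sup>2 / 2)) \<partial>std_normal \<partial>std_normal)"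
    by (intro nn_integral_cong nn_integral_multc[symmetric]) measurable
  also have "\<dots> = (\<integral>\<^sup>+x. \<integral>\<^sup>+y. ?F (Complex (a * x) (a * y)) * ennreal (exp ((2 * Re (cnj m * Complex (a * x) (a * y)) - (cmod m)\<^sup>2) / v)) \<partial>std_normal \<partial>std_normal)"
  proof (intro nn_integral_cong)
    fix x y
    have m2: "(cmod m)\<^sup>2 = (a * a) * (p\<^sup>2 + q\<^sup>2)"
      by (subst m, subst cmod_power2) (simp add: power2_eq_square algebra_simps)
    have mr: "Re (cnj m * Complex (a * x) (a * y)) = (a * a) * (p * x + q * y)"
      by (subst m) (simp add: algebra_simps)
    have "(2 * Re (cnj m * Complex (a * x) (a * y)) - (cmod m)\<^sup>2) / v = (q * y - q\<^sup>2 / 2) + (p * x - p\<^sup>2 / 2)"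
      unfolding m2 mr a(2) using v by (simp add: field_simps)
    then have "exp ((2 * Re (cnj m * Complex (a * x) (a * y)) - (cmod m)\<^sup>2) / v) = exp (q * y - q\<^sup>2 / 2) * exp (p * x - p\<^sup>2 / 2)"
      by (simp add: exp_add)
    then show "?F (Complex (a * x) (a * y)) * ennreal (exp (q * y - q\<^sup>2 / 2)) * ennreal (exp (p * x - p\<^sup>2 / 2)) =
      ?F (Complex (a * x) (a * y)) * ennreal (exp ((2 * Re (cnj m * Complex (a * x) (a * y)) - (cmod m)\<^sup>2) / v))"
      by (simp add: ennreal_mult mult_ac)
  qed
  also have "\<dots> = (\<integral>\<^sup>+z. ?F z * ennreal (exp ((2 * Re (cnj m * z) - (cmod m)\<^sup>2) / v)) \<partial>CN v)"
    by (subst nn_integral_CN) (simp_all add: a_def)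
  also have "\<dots> = emeasure (density (CN v) (\<lambda>z. ennreal (exp ((2 * Re (cnj m * z) - (cmod m)\<^sup>2) / v)))) A"
    by (subst emeasure_density) (simp_all add: mult.commute)
  finally show "emeasure (distr (CN v) borel (\<lambda>z. m + z)) A = emeasure (density (CN v) (\<lambda>z. ennreal (exp ((2 * Re (cnj m * z) - (cmod m)\<^sup>2) / v)))) A" .
qed simp

lemma PiM_density:
  assumes I: "finite I" and M: "\<And>i. prob_space (M i)" and f: "\<And>i. i \<in> I \<Longrightarrow> f i \<in> borel_measurable (M i)"
    and K: "\<And>i. prob_space (K i)" and eq: "\<And>i. i \<in> I \<Longrightarrow> K i = density (M i) (f i)"
  shows "PiM I K = density (PiM I M) (\<lambda>x. \<Prod>i\<in>I. f i (x i))"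
proof -
  interpret M: product_prob_space M by (intro product_prob_spaceI M)
  interpret K: product_prob_space K by (intro product_prob_spaceI K)
  have "(\<lambda>x. f i (x i)) \<in> borel_measurable (PiM I M)" if "i \<in> I" for i
    by (rule measurable_compose[OF measurable_component_singleton[OF that, of M] f[OF that]])
  then have fm: "(\<lambda>x. \<Prod>i\<in>I. f i (x i)) \<in> borel_measurable (PiM I M)"
    by (rule borel_measurable_prod_ennreal)
  have KM: "sets (K i) = sets (M i)" if "i \<in> I" for i using eq[OF that] by simp
  show ?thesis
  proof (rule K.PiM_eqI[OF I, symmetric])
    show "sets (density (PiM I M) (\<lambda>x. \<Prod>i\<in>I. f i (x i))) = sets (PiM I K)"
      unfolding sets_density by (intro sets_PiM_cong refl) (simp add: KM)
    fix A assume "\<And>i. i \<in> I \<Longrightarrow> A i \<in> sets (K i)"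
    then have A: "\<And>i. i \<in> I \<Longrightarrow> A i \<in> sets (M i)" using KM by blast
    have "emeasure (density (PiM I M) (\<lambda>x. \<Prod>i\<in>I. f i (x i))) (Pi\<^sub>E I A) = (\<integral>\<^sup>+x. (\<Prod>i\<in>I. f i (x i)) * indicator (Pi\<^sub>E I A) x \<partial>PiM I M)"
      by (rule emeasure_density[OF fm sets_PiM_I_finite[OF I A]])
    also have "\<dots> = (\<integral>\<^sup>+x. (\<Prod>i\<in>I. f i (x i) * indicator (A i) (x i)) \<partial>PiM I M)"
    proof (rule nn_integral_cong)
      fix x assume "x \<in> space (PiM I M)"
      then have x: "x \<in> extensional I" by (simp add: space_PiM PiE_def)
      have "indicator (Pi\<^sub>E I A) x = (\<Prod>i\<in>I. indicator (A i) (x i) :: ennreal)"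
      proof (cases "x \<in> Pi\<^sub>E I A")
        case True then show ?thesis by (simp add: PiE_iff)
      next
        case False
        then obtain i where "i \<in> I" "x i \<notin> A i" using x by (auto simp: PiE_iff)
        then show ?thesis using False I by (auto simp: prod_zero_iff indicator_def intro!: prod_zero[symmetric])
      qed
      then show "(\<Prod>i\<in>I. f i (x i)) * indicator (Pi\<^sub>E I A) x = (\<Prod>i\<in>I. f i (x i) * indicator (A i) (x i))"
        by (simp add: prod.distrib)
    qed
    also have "\<dots> = (\<Prod>i\<in>I. \<integral>\<^sup>+x. f i x * indicator (A i) x \<partial>M i)"
      using f A by (intro M.product_nn_integral_prod[OF I]) (auto intro!: borel_measurable_times_ennreal)
    also have "\<dots> = (\<Prod>i\<in>I. emeasure (K i) (A i))"
      using f A by (intro prod.cong refl) (simp add: eq emeasure_density)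
    finally show "emeasure (density (PiM I M) (\<lambda>x. \<Prod>i\<in>I. f i (x i))) (Pi\<^sub>E I A) = (\<Prod>i\<in>I. emeasure (K i) (A i))" .
  qed
qed

definition tilt :: "nat \<Rightarrow> real \<Rightarrow> cvec \<Rightarrow> cvec \<Rightarrow> real" where
  "tilt N v m x = exp (\<Sum>i<N. (2 * Re (cnj (m i) * x i) - (cmod (m i))\<^sup>2) / v)"

lemma nn_integral_PiM_CN_shift:
  fixes N :: nat
  assumes v: "0 < v" and F: "F \<in> borel_measurable (cspace N)"
  shows "(\<integral>\<^sup>+x. F (\<lambda>i\<in>{..<N}. m i + x i) \<partial>PiM {..<N} (\<lambda>_. CN v)) = (\<integral>\<^sup>+x. F x * ennreal (tilt N v m x) \<partial>PiM {..<N} (\<lambda>_. CN v))"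
proof -
  let ?G = "PiM {..<N} (\<lambda>_. CN v)"
  let ?K = "\<lambda>i. distr (CN v) borel (\<lambda>z. m i + z)"
  let ?f = "\<lambda>i z. ennreal (exp ((2 * Re (cnj (m i) * z) - (cmod (m i))\<^sup>2) / v))"
  have K: "prob_space (?K i)" for i by (rule CN.prob_space_distr) simp
  have d: "distr ?G (cspace N) (\<lambda>x. \<lambda>i\<in>{..<N}. m i + x i) = PiM {..<N} ?K"
    by (rule distr_PiM_componentwise) (auto simp: prob_space_CN K)
  also have "\<dots> = density ?G (\<lambda>x. \<Prod>i\<in>{..<N}. ?f i (x i))"
    by (intro PiM_density prob_space_CN K CN_shift[OF v]) simp_all
  finally have eq: "distr ?G (cspace N) (\<lambda>x. \<lambda>i\<in>{..<N}. m i + x i) = density ?G (\<lambda>x. \<Prod>i\<in>{..<N}. ?f i (x i))" .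
  have xm: "(\<lambda>x. x i) \<in> borel_measurable ?G" if "i \<in> {..<N}" for i
    using measurable_component_singleton[OF that, of "\<lambda>_. CN v"] by (simp cong: measurable_cong_sets)
  have mm: "(\<lambda>x. \<lambda>i\<in>{..<N}. m i + x i) \<in> ?G \<rightarrow>\<^sub>M cspace N"
    by (intro measurable_restrict borel_measurable_add borel_measurable_const xm)
  have fm: "(\<lambda>x. \<Prod>i\<in>{..<N}. ?f i (x i)) \<in> borel_measurable ?G"
    by (intro borel_measurable_prod_ennreal measurable_compose[OF xm]) simp_all
  have pr: "(\<Prod>i\<in>{..<N}. ?f i (x i)) = ennreal (tilt N v m x)" for x
    by (simp add: tilt_def exp_sum prod_ennreal)
  have "(\<integral>\<^sup>+x. F (\<lambda>i\<in>{..<N}. m i + x i) \<partial>?G) = (\<integral>\<^sup>+x. F x \<partial>distr ?G (cspace N) (\<lambda>x. \<lambda>i\<in>{..<N}. m i + x i))"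
    using mm F by (simp add: nn_integral_distr)
  also have "\<dots> = (\<integral>\<^sup>+x. (\<Prod>i\<in>{..<N}. ?f i (x i)) * F x \<partial>?G)"
    unfolding eq using fm F by (subst nn_integral_density) (auto cong: measurable_cong_sets)
  finally show ?thesis unfolding pr by (simp add: mult.commute)
qed

lemma CN_gaussian_tilt:
  assumes p: "0 < p" and s: "0 < s"
  shows "(\<integral>\<^sup>+z. ennreal (exp (ln (p / s) - (cmod (z - m))\<^sup>2 / s + (cmod z)\<^sup>2 / p)) \<partial>CN p) = 1"
proof -
  define a where "a = sqrt (p / 2)"
  have a: "0 < a" "a * a = p / 2" "a\<^sup>2 = p / 2" using p by (auto simp: a_def)
  define g where "g k x = sqrt (p / s) * exp (x\<^sup>2 / 2 - (a * x - k)\<^sup>2 / s)" for k x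
  have gm [measurable]: "g k \<in> borel_measurable borel" for k unfolding g_def by measurable
  have g0: "0 \<le> g k x" for k x using p s by (simp add: g_def)
  have g1: "(\<integral>\<^sup>+x. ennreal (g k x) \<partial>std_normal) = 1" for k
  proof -
    have e: "std_normal_density x * g k x = normal_density (k / a) (sqrt (s / p)) x" for x
    proof -
      have "a * x - k = a * (x - k / a)" using a(1) by (simp add: field_simps)
      then have "(a * x - k)\<^sup>2 / s = a\<^sup>2 * (x - k / a)\<^sup>2 / s" by (simp add: power_mult_distrib)
      also have "\<dots> = (x - k / a)\<^sup>2 / (2 * (s / p))" unfolding a(3) using p s by (simp add: field_simps)
      finally have "(a * x - k)\<^sup>2 / s = (x - k / a)\<^sup>2 / (2 * (s / p))" .
      then have e1: "exp (- x\<^sup>2 / 2) * exp (x\<^sup>2 / 2 - (a * x - k)\<^sup>2 / s) = exp (- (x - k / a)\<^sup>2 / (2 * (s / p)))"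
        by (simp flip: exp_add)
      have e2: "sqrt (p / s) / sqrt (2 * pi) = 1 / sqrt (2 * pi * (s / p))"
        using p s by (simp add: real_sqrt_mult real_sqrt_divide)
      have "std_normal_density x * g k x = (sqrt (p / s) / sqrt (2 * pi)) * (exp (- x\<^sup>2 / 2) * exp (x\<^sup>2 / 2 - (a * x - k)\<^sup>2 / s))"
        unfolding normal_density_def g_def by simp
      also have "\<dots> = normal_density (k / a) (sqrt (s / p)) x"
        unfolding e1 e2 normal_density_def using p s by simp
      finally show ?thesis .
    qed
    have "(\<integral>\<^sup>+x. ennreal (g k x) \<partial>std_normal) = (\<integral>\<^sup>+x. ennreal (std_normal_density x) * ennreal (g k x) \<partial>lborel)"
      by (subst nn_integral_density) auto
    also have "\<dots> = (\<integral>\<^sup>+x. ennreal (normal_density (k / a) (sqrt (s / p)) x) \<partial>lborel)"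
      using g0 by (simp add: e flip: ennreal_mult)
    also have "\<dots> = 1"
    proof -
      have "prob_space (density lborel (\<lambda>x. ennreal (normal_density (k / a) (sqrt (s / p)) x)))"
        by (rule prob_space_normal_density) (use p s in simp)
      from prob_space.emeasure_space_1[OF this] show ?thesis by (simp add: emeasure_density)
    qed
    finally show ?thesis .
  qed
  have "(\<integral>\<^sup>+z. ennreal (exp (ln (p / s) - (cmod (z - m))\<^sup>2 / s + (cmod z)\<^sup>2 / p)) \<partial>CN p)
     = (\<integral>\<^sup>+x. \<integral>\<^sup>+y. ennreal (g (Re m) x) * ennreal (g (Im m) y) \<partial>std_normal \<partial>std_normal)"
  proof (subst nn_integral_CN)
    show "(\<lambda>z. ennreal (exp (ln (p / s) - (cmod (z - m))\<^sup>2 / s + (cmod z)\<^sup>2 / p))) \<in> borel_measurable borel" by measurable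
    show "(\<integral>\<^sup>+x. \<integral>\<^sup>+y. ennreal (exp (ln (p / s) - (cmod (Complex (sqrt (p / 2) * x) (sqrt (p / 2) * y) - m))\<^sup>2 / s + (cmod (Complex (sqrt (p / 2) * x) (sqrt (p / 2) * y)))\<^sup>2 / p)) \<partial>std_normal \<partial>std_normal)
      = (\<integral>\<^sup>+x. \<integral>\<^sup>+y. ennreal (g (Re m) x) * ennreal (g (Im m) y) \<partial>std_normal \<partial>std_normal)"
    proof (intro nn_integral_cong)
      fix x y :: real
      have 1: "(cmod (Complex (a * x) (a * y)))\<^sup>2 / p = x\<^sup>2 / 2 + y\<^sup>2 / 2"
        unfolding cmod_power2 using p by (simp add: power_mult_distrib a(3) add_divide_distrib)
      have 2: "(cmod (Complex (a * x) (a * y) - m))\<^sup>2 / s = (a * x - Re m)\<^sup>2 / s + (a * y - Im m)\<^sup>2 / s"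
        unfolding cmod_power2 by (simp add: add_divide_distrib)
      have 3: "exp (ln (p / s)) = sqrt (p / s) * sqrt (p / s)" using p s by simp
      have "exp (ln (p / s) - (cmod (Complex (a * x) (a * y) - m))\<^sup>2 / s + (cmod (Complex (a * x) (a * y)))\<^sup>2 / p)
         = exp (ln (p / s)) * exp (x\<^sup>2 / 2 - (a * x - Re m)\<^sup>2 / s) * exp (y\<^sup>2 / 2 - (a * y - Im m)\<^sup>2 / s)"
        unfolding exp_add[symmetric] 1 2 by (simp add: algebra_simps)
      also have "\<dots> = g (Re m) x * g (Im m) y" unfolding 3 g_def by (simp only: mult_ac)
      finally show "ennreal (exp (ln (p / s) - (cmod (Complex (sqrt (p / 2) * x) (sqrt (p / 2) * y) - m))\<^sup>2 / s + (cmod (Complex (sqrt (p / 2) * x) (sqrt (p / 2) * y)))\<^sup>2 / p))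
        = ennreal (g (Re m) x) * ennreal (g (Im m) y)"
        unfolding a_def[symmetric] using g0 by (simp add: ennreal_mult)
    qed
  qed
  also have "\<dots> = 1" by (simp add: nn_integral_cmult g1)
  finally show ?thesis .
qed

section \<open>Lower bounds on mutual information\<close>

text \<open>Any \<open>G\<close> with \<open>\<integral> exp G(x, y) dx \<le> 1\<close>
  gives an auxiliary backward channel, and \<open>ln t \<ge> 1 - 1 / t\<close> compares it with the true one.\<close>

lemma mutual_information_ge:
  fixes D :: "'b measure" and E :: "'c measure" and M :: "'a measure"
    and f G :: "'b \<times> 'c \<Rightarrow> real" and g H :: "'c \<Rightarrow> real"
  assumes M: "prob_space M" and D: "prob_space D" and E: "prob_space E" and b: "1 < b"
    and X: "X \<in> M \<rightarrow>\<^sub>M D" and Y: "Y \<in> M \<rightarrow>\<^sub>M E"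
    and f: "f \<in> borel_measurable (D \<Otimes>\<^sub>M E)" "\<And>x. 0 < f x"
    and kernel: "\<And>F. F \<in> borel_measurable (D \<Otimes>\<^sub>M E) \<Longrightarrow>
      (\<integral>\<^sup>+w. F (X w, Y w) \<partial>M) = (\<integral>\<^sup>+x. F x * ennreal (f x) \<partial>(D \<Otimes>\<^sub>M E))"
    and X_law: "distr M D X = D"
    and g: "\<And>y. y \<in> space E \<Longrightarrow> (\<integral>\<^sup>+d. ennreal (f (d, y)) \<partial>D) = ennreal (g y)" "\<And>y. 0 < g y" "g \<in> borel_measurable E"
    and H: "integrable M (\<lambda>w. H (Y w))" "\<And>d y. d \<in> space D \<Longrightarrow> y \<in> space E \<Longrightarrow> ln (f (d, y)) - ln (g y) \<le> H y"
    and G: "G \<in> borel_measurable (D \<Otimes>\<^sub>M E)" "integrable M (\<lambda>w. G (X w, Y w))"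
      "\<And>y. y \<in> space E \<Longrightarrow> (\<integral>\<^sup>+d. ennreal (exp (G (d, y))) \<partial>D) \<le> 1"
  shows "(\<integral>w. G (X w, Y w) \<partial>M) / ln b \<le> prob_space.mutual_information M b D E X Y"
proof -
  interpret information_space M b
    unfolding information_space_def information_space_axioms_def using M b by blast
  interpret D: prob_space D by fact
  interpret E: prob_space E by fact
  interpret DE: pair_prob_space D E ..
  note XY = measurable_Pair[OF X Y]
  have gs: "(\<lambda>x. g (snd x)) \<in> borel_measurable (D \<Otimes>\<^sub>M E)" by (rule measurable_compose[OF measurable_snd g(3)])
  have marginal: "(\<integral>\<^sup>+x. F (snd x) * ennreal (f x) \<partial>(D \<Otimes>\<^sub>M E)) = (\<integral>\<^sup>+y. F y * ennreal (g y) \<partial>E)"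
    if F: "F \<in> borel_measurable E" for F
  proof -
    have m: "(\<lambda>x. F (snd x) * ennreal (f x)) \<in> borel_measurable (D \<Otimes>\<^sub>M E)"
      by (intro borel_measurable_times_ennreal measurable_compose[OF measurable_snd F] measurable_compose[OF f(1) measurable_ennreal])
    have "(\<integral>\<^sup>+x. F (snd x) * ennreal (f x) \<partial>(D \<Otimes>\<^sub>M E)) = (\<integral>\<^sup>+y. \<integral>\<^sup>+d. F y * ennreal (f (d, y)) \<partial>D \<partial>E)"
      using DE.nn_integral_snd[of "\<lambda>x. F (snd x) * ennreal (f x)"] m by (simp add: split_beta')
    also have "\<dots> = (\<integral>\<^sup>+y. F y * ennreal (g y) \<partial>E)"
    proof (rule nn_integral_cong)
      fix y assume y: "y \<in> space E"
      have "(\<lambda>d. f (d, y)) \<in> borel_measurable D" using measurable_compose[OF measurable_Pair2'[OF y] f(1)] .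
      then show "(\<integral>\<^sup>+d. F y * ennreal (f (d, y)) \<partial>D) = F y * ennreal (g y)"
        by (simp add: nn_integral_cmult g(1)[OF y])
    qed
    finally show ?thesis .
  qed
  have dX: "distributed M D X (\<lambda>x. ennreal 1)"
    unfolding distributed_def using X X_law by (simp add: density_1)
  have dXY: "distributed M (D \<Otimes>\<^sub>M E) (\<lambda>x. (X x, Y x)) (\<lambda>x. ennreal (f x))"
    unfolding distributed_def
  proof (intro conjI XY measure_eqI)
    fix A assume "A \<in> sets (distr M (D \<Otimes>\<^sub>M E) (\<lambda>x. (X x, Y x)))"
    then have A: "A \<in> sets (D \<Otimes>\<^sub>M E)" by simp
    show "emeasure (distr M (D \<Otimes>\<^sub>M E) (\<lambda>x. (X x, Y x))) A = emeasure (density (D \<Otimes>\<^sub>M E) (\<lambda>x. ennreal (f x))) A"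
      unfolding emeasure_distr_nn_integral[OF XY A] using A f(1)
      by (subst kernel[of "indicator A"]) (simp_all add: emeasure_density mult.commute)
  qed (use f in simp_all)
  have dY: "distributed M E Y (\<lambda>x. ennreal (g x))"
    unfolding distributed_def
  proof (intro conjI Y measure_eqI)
    fix A assume "A \<in> sets (distr M E Y)"
    then have A: "A \<in> sets E" by simp
    have i: "indicator A \<in> borel_measurable E" using A by simp
    have "emeasure (distr M E Y) A = (\<integral>\<^sup>+w. indicator A (snd (X w, Y w)) \<partial>M)"
      unfolding emeasure_distr_nn_integral[OF Y A] by simp
    also have "\<dots> = (\<integral>\<^sup>+y. indicator A y * ennreal (g y) \<partial>E)"
      by (subst kernel[of "\<lambda>x. indicator A (snd x)"]) (rule measurable_compose[OF measurable_snd i], rule marginal[OF i])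
    finally show "emeasure (distr M E Y) A = emeasure (density E (\<lambda>x. ennreal (g x))) A"
      using A g(3) by (simp add: emeasure_density mult.commute)
  qed (use g in simp_all)
  let ?u = "\<lambda>x. f x / (1 * g (snd x))"
  have um: "(\<lambda>x. log b (?u x)) \<in> borel_measurable (D \<Otimes>\<^sub>M E)" using f(1) gs by simp
  have "prob_space.mutual_information M b D E X Y = (\<integral>x. f x * log b (?u x) \<partial>(D \<Otimes>\<^sub>M E))"
    by (rule mutual_information_distr[OF D.sigma_finite_measure_axioms E.sigma_finite_measure_axioms dX _ dY _ dXY])
      (use f(2) g(2) in \<open>auto intro: less_imp_le\<close>)
  also have "\<dots> = (\<integral>w. log b (?u (X w, Y w)) \<partial>M)"
    by (rule distributed_integral[OF dXY um]) (use f(2) in \<open>auto intro: less_imp_le\<close>)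
  finally have MI: "prob_space.mutual_information M b D E X Y = (\<integral>w. ln (f (X w, Y w) / g (Y w)) \<partial>M) / ln b"
    by (simp add: log_def)
  define L where "L w = ln (f (X w, Y w) / g (Y w))" for w
  define Z where "Z w = g (Y w) * exp (G (X w, Y w)) / f (X w, Y w)" for w
  have fm: "(\<lambda>w. f (X w, Y w)) \<in> borel_measurable M" by (rule measurable_compose[OF XY f(1)])
  have Gm: "(\<lambda>w. G (X w, Y w)) \<in> borel_measurable M" by (rule measurable_compose[OF XY G(1)])
  have gm: "(\<lambda>w. g (Y w)) \<in> borel_measurable M" by (rule measurable_compose[OF Y g(3)])
  have Zm: "Z \<in> borel_measurable M" unfolding Z_def[abs_def] using fm Gm gm by simp
  have Lm: "L \<in> borel_measurable M" unfolding L_def[abs_def] using fm gm by simp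
  have Z0: "0 \<le> Z w" for w using f(2) g(2) by (simp add: Z_def less_imp_le)
  have "(\<integral>\<^sup>+w. ennreal (Z w) \<partial>M) = (\<integral>\<^sup>+x. ennreal (g (snd x) * exp (G x) / f x) * ennreal (f x) \<partial>(D \<Otimes>\<^sub>M E))"
    unfolding Z_def using kernel[of "\<lambda>x. ennreal (g (snd x) * exp (G x) / f x)"] gs G(1) f(1) by simp
  also have "\<dots> = (\<integral>\<^sup>+x. ennreal (g (snd x)) * ennreal (exp (G x)) \<partial>(D \<Otimes>\<^sub>M E))"
  proof (rule nn_integral_cong)
    fix x
    have "g (snd x) * exp (G x) / f x * f x = g (snd x) * exp (G x)" using f(2)[of x] by simp
    then show "ennreal (g (snd x) * exp (G x) / f x) * ennreal (f x) = ennreal (g (snd x)) * ennreal (exp (G x))"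
      using f(2)[of x] g(2)[of "snd x"] by (simp flip: ennreal_mult)
  qed
  also have "\<dots> = (\<integral>\<^sup>+y. \<integral>\<^sup>+d. ennreal (g y) * ennreal (exp (G (d, y))) \<partial>D \<partial>E)"
    using DE.nn_integral_snd[of "\<lambda>x. ennreal (g (snd x)) * ennreal (exp (G x))"] gs G(1) by (simp add: split_beta')
  also have "\<dots> \<le> (\<integral>\<^sup>+y. ennreal (g y) \<partial>E)"
  proof (rule nn_integral_mono)
    fix y assume y: "y \<in> space E"
    have "(\<lambda>d. G (d, y)) \<in> borel_measurable D" using measurable_compose[OF measurable_Pair2'[OF y] G(1)] .
    then have "(\<integral>\<^sup>+d. ennreal (g y) * ennreal (exp (G (d, y))) \<partial>D) = ennreal (g y) * (\<integral>\<^sup>+d. ennreal (exp (G (d, y))) \<partial>D)"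
      by (intro nn_integral_cmult) simp
    also have "\<dots> \<le> ennreal (g y) * 1" by (intro mult_left_mono G(3)[OF y]) simp
    finally show "(\<integral>\<^sup>+d. ennreal (g y) * ennreal (exp (G (d, y))) \<partial>D) \<le> ennreal (g y)" by simp
  qed
  also have "\<dots> = 1"
    using kernel[of "\<lambda>x. 1"] marginal[of "\<lambda>x. 1"] emeasure_space_1 by simp
  finally have Zi: "(\<integral>\<^sup>+w. ennreal (Z w) \<partial>M) \<le> ennreal 1" by simp
  note Zint = integrable_from_nn[OF Zm Z0 Zi zero_le_one]
  have ln_ge: "1 - 1 / t \<le> ln t" if "0 < t" for t :: real
    using ln_le_minus_one[of "1 / t"] that by (simp add: ln_div)
  have low: "G (X w, Y w) + 1 - Z w \<le> L w" for w
  proof -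
    have p: "0 < f (X w, Y w) / g (Y w) * exp (- G (X w, Y w))" using f(2) g(2) by simp
    have "1 - 1 / (f (X w, Y w) / g (Y w) * exp (- G (X w, Y w))) \<le> ln (f (X w, Y w) / g (Y w) * exp (- G (X w, Y w)))"
      by (rule ln_ge[OF p])
    also have "ln (f (X w, Y w) / g (Y w) * exp (- G (X w, Y w))) = L w - G (X w, Y w)"
      using f(2) g(2) by (subst ln_mult_pos) (simp_all add: L_def)
    also have "1 / (f (X w, Y w) / g (Y w) * exp (- G (X w, Y w))) = Z w"
      by (simp add: Z_def exp_minus field_simps)
    finally show ?thesis by simp
  qed
  have high: "L w \<le> H (Y w)" if "w \<in> space M" for w
    using H(2)[OF measurable_space[OF X that] measurable_space[OF Y that]] f(2)[of "(X w, Y w)"] g(2)[of "Y w"] by (simp add: L_def ln_div)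
  have Li: "integrable M L"
  proof (rule Bochner_Integration.integrable_bound[of _ "\<lambda>w. \<bar>G (X w, Y w)\<bar> + 1 + Z w + \<bar>H (Y w)\<bar>"])
    show "integrable M (\<lambda>w. \<bar>G (X w, Y w)\<bar> + 1 + Z w + \<bar>H (Y w)\<bar>)"
      using G(2) H(1) Zint(1) by simp
    show "AE w in M. norm (L w) \<le> norm (\<bar>G (X w, Y w)\<bar> + 1 + Z w + \<bar>H (Y w)\<bar>)"
    proof (rule AE_I2)
      fix w assume "w \<in> space M"
      from high[OF this] low[of w] Z0[of w] show "norm (L w) \<le> norm (\<bar>G (X w, Y w)\<bar> + 1 + Z w + \<bar>H (Y w)\<bar>)"
        by simp
    qed
  qed (rule Lm)
  have "(\<integral>w. G (X w, Y w) \<partial>M) \<le> (\<integral>w. G (X w, Y w) \<partial>M) + 1 - (\<integral>w. Z w \<partial>M)" using Zint(2) by simp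
  also have "\<dots> = (\<integral>w. G (X w, Y w) + 1 - Z w \<partial>M)"
    using G(2) Zint(1) by (simp add: prob_space)
  also have "\<dots> \<le> (\<integral>w. L w \<partial>M)" using G(2) Zint(1) Li low by (intro integral_mono) auto
  finally show ?thesis unfolding MI using b by (intro divide_right_mono) (simp_all add: L_def)
qed

lemma tilt_bounds:
  assumes v: "0 < v"
  shows "tilt N v m z \<le> exp (sqn N z / v)"
    and "exp (- sqn N z / v) * exp (- 2 * sqn N m / v) \<le> tilt N v m z"
proof -
  have c: "\<bar>2 * Re (cnj a * b)\<bar> \<le> (cmod a)\<^sup>2 + (cmod b)\<^sup>2" for a b :: complex
  proof -
    have "\<bar>Re (cnj a * b)\<bar> \<le> cmod a * cmod b" using abs_Re_le_cmod[of "cnj a * b"] by (simp add: norm_mult)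
    then show ?thesis using sum_squares_bound[of "cmod a" "cmod b"] by simp
  qed
  show "tilt N v m z \<le> exp (sqn N z / v)"
    unfolding tilt_def sqn_def sum_divide_distrib exp_le_cancel_iff
  proof (intro sum_mono divide_right_mono)
    fix i show "2 * Re (cnj (m i) * z i) - (cmod (m i))\<^sup>2 \<le> (cmod (z i))\<^sup>2" using c[of "m i" "z i"] by linarith
  qed (use v in simp)
  have "- sqn N z / v + - 2 * sqn N m / v = (\<Sum>i<N. (- (cmod (z i))\<^sup>2 - 2 * (cmod (m i))\<^sup>2) / v)"
    unfolding sqn_def by (simp add: sum_divide_distrib[symmetric] sum_subtractf sum_negf sum_distrib_left diff_divide_distrib)
  also have "\<dots> \<le> (\<Sum>i<N. (2 * Re (cnj (m i) * z i) - (cmod (m i))\<^sup>2) / v)"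
  proof (intro sum_mono divide_right_mono)
    fix i show "- (cmod (z i))\<^sup>2 - 2 * (cmod (m i))\<^sup>2 \<le> 2 * Re (cnj (m i) * z i) - (cmod (m i))\<^sup>2" using c[of "m i" "z i"] by linarith
  qed (use v in simp)
  finally show "exp (- sqn N z / v) * exp (- 2 * sqn N m / v) \<le> tilt N v m z"
    unfolding tilt_def exp_add[symmetric] exp_le_cancel_iff .
qed

lemma nn_integral_pos:
  assumes "prob_space M" "f \<in> borel_measurable M" "\<And>x. 0 < (f x :: real)"
  shows "0 < (\<integral>\<^sup>+x. ennreal (f x) \<partial>M)"
proof (rule ccontr)
  interpret prob_space M by fact
  assume "\<not> 0 < (\<integral>\<^sup>+x. ennreal (f x) \<partial>M)"
  then have "(\<integral>\<^sup>+x. ennreal (f x) \<partial>M) = 0" by (simp add: zero_less_iff_neq_zero)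
  then have "AE x in M. ennreal (f x) = 0" using assms(2) by (subst (asm) nn_integral_0_iff_AE) auto
  then have "AE x in M. False" using assms(3) by (auto elim!: eventually_mono simp: ennreal_eq_0_iff not_le[symmetric])
  then show False by simp
qed

lemma tilt_measurable:
  assumes "\<And>i. i < N \<Longrightarrow> (\<lambda>x. m x i) \<in> borel_measurable M" "\<And>i. i < N \<Longrightarrow> (\<lambda>x. z x i) \<in> borel_measurable M"
  shows "(\<lambda>x. tilt N v (m x) (z x)) \<in> borel_measurable M"
proof -
  have "(\<lambda>x. Re (cnj (m x i) * z x i)) \<in> borel_measurable M" "(\<lambda>x. (cmod (m x i))\<^sup>2) \<in> borel_measurable M" if "i < N" for i
    using assms[OF that] by (intro measurable_compose[OF _ borel_measurable_Re] borel_measurable_times borel_measurable_cnj' borel_measurable_norm2; simp)+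
  then have "(\<lambda>x. \<Sum>i<N. (2 * Re (cnj (m x i) * z x i) - (cmod (m x i))\<^sup>2) / v) \<in> borel_measurable M"
    by (intro borel_measurable_sum borel_measurable_divide borel_measurable_diff borel_measurable_times borel_measurable_const) auto
  then show ?thesis unfolding tilt_def by simp
qed

text \<open>A Gaussian additive noise \<open>CN(0, v I)\<close> on top of any signal \<open>m\<close> makes the densities positive
  and bounds their logarithms by quadratic functions of the observation.\<close>

lemma mutual_information_gaussian_noise_ge:
  fixes N :: nat and D :: "complex measure" and Th :: "'t measure" and m :: "complex \<Rightarrow> 't \<Rightarrow> cvec" and G :: "complex \<times> cvec \<Rightarrow> real"
  defines "E \<equiv> \<lambda>v. PiM {..<N} (\<lambda>_. CN v)"
  assumes M: "prob_space M" and D: "prob_space D" "sets D = sets borel" and Th: "prob_space Th" and v: "0 < v" and b: "1 < b"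
    and X: "X \<in> M \<rightarrow>\<^sub>M borel" and Y: "Y \<in> M \<rightarrow>\<^sub>M cspace N"
    and m: "\<And>i. i < N \<Longrightarrow> (\<lambda>(d, t). m d t i) \<in> borel_measurable (D \<Otimes>\<^sub>M Th)"
    and kernel: "\<And>F. F \<in> borel_measurable (D \<Otimes>\<^sub>M E v) \<Longrightarrow> (\<integral>\<^sup>+w. F (X w, Y w) \<partial>M) =
      (\<integral>\<^sup>+d. \<integral>\<^sup>+t. \<integral>\<^sup>+z. F (d, z) * ennreal (tilt N v (m d t) z) \<partial>E v \<partial>Th \<partial>D)"
    and q: "integrable M (\<lambda>w. sqn N (Y w))"
    and G: "G \<in> borel_measurable (D \<Otimes>\<^sub>M E v)" "integrable M (\<lambda>w. G (X w, Y w))"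
      "\<And>z. (\<integral>\<^sup>+d. ennreal (exp (G (d, z))) \<partial>D) \<le> 1"
  shows "(\<integral>w. G (X w, Y w) \<partial>M) / ln b \<le> prob_space.mutual_information M b borel (cspace N) X Y"
proof -
  interpret M: prob_space M by fact
  interpret D: prob_space D by fact
  interpret Th: prob_space Th by fact
  let ?E = "E v"
  have pE: "prob_space ?E" unfolding E_def by (intro prob_space_PiM prob_space_CN)
  interpret E: prob_space ?E by (rule pE)
  interpret DT: pair_prob_space D Th ..
  interpret TE: pair_prob_space Th ?E ..
  have sE: "sets ?E = sets (cspace N)" unfolding E_def by (rule sets_CN_PiM)
  have spE: "space ?E = space (cspace N)" by (rule sets_eq_imp_space_eq[OF sE])
  have spD: "space D = UNIV" using sets_eq_imp_space_eq[OF D(2)] by simp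
  have zm: "(\<lambda>z. z i) \<in> borel_measurable ?E" if "i < N" for i
    unfolding measurable_cong_sets[OF sE refl] using that by (intro measurable_component_singleton) simp
  define T where "T = (\<lambda>((d, z), t). tilt N v (m d t) z)"
  have Tm: "T \<in> borel_measurable ((D \<Otimes>\<^sub>M ?E) \<Otimes>\<^sub>M Th)"
    unfolding T_def split_beta'
  proof (rule tilt_measurable)
    fix i assume i: "i < N"
    have "(\<lambda>x. (fst (fst x), snd x)) \<in> (D \<Otimes>\<^sub>M ?E) \<Otimes>\<^sub>M Th \<rightarrow>\<^sub>M D \<Otimes>\<^sub>M Th"
      by (intro measurable_Pair measurable_fst measurable_snd measurable_compose[OF measurable_fst measurable_fst])
    from measurable_compose[OF this m[OF i]] show "(\<lambda>x. m (fst (fst x)) (snd x) i) \<in> borel_measurable ((D \<Otimes>\<^sub>M ?E) \<Otimes>\<^sub>M Th)" by simp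
    show "(\<lambda>x. snd (fst x) i) \<in> borel_measurable ((D \<Otimes>\<^sub>M ?E) \<Otimes>\<^sub>M Th)"
      by (rule measurable_compose[OF measurable_compose[OF measurable_fst measurable_snd] zm[OF i]])
  qed
  define k where "k x = (\<integral>\<^sup>+t. ennreal (T (x, t)) \<partial>Th)" for x
  have km: "k \<in> borel_measurable (D \<Otimes>\<^sub>M ?E)"
    unfolding k_def[abs_def] by (rule Th.borel_measurable_nn_integral) (use Tm in \<open>simp add: split_beta'\<close>)
  have T_upper: "T ((d, z), t) \<le> exp (sqn N z / v)" for d z t unfolding T_def using tilt_bounds(1)[OF v] by simp
  have T_pos: "0 < T x" for x unfolding T_def by (simp add: tilt_def split: prod.split)
  have mi: "(\<lambda>t. m d t i) \<in> borel_measurable Th" if "i < N" for d i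
    using measurable_compose[OF measurable_Pair1'[of d D Th] m[OF that]] by (simp add: spD)
  have Tt: "(\<lambda>t. T ((d, z), t)) \<in> borel_measurable Th" for d z
    unfolding T_def using mi by (auto intro!: tilt_measurable)
  have k_upper: "k (d, z) \<le> ennreal (exp (sqn N z / v))" for d z
  proof -
    have "k (d, z) \<le> (\<integral>\<^sup>+t. ennreal (exp (sqn N z / v)) \<partial>Th)" unfolding k_def by (intro nn_integral_mono ennreal_leI T_upper)
    then show ?thesis by (simp add: Th.emeasure_space_1)
  qed
  have k_pos: "0 < k x" for x unfolding k_def using Tt[of "fst x" "snd x"] T_pos by (intro nn_integral_pos[OF Th]) auto
  define f where "f x = enn2real (k x)" for x
  have k_fin: "k x < \<top>" for x using order.strict_trans1[OF k_upper[of "fst x" "snd x"]] by simp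
  have f_k: "ennreal (f x) = k x" for x unfolding f_def using k_fin by (rule ennreal_enn2real)
  have f_pos: "0 < f x" for x unfolding f_def using k_pos[of x] k_fin[of x] by (simp add: enn2real_positive_iff)
  have f_upper: "f (d, z) \<le> exp (sqn N z / v)" for d z
    using k_upper[of d z] unfolding f_k[symmetric] by (subst (asm) ennreal_le_iff) simp_all
  have fm: "f \<in> borel_measurable (D \<Otimes>\<^sub>M ?E)" unfolding f_def[abs_def] using km by simp
  define gk where "gk z = (\<integral>\<^sup>+d. k (d, z) \<partial>D)" for z
  define g where "g z = enn2real (gk z)" for z
  have gk_upper: "gk z \<le> ennreal (exp (sqn N z / v))" for z
  proof -
    have "gk z \<le> (\<integral>\<^sup>+d. ennreal (exp (sqn N z / v)) \<partial>D)" unfolding gk_def by (intro nn_integral_mono k_upper)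
    then show ?thesis by (simp add: D.emeasure_space_1)
  qed
  have gkm: "gk \<in> borel_measurable ?E"
    unfolding gk_def[abs_def] by (rule D.borel_measurable_nn_integral) (use measurable_compose[OF measurable_pair_swap' km] in \<open>simp add: split_beta'\<close>)
  have gm: "g \<in> borel_measurable ?E" unfolding g_def[abs_def] using gkm by simp
  define k0 where "k0 = (\<integral>\<^sup>+d. \<integral>\<^sup>+t. ennreal (exp (- 2 * sqn N (m d t) / v)) \<partial>Th \<partial>D)"
  have m2: "(\<lambda>x. exp (- 2 * sqn N (m (fst x) (snd x)) / v)) \<in> borel_measurable (D \<Otimes>\<^sub>M Th)"
  proof -
    have "(\<lambda>x. sqn N (m (fst x) (snd x))) \<in> borel_measurable (D \<Otimes>\<^sub>M Th)"
      unfolding sqn_def by (intro borel_measurable_sum borel_measurable_norm2) (use m in \<open>simp add: split_beta'\<close>)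
    then show ?thesis by simp
  qed
  have k0_eq: "k0 = (\<integral>\<^sup>+x. ennreal (exp (- 2 * sqn N (m (fst x) (snd x)) / v)) \<partial>(D \<Otimes>\<^sub>M Th))"
    unfolding k0_def using Th.nn_integral_fst[of "\<lambda>x. ennreal (exp (- 2 * sqn N (m (fst x) (snd x)) / v))" D] m2 by simp
  have k0_pos: "0 < k0" unfolding k0_eq using m2 by (intro nn_integral_pos DT.prob_space_axioms) auto
  have k0_le: "k0 \<le> 1"
  proof -
    have "k0 \<le> (\<integral>\<^sup>+x. 1 \<partial>(D \<Otimes>\<^sub>M Th))" unfolding k0_eq using v
      by (intro nn_integral_mono) (auto intro!: divide_nonneg_pos sum_nonneg simp: sqn_def)
    then show ?thesis by (simp add: DT.emeasure_space_1)
  qed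
  define \<kappa> where "\<kappa> = enn2real k0"
  have \<kappa>: "0 < \<kappa>" "ennreal \<kappa> = k0" using k0_pos k0_le by (auto simp: \<kappa>_def enn2real_positive_iff less_top[symmetric] top_unique intro!: ennreal_enn2real order.strict_trans1[OF k0_le])
  have gk_lower: "ennreal (exp (- sqn N z / v) * \<kappa>) \<le> gk z" for z
  proof -
    have "ennreal (exp (- sqn N z / v) * \<kappa>) = ennreal (exp (- sqn N z / v)) * k0"
      unfolding \<kappa>(2)[symmetric] by (rule ennreal_mult') simp
    also have "\<dots> = (\<integral>\<^sup>+x. ennreal (exp (- sqn N z / v)) * ennreal (exp (- 2 * sqn N (m (fst x) (snd x)) / v)) \<partial>(D \<Otimes>\<^sub>M Th))"
      unfolding k0_eq using m2 by (intro nn_integral_cmult[symmetric]) simp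
    also have "\<dots> = (\<integral>\<^sup>+d. \<integral>\<^sup>+t. ennreal (exp (- sqn N z / v)) * ennreal (exp (- 2 * sqn N (m d t) / v)) \<partial>Th \<partial>D)"
      using Th.nn_integral_fst[of "\<lambda>x. ennreal (exp (- sqn N z / v)) * ennreal (exp (- 2 * sqn N (m (fst x) (snd x)) / v))" D] m2 by simp
    also have "\<dots> \<le> gk z"
      unfolding gk_def k_def T_def using tilt_bounds(2)[OF v]
      by (intro nn_integral_mono) (simp add: ennreal_leI flip: ennreal_mult)
    finally show ?thesis .
  qed
  have gk_fin: "gk z < \<top>" for z using order.strict_trans1[OF gk_upper[of z]] by simp
  have g_gk: "ennreal (g z) = gk z" for z unfolding g_def using gk_fin by (rule ennreal_enn2real)
  have g_lower: "exp (- sqn N z / v) * \<kappa> \<le> g z" for z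
    using gk_lower[of z] unfolding g_gk[symmetric] by (subst (asm) ennreal_le_iff) (simp_all add: g_def)
  have g_pos: "0 < g z" for z by (rule less_le_trans[OF _ g_lower]) (use \<kappa> in simp)
  have kernel': "(\<integral>\<^sup>+w. F (X w, Y w) \<partial>M) = (\<integral>\<^sup>+x. F x * ennreal (f x) \<partial>(D \<Otimes>\<^sub>M ?E))"
    if F: "F \<in> borel_measurable (D \<Otimes>\<^sub>M ?E)" for F
  proof -
    have "(\<integral>\<^sup>+w. F (X w, Y w) \<partial>M) = (\<integral>\<^sup>+d. \<integral>\<^sup>+t. \<integral>\<^sup>+z. F (d, z) * ennreal (T ((d, z), t)) \<partial>?E \<partial>Th \<partial>D)"
      unfolding kernel[OF F] T_def by simp
    also have "\<dots> = (\<integral>\<^sup>+d. \<integral>\<^sup>+z. F (d, z) * k (d, z) \<partial>?E \<partial>D)"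
    proof (rule nn_integral_cong)
      fix d assume d: "d \<in> space D"
      have p: "(\<lambda>x. ((d, snd x), fst x)) \<in> Th \<Otimes>\<^sub>M ?E \<rightarrow>\<^sub>M (D \<Otimes>\<^sub>M ?E) \<Otimes>\<^sub>M Th"
        using d by (intro measurable_Pair measurable_fst measurable_snd measurable_const)
      have Fd: "(\<lambda>x. F (d, snd x)) \<in> borel_measurable (Th \<Otimes>\<^sub>M ?E)"
        using measurable_compose[OF measurable_compose[OF p measurable_fst] F] by simp
      have FT: "(\<lambda>x. F (d, snd x) * ennreal (T ((d, snd x), fst x))) \<in> borel_measurable (Th \<Otimes>\<^sub>M ?E)"
        by (intro borel_measurable_times_ennreal Fd measurable_compose[OF measurable_compose[OF p Tm] measurable_ennreal])
      have "(\<integral>\<^sup>+t. \<integral>\<^sup>+z. F (d, z) * ennreal (T ((d, z), t)) \<partial>?E \<partial>Th) = (\<integral>\<^sup>+z. \<integral>\<^sup>+t. F (d, z) * ennreal (T ((d, z), t)) \<partial>Th \<partial>?E)"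
        using TE.Fubini'[of "\<lambda>t z. F (d, z) * ennreal (T ((d, z), t))"] FT by (simp add: split_beta')
      also have "\<dots> = (\<integral>\<^sup>+z. F (d, z) * k (d, z) \<partial>?E)"
        unfolding k_def using Tt by (intro nn_integral_cong nn_integral_cmult) simp
      finally show "(\<integral>\<^sup>+t. \<integral>\<^sup>+z. F (d, z) * ennreal (T ((d, z), t)) \<partial>?E \<partial>Th) = (\<integral>\<^sup>+z. F (d, z) * k (d, z) \<partial>?E)" .
    qed
    also have "\<dots> = (\<integral>\<^sup>+x. F x * k x \<partial>(D \<Otimes>\<^sub>M ?E))"
      using E.nn_integral_fst[of "\<lambda>x. F x * k x" D] F km by simp
    finally show ?thesis unfolding f_k .
  qed
  have XD: "X \<in> M \<rightarrow>\<^sub>M D" and YE: "Y \<in> M \<rightarrow>\<^sub>M ?E"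
    using X Y by (simp_all add: measurable_cong_sets[OF refl D(2)] measurable_cong_sets[OF refl sE])
  have norm1: "(\<integral>\<^sup>+z. ennreal (tilt N v u z) \<partial>?E) = 1" for u
    using nn_integral_PiM_CN_shift[OF v, of "\<lambda>z. 1" N u] E.emeasure_space_1 by (simp add: E_def)
  have X_law: "distr M D X = D"
  proof (rule measure_eqI)
    fix A assume "A \<in> sets (distr M D X)"
    then have A: "A \<in> sets D" by simp
    have i: "indicator A \<in> borel_measurable D" using A by simp
    have im: "(\<lambda>z. ennreal (tilt N v u z)) \<in> borel_measurable ?E" for u
      using zm by (intro measurable_compose[OF tilt_measurable measurable_ennreal]) auto
    have "emeasure (distr M D X) A = (\<integral>\<^sup>+w. indicator A (fst (X w, Y w)) \<partial>M)"
      unfolding emeasure_distr_nn_integral[OF XD A] by simp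
    also have "\<dots> = (\<integral>\<^sup>+d. \<integral>\<^sup>+t. \<integral>\<^sup>+z. indicator A d * ennreal (tilt N v (m d t) z) \<partial>?E \<partial>Th \<partial>D)"
      by (subst kernel[of "\<lambda>x. indicator A (fst x)"]) (rule measurable_compose[OF measurable_fst i], simp)
    also have "\<dots> = (\<integral>\<^sup>+d. indicator A d \<partial>D)"
      by (simp add: nn_integral_cmult im norm1 Th.emeasure_space_1)
    finally show "emeasure (distr M D X) A = emeasure D A" using A by simp
  qed simp
  have "(\<integral>w. G (X w, Y w) \<partial>M) / ln b \<le> prob_space.mutual_information M b D ?E X Y"
  proof (rule mutual_information_ge[OF M D(1) pE b XD YE fm f_pos kernel' X_law _ g_pos gm _ _ G(1,2)])
    show "(\<integral>\<^sup>+d. ennreal (f (d, y)) \<partial>D) = ennreal (g y)" for y unfolding f_k g_gk gk_def ..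
    show "integrable M (\<lambda>w. 2 * sqn N (Y w) / v - ln \<kappa>)" using q by simp
    show "ln (f (d, y)) - ln (g y) \<le> 2 * sqn N y / v - ln \<kappa>" for d y
    proof -
      have "ln (f (d, y)) \<le> sqn N y / v" using f_upper[of d y] f_pos by (metis exp_le_cancel_iff exp_ln)
      moreover have "ln (exp (- sqn N y / v) * \<kappa>) \<le> ln (g y)" using g_lower[of y] g_pos \<kappa> by (subst ln_le_cancel_iff) auto
      moreover have "ln (exp (- sqn N y / v) * \<kappa>) = - sqn N y / v + ln \<kappa>" using \<kappa> by (subst ln_mult_pos) auto
      ultimately show ?thesis by simp
    qed
    show "(\<integral>\<^sup>+d. ennreal (exp (G (d, y))) \<partial>D) \<le> 1" for y by (rule G(3))
  qed
  also have "prob_space.mutual_information M b D ?E X Y = prob_space.mutual_information M b borel (cspace N) X Y"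
    unfolding prob_space.mutual_information_def[OF M]
    by (intro arg_cong2[where f="KL_divergence b"] arg_cong2[where f="(\<Otimes>\<^sub>M)"] distr_cong refl D(2) sE sets_pair_measure_cong)
  finally show ?thesis .
qed

definition centred :: "'a measure \<Rightarrow> ('a \<Rightarrow> complex) \<Rightarrow> real \<Rightarrow> bool" where
  "centred M X q \<longleftrightarrow> prob_space M \<and> has_bochner_integral M X 0 \<and> has_bochner_integral M (\<lambda>w. (cmod (X w))\<^sup>2) q"

lemma centred_nonneg: "centred M X q \<Longrightarrow> 0 \<le> q"
  unfolding centred_def by (auto simp: has_bochner_integral_iff)

lemma nn_integral_centred_add:
  assumes c: "centred M X q" and r: "0 \<le> r"
  shows "(\<integral>\<^sup>+w. ennreal ((cmod (A + X w))\<^sup>2 + r) \<partial>M) = ennreal ((cmod A)\<^sup>2 + (q + r))"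
proof -
  interpret prob_space M using c by (simp add: centred_def)
  have X: "has_bochner_integral M X 0" and q: "has_bochner_integral M (\<lambda>w. (cmod (X w))\<^sup>2) q"
    using c by (auto simp: centred_def)
  have e: "(cmod (A + X w))\<^sup>2 + r = ((cmod A)\<^sup>2 + r) + (2 * Re (cnj A * X w) + (cmod (X w))\<^sup>2)" for w
    unfolding cmod_power2 by (simp add: power2_eq_square algebra_simps)
  have k: "has_bochner_integral M (\<lambda>w. (cmod A)\<^sup>2 + r) ((cmod A)\<^sup>2 + r)" by (simp add: has_bochner_integral_iff prob_space)
  have "has_bochner_integral M (\<lambda>w. Re (cnj A * X w)) (Re (cnj A * 0))"
    by (intro has_bochner_integral_bounded_linear[OF bounded_linear_Re] has_bochner_integral_mult_right X)
  from has_bochner_integral_add[OF k has_bochner_integral_add[OF has_bochner_integral_mult_right[OF this, of 2] q]]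
  have "has_bochner_integral M (\<lambda>w. (cmod (A + X w))\<^sup>2 + r) (((cmod A)\<^sup>2 + r) + (2 * Re (cnj A * 0) + q))"
    unfolding e .
  from nn_integral_has_bochner_integral[OF this] r show ?thesis by (simp add: add_ac)
qed

lemma centred_CN:
  assumes v: "0 \<le> v"
  shows "centred (CN v) (\<lambda>z. k * z) ((cmod k)\<^sup>2 * v)"
  unfolding centred_def norm_mult power_mult_distrib
  using has_bochner_integral_mult_right[OF CN_moments(3)[OF v], of k] has_bochner_integral_mult_right[OF CN_moments(1)[OF v], of "(cmod k)\<^sup>2"]
  by (simp add: prob_space_CN)

lemma centred_sum:
  fixes N :: nat
  assumes "prob_space M" and X: "\<And>i. i < N \<Longrightarrow> has_bochner_integral M (\<lambda>x. X x i) 0"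
    and q: "has_bochner_integral M (\<lambda>x. (cmod (\<Sum>i<N. c i * X x i))\<^sup>2) q"
  shows "centred M (\<lambda>x. \<Sum>i<N. c i * X x i) q"
  unfolding centred_def using has_bochner_integral_sum[OF has_bochner_integral_mult_right[OF X], of "{..<N}" c] assms(1) q by simp

lemma centred_PiM_CN:
  fixes N :: nat
  assumes v: "\<And>i. i < N \<Longrightarrow> 0 \<le> v i"
  shows "centred (PiM {..<N} (\<lambda>i. CN (v i))) (\<lambda>x. \<Sum>i<N. c i * x i) (\<Sum>i<N. (cmod (c i))\<^sup>2 * v i)"
proof (rule centred_sum)
  let ?M = "PiM {..<N} (\<lambda>i. CN (v i))"
  show "prob_space ?M" by (intro prob_space_PiM prob_space_CN)
  have xm: "(\<lambda>x. x i) \<in> borel_measurable ?M" if "i < N" for i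
    unfolding measurable_cong_sets[OF sets_CN_PiM refl] using that by (intro measurable_component_singleton) simp
  show "has_bochner_integral ?M (\<lambda>x. x i) 0" if i: "i < N" for i
  proof -
    have c: "(\<lambda>x. x i) \<in> ?M \<rightarrow>\<^sub>M CN (v i)" using i by (intro measurable_component_singleton) simp
    have d: "distr ?M (CN (v i)) (\<lambda>x. x i) = CN (v i)"
      using i by (intro distr_PiM_component) (auto simp: prob_space_CN)
    have id: "(\<lambda>z. z) \<in> borel_measurable (CN (v i))" by simp
    have "has_bochner_integral (distr ?M (CN (v i)) (\<lambda>x. x i)) (\<lambda>z. z) 0" unfolding d by (rule CN_moments(3)[OF v[OF i]])
    then have m: "integrable (distr ?M (CN (v i)) (\<lambda>x. x i)) (\<lambda>z. z)" "(\<integral>z. z \<partial>distr ?M (CN (v i)) (\<lambda>x. x i)) = 0"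
      unfolding has_bochner_integral_iff by blast+
    show ?thesis unfolding has_bochner_integral_iff
      using integrable_distr_eq[OF c id, THEN iffD1, OF m(1)] integral_distr[OF c id, symmetric, unfolded m(2)] by blast
  qed
  have s: "0 \<le> (\<Sum>i<N. (cmod (c i))\<^sup>2 * v i)" using v by (intro sum_nonneg mult_nonneg_nonneg) auto
  show "has_bochner_integral ?M (\<lambda>x. (cmod (\<Sum>i<N. c i * x i))\<^sup>2) (\<Sum>i<N. (cmod (c i))\<^sup>2 * v i)"
  proof (rule has_bochner_integral_nn_integral)
    show "(\<lambda>x. (cmod (\<Sum>i<N. c i * x i))\<^sup>2) \<in> borel_measurable ?M"
      using xm by (intro borel_measurable_norm2 borel_measurable_sum borel_measurable_times borel_measurable_const) auto
  qed (use s nn_integral_PiM_CN_linear[OF v] in simp_all)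
qed

locale uplink_fixed =
  fixes P :: params and N :: nat and h :: cvec and L :: "cvec measure" and Q :: "complex mat"
  assumes valid: "valid_params P" and L: "prob_space L" "sets L = sets (cspace N)"
    and L1: "\<And>i. i < N \<Longrightarrow> has_bochner_integral L (\<lambda>x. x i) 0"
    and L2: "\<And>i j. i < N \<Longrightarrow> j < N \<Longrightarrow> has_bochner_integral L (\<lambda>x. x i * cnj (x j)) (Q $$ (i, j))"
begin

abbreviation "p \<equiv> p_UE P"
abbreviation "er \<equiv> PiM {..<N} (\<lambda>i. CN (kappa_r P * p * (cmod (h i))\<^sup>2))"
abbreviation "nr \<equiv> PiM {..<N} (\<lambda>_. CN (sigma2 P))"
abbreviation "joint \<equiv> CN p \<Otimes>\<^sub>M disturb_law P N h L"

definition "mse \<beta> c = (cmod (\<beta> - (\<Sum>i<N. c i * h i)))\<^sup>2 * p + ((cmod (\<Sum>i<N. c i * h i))\<^sup>2 * (kappa_t P * p)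
  + ((\<Sum>i<N. (cmod (c i))\<^sup>2 * (kappa_r P * p * (cmod (h i))\<^sup>2)) + (Re (\<Sum>i<N. \<Sum>j<N. c i * Q $$ (i, j) * cnj (c j))
  + (\<Sum>i<N. (cmod (c i))\<^sup>2 * sigma2 P))))"

lemma pars: "0 < p" "0 \<le> kappa_t P * p" "0 \<le> kappa_r P * p * x\<^sup>2" "0 < sigma2 P"
proof -
  have "pilot P \<noteq> 0" "(cmod (pilot P))\<^sup>2 = p" using valid by (auto simp: valid_params_def)
  then show "0 < p" by (metis zero_less_norm_iff zero_less_power)
  then show "0 \<le> kappa_t P * p" "0 \<le> kappa_r P * p * x\<^sup>2" "0 < sigma2 P" using valid by (auto simp: valid_params_def)
qed

lemma sigma_finite: "sigma_finite_measure (CN v)" "sigma_finite_measure er" "sigma_finite_measure nr" "sigma_finite_measure L"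
  by (intro prob_space_imp_sigma_finite prob_space_CN prob_space_PiM L)+

lemma law: "disturb_law P N h L = CN (kappa_t P * p) \<Otimes>\<^sub>M er \<Otimes>\<^sub>M nr \<Otimes>\<^sub>M L"
  by (simp add: disturb_law_def)

lemma sets_law: "sets (disturb_law P N h L) = sets (disturb_space N)"
  unfolding law by (intro sets_pair_measure_cong sets_CN sets_CN_PiM L)

lemma prob_law: "prob_space (disturb_law P N h L)"
  unfolding law by (intro prob_space_pair prob_space_CN prob_space_PiM L)

lemma prob_joint: "prob_space joint"
  by (intro prob_space_pair prob_space_CN prob_law)

lemma sets_joint: "sets joint = sets (borel \<Otimes>\<^sub>M disturb_space N)"
  by (intro sets_pair_measure_cong sets_CN sets_law)

lemma nn_integral_joint:
  assumes F: "F \<in> borel_measurable (borel \<Otimes>\<^sub>M disturb_space N)"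
  shows "(\<integral>\<^sup>+x. F x \<partial>joint) = (\<integral>\<^sup>+d. \<integral>\<^sup>+et. \<integral>\<^sup>+e. \<integral>\<^sup>+x. \<integral>\<^sup>+z. F (d, et, e, z, x) \<partial>nr \<partial>L \<partial>er \<partial>CN (kappa_t P * p) \<partial>CN p)"
proof -
  interpret law: prob_space "disturb_law P N h L" by (rule prob_law)
  have "(\<integral>\<^sup>+x. F x \<partial>joint) = (\<integral>\<^sup>+d. \<integral>\<^sup>+w. F (d, w) \<partial>disturb_law P N h L \<partial>CN p)"
    by (rule law.nn_integral_fst[symmetric]) (use F in \<open>simp add: measurable_cong_sets[OF sets_joint refl]\<close>)
  also have "\<dots> = (\<integral>\<^sup>+d. \<integral>\<^sup>+et. \<integral>\<^sup>+e. \<integral>\<^sup>+x. \<integral>\<^sup>+z. F (d, et, e, z, x) \<partial>nr \<partial>L \<partial>er \<partial>CN (kappa_t P * p) \<partial>CN p)"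
  proof (rule nn_integral_cong)
    fix d
    have "(\<lambda>w. F (d, w)) \<in> borel_measurable (disturb_space N)"
      using measurable_compose[OF measurable_Pair1'[of d borel "disturb_space N"] F] by simp
    then have "(\<lambda>w. F (d, w)) \<in> borel_measurable (CN (kappa_t P * p) \<Otimes>\<^sub>M er \<Otimes>\<^sub>M nr \<Otimes>\<^sub>M L)"
      by (simp only: measurable_cong_sets[OF sets_law[unfolded law] refl])
    from nn_integral_pair4_3[OF sigma_finite this]
    show "(\<integral>\<^sup>+w. F (d, w) \<partial>disturb_law P N h L) = (\<integral>\<^sup>+et. \<integral>\<^sup>+e. \<integral>\<^sup>+x. \<integral>\<^sup>+z. F (d, et, e, z, x) \<partial>nr \<partial>L \<partial>er \<partial>CN (kappa_t P * p))"
      unfolding law .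
  qed
  finally show ?thesis .
qed

lemma received_components:
  assumes i: "i < N"
  shows "(\<lambda>x. received N h (fst x) (snd x) i) \<in> borel_measurable (borel \<Otimes>\<^sub>M disturb_space N)"
proof -
  let ?M = "borel \<Otimes>\<^sub>M disturb_space N"
  have a: "(\<lambda>x. fst (snd x)) \<in> borel_measurable ?M" "(\<lambda>x. fst (snd (snd x)) i) \<in> borel_measurable ?M"
    "(\<lambda>x. fst (snd (snd (snd x))) i) \<in> borel_measurable ?M" "(\<lambda>x. snd (snd (snd (snd x))) i) \<in> borel_measurable ?M"
    using i by (intro cspace_component[of _ _ N] measurable_fst measurable_snd measurable_compose[OF measurable_snd measurable_fst]
      measurable_compose[OF measurable_snd measurable_compose[OF measurable_snd measurable_fst]]
      measurable_compose[OF measurable_snd measurable_compose[OF measurable_snd measurable_compose[OF measurable_snd measurable_fst]]]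
      measurable_compose[OF measurable_snd measurable_compose[OF measurable_snd measurable_compose[OF measurable_snd measurable_snd]]]; simp)+
  have "(\<lambda>x. h i * (fst x + fst (snd x)) + fst (snd (snd x)) i + (fst (snd (snd (snd x))) i + snd (snd (snd (snd x))) i)) \<in> borel_measurable ?M"
    by (intro borel_measurable_add borel_measurable_times borel_measurable_const measurable_fst a)
  then show ?thesis using i by (simp add: received_def split_beta')
qed

lemma received_measurable: "(\<lambda>(d, w). received N h d w) \<in> borel \<Otimes>\<^sub>M disturb_space N \<rightarrow>\<^sub>M cspace N"
proof -
  have "(\<lambda>x. \<lambda>i\<in>{..<N}. received N h (fst x) (snd x) i) \<in> borel \<Otimes>\<^sub>M disturb_space N \<rightarrow>\<^sub>M cspace N"
    by (intro measurable_restrict received_components) simp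
  moreover have "(\<lambda>i\<in>{..<N}. received N h d w i) = received N h d w" for d w
    by (auto simp: received_def restrict_def split: prod.split)
  ultimately show ?thesis by (simp add: split_beta')
qed

lemma mse_integral:
  "has_bochner_integral joint (\<lambda>x. (cmod (\<beta> * fst x - (\<Sum>i<N. c i * received N h (fst x) (snd x) i)))\<^sup>2) (mse \<beta> c)"
proof -
  define \<mu> where "\<mu> = (\<Sum>i<N. c i * h i)"
  define qd where "qd = (cmod (\<beta> - \<mu>))\<^sup>2 * p"
  define qt where "qt = (cmod (- \<mu>))\<^sup>2 * (kappa_t P * p)"
  define qr where "qr = (\<Sum>i<N. (cmod (- c i))\<^sup>2 * (kappa_r P * p * (cmod (h i))\<^sup>2))"
  define qi where "qi = Re (\<Sum>i<N. \<Sum>j<N. - c i * Q $$ (i, j) * cnj (- c j))"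
  define qn where "qn = (\<Sum>i<N. (cmod (- c i))\<^sup>2 * sigma2 P)"
  have cd: "centred (CN p) (\<lambda>z. (\<beta> - \<mu>) * z) qd" unfolding qd_def by (rule centred_CN[OF less_imp_le[OF pars(1)]])
  have ct: "centred (CN (kappa_t P * p)) (\<lambda>z. - \<mu> * z) qt" unfolding qt_def by (rule centred_CN[OF pars(2)])
  have cr: "centred er (\<lambda>x. \<Sum>i<N. - c i * x i) qr" unfolding qr_def by (rule centred_PiM_CN) (rule pars(3))
  have cn: "centred nr (\<lambda>x. \<Sum>i<N. - c i * x i) qn" unfolding qn_def by (rule centred_PiM_CN) (use pars(4) in simp)
  have ci: "centred L (\<lambda>x. \<Sum>i<N. - c i * x i) qi" unfolding qi_def by (intro centred_sum L L1 linear_second_moment L2)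
  note nn = cd[THEN centred_nonneg] ct[THEN centred_nonneg] cr[THEN centred_nonneg] cn[THEN centred_nonneg] ci[THEN centred_nonneg]
  let ?W = "\<lambda>x. \<beta> * fst x - (\<Sum>i<N. c i * received N h (fst x) (snd x) i)"
  have Wm: "(\<lambda>x. (cmod (?W x))\<^sup>2) \<in> borel_measurable (borel \<Otimes>\<^sub>M disturb_space N)"
    by (intro borel_measurable_norm2 borel_measurable_diff borel_measurable_sum borel_measurable_times borel_measurable_const measurable_fst received_components) simp
  have W: "?W (d, et, e, z, x) = ((((\<beta> - \<mu>) * d + - \<mu> * et) + (\<Sum>i<N. - c i * e i)) + (\<Sum>i<N. - c i * x i)) + (\<Sum>i<N. - c i * z i)" for d et e z x
  proof -
    have "(\<Sum>i<N. c i * received N h d (et, e, z, x) i) = (\<Sum>i<N. c i * h i * (d + et) + c i * e i + (c i * z i + c i * x i))"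
      by (intro sum.cong refl) (simp add: received_def algebra_simps)
    also have "\<dots> = \<mu> * (d + et) + (\<Sum>i<N. c i * e i) + ((\<Sum>i<N. c i * z i) + (\<Sum>i<N. c i * x i))"
      by (simp add: sum.distrib \<mu>_def sum_distrib_right)
    finally show ?thesis by (simp add: sum_negf algebra_simps)
  qed
  have "msq joint ?W = (\<integral>\<^sup>+d. \<integral>\<^sup>+et. \<integral>\<^sup>+e. \<integral>\<^sup>+x. \<integral>\<^sup>+z. ennreal ((cmod (?W (d, et, e, z, x)))\<^sup>2 + 0) \<partial>nr \<partial>L \<partial>er \<partial>CN (kappa_t P * p) \<partial>CN p)"
    using nn_integral_joint[OF measurable_compose[OF Wm measurable_ennreal]] by simp
  also have "\<dots> = (\<integral>\<^sup>+d. \<integral>\<^sup>+et. \<integral>\<^sup>+e. \<integral>\<^sup>+x. ennreal ((cmod ((((\<beta> - \<mu>) * d + - \<mu> * et) + (\<Sum>i<N. - c i * e i)) + (\<Sum>i<N. - c i * x i)))\<^sup>2 + (qn + 0)) \<partial>L \<partial>er \<partial>CN (kappa_t P * p) \<partial>CN p)"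
    unfolding W by (intro nn_integral_cong nn_integral_centred_add[OF cn]) simp
  also have "\<dots> = (\<integral>\<^sup>+d. \<integral>\<^sup>+et. \<integral>\<^sup>+e. ennreal ((cmod (((\<beta> - \<mu>) * d + - \<mu> * et) + (\<Sum>i<N. - c i * e i)))\<^sup>2 + (qi + (qn + 0))) \<partial>er \<partial>CN (kappa_t P * p) \<partial>CN p)"
    by (intro nn_integral_cong nn_integral_centred_add[OF ci]) (use nn in simp)
  also have "\<dots> = (\<integral>\<^sup>+d. \<integral>\<^sup>+et. ennreal ((cmod ((\<beta> - \<mu>) * d + - \<mu> * et))\<^sup>2 + (qr + (qi + (qn + 0)))) \<partial>CN (kappa_t P * p) \<partial>CN p)"
    by (intro nn_integral_cong nn_integral_centred_add[OF cr]) (use nn in simp)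
  also have "\<dots> = (\<integral>\<^sup>+d. ennreal ((cmod (0 + (\<beta> - \<mu>) * d))\<^sup>2 + (qt + (qr + (qi + (qn + 0))))) \<partial>CN p)"
    unfolding add_0_left by (intro nn_integral_cong nn_integral_centred_add[OF ct]) (use nn in simp)
  also have "\<dots> = ennreal ((cmod 0)\<^sup>2 + (qd + (qt + (qr + (qi + (qn + 0))))))"
    by (rule nn_integral_centred_add[OF cd]) (use nn in simp)
  also have "(cmod 0)\<^sup>2 + (qd + (qt + (qr + (qi + (qn + 0))))) = mse \<beta> c"
    by (simp add: mse_def qd_def qt_def qr_def qi_def qn_def \<mu>_def)
  finally have i: "msq joint ?W = ennreal (mse \<beta> c)" .
  have "0 \<le> mse \<beta> c" using nn by (simp add: mse_def qd_def qt_def qr_def qi_def qn_def \<mu>_def)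
  then show ?thesis using Wm i by (intro has_bochner_integral_nn_integral) (simp_all add: measurable_cong_sets[OF sets_joint refl])
qed

lemma mutual_information_mse_ge:
  assumes s: "0 < s"
  shows "(ln (p / s) + 1 - mse 1 c / s) / ln 2
    \<le> prob_space.mutual_information joint 2 borel (cspace N) (\<lambda>(d, w). d) (\<lambda>(d, w). received N h d w)"
proof -
  define G where "G x = ln (p / s) - (cmod (fst x - (\<Sum>i<N. c i * snd x i)))\<^sup>2 / s + (cmod (fst x))\<^sup>2 / p" for x :: "complex \<times> cvec"
  define m where "m d t = (\<lambda>i. h i * (d + fst t) + fst (snd t) i + snd (snd t) i)" for d and t :: "complex \<times> cvec \<times> cvec"
  let ?Th = "CN (kappa_t P * p) \<Otimes>\<^sub>M er \<Otimes>\<^sub>M L"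
  let ?DE = "CN p \<Otimes>\<^sub>M nr"
  have sDE: "sets ?DE = sets (borel \<Otimes>\<^sub>M cspace N)" by (intro sets_pair_measure_cong sets_CN sets_CN_PiM)
  have sTh: "sets ?Th = sets (borel \<Otimes>\<^sub>M cspace N \<Otimes>\<^sub>M cspace N)" by (intro sets_pair_measure_cong sets_CN sets_CN_PiM L)
  have sDT: "sets (CN p \<Otimes>\<^sub>M ?Th) = sets (borel \<Otimes>\<^sub>M borel \<Otimes>\<^sub>M cspace N \<Otimes>\<^sub>M cspace N)" by (intro sets_pair_measure_cong sets_CN sTh)
  interpret J: prob_space joint by (rule prob_joint)
  interpret eL: prob_space "er \<Otimes>\<^sub>M L" by (intro prob_space_pair prob_space_PiM prob_space_CN L)
  interpret L: prob_space L by (rule L)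
  interpret nr: prob_space nr by (intro prob_space_PiM prob_space_CN)
  have pTh: "prob_space ?Th" by (intro prob_space_pair prob_space_PiM prob_space_CN L)
  have Xm: "(\<lambda>(d, w). d) \<in> joint \<rightarrow>\<^sub>M borel" unfolding measurable_cong_sets[OF sets_joint refl] by (simp add: split_beta')
  have Ym: "(\<lambda>(d, w). received N h d w) \<in> joint \<rightarrow>\<^sub>M cspace N" unfolding measurable_cong_sets[OF sets_joint refl] by (rule received_measurable)
  have mm: "(\<lambda>(d, t). m d t i) \<in> borel_measurable (CN p \<Otimes>\<^sub>M ?Th)" if i: "i < N" for i
  proof -
    let ?M = "borel \<Otimes>\<^sub>M borel \<Otimes>\<^sub>M cspace N \<Otimes>\<^sub>M cspace N"
    have a: "(\<lambda>x. fst (snd x)) \<in> borel_measurable ?M" "(\<lambda>x. fst (snd (snd x)) i) \<in> borel_measurable ?M" "(\<lambda>x. snd (snd (snd x)) i) \<in> borel_measurable ?M"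
      using i by (intro cspace_component[of _ _ N] measurable_compose[OF measurable_snd measurable_fst]
        measurable_compose[OF measurable_snd measurable_compose[OF measurable_snd measurable_fst]]
        measurable_compose[OF measurable_snd measurable_compose[OF measurable_snd measurable_snd]]; simp)+
    have "(\<lambda>x. h i * (fst x + fst (snd x)) + fst (snd (snd x)) i + snd (snd (snd x)) i) \<in> borel_measurable ?M"
      by (intro borel_measurable_add borel_measurable_times borel_measurable_const measurable_fst a)
    then show ?thesis unfolding measurable_cong_sets[OF sDT refl] by (simp add: m_def split_beta')
  qed
  have zc: "(\<lambda>x. snd x i) \<in> borel_measurable (borel \<Otimes>\<^sub>M cspace N)" if "i < N" for i
    using that by (intro cspace_component[of _ _ N] measurable_snd) simp
  have Gm: "G \<in> borel_measurable ?DE"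
  proof -
    have "(\<lambda>x. (cmod (fst x - (\<Sum>i<N. c i * snd x i)))\<^sup>2) \<in> borel_measurable (borel \<Otimes>\<^sub>M cspace N)" "(\<lambda>x. (cmod (fst x))\<^sup>2) \<in> borel_measurable (borel \<Otimes>\<^sub>M cspace N)"
      by (intro borel_measurable_norm2 borel_measurable_diff borel_measurable_sum borel_measurable_times borel_measurable_const measurable_fst zc; simp)+
    then show ?thesis unfolding measurable_cong_sets[OF sDE refl] G_def[abs_def] by simp
  qed
  have kernel: "(\<integral>\<^sup>+x. F (case x of (d, w) \<Rightarrow> d, case x of (d, w) \<Rightarrow> received N h d w) \<partial>joint) =
      (\<integral>\<^sup>+d. \<integral>\<^sup>+t. \<integral>\<^sup>+z. F (d, z) * ennreal (tilt N (sigma2 P) (m d t) z) \<partial>nr \<partial>?Th \<partial>CN p)"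
    if F: "F \<in> borel_measurable ?DE" for F
  proof -
    have F': "F \<in> borel_measurable (borel \<Otimes>\<^sub>M cspace N)" using F by (simp add: measurable_cong_sets[OF sDE refl])
    have "(\<lambda>x. F (fst x, case x of (d, w) \<Rightarrow> received N h d w)) \<in> borel_measurable (borel \<Otimes>\<^sub>M disturb_space N)"
      by (rule measurable_compose[OF measurable_Pair[OF measurable_fst received_measurable] F'])
    from nn_integral_joint[OF this]
    have "(\<integral>\<^sup>+x. F (case x of (d, w) \<Rightarrow> d, case x of (d, w) \<Rightarrow> received N h d w) \<partial>joint)
      = (\<integral>\<^sup>+d. \<integral>\<^sup>+et. \<integral>\<^sup>+e. \<integral>\<^sup>+x. \<integral>\<^sup>+z. F (d, received N h d (et, e, z, x)) \<partial>nr \<partial>L \<partial>er \<partial>CN (kappa_t P * p) \<partial>CN p)"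
      by (simp add: split_beta')
    also have "\<dots> = (\<integral>\<^sup>+d. \<integral>\<^sup>+et. \<integral>\<^sup>+e. \<integral>\<^sup>+x. \<integral>\<^sup>+z. F (d, z) * ennreal (tilt N (sigma2 P) (m d (et, e, x)) z) \<partial>nr \<partial>L \<partial>er \<partial>CN (kappa_t P * p) \<partial>CN p)"
    proof (rule nn_integral_cong, rule nn_integral_cong, rule nn_integral_cong, rule nn_integral_cong)
      fix d et e x
      have "(\<lambda>z. F (d, z)) \<in> borel_measurable (cspace N)"
        using measurable_compose[OF measurable_Pair1'[of d borel "cspace N"] F'] by simp
      from nn_integral_PiM_CN_shift[OF pars(4) this, of "m d (et, e, x)"]
      show "(\<integral>\<^sup>+z. F (d, received N h d (et, e, z, x)) \<partial>nr) = (\<integral>\<^sup>+z. F (d, z) * ennreal (tilt N (sigma2 P) (m d (et, e, x)) z) \<partial>nr)"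
        by (simp add: received_def m_def add_ac)
    qed
    also have "\<dots> = (\<integral>\<^sup>+d. \<integral>\<^sup>+t. \<integral>\<^sup>+z. F (d, z) * ennreal (tilt N (sigma2 P) (m d t) z) \<partial>nr \<partial>?Th \<partial>CN p)"
    proof (rule nn_integral_cong)
      fix d
      let ?K = "\<lambda>t. \<integral>\<^sup>+z. F (d, z) * ennreal (tilt N (sigma2 P) (m d t) z) \<partial>nr"
      have "(\<lambda>x. F (d, snd x) * ennreal (tilt N (sigma2 P) (m d (fst x)) (snd x))) \<in> borel_measurable (?Th \<Otimes>\<^sub>M nr)"
      proof (intro borel_measurable_times_ennreal measurable_compose[OF tilt_measurable measurable_ennreal])
        show "(\<lambda>x. F (d, snd x)) \<in> borel_measurable (?Th \<Otimes>\<^sub>M nr)"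
          by (rule measurable_compose[OF _ F]) (intro measurable_Pair measurable_snd measurable_const; simp)
        fix i assume i: "i < N"
        have "(\<lambda>x. (d, fst x)) \<in> ?Th \<Otimes>\<^sub>M nr \<rightarrow>\<^sub>M CN p \<Otimes>\<^sub>M ?Th" by (intro measurable_Pair measurable_fst measurable_const) simp
        from measurable_compose[OF this mm[OF i]] show "(\<lambda>x. m d (fst x) i) \<in> borel_measurable (?Th \<Otimes>\<^sub>M nr)" by simp
        have "(\<lambda>z. z i) \<in> borel_measurable nr"
          unfolding measurable_cong_sets[OF sets_CN_PiM refl] using i by (intro measurable_component_singleton) simp
        then show "(\<lambda>x. snd x i) \<in> borel_measurable (?Th \<Otimes>\<^sub>M nr)" by (rule measurable_compose[OF measurable_snd])
      qed
      then have Km: "?K \<in> borel_measurable ?Th"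
        by (intro sigma_finite_measure.borel_measurable_nn_integral[OF sigma_finite(3)]) (simp add: split_beta')
      have Kt: "(\<lambda>t. ?K (et, t)) \<in> borel_measurable (er \<Otimes>\<^sub>M L)" for et
        using measurable_compose[OF measurable_Pair1'[of et "CN (kappa_t P * p)" "er \<Otimes>\<^sub>M L"] Km] by simp
      have "(\<integral>\<^sup>+t. ?K t \<partial>?Th) = (\<integral>\<^sup>+et. \<integral>\<^sup>+t. ?K (et, t) \<partial>(er \<Otimes>\<^sub>M L) \<partial>CN (kappa_t P * p))"
        by (rule eL.nn_integral_fst[OF Km, symmetric])
      also have "\<dots> = (\<integral>\<^sup>+et. \<integral>\<^sup>+e. \<integral>\<^sup>+x. ?K (et, e, x) \<partial>L \<partial>er \<partial>CN (kappa_t P * p))"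
        by (intro nn_integral_cong L.nn_integral_fst[OF Kt, symmetric])
      finally show "(\<integral>\<^sup>+et. \<integral>\<^sup>+e. \<integral>\<^sup>+x. ?K (et, e, x) \<partial>L \<partial>er \<partial>CN (kappa_t P * p)) = (\<integral>\<^sup>+t. ?K t \<partial>?Th)" by simp
    qed
    finally show ?thesis .
  qed
  have q: "integrable joint (\<lambda>x. sqn N (case x of (d, w) \<Rightarrow> received N h d w))"
    unfolding sqn_def
  proof (rule Bochner_Integration.integrable_sum)
    fix i assume i: "i \<in> {..<N}"
    have "(\<Sum>j<N. (if i = j then 1 else 0) * y j) = y i" for y :: "nat \<Rightarrow> complex"
      using i by (simp add: if_distrib[of "\<lambda>z. z * _"] cong: if_cong)
    then show "integrable joint (\<lambda>x. (cmod ((case x of (d, w) \<Rightarrow> received N h d w) i))\<^sup>2)"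
      using mse_integral[of 0 "\<lambda>j. if i = j then 1 else 0"] by (simp add: has_bochner_integral_iff split_beta')
  qed
  have G_int: "has_bochner_integral joint (\<lambda>x. G (case x of (d, w) \<Rightarrow> d, case x of (d, w) \<Rightarrow> received N h d w)) (ln (p / s) - mse 1 c / s + p / p)"
  proof -
    have "mse 1 (\<lambda>_. 0) = p" by (simp add: mse_def)
    then have d2: "has_bochner_integral joint (\<lambda>x. (cmod (fst x))\<^sup>2) p" using mse_integral[of 1 "\<lambda>_. 0"] by simp
    have e2: "has_bochner_integral joint (\<lambda>x. (cmod (fst x - (\<Sum>i<N. c i * received N h (fst x) (snd x) i)))\<^sup>2) (mse 1 c)"
      using mse_integral[of 1 c] by simp
    have k: "has_bochner_integral joint (\<lambda>x. ln (p / s)) (ln (p / s))" by (simp add: has_bochner_integral_iff J.prob_space)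
    have "G (case x of (d, w) \<Rightarrow> d, case x of (d, w) \<Rightarrow> received N h d w) = ln (p / s)
        - (cmod (fst x - (\<Sum>i<N. c i * received N h (fst x) (snd x) i)))\<^sup>2 / s + (cmod (fst x))\<^sup>2 / p" for x
      by (cases x) (simp add: G_def)
    then show ?thesis
      using has_bochner_integral_add[OF has_bochner_integral_diff[OF k has_bochner_integral_divide_zero[OF e2, of s]] has_bochner_integral_divide_zero[OF d2, of p]]
      by (simp only:)
  qed
  have "(\<integral>x. G (case x of (d, w) \<Rightarrow> d, case x of (d, w) \<Rightarrow> received N h d w) \<partial>joint) = ln (p / s) - mse 1 c / s + p / p"
    using G_int by (rule has_bochner_integral_integral_eq)
  then have I: "(\<integral>x. G (case x of (d, w) \<Rightarrow> d, case x of (d, w) \<Rightarrow> received N h d w) \<partial>joint) = ln (p / s) + 1 - mse 1 c / s"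
    using pars(1) by simp
  note lower = mutual_information_gaussian_noise_ge[where M=joint and D="CN p" and Th="?Th" and v="sigma2 P" and b=2 and N=N and m=m and G=G
      and X="\<lambda>(d, w). d" and Y="\<lambda>(d, w). received N h d w"]
  have Gi: "integrable joint (\<lambda>x. G (case x of (d, w) \<Rightarrow> d, case x of (d, w) \<Rightarrow> received N h d w))" using G_int by (simp add: has_bochner_integral_iff)
  have G1: "(\<integral>\<^sup>+d. ennreal (exp (G (d, z))) \<partial>CN p) \<le> 1" for z
    using CN_gaussian_tilt[OF pars(1) s, of "\<Sum>i<N. c i * z i"] by (simp add: G_def)
  have "(\<integral>x. G (case x of (d, w) \<Rightarrow> d, case x of (d, w) \<Rightarrow> received N h d w) \<partial>joint) / ln 2
    \<le> prob_space.mutual_information joint 2 borel (cspace N) (\<lambda>(d, w). d) (\<lambda>(d, w). received N h d w)"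
  proof (rule lower)
    show "prob_space joint" "prob_space (CN p)" "sets (CN p) = sets borel" "prob_space ?Th" "0 < sigma2 P" "(1::real) < 2"
      using prob_joint prob_space_CN pTh pars(4) by auto
    show "(\<lambda>(d, w). d) \<in> joint \<rightarrow>\<^sub>M borel" by (rule Xm)
    show "(\<lambda>(d, w). received N h d w) \<in> joint \<rightarrow>\<^sub>M cspace N" by (rule Ym)
    show "(\<lambda>(d, t). m d t i) \<in> borel_measurable (CN p \<Otimes>\<^sub>M ?Th)" if "i < N" for i using that by (rule mm)
    show "integrable joint (\<lambda>x. sqn N (case x of (d, w) \<Rightarrow> received N h d w))" by (rule q)
    show "G \<in> borel_measurable ?DE" by (rule Gm)
    show "integrable joint (\<lambda>x. G (case x of (d, w) \<Rightarrow> d, case x of (d, w) \<Rightarrow> received N h d w))" by (rule Gi)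
    show "(\<integral>\<^sup>+d. ennreal (exp (G (d, z))) \<partial>CN p) \<le> 1" for z by (rule G1)
    fix F :: "complex \<times> cvec \<Rightarrow> ennreal" assume F: "F \<in> borel_measurable ?DE"
    show "(\<integral>\<^sup>+x. F (case x of (d, w) \<Rightarrow> d, case x of (d, w) \<Rightarrow> received N h d w) \<partial>joint) =
      (\<integral>\<^sup>+d. \<integral>\<^sup>+t. \<integral>\<^sup>+z. F (d, z) * ennreal (tilt N (sigma2 P) (m d t) z) \<partial>nr \<partial>?Th \<partial>CN p)"
      by (rule kernel[OF F])
  qed
  then show ?thesis by (simp only: I)
qed

end

section \<open>Averaging over the channel\<close>

context uplink_sys
begin

lemma data_model:
  "bs_csi U \<in> prb U \<rightarrow>\<^sub>M bs_space U" "ue_csi U \<in> prb U \<rightarrow>\<^sub>M ue_space U"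
  "data_interf U \<in> chans U \<Otimes>\<^sub>M bs_space U \<Otimes>\<^sub>M ue_space U \<rightarrow>\<^sub>M prob_algebra (cspace N)"
  "\<forall>c\<in>space (chans U). \<forall>b\<in>space (bs_space U). \<forall>u\<in>space (ue_space U). \<forall>i<N.
        integrable (data_interf U (c, b, u)) (\<lambda>x. x i) \<and>
        (\<integral>x. x i \<partial>data_interf U (c, b, u)) = 0 \<and>
        (\<forall>j<N. integrable (data_interf U (c, b, u)) (\<lambda>x. x i * cnj (x j)) \<and>
           (\<integral>x. x i * cnj (x j) \<partial>data_interf U (c, b, u)) = cov_Q U c $$ (i, j))"
  using model unfolding uplink_model_def by (elim conjE, blast)+

lemma csi_meas: "(\<lambda>w. (chan U w, bs_csi U w, ue_csi U w)) \<in> prb U \<rightarrow>\<^sub>M chans U \<Otimes>\<^sub>M bs_space U \<Otimes>\<^sub>M ue_space U"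
  by (intro measurable_Pair chan_meas data_model)

lemma data_moments:
  assumes w: "w \<in> space (prb U)" and ij: "i < N" "j < N"
  shows "has_bochner_integral (data_interf U (chan U w, bs_csi U w, ue_csi U w)) (\<lambda>x. x i) 0"
    "has_bochner_integral (data_interf U (chan U w, bs_csi U w, ue_csi U w)) (\<lambda>x. x i * cnj (x j)) (cov_Q U (chan U w) $$ (i, j))"
  using data_model(4)[rule_format, OF measurable_space[OF chan_meas w] measurable_space[OF data_model(1) w] measurable_space[OF data_model(2) w] ij(1)] ij(2)
  by (auto simp: has_bochner_integral_iff)

lemma cov_Q_meas:
  assumes ij: "i < N" "j < N"
  shows "(\<lambda>w. cov_Q U (chan U w) $$ (i, j)) \<in> borel_measurable (prb U)"
proof -
  have f: "(\<lambda>x. x i * cnj (x j)) \<in> borel_measurable (cspace N)"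
    using ij by (intro borel_measurable_times borel_measurable_cnj' measurable_component_singleton) auto
  have "(\<lambda>w. \<integral>x. x i * cnj (x j) \<partial>data_interf U (chan U w, bs_csi U w, ue_csi U w)) \<in> borel_measurable (prb U)"
    by (rule measurable_compose[OF csi_meas measurable_compose[OF measurable_prob_algebraD[OF data_model(3)] integral_measurable_subprob_algebra[OF f]]])
  then show ?thesis
    by (rule measurable_cong[THEN iffD1, rotated]) (use data_moments(2)[OF _ ij] in \<open>auto simp: has_bochner_integral_iff\<close>)
qed

lemma uplink_fixed_at:
  assumes w: "w \<in> space (prb U)"
  shows "uplink_fixed P N (data_interf U (chan U w, bs_csi U w, ue_csi U w)) (cov_Q U (chan U w))"
proof (rule uplink_fixed.intro)
  have "data_interf U (chan U w, bs_csi U w, ue_csi U w) \<in> space (prob_algebra (cspace N))"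
    by (rule measurable_space[OF measurable_compose[OF csi_meas data_model(3)] w])
  then show "prob_space (data_interf U (chan U w, bs_csi U w, ue_csi U w))"
    "sets (data_interf U (chan U w, bs_csi U w, ue_csi U w)) = sets (cspace N)" by (auto simp: space_prob_algebra)
qed (use params data_moments[OF w] in auto)

abbreviation "v w \<equiv> mrc P N U w"
definition "W w = v w \<bullet>c hvec N U w"
definition "K w = Re (((cov_Q U (chan U w) + complex_of_real (sigma2 P) \<cdot>\<^sub>m 1\<^sub>m N) *\<^sub>v v w) \<bullet>c v w)"
definition "J w = (\<Sum>i<N. (cmod (hvec N U w $ i))\<^sup>2 * (cmod (v w $ i))\<^sup>2)"

lemma W_sum: "W w = (\<Sum>i<N. v w $ i * cnj (h w i))"
  unfolding W_def by (subst cscalar_prod_sum) (auto simp: hvec_def intro!: sum.cong)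

lemma K_sum:
  assumes "w \<in> space (prb U)"
  shows "K w = Re (\<Sum>i<N. \<Sum>j<N. cnj (v w $ i) * cov_Q U (chan U w) $$ (i, j) * v w $ j) + sigma2 P * (\<Sum>i<N. (cmod (v w $ i))\<^sup>2)"
proof -
  let ?Q = "cov_Q U (chan U w)"
  have Q: "?Q \<in> carrier_mat N N" by (rule cov_Q_carrier[OF measurable_space[OF chan_meas assms]])
  then have c: "?Q + complex_of_real (sigma2 P) \<cdot>\<^sub>m 1\<^sub>m N \<in> carrier_mat N N" by simp
  have "K w = Re (\<Sum>i<N. \<Sum>j<N. cnj (v w $ i) * (?Q + complex_of_real (sigma2 P) \<cdot>\<^sub>m 1\<^sub>m N) $$ (i, j) * v w $ j)"
    unfolding K_def quad_form_sum[OF c mrc_carrier] ..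
  also have "(\<Sum>i<N. \<Sum>j<N. cnj (v w $ i) * (?Q + complex_of_real (sigma2 P) \<cdot>\<^sub>m 1\<^sub>m N) $$ (i, j) * v w $ j)
    = (\<Sum>i<N. (\<Sum>j<N. cnj (v w $ i) * ?Q $$ (i, j) * v w $ j) + complex_of_real (sigma2 P * (cmod (v w $ i))\<^sup>2))"
  proof (intro sum.cong refl)
    fix i assume i: "i \<in> {..<N}"
    have "(\<Sum>j<N. cnj (v w $ i) * (?Q + complex_of_real (sigma2 P) \<cdot>\<^sub>m 1\<^sub>m N) $$ (i, j) * v w $ j)
      = (\<Sum>j<N. cnj (v w $ i) * ?Q $$ (i, j) * v w $ j + (if i = j then complex_of_real (sigma2 P) * (v w $ i * cnj (v w $ i)) else 0))"
      using Q i by (intro sum.cong refl) (auto simp: distrib_left distrib_right mult_ac)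
    also have "\<dots> = (\<Sum>j<N. cnj (v w $ i) * ?Q $$ (i, j) * v w $ j) + complex_of_real (sigma2 P) * (v w $ i * cnj (v w $ i))"
      using i by (simp add: sum.distrib)
    finally show "(\<Sum>j<N. cnj (v w $ i) * (?Q + complex_of_real (sigma2 P) \<cdot>\<^sub>m 1\<^sub>m N) $$ (i, j) * v w $ j)
      = (\<Sum>j<N. cnj (v w $ i) * ?Q $$ (i, j) * v w $ j) + complex_of_real (sigma2 P * (cmod (v w $ i))\<^sup>2)"
      unfolding of_real_mult complex_norm_square .
  qed
  finally show ?thesis by (simp add: sum.distrib sum_distrib_left del: of_real_mult of_real_power)
qed

lemma mse_mrc:
  assumes w: "w \<in> space (prb U)"
  shows "uplink_fixed.mse P N (h w) (cov_Q U (chan U w)) 1 (\<lambda>i. a * cnj (v w $ i))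
    = p_UE P * (1 - 2 * Re (a * cnj (W w))) + (cmod a)\<^sup>2 * (p_UE P * ((1 + kappa_t P) * (cmod (W w))\<^sup>2 + kappa_r P * J w + K w / p_UE P))"
proof -
  let ?Q = "cov_Q U (chan U w)"
  let ?z = "\<Sum>i<N. \<Sum>j<N. cnj (v w $ i) * ?Q $$ (i, j) * v w $ j"
  have 1: "(\<Sum>i<N. a * cnj (v w $ i) * h w i) = a * cnj (W w)"
    unfolding W_sum cnj_sum sum_distrib_left by (intro sum.cong refl) simp
  have 2: "(\<Sum>i<N. (cmod (a * cnj (v w $ i)))\<^sup>2 * (kappa_r P * p_UE P * (cmod (h w i))\<^sup>2)) = (cmod a)\<^sup>2 * (p_UE P * (kappa_r P * J w))"
    unfolding J_def sum_distrib_left by (intro sum.cong refl) (simp add: hvec_def norm_mult power_mult_distrib mult_ac)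
  have "(\<Sum>i<N. \<Sum>j<N. a * cnj (v w $ i) * ?Q $$ (i, j) * cnj (a * cnj (v w $ j))) = (\<Sum>i<N. \<Sum>j<N. (a * cnj a) * (cnj (v w $ i) * ?Q $$ (i, j) * v w $ j))"
    by (intro sum.cong refl) (simp add: mult_ac)
  also have "\<dots> = complex_of_real ((cmod a)\<^sup>2) * ?z"
    by (simp only: complex_norm_square sum_distrib_left)
  finally have 3: "Re (\<Sum>i<N. \<Sum>j<N. a * cnj (v w $ i) * ?Q $$ (i, j) * cnj (a * cnj (v w $ j))) = (cmod a)\<^sup>2 * Re ?z"
    by (simp del: of_real_power)
  have 4: "(\<Sum>i<N. (cmod (a * cnj (v w $ i)))\<^sup>2 * sigma2 P) = (cmod a)\<^sup>2 * (sigma2 P * (\<Sum>i<N. (cmod (v w $ i))\<^sup>2))"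
    unfolding sum_distrib_left by (intro sum.cong refl) (simp add: norm_mult power_mult_distrib mult_ac)
  have 5: "(cmod (a * cnj (W w)))\<^sup>2 = (cmod a)\<^sup>2 * (cmod (W w))\<^sup>2" by (simp add: norm_mult power_mult_distrib)
  have 6: "(cmod (1 - a * cnj (W w)))\<^sup>2 = 1 - 2 * Re (a * cnj (W w)) + (cmod a)\<^sup>2 * (cmod (W w))\<^sup>2"
    unfolding 5[symmetric] cmod_power2 by (simp add: power2_eq_square algebra_simps)
  have 7: "p_UE P * (x + y + K w / p_UE P) = p_UE P * (x + y) + K w" for x y using p_pos by (simp add: distrib_left)
  have z: "Re ?z = K w - sigma2 P * (\<Sum>i<N. (cmod (v w $ i))\<^sup>2)" using K_sum[OF w] by linarith
  show ?thesis unfolding uplink_fixed.mse_def[OF uplink_fixed_at[OF w]] 1 2 3 4 5 6 7 z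
    by (simp add: distrib_left distrib_right right_diff_distrib mult_ac)
qed

lemma h_square_integrable:
  assumes i: "i < N"
  shows "integrable (prb U) (\<lambda>w. (cmod (h w i))\<^sup>2)"
proof -
  have "(\<Sum>j<N. (if i = j then 1 else 0) * y j) = y i" for y :: "nat \<Rightarrow> complex"
    using i by (simp add: if_distrib[of "\<lambda>z. z * _"] cong: if_cong)
  then show ?thesis
    using complex_normal_linear(1)[OF normal_h psd_R, of "\<lambda>j. if i = j then 1 else 0"] by (simp add: has_bochner_integral_iff)
qed

lemma W_meas: "W \<in> borel_measurable (prb U)"
  unfolding W_sum[abs_def] by (intro borel_measurable_sum borel_measurable_times borel_measurable_cnj' mrc_meas h_meas_i) auto

lemma W_square_integrable: "integrable (prb U) (\<lambda>w. (cmod (W w))\<^sup>2)"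
proof (rule Bochner_Integration.integrable_bound)
  show "integrable (prb U) (\<lambda>w. sqn N (h w))" unfolding sqn_def
    by (intro Bochner_Integration.integrable_sum h_square_integrable) simp
  show "(\<lambda>w. (cmod (W w))\<^sup>2) \<in> borel_measurable (prb U)" by (intro borel_measurable_norm2 W_meas)
  show "AE w in prb U. norm ((cmod (W w))\<^sup>2) \<le> norm (sqn N (h w))"
  proof (rule AE_I2)
    fix w
    have "(cmod (W w))\<^sup>2 \<le> sqn N (\<lambda>i. v w $ i) * sqn N (h w)"
      unfolding W_sum using sum_Cauchy_Schwarz_complex[of "\<lambda>i. v w $ i" "\<lambda>i. cnj (h w i)" N] by simp
    also have "\<dots> \<le> 1 * sqn N (h w)" by (intro mult_right_mono mrc_sqn) simp
    finally show "norm ((cmod (W w))\<^sup>2) \<le> norm (sqn N (h w))" by simp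
  qed
qed

lemma W_integrable: "integrable (prb U) W"
proof (rule Bochner_Integration.integrable_bound)
  show "integrable (prb U) (\<lambda>w. 1 + (cmod (W w))\<^sup>2)" using W_square_integrable by simp
  show "AE w in prb U. norm (W w) \<le> norm (1 + (cmod (W w))\<^sup>2)"
  proof (rule AE_I2)
    fix w
    have "x \<le> 1 + x\<^sup>2" for x :: real
      using sum_squares_bound[of 1 x] zero_le_power2[of x] by (simp only: power_one mult_1_right)
    then show "norm (W w) \<le> norm (1 + (cmod (W w))\<^sup>2)" by simp
  qed
qed (rule W_meas)

lemma J_integral: "has_bochner_integral (prb U) J (\<Sum>i<N. \<integral>w. (cmod (hvec N U w $ i))\<^sup>2 * (cmod (v w $ i))\<^sup>2 \<partial>prb U)"
  unfolding J_def[abs_def]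
proof (intro has_bochner_integral_sum has_bochner_integral_integrable)
  fix i assume "i \<in> {..<N}"
  then have i: "i < N" by simp
  have "integrable (prb U) (\<lambda>w. (cmod (h w i))\<^sup>2 * (cmod (v w $ i))\<^sup>2)"
  proof (rule Bochner_Integration.integrable_bound[OF h_square_integrable[OF i]])
    show "(\<lambda>w. (cmod (h w i))\<^sup>2 * (cmod (v w $ i))\<^sup>2) \<in> borel_measurable (prb U)" by (intro borel_measurable_times borel_measurable_norm2 h_meas_i mrc_meas i)
    show "AE w in prb U. norm ((cmod (h w i))\<^sup>2 * (cmod (v w $ i))\<^sup>2) \<le> norm ((cmod (h w i))\<^sup>2)"
      using mrc_entry_le[OF i] by (intro AE_I2) (simp add: mult_left_le)
  qed
  then show "integrable (prb U) (\<lambda>w. (cmod (hvec N U w $ i))\<^sup>2 * (cmod (v w $ i))\<^sup>2)" using i by (simp add: hvec_def)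
qed

lemma K_integrable: "integrable (prb U) K"
proof (rule Bochner_Integration.integrable_bound)
  show "integrable (prb U) (\<lambda>w. spectral_norm (cov_Q U (chan U w)) + sigma2 P)" using cov_Q_integrable by simp
  show "AE w in prb U. norm (K w) \<le> norm (spectral_norm (cov_Q U (chan U w)) + sigma2 P)"
    using mrc_quad_le unfolding K_def real_norm_def by (intro AE_I2) (meson order_trans abs_ge_self)
  have m: "(\<lambda>w. Re (\<Sum>i<N. \<Sum>j<N. cnj (v w $ i) * cov_Q U (chan U w) $$ (i, j) * v w $ j) + sigma2 P * (\<Sum>i<N. (cmod (v w $ i))\<^sup>2)) \<in> borel_measurable (prb U)"
    by (intro borel_measurable_add borel_measurable_times borel_measurable_const measurable_compose[OF _ borel_measurable_Re]
        borel_measurable_sum borel_measurable_cnj' borel_measurable_norm2 mrc_meas cov_Q_meas) auto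
  show "K \<in> borel_measurable (prb U)"
    by (rule measurable_cong[THEN iffD2, OF K_sum m])
qed

lemma input_law: "(\<lambda>_. CN (p_UE P)) \<in> input_laws P U"
proof -
  have "(\<integral>\<^sup>+d. ennreal ((cmod d)\<^sup>2) \<partial>CN (p_UE P)) = ennreal (p_UE P)"
    using p_pos by (intro nn_integral_has_bochner_integral CN_moments) auto
  then show ?thesis unfolding input_laws_def using measurable_const[OF CN_in_prob_algebra] by simp
qed

lemma mutual_info_ge:
  assumes w: "w \<in> space (prb U)" and s: "0 < s"
  shows "(ln (p_UE P / s) + 1 - uplink_fixed.mse P N (h w) (cov_Q U (chan U w)) 1 c / s) / ln 2
    \<le> mutual_info P N U (\<lambda>_. CN (p_UE P)) (chan U w) (bs_csi U w) (ue_csi U w)"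
  using uplink_fixed.mutual_information_mse_ge[OF uplink_fixed_at[OF w] s, where c=c and h="h w"]
  unfolding mutual_info_def channel_def .

lemma ennreal_integral_le:
  fixes f :: "'a \<Rightarrow> real"
  assumes "integrable (prb U) f"
  shows "ennreal (\<integral>w. f w \<partial>prb U) \<le> (\<integral>\<^sup>+w. ennreal (f w) \<partial>prb U)"
proof -
  have "ennreal (\<integral>w. f w \<partial>prb U) \<le> ennreal (\<integral>w. max 0 (f w) \<partial>prb U)"
    using assms by (intro ennreal_leI integral_mono integrable_max) auto
  also have "\<dots> = (\<integral>\<^sup>+w. ennreal (max 0 (f w)) \<partial>prb U)"
    using assms by (intro nn_integral_eq_integral[symmetric] integrable_max) auto
  finally show ?thesis by simp
qed

lemma capacity_ge: "ennreal (capacity_lower P N U (mrc P N U)) \<le> capacity P N U"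
proof -
  let ?r = "real (T_data P) / real (T_coher P)"
  define m where "m = (\<integral>w. W w \<partial>prb U)"
  define T where "T = den + sig"
  have sig: "sig = (cmod m)\<^sup>2" unfolding sig_def m_def W_def ..
  have T_eq: "T = (1 + kappa_t P) * (\<integral>w. (cmod (W w))\<^sup>2 \<partial>prb U) + kappa_r P * (\<Sum>i<N. \<integral>w. (cmod (hvec N U w $ i))\<^sup>2 * (cmod (v w $ i))\<^sup>2 \<partial>prb U)
    + (\<integral>w. K w \<partial>prb U) / p_UE P"
    unfolding T_def den_def W_def K_def by simp
  define e where "e a w = p_UE P * (1 - 2 * Re (a * cnj (W w))) + (cmod a)\<^sup>2 * (p_UE P * ((1 + kappa_t P) * (cmod (W w))\<^sup>2 + kappa_r P * J w + K w / p_UE P))" for a w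
  have e_int: "has_bochner_integral (prb U) (e a) (p_UE P * (1 - 2 * Re (a * cnj m)) + (cmod a)\<^sup>2 * (p_UE P * T))" for a
  proof -
    have W: "has_bochner_integral (prb U) W m" unfolding m_def by (rule has_bochner_integral_integrable[OF W_integrable])
    have 1: "has_bochner_integral (prb U) (\<lambda>w. Re (a * cnj (W w))) (Re (a * cnj m))"
      by (intro has_bochner_integral_bounded_linear[OF bounded_linear_Re] has_bochner_integral_mult_right has_bochner_integral_bounded_linear[OF bounded_linear_cnj] W)
    have 0: "has_bochner_integral (prb U) (\<lambda>w. 1 :: real) 1" by (simp add: has_bochner_integral_iff M.prob_space)
    show ?thesis unfolding e_def[abs_def] T_eq
      by (intro has_bochner_integral_add has_bochner_integral_mult_right has_bochner_integral_diff has_bochner_integral_divide_zero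
          0 1 J_integral has_bochner_integral_integrable W_square_integrable K_integrable)
  qed
  have e_mse: "e a w = uplink_fixed.mse P N (h w) (cov_Q U (chan U w)) 1 (\<lambda>i. a * cnj (v w $ i))" if "w \<in> space (prb U)" for a w
    unfolding e_def mse_mrc[OF that] ..
  have "ennreal (log 2 (1 + sig / den)) \<le> (\<integral>\<^sup>+w. (SUP f\<in>input_laws P U. ennreal (mutual_info P N U f (chan U w) (bs_csi U w) (ue_csi U w))) \<partial>prb U)"
  proof (cases "sig = 0 \<or> den = 0")
    case True then show ?thesis by auto
  next
    case False
    then have sp: "0 < sig" and d0: "den \<noteq> 0" and m0: "m \<noteq> 0" by (auto simp: sig)
    have mm: "m * cnj m = complex_of_real sig" unfolding sig by (simp only: complex_norm_square)
    have "0 \<le> e a w" if w: "w \<in> space (prb U)" for a w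
    proof -
      interpret F: uplink_fixed P N "h w" "data_interf U (chan U w, bs_csi U w, ue_csi U w)" "cov_Q U (chan U w)"
        by (rule uplink_fixed_at[OF w])
      show ?thesis unfolding e_mse[OF w]
        by (subst has_bochner_integral_integral_eq[OF F.mse_integral, symmetric]) (rule Bochner_Integration.integral_nonneg, simp)
    qed
    then have "0 \<le> (\<integral>w. e (m / complex_of_real sig) w \<partial>prb U)" by (rule Bochner_Integration.integral_nonneg)
    also have "\<dots> = p_UE P * (1 - 2 * Re (m / complex_of_real sig * cnj m)) + (cmod (m / complex_of_real sig))\<^sup>2 * (p_UE P * T)"
      by (rule has_bochner_integral_integral_eq[OF e_int])
    also have "m / complex_of_real sig * cnj m = 1" using mm sp by simp
    also have "(cmod (m / complex_of_real sig))\<^sup>2 = 1 / sig"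
      using sp by (simp add: norm_divide power_divide sig[symmetric]) (simp add: power2_eq_square)
    finally have "0 \<le> p_UE P * (T / sig - 1)" by (simp add: algebra_simps)
    then have "sig \<le> T" using p_pos sp by (simp add: zero_le_mult_iff)
    then have dp: "0 < den" using d0 by (simp add: T_def)
    then have Tp: "0 < T" using sp by (simp add: T_def)
    define s where "s = p_UE P * den / T"
    have s: "0 < s" using p_pos dp Tp by (simp add: s_def)
    let ?a = "m / complex_of_real T"
    have "p_UE P * (1 - 2 * Re (?a * cnj m)) + (cmod ?a)\<^sup>2 * (p_UE P * T) = s"
    proof -
      have 1: "?a * cnj m = complex_of_real (sig / T)" using mm by simp
      have 2: "(cmod ?a)\<^sup>2 = sig / T\<^sup>2" using Tp by (simp add: norm_divide power_divide sig)
      have "p_UE P * (1 - 2 * (sig / T)) + sig / T\<^sup>2 * (p_UE P * T) = p_UE P * (T - sig) / T"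
        using Tp by (simp add: field_simps power2_eq_square)
      also have "T - sig = den" by (simp add: T_def)
      finally show ?thesis unfolding 1 2 Re_complex_of_real s_def .
    qed
    then have es: "has_bochner_integral (prb U) (e ?a) s" using e_int[of ?a] by simp
    have k: "has_bochner_integral (prb U) (\<lambda>w. ln (p_UE P / s) + 1) (ln (p_UE P / s) + 1)" by (simp add: has_bochner_integral_iff M.prob_space)
    have I: "has_bochner_integral (prb U) (\<lambda>w. (ln (p_UE P / s) + 1 - e ?a w / s) / ln 2) ((ln (p_UE P / s) + 1 - s / s) / ln 2)"
      by (intro has_bochner_integral_divide_zero has_bochner_integral_diff k es)
    have "p_UE P / s = 1 + sig / den" using p_pos Tp dp by (simp add: s_def T_def field_simps)
    then have "log 2 (1 + sig / den) = (ln (p_UE P / s) + 1 - s / s) / ln 2" using s by (simp add: log_def)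
    also have "\<dots> = (\<integral>w. (ln (p_UE P / s) + 1 - e ?a w / s) / ln 2 \<partial>prb U)"
      by (rule has_bochner_integral_integral_eq[OF I, symmetric])
    finally have "ennreal (log 2 (1 + sig / den)) \<le> (\<integral>\<^sup>+w. ennreal ((ln (p_UE P / s) + 1 - e ?a w / s) / ln 2) \<partial>prb U)"
      using ennreal_integral_le[OF I[THEN has_bochner_integral_iff[THEN iffD1], THEN conjunct1]] by simp
    also have "\<dots> \<le> (\<integral>\<^sup>+w. (SUP f\<in>input_laws P U. ennreal (mutual_info P N U f (chan U w) (bs_csi U w) (ue_csi U w))) \<partial>prb U)"
    proof (rule nn_integral_mono)
      fix w assume w: "w \<in> space (prb U)"
      show "ennreal ((ln (p_UE P / s) + 1 - e ?a w / s) / ln 2) \<le> (SUP f\<in>input_laws P U. ennreal (mutual_info P N U f (chan U w) (bs_csi U w) (ue_csi U w)))"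
        unfolding e_mse[OF w] 
        by (rule order_trans[OF ennreal_leI[OF mutual_info_ge[OF w s]]
            SUP_upper[OF input_law, of "\<lambda>f. ennreal (mutual_info P N U f (chan U w) (bs_csi U w) (ue_csi U w))"]])
    qed
    finally show ?thesis .
  qed
  then have "ennreal ?r * ennreal (log 2 (1 + sig / den)) \<le> capacity P N U" unfolding capacity_def by (intro mult_left_mono) auto
  then show ?thesis unfolding capacity_lower_eq by (subst ennreal_mult') simp_all
qed

end

lemma norm_expectation_square_le:
  fixes X :: "'a \<Rightarrow> complex"
  assumes "prob_space M" and X: "integrable M X" and X2: "integrable M (\<lambda>w. (cmod (X w))\<^sup>2)"
  shows "(cmod (\<integral>w. X w \<partial>M))\<^sup>2 \<le> (\<integral>w. (cmod (X w))\<^sup>2 \<partial>M)"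
proof -
  interpret prob_space M by fact
  define m where "m = (\<integral>w. X w \<partial>M)"
  have e: "(cmod (X w - m))\<^sup>2 = (cmod (X w))\<^sup>2 - 2 * Re (cnj m * X w) + (cmod m)\<^sup>2" for w
    unfolding cmod_power2 by (simp add: power2_eq_square algebra_simps)
  have "has_bochner_integral M X m" unfolding m_def by (rule has_bochner_integral_integrable[OF X])
  then have r: "has_bochner_integral M (\<lambda>w. Re (cnj m * X w)) (Re (cnj m * m))"
    by (intro has_bochner_integral_bounded_linear[OF bounded_linear_Re] has_bochner_integral_mult_right)
  have k: "has_bochner_integral M (\<lambda>w. (cmod m)\<^sup>2) ((cmod m)\<^sup>2)" by (simp add: has_bochner_integral_iff prob_space)
  have h: "has_bochner_integral M (\<lambda>w. (cmod (X w - m))\<^sup>2) ((\<integral>w. (cmod (X w))\<^sup>2 \<partial>M) - 2 * Re (cnj m * m) + (cmod m)\<^sup>2)"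
    unfolding e by (intro has_bochner_integral_add[OF has_bochner_integral_diff[OF has_bochner_integral_integrable[OF X2] has_bochner_integral_mult_right[OF r]] k])
  have "0 \<le> (\<integral>w. (cmod (X w - m))\<^sup>2 \<partial>M)" by simp
  also have "\<dots> = (\<integral>w. (cmod (X w))\<^sup>2 \<partial>M) - 2 * Re (cnj m * m) + (cmod m)\<^sup>2" by (rule has_bochner_integral_integral_eq[OF h])
  also have "Re (cnj m * m) = (cmod m)\<^sup>2" unfolding cmod_power2 by (simp add: power2_eq_square)
  finally show ?thesis by (simp add: m_def)
qed

lemma (in uplink_bounds) uplink_limitI:
  assumes r: "r = s" "0 < r" and c1: "0 < c1" "c1 * real N \<le> Re (mtrace (cov_R U))"
    and quad: "interf_quadratic_bound N U k" and a: "a = cmod (pilot P) * (r * (1 / sigma2 P))"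
    and \<rho>: "\<rho> = 1 + r + kp + sigma2 P + a + zb * a\<^sup>2 + 8 * ((p_UE P)\<^sup>2 + 2 * (kappa_t P * p_UE P)\<^sup>2) + \<bar>k\<bar>"
  shows "uplink_limit P N U \<rho> k (sigma2 P * p_UE P * c1\<^sup>2 / zb\<^sup>2)"
proof -
  have z: "0 < zb" unfolding zb_def
    using p_pos kt_nonneg r kp_nonneg sigma2_pos by (intro add_nonneg_pos add_pos_nonneg mult_nonneg_nonneg) auto
  have a0: "0 \<le> a" using r sigma2_pos by (simp add: a)
  have n: "0 \<le> zb * a\<^sup>2" "0 \<le> 8 * ((p_UE P)\<^sup>2 + 2 * (kappa_t P * p_UE P)\<^sup>2)" "0 \<le> \<bar>k\<bar>" "k \<le> \<bar>k\<bar>" using z by auto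
  note le = n a0 r(2) kp_nonneg sigma2_pos
  have "r \<le> \<rho>" "a \<le> \<rho>" "kp \<le> \<rho>" "sigma2 P \<le> \<rho>" "k \<le> \<rho>" "1 \<le> \<rho>" "1 + 8 * ((p_UE P)\<^sup>2 + 2 * (kappa_t P * p_UE P)\<^sup>2) \<le> \<rho>" "zb * a\<^sup>2 \<le> \<rho>"
    unfolding \<rho> using le by linarith+
  note \<rho>' = this
  show ?thesis
  proof (intro uplink_limit.intro uplink_rho.intro uplink_rho_axioms.intro uplink_limit_axioms.intro uplink_sys_axioms quad)
    show "opb N R \<rho>" by (rule opb_mono[OF R_bound \<rho>'(1)])
    show "opb N S \<rho>" by (rule opb_mono[OF S_bound]) (use \<rho>'(1) r in simp)
    show "opb N A \<rho>" by (rule opb_mono[OF A_bound]) (use \<rho>'(2) a in simp)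
    show "0 < sigma2 P * p_UE P * c1\<^sup>2 / zb\<^sup>2" using sigma2_pos p_pos c1 z by simp
    show "sigma2 P * p_UE P * c1\<^sup>2 / zb\<^sup>2 * real N \<le> beta" by (rule beta_lower[OF c1(2) c1(1) z])
    have "tau \<le> zb * (real N * a\<^sup>2)" by (rule tau_upper) (use A_bound a in simp)
    also have "\<dots> \<le> \<rho> * real N" using mult_right_mono[OF \<rho>'(8), of "real N"] by (simp add: mult_ac)
    finally show "tau \<le> \<rho> * real N" .
  qed (use \<rho>' in auto)
qed

lemma eventually_uplink_limit:
  fixes U :: "nat \<Rightarrow> ('a, 'c, 'b, 'u) uplink"
  assumes params: "valid_params P" and model: "\<And>N. 1 \<le> N \<Longrightarrow> uplink_model P N (U N)"
    and R_bounded: "(\<lambda>N. spectral_norm (cov_R (U N))) \<in> O(\<lambda>N. 1)"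
    and S_bounded: "(\<lambda>N. spectral_norm (cov_S (U N))) \<in> O(\<lambda>N. 1)"
    and R_trace_lower: "0 < liminf (\<lambda>N. ereal (Re (mtrace (cov_R (U N))) / real N))"
    and quad: "\<And>N. 1 \<le> N \<Longrightarrow> interf_quadratic_bound N (U N) K"
  shows "\<exists>\<rho> c. eventually (\<lambda>N. uplink_limit P N (U N) \<rho> K c) sequentially"
proof -
  obtain r1 where r1: "0 < r1" "eventually (\<lambda>N. norm (spectral_norm (cov_R (U N))) \<le> r1 * norm (1::real)) sequentially"
    using R_bounded by (elim landau_o.bigE)
  obtain s1 where s1: "0 < s1" "eventually (\<lambda>N. norm (spectral_norm (cov_S (U N))) \<le> s1 * norm (1::real)) sequentially"
    using S_bounded by (elim landau_o.bigE)
  obtain c1 :: real where c1: "0 < ereal c1" "ereal c1 < liminf (\<lambda>N. ereal (Re (mtrace (cov_R (U N))) / real N))"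
    using ereal_dense2[OF R_trace_lower] by blast
  define r where "r = max r1 s1"
  define a where "a = cmod (pilot P) * (r * (1 / sigma2 P))"
  define z where "z = p_UE P * (1 + kappa_t P) * r + (kappa_r P * p_UE P * r + sigma2 P + r)"
  define \<rho> where "\<rho> = 1 + r + kappa_r P * p_UE P + sigma2 P + a + z * a\<^sup>2 + 8 * ((p_UE P)\<^sup>2 + 2 * (kappa_t P * p_UE P)\<^sup>2) + \<bar>K\<bar>"
  have "eventually (\<lambda>N. uplink_limit P N (U N) \<rho> K (sigma2 P * p_UE P * c1\<^sup>2 / z\<^sup>2)) sequentially"
    using r1(2) s1(2) less_LiminfD[OF c1(2)] eventually_ge_at_top[of 1]
  proof eventually_elim
    case (elim N)
    interpret S: uplink_sys P N "U N" using params model[OF elim(4)] elim(4) by unfold_locales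
    have R: "opb N (\<lambda>i j. cov_R (U N) $$ (i, j)) r"
      by (rule opb_mono[OF opb_spectral_norm(1)[OF S.R_carrier elim(4)]]) (use elim(1) in \<open>simp add: r_def\<close>)
    have S: "opb N (\<lambda>i j. cov_S (U N) $$ (i, j)) r"
      by (rule opb_mono[OF opb_spectral_norm(1)[OF S.S_carrier elim(4)]]) (use elim(2) in \<open>simp add: r_def\<close>)
    interpret B: uplink_bounds P N "U N" r r using R S by unfold_locales
    have z: "z = B.zb" by (simp add: z_def B.zb_def S.kp_def)
    have "c1 * real N \<le> Re (mtrace (cov_R (U N)))" using elim(3,4) by (simp add: field_simps)
    then show ?case unfolding z
      by (intro B.uplink_limitI[OF refl _ _ _ quad[OF elim(4)] a_def]) (use c1 r1(1) z in \<open>simp_all add: r_def \<rho>_def S.kp_def\<close>)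
  qed
  then show ?thesis by blast
qed

lemma const_over_sqrt_tendsto_0: "(\<lambda>N. C / sqrt (real N)) \<longlonglongrightarrow> 0"
  by (intro tendsto_divide_0[OF tendsto_const] filterlim_at_top_imp_at_infinity filterlim_compose[OF sqrt_at_top filterlim_real_sequentially])

theorem corollary5:
  fixes P :: params
    and U :: "nat \<Rightarrow> ('a, 'c, 'b, 'u) uplink"
    and n K :: real
  assumes params: "valid_params P"
    and model: "\<And>N. 1 \<le> N \<Longrightarrow> uplink_model P N (U N)"
    and R_bounded: "(\<lambda>N. spectral_norm (cov_R (U N))) \<in> O(\<lambda>N. 1)"
    and S_bounded: "(\<lambda>N. spectral_norm (cov_S (U N))) \<in> O(\<lambda>N. 1)"
    and R_trace_lower: "0 < liminf (\<lambda>N. ereal (Re (mtrace (cov_R (U N))) / real N))"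
    and R_trace_upper: "limsup (\<lambda>N. ereal (Re (mtrace (cov_R (U N))) / real N)) < \<infinity>"
    and pilot_interference: "\<And>N. 1 \<le> N \<Longrightarrow> interf_quadratic_bound N (U N) K"
    and n_less: "n < 1"
    and Q_growth: "(\<lambda>N. \<integral>\<omega>. spectral_norm (cov_Q (U N) (chan (U N) \<omega>)) \<partial>prb (U N))
                     \<in> O(\<lambda>N. real N powr n)"
  shows "\<exists>e1 e2 :: nat \<Rightarrow> real.
      e1 \<in> O(\<lambda>N. 1 / sqrt (real N)) \<and>
      e2 \<in> O(\<lambda>N. 1 / sqrt (real N) + 1 / real N powr (1 - n)) \<and>
      (\<forall>N\<ge>1.
         ennreal (capacity_lower P N (U N) (mrc P N (U N))) \<le> capacity P N (U N) \<and>
         capacity_lower P N (U N) (mrc P N (U N)) =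
           real (T_data P) / real (T_coher P) *
           log 2 (1 + ((cmod (\<integral>\<omega>. phi P N (U N) \<omega> \<partial>prb (U N)))\<^sup>2 + e1 N) /
             ((1 + kappa_t P) * (\<integral>\<omega>. (cmod (phi P N (U N) \<omega>))\<^sup>2 \<partial>prb (U N))
              - (cmod (\<integral>\<omega>. phi P N (U N) \<omega> \<partial>prb (U N)))\<^sup>2 + e2 N))) \<and>
      e1 \<longlonglongrightarrow> 0 \<and> e2 \<longlonglongrightarrow> 0 \<and>
      0 < liminf (\<lambda>N. ereal ((cmod (\<integral>\<omega>. phi P N (U N) \<omega> \<partial>prb (U N)))\<^sup>2)) \<and>
      0 < liminf (\<lambda>N. ereal ((1 + kappa_t P) *
             (\<integral>\<omega>. (cmod (phi P N (U N) \<omega>))\<^sup>2 \<partial>prb (U N)))) \<and>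
      (0 < kappa_t P \<longrightarrow>
         0 < liminf (\<lambda>N. ereal ((1 + kappa_t P) *
               (\<integral>\<omega>. (cmod (phi P N (U N) \<omega>))\<^sup>2 \<partial>prb (U N))
             - (cmod (\<integral>\<omega>. phi P N (U N) \<omega> \<partial>prb (U N)))\<^sup>2)))"
proof -
  define F1 where "F1 N = (cmod (\<integral>\<omega>. phi P N (U N) \<omega> \<partial>prb (U N)))\<^sup>2" for N
  define F2 where "F2 N = (\<integral>\<omega>. (cmod (phi P N (U N) \<omega>))\<^sup>2 \<partial>prb (U N))" for N
  define q where "q N = (\<integral>\<omega>. spectral_norm (cov_Q (U N) (chan (U N) \<omega>)) \<partial>prb (U N))" for N
  define sg where "sg N = uplink_sys.sig P N (U N)" for N
  define dn where "dn N = uplink_sys.den P N (U N)" for N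
  define t where "t N = (if 0 < uplink_sys.tau P N (U N) then uplink_sys.tau P N (U N) else 1)" for N
  define e1 where "e1 N = sg N / t N - F1 N" for N
  define e2 where "e2 N = dn N / t N - ((1 + kappa_t P) * F2 N - F1 N)" for N
  have sys: "uplink_sys P N (U N)" if "1 \<le> N" for N
    using params that model[OF that] by (rule uplink_sys.intro)
  obtain \<rho> c where lim: "eventually (\<lambda>N. uplink_limit P N (U N) \<rho> K c) sequentially"
    using eventually_uplink_limit[OF params model R_bounded S_bounded R_trace_lower pilot_interference] by blast
  have ev1: "eventually (\<lambda>N. 1 \<le> N) sequentially" by (rule eventually_ge_at_top)
  have c: "0 < c"
  proof -
    from eventually_happens[OF lim] obtain N where "uplink_limit P N (U N) \<rho> K c" by auto
    then show ?thesis by (rule uplink_limit.c_pos)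
  qed
  have p: "0 < p_UE P" and s2: "0 < sigma2 P" and kt: "0 \<le> kappa_t P"
    using uplink_sys.p_pos[OF sys[OF order_refl]] params by (auto simp: valid_params_def)
  define C1 where "C1 = uplink_limit.C_err P \<rho> c"
  define C2 where "C2 = (2 + kappa_t P) * C1 + kappa_r P * (2 * \<rho>\<^sup>2 + 1) / (2 * c)"
  obtain C3 where C3: "0 < C3" "eventually (\<lambda>N. norm (q N) \<le> C3 * norm (real N powr n)) sequentially"
    using Q_growth unfolding q_def[symmetric] by (elim landau_o.bigE)
  define C4 where "C4 = \<bar>C2\<bar> + C3 / (p_UE P * c) + sigma2 P / (p_UE P * c)"
  let ?g = "\<lambda>N. 1 / sqrt (real N) + 1 / real N powr (1 - n)"
  have b1: "eventually (\<lambda>N. norm (e1 N) \<le> C1 / sqrt (real N)) sequentially"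
    using lim
  proof eventually_elim
    case (elim N)
    interpret L: uplink_limit P N "U N" \<rho> K c by (rule elim)
    show ?case using L.comparison(1) L.tau_pos by (simp add: e1_def t_def sg_def F1_def C1_def)
  qed
  have b2: "eventually (\<lambda>N. norm (e2 N) \<le> C4 * ?g N) sequentially"
    using lim C3(2) ev1
  proof eventually_elim
    case (elim N)
    interpret L: uplink_limit P N "U N" \<rho> K c by (rule elim(1))
    have N: "1 \<le> real N" using elim(3) by simp
    have sq: "1 / real N \<le> 1 / sqrt (real N)" "0 \<le> 1 / sqrt (real N)" "0 \<le> 1 / real N powr (1 - n)"
    proof -
      have "sqrt (real N) \<le> real N" using N by (intro real_le_lsqrt) (auto simp: power2_eq_square)
      then show "1 / real N \<le> 1 / sqrt (real N)" using N by (intro divide_left_mono) auto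
    qed auto
    have pw: "real N powr n / real N = 1 / real N powr (1 - n)" using N by (simp add: powr_diff)
    have "norm (e2 N) \<le> C2 / sqrt (real N) + (q N + sigma2 P) / (p_UE P * c * real N)"
      using L.den_comparison L.tau_pos by (simp add: e2_def t_def dn_def F1_def F2_def C1_def C2_def q_def)
    also have "\<dots> \<le> \<bar>C2\<bar> * (1 / sqrt (real N)) + (C3 * real N powr n + sigma2 P) / (p_UE P * c * real N)"
    proof (intro add_mono divide_right_mono)
      show "C2 / sqrt (real N) \<le> \<bar>C2\<bar> * (1 / sqrt (real N))" by (simp add: divide_right_mono)
      show "q N \<le> C3 * real N powr n" using elim(2) by simp
    qed (use p c in auto)
    also have "(C3 * real N powr n + sigma2 P) / (p_UE P * c * real N)
        = C3 / (p_UE P * c) * (real N powr n / real N) + sigma2 P / (p_UE P * c) * (1 / real N)"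
      by (simp add: add_divide_distrib)
    also have "\<bar>C2\<bar> * (1 / sqrt (real N)) + \<dots> \<le> \<bar>C2\<bar> * ?g N + (C3 / (p_UE P * c) * ?g N + sigma2 P / (p_UE P * c) * ?g N)"
    proof -
      have "1 / sqrt (real N) \<le> ?g N" "1 / real N powr (1 - n) \<le> ?g N" "1 / real N \<le> ?g N" using sq by linarith+
      then show ?thesis unfolding pw using p c C3(1) s2 by (intro add_mono mult_left_mono) auto
    qed
    also have "\<dots> = C4 * ?g N" by (simp add: C4_def distrib_right)
    finally show ?case .
  qed
  have O1: "e1 \<in> O(\<lambda>N. 1 / sqrt (real N))"
    using b1 by (intro bigoI[of _ C1]) (auto elim!: eventually_mono)
  have O2: "e2 \<in> O(?g)"
  proof (rule bigoI[of _ C4])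
    show "eventually (\<lambda>N. norm (e2 N) \<le> C4 * norm (?g N)) sequentially"
      using b2 by eventually_elim simp
  qed
  have g0: "?g \<longlonglongrightarrow> 0"
  proof -
    have "(\<lambda>N. real N powr (- (1 - n))) \<longlonglongrightarrow> 0"
      using n_less by (intro tendsto_neg_powr filterlim_real_sequentially) simp
    then have "(\<lambda>N. 1 / real N powr (1 - n)) \<longlonglongrightarrow> 0" unfolding powr_minus_divide .
    from tendsto_add[OF const_over_sqrt_tendsto_0[of 1] this] show ?thesis by simp
  qed
  have e1_0: "e1 \<longlonglongrightarrow> 0" by (rule Lim_null_comparison[OF b1 const_over_sqrt_tendsto_0])
  have e2_0: "e2 \<longlonglongrightarrow> 0" by (rule Lim_null_comparison[OF b2]) (use tendsto_mult_left[OF g0, of C4] in simp)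
  define \<delta> where "\<delta> = measure (CN (kappa_t P * p_UE P)) {z. cmod z \<le> cmod (pilot P) / 2} / 3"
  have \<delta>: "0 < \<delta>\<^sup>2"
    using CN_ball_pos[of "cmod (pilot P) / 2" "kappa_t P * p_UE P"] params p by (simp add: \<delta>_def valid_params_def)
  have low: "eventually (\<lambda>N. \<delta>\<^sup>2 \<le> F1 N \<and> F1 N \<le> F2 N) sequentially"
    using lim
  proof eventually_elim
    case (elim N)
    interpret L: uplink_limit P N "U N" \<rho> K c by (rule elim)
    have "\<delta> \<le> cmod (\<integral>\<omega>. phi P N (U N) \<omega> \<partial>prb (U N))"
      unfolding \<delta>_def by (rule L.phi_mean_lower[OF L.comparison(3)])
    then have "\<delta>\<^sup>2 \<le> F1 N" unfolding F1_def by (rule power_mono) (simp add: \<delta>_def)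
    then show ?case using norm_expectation_square_le[OF L.prob_M L.comparison(3,4)] by (simp add: F1_def F2_def)
  qed
  have liminf_pos: "0 < liminf (\<lambda>N. ereal (x N))" if "0 < y" "eventually (\<lambda>N. y \<le> x N) sequentially" for x :: "nat \<Rightarrow> real" and y
  proof -
    have "ereal y \<le> liminf (\<lambda>N. ereal (x N))" by (rule Liminf_bounded) (use that(2) in simp)
    then show ?thesis using that(1) by (meson ereal_less(2) less_le_trans)
  qed
  have l1: "0 < liminf (\<lambda>N. ereal (F1 N))"
    by (rule liminf_pos[OF \<delta>]) (use low in \<open>auto elim!: eventually_mono\<close>)
  have l2: "0 < liminf (\<lambda>N. ereal ((1 + kappa_t P) * F2 N))"
  proof (rule liminf_pos[OF \<delta>])
    show "eventually (\<lambda>N. \<delta>\<^sup>2 \<le> (1 + kappa_t P) * F2 N) sequentially"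
      using low
    proof eventually_elim
      case (elim N)
      then have "1 * \<delta>\<^sup>2 \<le> (1 + kappa_t P) * F2 N" using kt by (intro mult_mono) auto
      then show ?case by simp
    qed
  qed
  have l3: "0 < liminf (\<lambda>N. ereal ((1 + kappa_t P) * F2 N - F1 N))" if k: "0 < kappa_t P"
  proof (rule liminf_pos[OF mult_pos_pos[OF k \<delta>]])
    show "eventually (\<lambda>N. kappa_t P * \<delta>\<^sup>2 \<le> (1 + kappa_t P) * F2 N - F1 N) sequentially"
      using low
    proof eventually_elim
      case (elim N)
      then have "kappa_t P * \<delta>\<^sup>2 \<le> kappa_t P * F2 N" using k by (intro mult_left_mono) auto
      then show ?case using elim by (simp add: distrib_right)
    qed
  qed
  have main: "ennreal (capacity_lower P N (U N) (mrc P N (U N))) \<le> capacity P N (U N) \<and>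
      capacity_lower P N (U N) (mrc P N (U N)) =
        real (T_data P) / real (T_coher P) * log 2 (1 + (F1 N + e1 N) / ((1 + kappa_t P) * F2 N - F1 N + e2 N))"
    if N: "1 \<le> N" for N
  proof
    show "ennreal (capacity_lower P N (U N) (mrc P N (U N))) \<le> capacity P N (U N)"
      by (rule uplink_sys.capacity_ge[OF sys[OF N]])
    have "t N \<noteq> 0" by (simp add: t_def)
    then have "(F1 N + e1 N) / ((1 + kappa_t P) * F2 N - F1 N + e2 N) = sg N / dn N"
      by (simp add: e1_def e2_def)
    then show "capacity_lower P N (U N) (mrc P N (U N)) =
        real (T_data P) / real (T_coher P) * log 2 (1 + (F1 N + e1 N) / ((1 + kappa_t P) * F2 N - F1 N + e2 N))"
      unfolding sg_def dn_def by (simp add: uplink_sys.capacity_lower_eq[OF sys[OF N]])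
  qed
  show ?thesis
    using O1 O2 main e1_0 e2_0 l1 l2 l3 unfolding F1_def F2_def by blast
qed

end
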